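(* Let $k$ be a field, let $S$ be a noetherian $k$-algebra, and let $H$ be a finite-dimensional Hopf algebra over $k$ acting on $S$ such that $S$ is faithful as a left $H$-module. Suppose that $S$ is GK-Cohen--Macaulay of GK dimension $d\geq 2$ and has no zero-divisors. Let $t$ be a nonzero left integral of $H$, and write $(1\#t)$ for the two-sided ideal of the smash product $S\#H$ generated by $1\#t$. Then the Auslander map $$S\#H\to\operatorname{End}_{S^H}(S),\qquad s\#h\mapsto\bigl(x\mapsto s(h\rightharpoonup x)\bigr)$$ is an isomorphism if $\operatorname{GKdim}\bigl(S\#H/(1\#t)\bigr)\leq d-2$.
   Context: "$H$ acts on $S$" means that $S$ is a left $H$-module algebra; the action is denoted $h\rightharpoonup s$. $S^H=\{s\in S\mid h\rightharpoonup s=\epsilon(h)s\ \forall h\in H\}$ is the invariant subalgebra, and $S\#H$ is the smash product algebra. $S$ is viewed as a right $S^H$-module by multiplication, and $\operatorname{End}_{S^H}(S)$ is its ring of right $S^H$-module endomorphisms. A left integral of $H$ is an element $t$ with $ht=\epsilon(h)t$ for all $h\in H$. $\operatorname{GKdim}$ denotes Gelfand--Kirillov dimension. For a ring $S$ and an $S$-module $M$, the grade is $j_S(M)=\inf\{i\in\mathbb{N}\mid\operatorname{Ext}^i_S(M,S)\neq0\}$. The algebra $S$ is GK-Cohen--Macaulay if $\operatorname{GKdim}(S)<\infty$ and $j_S(M)+\operatorname{GKdim}(M)=\operatorname{GKdim}(S)$ for every nonzero finitely generated left or right $S$-module $M$. *)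

theory Defs
  imports
    "HOL-Algebra.QuotRing"
    "HOL-Library.Extended_Real"
    "HOL-Library.Liminf_Limsup"
    "Jordan_Normal_Form.Missing_VectorSpace"
begin

text \<open>
  Everything is carrier based. A \<open>K\<close>-algebra is a \<open>module\<close> record: its ring part is the
  ring structure and its \<open>smult\<close> part the scalar multiplication by \<open>K\<close>. The library locale
  \<open>algebra\<close> only covers commutative algebras and \<open>module\<close> only commutative base
  rings, so the noncommutative versions are given here.
\<close>

section \<open>Algebras\<close>

locale assoc_algebra =
  fixes K (structure) and A (structure)
  assumes vectorspace: "vectorspace K A"
    and ring: "ring A"
    and smult_mult_left:
      "\<lbrakk>c \<in> carrier K; x \<in> carrier A; y \<in> carrier A\<rbrakk>
        \<Longrightarrow> (c \<odot>\<^bsub>A\<^esub> x) \<otimes>\<^bsub>A\<^esub> y = c \<odot>\<^bsub>A\<^esub> (x \<otimes>\<^bsub>A\<^esub> y)"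
    and smult_mult_right:
      "\<lbrakk>c \<in> carrier K; x \<in> carrier A; y \<in> carrier A\<rbrakk>
        \<Longrightarrow> x \<otimes>\<^bsub>A\<^esub> (c \<odot>\<^bsub>A\<^esub> y) = c \<odot>\<^bsub>A\<^esub> (x \<otimes>\<^bsub>A\<^esub> y)"

definition opposite :: "('k, 'a) module \<Rightarrow> ('k, 'a) module" where
  "opposite A = A\<lparr>mult := (\<lambda>x y. y \<otimes>\<^bsub>A\<^esub> x)\<rparr>"

text \<open>The quotient \<open>A/I\<close> with its induced scalar multiplication. This also serves for
  quotients of vector spaces, where the ring multiplication has no meaning.\<close>

definition quot_alg :: "('k, 'a, 'x) module_scheme \<Rightarrow> 'a set \<Rightarrow> ('k, 'a set) module" where
  "quot_alg A I = ring.extend (A Quot I)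
     (module.fields (\<lambda>c X. \<Union>x\<in>X. I +>\<^bsub>A\<^esub> (c \<odot>\<^bsub>A\<^esub> x)))"

section \<open>Tensor products of vector spaces\<close>

text \<open>\<open>V \<otimes> W\<close> is the free vector space on \<open>V \<times> W\<close> (finitely supported
  functions) modulo the span of the bilinearity relations.\<close>

definition free_space :: "('k, 'm) ring_scheme \<Rightarrow> 'x set \<Rightarrow> ('k, 'x \<Rightarrow> 'k) module" where
  "free_space K X = (ring.func_space K X)
     \<lparr>carrier := {f \<in> X \<rightarrow>\<^sub>E carrier K. finite {x \<in> X. f x \<noteq> \<zero>\<^bsub>K\<^esub>}}\<rparr>"

definition free_gen :: "('k, 'm) ring_scheme \<Rightarrow> 'x set \<Rightarrow> 'x \<Rightarrow> 'x \<Rightarrow> 'k" where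
  "free_gen K X x = (\<lambda>y\<in>X. if y = x then \<one>\<^bsub>K\<^esub> else \<zero>\<^bsub>K\<^esub>)"

definition tensor_relations ::
  "('k, 'm) ring_scheme \<Rightarrow> ('k, 'v, 'x) module_scheme \<Rightarrow> ('k, 'w, 'y) module_scheme
    \<Rightarrow> ('v \<times> 'w \<Rightarrow> 'k) set" where
  "tensor_relations K V W =
    (let F = free_space K (carrier V \<times> carrier W);
         e = (\<lambda>v w. free_gen K (carrier V \<times> carrier W) (v, w))
     in LinearCombinations.module.span K F
         ({e (v \<oplus>\<^bsub>V\<^esub> v') w \<ominus>\<^bsub>F\<^esub> (e v w \<oplus>\<^bsub>F\<^esub> e v' w) | v v' w.
              v \<in> carrier V \<and> v' \<in> carrier V \<and> w \<in> carrier W} \<union>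
          {e v (w \<oplus>\<^bsub>W\<^esub> w') \<ominus>\<^bsub>F\<^esub> (e v w \<oplus>\<^bsub>F\<^esub> e v w') | v w w'.
              v \<in> carrier V \<and> w \<in> carrier W \<and> w' \<in> carrier W} \<union>
          {e (c \<odot>\<^bsub>V\<^esub> v) w \<ominus>\<^bsub>F\<^esub> (c \<odot>\<^bsub>F\<^esub> e v w) | c v w.
              c \<in> carrier K \<and> v \<in> carrier V \<and> w \<in> carrier W} \<union>
          {e v (c \<odot>\<^bsub>W\<^esub> w) \<ominus>\<^bsub>F\<^esub> (c \<odot>\<^bsub>F\<^esub> e v w) | c v w.
              c \<in> carrier K \<and> v \<in> carrier V \<and> w \<in> carrier W}))"

definition tensor_space ::
  "('k, 'm) ring_scheme \<Rightarrow> ('k, 'v, 'x) module_scheme \<Rightarrow> ('k, 'w, 'y) module_scheme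
    \<Rightarrow> ('k, ('v \<times> 'w \<Rightarrow> 'k) set) module" where
  "tensor_space K V W =
    quot_alg (free_space K (carrier V \<times> carrier W)) (tensor_relations K V W)"

definition pure_tensor ::
  "('k, 'm) ring_scheme \<Rightarrow> ('k, 'v, 'x) module_scheme \<Rightarrow> ('k, 'w, 'y) module_scheme
    \<Rightarrow> 'v \<Rightarrow> 'w \<Rightarrow> ('v \<times> 'w \<Rightarrow> 'k) set" where
  "pure_tensor K V W v w =
    tensor_relations K V W +>\<^bsub>free_space K (carrier V \<times> carrier W)\<^esub>
      free_gen K (carrier V \<times> carrier W) (v, w)"

text \<open>The linear map \<open>V \<otimes> W \<rightarrow> U\<close> induced by a bilinear map \<open>\<beta>\<close>, i.e. the map sending
  \<open>\<Sum> v\<^sub>i \<otimes> w\<^sub>i\<close> to \<open>\<Sum> \<beta> v\<^sub>i w\<^sub>i\<close>. It is evaluated on an arbitrary representative; it is only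
  used for bilinear \<open>\<beta>\<close>, where the choice is immaterial.\<close>

definition tensor_lift ::
  "('k, 'm) ring_scheme \<Rightarrow> ('k, 'v, 'x) module_scheme \<Rightarrow> ('k, 'w, 'y) module_scheme
    \<Rightarrow> ('k, 'u, 'z) module_scheme \<Rightarrow> ('v \<Rightarrow> 'w \<Rightarrow> 'u) \<Rightarrow> ('v \<times> 'w \<Rightarrow> 'k) set \<Rightarrow> 'u" where
  "tensor_lift K V W U \<beta> X =
    (let f = (SOME f. f \<in> X)
     in \<Oplus>\<^bsub>U\<^esub> p \<in> {p \<in> carrier V \<times> carrier W. f p \<noteq> \<zero>\<^bsub>K\<^esub>}. f p \<odot>\<^bsub>U\<^esub> \<beta> (fst p) (snd p))"

text \<open>The tensor product of algebras: \<open>(a \<otimes> b) (c \<otimes> d) = a c \<otimes> b d\<close>.\<close>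

definition tensor_algebra ::
  "('k, 'm) ring_scheme \<Rightarrow> ('k, 'a, 'x) module_scheme \<Rightarrow> ('k, 'b, 'y) module_scheme
    \<Rightarrow> ('k, ('a \<times> 'b \<Rightarrow> 'k) set) module" where
  "tensor_algebra K A B = (tensor_space K A B)
     \<lparr>mult := (\<lambda>X Y.
        tensor_lift K A B (tensor_space K A B) (\<lambda>a b.
          tensor_lift K A B (tensor_space K A B) (\<lambda>c d.
            pure_tensor K A B (a \<otimes>\<^bsub>A\<^esub> c) (b \<otimes>\<^bsub>B\<^esub> d)) Y) X),
      one := pure_tensor K A B \<one>\<^bsub>A\<^esub> \<one>\<^bsub>B\<^esub>\<rparr>"

section \<open>Hopf algebras and their actions\<close>

record ('k, 'h) hopf = "('k, 'h) module" +
  comult :: "'h \<Rightarrow> ('h \<times> 'h \<Rightarrow> 'k) set"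
  counit :: "'h \<Rightarrow> 'k"
  antipode :: "'h \<Rightarrow> 'h"

text \<open>In Sweedler notation, \<open>tensor_lift K H H U \<beta> (comult H h)\<close> is \<open>\<Sum> \<beta> h\<^sub>1 h\<^sub>2\<close>.\<close>

abbreviation sweedler ::
  "('k, 'm) ring_scheme \<Rightarrow> ('k, 'h) hopf \<Rightarrow> ('k, 'u, 'z) module_scheme
    \<Rightarrow> ('h \<Rightarrow> 'h \<Rightarrow> 'u) \<Rightarrow> 'h \<Rightarrow> 'u" where
  "sweedler K H U \<beta> h \<equiv> tensor_lift K H H U \<beta> (comult H h)"

text \<open>Coassociativity is stated in \<open>H \<otimes> (H \<otimes> H)\<close>.\<close>

locale hopf_algebra =
  fixes K (structure) and H :: "('k, 'h) hopf"
  assumes algebra: "assoc_algebra K H"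
    and comult_linear: "comult H \<in> module_hom K H (tensor_space K H H)"
    and comult_ring_hom: "comult H \<in> ring_hom H (tensor_algebra K H H)"
    and counit_ring_hom: "counit H \<in> ring_hom H K"
    and counit_linear:
      "\<lbrakk>c \<in> carrier K; h \<in> carrier H\<rbrakk> \<Longrightarrow> counit H (c \<odot>\<^bsub>H\<^esub> h) = c \<otimes>\<^bsub>K\<^esub> counit H h"
    and antipode_linear: "antipode H \<in> module_hom K H H"
    and coassoc:
      "h \<in> carrier H \<Longrightarrow>
        sweedler K H (tensor_space K H (tensor_space K H H))
          (\<lambda>a b. sweedler K H (tensor_space K H (tensor_space K H H))
            (\<lambda>a1 a2. pure_tensor K H (tensor_space K H H) a1 (pure_tensor K H H a2 b)) a) h =
        sweedler K H (tensor_space K H (tensor_space K H H))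
          (\<lambda>a b. pure_tensor K H (tensor_space K H H) a (comult H b)) h"
    and counit_left: "h \<in> carrier H \<Longrightarrow> sweedler K H H (\<lambda>a b. counit H a \<odot>\<^bsub>H\<^esub> b) h = h"
    and counit_right: "h \<in> carrier H \<Longrightarrow> sweedler K H H (\<lambda>a b. counit H b \<odot>\<^bsub>H\<^esub> a) h = h"
    and antipode_left:
      "h \<in> carrier H \<Longrightarrow>
        sweedler K H H (\<lambda>a b. antipode H a \<otimes>\<^bsub>H\<^esub> b) h = counit H h \<odot>\<^bsub>H\<^esub> \<one>\<^bsub>H\<^esub>"
    and antipode_right:
      "h \<in> carrier H \<Longrightarrow>
        sweedler K H H (\<lambda>a b. a \<otimes>\<^bsub>H\<^esub> antipode H b) h = counit H h \<odot>\<^bsub>H\<^esub> \<one>\<^bsub>H\<^esub>"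

definition left_integral :: "('k, 'h) hopf \<Rightarrow> 'h \<Rightarrow> bool" where
  "left_integral H t \<longleftrightarrow> t \<in> carrier H \<and>
     (\<forall>h\<in>carrier H. h \<otimes>\<^bsub>H\<^esub> t = counit H h \<odot>\<^bsub>H\<^esub> t)"

locale module_algebra =
  fixes K (structure) and H :: "('k, 'h) hopf" and S :: "('k, 's) module"
    and act :: "'h \<Rightarrow> 's \<Rightarrow> 's"
  assumes hopf: "hopf_algebra K H"
    and algebra: "assoc_algebra K S"
    and act_linear: "h \<in> carrier H \<Longrightarrow> act h \<in> module_hom K S S"
    and act_linear_left: "s \<in> carrier S \<Longrightarrow> (\<lambda>h. act h s) \<in> module_hom K H S"
    and act_mult:
      "\<lbrakk>g \<in> carrier H; h \<in> carrier H; s \<in> carrier S\<rbrakk> \<Longrightarrow> act (g \<otimes>\<^bsub>H\<^esub> h) s = act g (act h s)"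
    and act_one: "s \<in> carrier S \<Longrightarrow> act \<one>\<^bsub>H\<^esub> s = s"
    and act_prod:
      "\<lbrakk>h \<in> carrier H; a \<in> carrier S; b \<in> carrier S\<rbrakk>
        \<Longrightarrow> act h (a \<otimes>\<^bsub>S\<^esub> b) = sweedler K H S (\<lambda>h1 h2. act h1 a \<otimes>\<^bsub>S\<^esub> act h2 b) h"
    and act_unit: "h \<in> carrier H \<Longrightarrow> act h \<one>\<^bsub>S\<^esub> = counit H h \<odot>\<^bsub>S\<^esub> \<one>\<^bsub>S\<^esub>"

definition faithful_action ::
  "('k, 'h) hopf \<Rightarrow> ('k, 's) module \<Rightarrow> ('h \<Rightarrow> 's \<Rightarrow> 's) \<Rightarrow> bool" where
  "faithful_action H S act \<longleftrightarrow>
     (\<forall>h\<in>carrier H. (\<forall>s\<in>carrier S. act h s = \<zero>\<^bsub>S\<^esub>) \<longrightarrow> h = \<zero>\<^bsub>H\<^esub>)"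

definition invariants ::
  "('k, 'h) hopf \<Rightarrow> ('k, 's) module \<Rightarrow> ('h \<Rightarrow> 's \<Rightarrow> 's) \<Rightarrow> 's set" where
  "invariants H S act = {s \<in> carrier S. \<forall>h\<in>carrier H. act h s = counit H h \<odot>\<^bsub>S\<^esub> s}"

text \<open>\<open>(s # h) (s' # h') = \<Sum> s (h\<^sub>1 \<rightharpoonup> s') # h\<^sub>2 h'\<close>, where \<open>s # h\<close> is \<^term>\<open>pure_tensor K S H s h\<close>.\<close>

definition smash ::
  "('k, 'm) ring_scheme \<Rightarrow> ('k, 's) module \<Rightarrow> ('k, 'h) hopf \<Rightarrow> ('h \<Rightarrow> 's \<Rightarrow> 's)
    \<Rightarrow> ('k, ('s \<times> 'h \<Rightarrow> 'k) set) module" where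
  "smash K S H act = (tensor_space K S H)
     \<lparr>mult := (\<lambda>X Y.
        tensor_lift K S H (tensor_space K S H) (\<lambda>s h.
          tensor_lift K S H (tensor_space K S H) (\<lambda>s' h'.
            sweedler K H (tensor_space K S H) (\<lambda>h1 h2.
              pure_tensor K S H (s \<otimes>\<^bsub>S\<^esub> act h1 s') (h2 \<otimes>\<^bsub>H\<^esub> h')) h) Y) X),
      one := pure_tensor K S H \<one>\<^bsub>S\<^esub> \<one>\<^bsub>H\<^esub>\<rparr>"

text \<open>Endomorphisms of \<open>S\<close> as a right module over a subalgebra \<open>B\<close>; functions are made
  extensional on the carrier of \<open>S\<close>.\<close>

definition right_End :: "('k, 's) module \<Rightarrow> 's set \<Rightarrow> ('k, 's \<Rightarrow> 's) module" where
  "right_End S B =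
    \<lparr>carrier = {f \<in> carrier S \<rightarrow>\<^sub>E carrier S.
        (\<forall>x\<in>carrier S. \<forall>y\<in>carrier S. f (x \<oplus>\<^bsub>S\<^esub> y) = f x \<oplus>\<^bsub>S\<^esub> f y) \<and>
        (\<forall>x\<in>carrier S. \<forall>b\<in>B. f (x \<otimes>\<^bsub>S\<^esub> b) = f x \<otimes>\<^bsub>S\<^esub> b)},
     mult = compose (carrier S),
     one = (\<lambda>x\<in>carrier S. x),
     zero = (\<lambda>x\<in>carrier S. \<zero>\<^bsub>S\<^esub>),
     add = (\<lambda>f g. \<lambda>x\<in>carrier S. f x \<oplus>\<^bsub>S\<^esub> g x),
     smult = (\<lambda>c f. \<lambda>x\<in>carrier S. c \<odot>\<^bsub>S\<^esub> f x)\<rparr>"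

definition auslander_map ::
  "('k, 'm) ring_scheme \<Rightarrow> ('k, 's) module \<Rightarrow> ('k, 'h) hopf \<Rightarrow> ('h \<Rightarrow> 's \<Rightarrow> 's)
    \<Rightarrow> ('s \<times> 'h \<Rightarrow> 'k) set \<Rightarrow> 's \<Rightarrow> 's" where
  "auslander_map K S H act X =
    (\<lambda>x\<in>carrier S. tensor_lift K S H S (\<lambda>s h. s \<otimes>\<^bsub>S\<^esub> act h x) X)"

section \<open>Modules over noncommutative rings\<close>

text \<open>Right \<open>R\<close>-modules are treated as left modules over \<^term>\<open>opposite R\<close>. The predicates
  \<open>Module.submodule\<close> and \<^term>\<open>module_hom\<close> from the library do not assume commutativity.\<close>

locale left_module =
  fixes R (structure) and M (structure)
  assumes ring: "ring R"
    and abelian_group: "abelian_group M"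
    and smult_closed: "\<lbrakk>a \<in> carrier R; x \<in> carrier M\<rbrakk> \<Longrightarrow> a \<odot>\<^bsub>M\<^esub> x \<in> carrier M"
    and smult_l_distr:
      "\<lbrakk>a \<in> carrier R; b \<in> carrier R; x \<in> carrier M\<rbrakk>
        \<Longrightarrow> (a \<oplus>\<^bsub>R\<^esub> b) \<odot>\<^bsub>M\<^esub> x = a \<odot>\<^bsub>M\<^esub> x \<oplus>\<^bsub>M\<^esub> b \<odot>\<^bsub>M\<^esub> x"
    and smult_r_distr:
      "\<lbrakk>a \<in> carrier R; x \<in> carrier M; y \<in> carrier M\<rbrakk>
        \<Longrightarrow> a \<odot>\<^bsub>M\<^esub> (x \<oplus>\<^bsub>M\<^esub> y) = a \<odot>\<^bsub>M\<^esub> x \<oplus>\<^bsub>M\<^esub> a \<odot>\<^bsub>M\<^esub> y"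
    and smult_assoc:
      "\<lbrakk>a \<in> carrier R; b \<in> carrier R; x \<in> carrier M\<rbrakk>
        \<Longrightarrow> (a \<otimes>\<^bsub>R\<^esub> b) \<odot>\<^bsub>M\<^esub> x = a \<odot>\<^bsub>M\<^esub> (b \<odot>\<^bsub>M\<^esub> x)"
    and smult_one: "x \<in> carrier M \<Longrightarrow> \<one>\<^bsub>R\<^esub> \<odot>\<^bsub>M\<^esub> x = x"

definition regular_module :: "('r, 'y) ring_scheme \<Rightarrow> ('r, 'r) module" where
  "regular_module R =
    \<lparr>carrier = carrier R, mult = mult R, one = one R, zero = zero R, add = add R,
     smult = mult R\<rparr>"

definition fin_gen_module :: "('r, 'y) ring_scheme \<Rightarrow> ('r, 'm) module \<Rightarrow> bool" where
  "fin_gen_module R M \<longleftrightarrow>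
    (\<exists>X. finite X \<and> X \<subseteq> carrier M \<and>
      (\<forall>N. Module.submodule N R M \<and> X \<subseteq> N \<longrightarrow> N = carrier M))"

definition left_noetherian :: "('r, 'y) ring_scheme \<Rightarrow> bool" where
  "left_noetherian R \<longleftrightarrow>
    (\<forall>I. Module.submodule I R (regular_module R) \<longrightarrow>
      fin_gen_module R ((regular_module R)\<lparr>carrier := I\<rparr>))"

definition noetherian :: "('k, 's) module \<Rightarrow> bool" where
  "noetherian S \<longleftrightarrow> left_noetherian S \<and> left_noetherian (opposite S)"

section \<open>Ext and grade\<close>

text \<open>Projectivity is tested against modules with elements in the type of \<open>P\<close>. This is the
  usual notion as soon as that type is large enough to contain a free module mapping onto \<open>P\<close>;
  below only the type \<^typ>\<open>nat \<Rightarrow> 'r\<close> is used, with \<open>'r\<close> the type of elements of the ring, which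
  has room for the free module on any of its subsets and for a projective resolution of
  any module living on it.\<close>

definition projective_module :: "('r, 'y) ring_scheme \<Rightarrow> ('r, 'm) module \<Rightarrow> bool" where
  "projective_module R P \<longleftrightarrow> left_module R P \<and>
    (\<forall>(M :: ('r, 'm) module) (N :: ('r, 'm) module) g f.
      left_module R M \<and> left_module R N \<and> g \<in> module_hom R M N \<and>
      g ` carrier M = carrier N \<and> f \<in> module_hom R P N \<longrightarrow>
      (\<exists>h\<in>module_hom R P M. \<forall>x\<in>carrier P. g (h x) = f x))"

text \<open>\<open>\<dots> \<rightarrow> P 1 \<rightarrow> P 0 \<rightarrow> M \<rightarrow> 0\<close> is exact, where \<open>d 0 : P 0 \<rightarrow> M\<close> is the augmentation and
  \<open>d (i + 1) : P (i + 1) \<rightarrow> P i\<close>.\<close>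

definition projective_resolution ::
  "('r, 'y) ring_scheme \<Rightarrow> ('r, 'm) module \<Rightarrow> (nat \<Rightarrow> ('r, 'm) module) \<Rightarrow> (nat \<Rightarrow> 'm \<Rightarrow> 'm)
    \<Rightarrow> bool" where
  "projective_resolution R M P d \<longleftrightarrow>
    (\<forall>i. projective_module R (P i)) \<and>
    (\<forall>i. d i \<in> module_hom R (P i) (case_nat M P i)) \<and>
    d 0 ` carrier (P 0) = carrier M \<and>
    (\<forall>i. d (Suc i) ` carrier (P (Suc i)) = a_kernel (P i) (case_nat M P i) (d i))"

definition Hom_group ::
  "('r, 'y) ring_scheme \<Rightarrow> ('r, 'm) module \<Rightarrow> ('r, 'n) module \<Rightarrow> ('m \<Rightarrow> 'n) monoid" where
  "Hom_group R M N =
    \<lparr>carrier = module_hom R M N \<inter> extensional (carrier M),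
     mult = (\<lambda>f g. \<lambda>x\<in>carrier M. f x \<oplus>\<^bsub>N\<^esub> g x),
     one = (\<lambda>x\<in>carrier M. \<zero>\<^bsub>N\<^esub>)\<rparr>"

text \<open>The cohomology group \<open>H\<^sup>i(Hom\<^sub>R(P, N))\<close>.\<close>

definition Hom_cohomology ::
  "('r, 'y) ring_scheme \<Rightarrow> (nat \<Rightarrow> ('r, 'm) module) \<Rightarrow> (nat \<Rightarrow> 'm \<Rightarrow> 'm) \<Rightarrow> ('r, 'n) module
    \<Rightarrow> nat \<Rightarrow> ('m \<Rightarrow> 'n) set monoid" where
  "Hom_cohomology R P d N i =
    (let C = (\<lambda>j. Hom_group R (P j) N);
         \<delta> = (\<lambda>j f. compose (carrier (P (Suc j))) f (d (Suc j)));
         Z = kernel (C i) (C (Suc i)) (\<delta> i);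
         B = (case i of 0 \<Rightarrow> {one (C 0)} | Suc j \<Rightarrow> \<delta> j ` carrier (C j))
     in (C i)\<lparr>carrier := Z\<rparr> Mod B)"

definition Ext ::
  "('r, 'y) ring_scheme \<Rightarrow> nat \<Rightarrow> ('r, 'm) module \<Rightarrow> ('r, 'n) module \<Rightarrow> ('m \<Rightarrow> 'n) set monoid"
  where
  "Ext R i M N =
    (let (P, d) = (SOME (P, d). projective_resolution R M P d) in Hom_cohomology R P d N i)"

definition grade :: "('r, 'y) ring_scheme \<Rightarrow> ('r, 'm) module \<Rightarrow> ereal" where
  "grade R M =
    (INF i \<in> {i. carrier (Ext R i M (regular_module R)) \<noteq> {one (Ext R i M (regular_module R))}}.
      ereal (real i))"

section \<open>Gelfand--Kirillov dimension\<close>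

definition restrict_scalars :: "('k, 'a) module \<Rightarrow> ('a, 'm) module \<Rightarrow> ('k, 'm) module" where
  "restrict_scalars A M =
    \<lparr>carrier = carrier M, mult = mult M, one = one M, zero = zero M, add = add M,
     smult = (\<lambda>c m. (c \<odot>\<^bsub>A\<^esub> \<one>\<^bsub>A\<^esub>) \<odot>\<^bsub>M\<^esub> m)\<rparr>"

definition fin_dim_subspaces ::
  "('k, 'm) ring_scheme \<Rightarrow> ('k, 'v) module \<Rightarrow> 'v set set" where
  "fin_dim_subspaces K V =
    {W. subspace K W V \<and> vectorspace.fin_dim K (V\<lparr>carrier := W\<rparr>)}"

primrec power_action :: "('a, 'm) module \<Rightarrow> 'a set \<Rightarrow> 'm set \<Rightarrow> nat \<Rightarrow> 'm set" where
  "power_action M V F 0 = F"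
| "power_action M V F (Suc n) = {v \<odot>\<^bsub>M\<^esub> m | v m. v \<in> V \<and> m \<in> power_action M V F n}"

text \<open>\<open>dim\<^sub>K (F + V F + \<dots> + V\<^sup>n F)\<close>.\<close>

definition growth ::
  "('k, 'm) ring_scheme \<Rightarrow> ('k, 'a) module \<Rightarrow> ('a, 'v) module \<Rightarrow> 'a set \<Rightarrow> 'v set \<Rightarrow> nat \<Rightarrow> nat"
  where
  "growth K A M V F n =
    (let U = restrict_scalars A M
     in vectorspace.dim K (U\<lparr>carrier :=
          LinearCombinations.module.span K U (\<Union>i\<le>n. power_action M V F i)\<rparr>))"

definition growth_exponent :: "(nat \<Rightarrow> nat) \<Rightarrow> ereal" where
  "growth_exponent g = limsup (\<lambda>n. ereal (ln (real (g n)) / ln (real n)))"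

definition GKdim_module ::
  "('k, 'm) ring_scheme \<Rightarrow> ('k, 'a) module \<Rightarrow> ('a, 'v) module \<Rightarrow> ereal" where
  "GKdim_module K A M =
    (if carrier M = {\<zero>\<^bsub>M\<^esub>} then - \<infinity>
     else SUP V \<in> fin_dim_subspaces K A. SUP F \<in> fin_dim_subspaces K (restrict_scalars A M).
       growth_exponent (growth K A M V F))"

text \<open>For the algebra itself the growth function is \<open>dim\<^sub>K (K + V + \<dots> + V\<^sup>n)\<close>.\<close>

definition GKdim :: "('k, 'm) ring_scheme \<Rightarrow> ('k, 'a) module \<Rightarrow> ereal" where
  "GKdim K A =
    (if carrier A = {\<zero>\<^bsub>A\<^esub>} then - \<infinity>
     else SUP V \<in> fin_dim_subspaces K A.
       growth_exponent (growth K A (regular_module A) V {\<one>\<^bsub>A\<^esub>}))"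

text \<open>Every finitely generated module is a quotient of some \<open>S\<^sup>n\<close>, hence isomorphic to one with
  elements in the type \<^typ>\<open>nat \<Rightarrow> 's\<close>.\<close>

definition GK_Cohen_Macaulay :: "('k, 'm) ring_scheme \<Rightarrow> ('k, 's) module \<Rightarrow> bool" where
  "GK_Cohen_Macaulay K S \<longleftrightarrow> GKdim K S < \<infinity> \<and>
    (\<forall>R\<in>{S, opposite S}. \<forall>M :: ('s, nat \<Rightarrow> 's) module.
      left_module R M \<and> fin_gen_module R M \<and> carrier M \<noteq> {\<zero>\<^bsub>M\<^esub>} \<longrightarrow>
      grade R M + GKdim_module K R M = GKdim K S)"

end

theory Submission
  imports Defs "HOL-Real_Asymp.Real_Asymp"
begin

text \<open>
  Let \<open>B = S # H\<close>, \<open>J = (1 # t)\<close> and let \<open>\<phi>\<close> be the Auslander map. Since \<open>b (1 # t) = \<phi>(b)(1) # t\<close>,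
  the kernel of \<open>\<phi>\<close> annihilates \<open>1 # t\<close>, hence \<open>J\<close>; and for an endomorphism \<open>f\<close> the map
  \<open>f \<circ> \<phi>(1 # t) = \<phi>(f(1) # t)\<close> is in the image of \<open>\<phi>\<close>, hence so is \<open>f \<circ> \<phi>(y)\<close> for every \<open>y \<in> J\<close>.

  A functional \<open>\<lambda>\<close> on \<open>H\<close> with \<open>\<Sum> \<lambda>(t\<^sub>2) t\<^sub>1 = 1\<close> is an integral of the dual and makes \<open>H\<close> a Frobenius algebra.
  Therefore \<open>\<Lambda>(s # h) = \<lambda>(h) s\<close> is a right \<open>S\<close>-linear map \<open>B \<rightarrow> S\<close> with \<open>\<Lambda>(z B) = 0\<close> only for
  \<open>z = 0\<close>, and every right linear map \<open>B \<rightarrow> S\<close> has the form \<open>x \<mapsto> \<Lambda>(b x)\<close>.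

  The right \<open>S\<close>-module \<open>B/J\<close> is finitely generated of GK dimension at most \<open>d - 2\<close>, so its grade is at
  least \<open>2\<close>: a right linear map \<open>B \<rightarrow> S\<close> vanishing on \<open>J\<close> is zero, and every right linear map
  \<open>J \<rightarrow> S\<close> extends to \<open>B\<close>. The first statement, applied to \<open>x \<mapsto> \<Lambda>(z x)\<close> with \<open>\<phi>(z) = 0\<close>, gives
  injectivity. For \<open>f\<close> as above let \<open>F(y)\<close> be the element with \<open>\<phi>(F(y)) = f \<circ> \<phi>(y)\<close>. The second
  statement, applied to \<open>\<Lambda> \<circ> F\<close>, gives \<open>b\<close> with \<open>F(y) = b y\<close> on \<open>J\<close>, so \<open>f\<close> and \<open>\<phi>(b)\<close> agree on all
  \<open>s (t \<rightharpoonup> x)\<close>. As \<open>t \<rightharpoonup> x\<close> is invariant and nonzero for some \<open>x\<close>, and \<open>S\<close> is a domain, \<open>f = \<phi>(b)\<close>.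
\<close>

section \<open>Additive and linear maps on carrier-based structures\<close>

section \<open>Linear maps\<close>

text \<open>The axioms provide neither a form on \<open>H\<close> nor an inverse of the antipode;
  both are built from \<open>t\<close>. Contracting one leg of the coproduct of \<open>t\<close>
  with functionals has a left ideal of \<open>H\<close> as image, and the antipode axiom puts
  \<open>1\<close> into it. The inverse antipode is needed because \<open>S # H\<close> is written
  with \<open>S\<close> on the left, while it must be generated as a right \<open>S\<close>-module
  by elements \<open>1 # h\<close>. Grade at least two means that Hom and first Ext from
  \<open>B/J\<close> to \<open>S\<close> vanish, but \<open>Ext\<close> is computed from an
  unspecified projective resolution on the type \<open>nat \<Rightarrow> 's\<close>. Noetherianity
  yields a resolution on that type, so the choice is a genuine one, and the two consequences are
  proved for an arbitrary resolution. For the same reason \<open>B/J\<close> is replaced by a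
  quotient of \<open>S^n\<close> whose elements are chosen representatives. The dimension of this
  quotient is bounded by embedding it into \<open>B/J\<close>, where the right action of
  \<open>S\<close> is right multiplication: \<open>n\<close> scalars applied to a generator become a
  product of \<open>n + 1\<close> elements, a shift that the growth exponent does not see.\<close>

lemma vectorspaceD:
  assumes "vectorspace K V"
  shows "field K" "cring K" "ring K" "abelian_group V" "abelian_monoid V" "Module.module K V"
  using assms by (auto simp: vectorspace_def module_def field_def domain_def cring_def
      abelian_group_def)

lemma vectorspace_closed [simp]:
  assumes "vectorspace K V"
  shows "\<zero>\<^bsub>V\<^esub> \<in> carrier V"
    and "x \<in> carrier V \<Longrightarrow> y \<in> carrier V \<Longrightarrow> x \<oplus>\<^bsub>V\<^esub> y \<in> carrier V"
    and "x \<in> carrier V \<Longrightarrow> \<ominus>\<^bsub>V\<^esub> x \<in> carrier V"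
    and "x \<in> carrier V \<Longrightarrow> y \<in> carrier V \<Longrightarrow> x \<ominus>\<^bsub>V\<^esub> y \<in> carrier V"
    and "c \<in> carrier K \<Longrightarrow> x \<in> carrier V \<Longrightarrow> c \<odot>\<^bsub>V\<^esub> x \<in> carrier V"
proof -
  interpret vectorspace K V by fact
  show "\<zero>\<^bsub>V\<^esub> \<in> carrier V"
    and "x \<in> carrier V \<Longrightarrow> y \<in> carrier V \<Longrightarrow> x \<oplus>\<^bsub>V\<^esub> y \<in> carrier V"
    and "x \<in> carrier V \<Longrightarrow> \<ominus>\<^bsub>V\<^esub> x \<in> carrier V"
    and "x \<in> carrier V \<Longrightarrow> y \<in> carrier V \<Longrightarrow> x \<ominus>\<^bsub>V\<^esub> y \<in> carrier V"
    and "c \<in> carrier K \<Longrightarrow> x \<in> carrier V \<Longrightarrow> c \<odot>\<^bsub>V\<^esub> x \<in> carrier V"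
    by auto
qed

lemma module_homI:
  assumes "\<And>x. x \<in> carrier M \<Longrightarrow> f x \<in> carrier N"
    and "\<And>x y. x \<in> carrier M \<Longrightarrow> y \<in> carrier M \<Longrightarrow> f (x \<oplus>\<^bsub>M\<^esub> y) = f x \<oplus>\<^bsub>N\<^esub> f y"
    and "\<And>r x. r \<in> carrier R \<Longrightarrow> x \<in> carrier M \<Longrightarrow> f (r \<odot>\<^bsub>M\<^esub> x) = r \<odot>\<^bsub>N\<^esub> f x"
  shows "f \<in> module_hom R M N"
  using assms by (auto simp: module_hom_def)

lemma module_hom_mem: "f \<in> module_hom R M N \<Longrightarrow> x \<in> carrier M \<Longrightarrow> f x \<in> carrier N"
  by (auto simp: module_hom_def)

lemma module_hom_cong:
  assumes "f \<in> module_hom R M N" "\<And>x. x \<in> carrier M \<Longrightarrow> f x = g x"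
    "\<And>x y. x \<in> carrier M \<Longrightarrow> y \<in> carrier M \<Longrightarrow> x \<oplus>\<^bsub>M\<^esub> y \<in> carrier M"
    "\<And>r x. r \<in> carrier R \<Longrightarrow> x \<in> carrier M \<Longrightarrow> r \<odot>\<^bsub>M\<^esub> x \<in> carrier M"
  shows "g \<in> module_hom R M N"
  using assms unfolding module_hom_def by (auto simp: Pi_def)

text \<open>Stated without scalars, because it is also applied to multiplication by a fixed ring
  element, which is additive but not linear over a noncommutative ring.\<close>

lemma additive_zero:
  assumes "abelian_group M" "abelian_group N"
    and "\<And>x. x \<in> carrier M \<Longrightarrow> f x \<in> carrier N"
    and "\<And>x y. x \<in> carrier M \<Longrightarrow> y \<in> carrier M \<Longrightarrow> f (x \<oplus>\<^bsub>M\<^esub> y) = f x \<oplus>\<^bsub>N\<^esub> f y"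
  shows "f \<zero>\<^bsub>M\<^esub> = \<zero>\<^bsub>N\<^esub>"
proof -
  interpret M: abelian_group M by fact
  interpret N: abelian_group N by fact
  have "f \<zero>\<^bsub>M\<^esub> \<oplus>\<^bsub>N\<^esub> f \<zero>\<^bsub>M\<^esub> = f \<zero>\<^bsub>M\<^esub>"
    using assms(4)[of "\<zero>\<^bsub>M\<^esub>" "\<zero>\<^bsub>M\<^esub>"] by simp
  then show ?thesis
    using assms(3)[OF M.zero_closed] by (metis N.add.r_cancel_one')
qed

lemma additive_uminus:
  assumes "abelian_group M" "abelian_group N"
    and "\<And>x. x \<in> carrier M \<Longrightarrow> f x \<in> carrier N"
    and "\<And>x y. x \<in> carrier M \<Longrightarrow> y \<in> carrier M \<Longrightarrow> f (x \<oplus>\<^bsub>M\<^esub> y) = f x \<oplus>\<^bsub>N\<^esub> f y"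
    and "x \<in> carrier M"
  shows "f (\<ominus>\<^bsub>M\<^esub> x) = \<ominus>\<^bsub>N\<^esub> f x"
proof -
  interpret M: abelian_group M by fact
  interpret N: abelian_group N by fact
  have "f (\<ominus>\<^bsub>M\<^esub> x) \<oplus>\<^bsub>N\<^esub> f x = \<zero>\<^bsub>N\<^esub>"
    using assms(4)[of "\<ominus>\<^bsub>M\<^esub> x" x] assms(5) additive_zero[OF assms(1-4)] by (simp add: M.l_neg)
  then show ?thesis
    using assms(3,5) by (metis M.a_inv_closed N.minus_equality)
qed

lemma module_hom_zero:
  assumes "abelian_group M" "abelian_group N" "f \<in> module_hom R M N"
  shows "f \<zero>\<^bsub>M\<^esub> = \<zero>\<^bsub>N\<^esub>"
  using additive_zero[OF assms(1,2), of f] assms(3) by (auto simp: module_hom_def)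

lemma module_hom_uminus:
  assumes "abelian_group M" "abelian_group N" "f \<in> module_hom R M N" "x \<in> carrier M"
  shows "f (\<ominus>\<^bsub>M\<^esub> x) = \<ominus>\<^bsub>N\<^esub> f x"
  using additive_uminus[OF assms(1,2), of f] assms(3,4) by (auto simp: module_hom_def)

lemma module_hom_diff:
  assumes "abelian_group M" "abelian_group N" "f \<in> module_hom R M N"
    "x \<in> carrier M" "y \<in> carrier M"
  shows "f (x \<ominus>\<^bsub>M\<^esub> y) = f x \<ominus>\<^bsub>N\<^esub> f y"
  using assms module_hom_uminus[OF assms(1-3,5)]
  by (simp add: a_minus_def module_hom_add abelian_group.a_inv_closed)

lemma module_hom_finsum:
  assumes "abelian_group M" "abelian_group N" "f \<in> module_hom R M N"
    "g \<in> A \<rightarrow> carrier M"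
  shows "f (finsum M g A) = finsum N (\<lambda>a. f (g a)) A"
proof (cases "finite A")
  interpret M: abelian_group M by fact
  interpret N: abelian_group N by fact
  case True
  then show ?thesis
    using assms(4)
  proof (induction A rule: finite_induct)
    case empty
    then show ?case using module_hom_zero[OF assms(1-3)] by simp
  next
    case (insert a A)
    then have "g \<in> A \<rightarrow> carrier M" "g a \<in> carrier M" "finsum M g A \<in> carrier M"
      by (auto intro: M.finsum_closed)
    moreover have "(\<lambda>a. f (g a)) \<in> A \<rightarrow> carrier N" "f (g a) \<in> carrier N"
      using calculation module_hom_mem[OF assms(3)] by auto
    ultimately show ?case
      using insert by (simp add: module_hom_add[OF assms(3)])
  qed
next
  interpret M: abelian_group M by fact
  interpret N: abelian_group N by fact
  \<comment> \<open>Over an infinite index set \<open>finsum\<close> is zero by definition, and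
    \<open>f\<close> preserves zero.\<close>
  case False
  then show ?thesis using module_hom_zero[OF assms(1-3)]
    by (simp add: finsum_def finprod_def)
qed

context
  fixes K :: "('k, 'm) ring_scheme"
begin

abbreviation lin :: "('k, 'a, 'x) module_scheme \<Rightarrow> ('k, 'b, 'y) module_scheme \<Rightarrow> ('a \<Rightarrow> 'b) \<Rightarrow> bool"
  where "lin V W f \<equiv> f \<in> module_hom K V W"

lemma lin_id: "lin V V (\<lambda>x. x)"
  by (auto simp: module_hom_def)

lemma lin_comp: "lin V W f \<Longrightarrow> lin U V g \<Longrightarrow> lin U W (\<lambda>x. f (g x))"
  unfolding module_hom_def by (auto simp: Pi_def)

lemma lin_finsum:
  assumes "vectorspace K V" "vectorspace K W" "\<And>i. i \<in> A \<Longrightarrow> lin V W (f i)"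
  shows "lin V W (\<lambda>x. finsum W (\<lambda>i. f i x) A)"
proof -
  interpret V: vectorspace K V by fact
  interpret W: vectorspace K W by fact
  show ?thesis
  proof (cases "finite A")
    case True
    then show ?thesis using assms(3)
    proof (induction A rule: finite_induct)
      case empty
      then show ?case by (auto intro!: module_homI)
    next
      case (insert a A)
      have *: "f i x \<in> carrier W" if "x \<in> carrier V" "i \<in> insert a A" for i x
        using insert(4) that module_hom_mem by metis
      have **: "finsum W (\<lambda>i. f i x) (insert a A) = f a x \<oplus>\<^bsub>W\<^esub> finsum W (\<lambda>i. f i x) A"
        if "x \<in> carrier V" for x
        using insert(1,2) * that by (intro W.finsum_insert) auto
      have IH: "lin V W (\<lambda>x. finsum W (\<lambda>i. f i x) A)" using insert by auto
      have fa: "lin V W (f a)" using insert by auto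
      show ?case
      proof (rule module_homI)
        fix x y assume xy: "x \<in> carrier V" "y \<in> carrier V"
        show "finsum W (\<lambda>i. f i (x \<oplus>\<^bsub>V\<^esub> y)) (insert a A) =
          finsum W (\<lambda>i. f i x) (insert a A) \<oplus>\<^bsub>W\<^esub> finsum W (\<lambda>i. f i y) (insert a A)"
          using xy module_hom_mem[OF IH] module_hom_mem[OF fa]
          by (simp add: ** module_hom_add[OF IH] module_hom_add[OF fa] W.M.add.m_ac)
      next
        fix r x assume "r \<in> carrier K" "x \<in> carrier V"
        then show "finsum W (\<lambda>i. f i (r \<odot>\<^bsub>V\<^esub> x)) (insert a A) =
          r \<odot>\<^bsub>W\<^esub> finsum W (\<lambda>i. f i x) (insert a A)"
          using module_hom_mem[OF IH] module_hom_mem[OF fa]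
          by (simp add: ** module_hom_smult[OF IH] module_hom_smult[OF fa] W.smult_r_distr)
      qed (auto simp: ** module_hom_mem[OF IH] module_hom_mem[OF fa])
    qed
  next
    case False
    then show ?thesis
      by (simp add: finsum_def finprod_def) (auto intro!: module_homI)
  qed
qed

lemma lin_add:
  assumes "vectorspace K V" "vectorspace K W" "lin V W f" "lin V W g"
  shows "lin V W (\<lambda>x. f x \<oplus>\<^bsub>W\<^esub> g x)"
proof -
  interpret V: vectorspace K V by fact
  interpret W: vectorspace K W by fact
  show ?thesis
    using module_hom_mem[OF assms(3)] module_hom_mem[OF assms(4)]
    by (intro module_homI)
      (auto simp: module_hom_add[OF assms(3)] module_hom_add[OF assms(4)]
        module_hom_smult[OF assms(3)] module_hom_smult[OF assms(4)] W.M.add.m_ac W.smult_r_distr)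
qed

lemma lin_smult:
  assumes "vectorspace K W" "lin V W f" "c \<in> carrier K"
  shows "lin V W (\<lambda>x. c \<odot>\<^bsub>W\<^esub> f x)"
proof -
  interpret W: vectorspace K W by fact
  show ?thesis
    using module_hom_mem[OF assms(2)] assms(3)
    by (intro module_homI)
      (auto simp: module_hom_add[OF assms(2)] module_hom_smult[OF assms(2)] W.smult_r_distr
        W.smult_assoc_simp W.R.m_comm)
qed

end

section \<open>Quotients of vector spaces in the form of \<open>quot_alg\<close>\<close>

section \<open>Quotient spaces\<close>

locale quotient_space = V: vectorspace K V + W: subspace K W V
  for K :: "('k, 'm) ring_scheme" (structure) and V :: "('k, 'v, 'x) module_scheme" and W
begin

lemma W_subset: "W \<subseteq> carrier V" and W_module: "LinearCombinations.submodule K W V"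
  using W.submod by (auto simp: LinearCombinations.submodule_def)

lemma W_uminus: "w \<in> W \<Longrightarrow> \<ominus>\<^bsub>V\<^esub> w \<in> W"
  using W_module W_subset V.smult_minus_1[of w]
  by (metis (no_types, lifting) LinearCombinations.submodule.smult_closed V.R.add.inv_closed
      V.one_closed in_mono)

lemma additive_subgroup: "additive_subgroup W V"
proof (intro additive_subgroup.intro group.subgroupI)
  show "Group.group (add_monoid V)" by (rule V.M.a_group)
qed (use W_module W_subset W_uminus in \<open>auto simp: LinearCombinations.submodule_def a_inv_def\<close>)

lemma abelian_subgroup: "abelian_subgroup W V"
  using additive_subgroup V.M.abelian_group_axioms by (intro abelian_subgroupI3)

sublocale A: abelian_subgroup W V
  by (rule abelian_subgroup)

lemma coset_eq_iff:
  assumes "v \<in> carrier V" "w \<in> carrier V"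
  shows "W +>\<^bsub>V\<^esub> v = W +>\<^bsub>V\<^esub> w \<longleftrightarrow> v \<ominus>\<^bsub>V\<^esub> w \<in> W"
proof -
  have "W +>\<^bsub>V\<^esub> v = W +>\<^bsub>V\<^esub> w \<longleftrightarrow> v \<in> W +>\<^bsub>V\<^esub> w"
    using assms A.a_rcos_self V.M.a_repr_independence[OF _ _ A.a_subgroup] by metis
  also have "\<dots> \<longleftrightarrow> v \<ominus>\<^bsub>V\<^esub> w \<in> W"
    using A.a_rcos_module[OF assms(2,1)] by (simp add: a_minus_def)
  finally show ?thesis .
qed

lemma mem_coset_iff:
  assumes "v \<in> carrier V"
  shows "w \<in> W +>\<^bsub>V\<^esub> v \<longleftrightarrow> w \<in> carrier V \<and> w \<ominus>\<^bsub>V\<^esub> v \<in> W"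
  using A.a_rcos_module[OF assms, of w] V.M.a_r_coset_subset_G[OF W_subset assms]
  by (auto simp: a_minus_def)

abbreviation Q where "Q \<equiv> quot_alg V W"

lemma quot_carrier: "carrier Q = {W +>\<^bsub>V\<^esub> v | v. v \<in> carrier V}"
  by (auto simp: quot_alg_def ring.defs module.defs FactRing_def A_RCOSETS_def RCOSETS_def
      a_r_coset_def)

lemma quot_coset_closed [simp]: "v \<in> carrier V \<Longrightarrow> W +>\<^bsub>V\<^esub> v \<in> carrier Q"
  by (auto simp: quot_carrier)

lemma quot_zero: "\<zero>\<^bsub>Q\<^esub> = W"
  by (simp add: quot_alg_def ring.defs module.defs FactRing_def)

lemma quot_add:
  "v \<in> carrier V \<Longrightarrow> w \<in> carrier V \<Longrightarrow> (W +>\<^bsub>V\<^esub> v) \<oplus>\<^bsub>Q\<^esub> (W +>\<^bsub>V\<^esub> w) = W +>\<^bsub>V\<^esub> (v \<oplus>\<^bsub>V\<^esub> w)"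
  by (simp add: quot_alg_def ring.defs module.defs FactRing_def A.a_rcos_sum)

lemma quot_smult:
  assumes "c \<in> carrier K" "v \<in> carrier V"
  shows "c \<odot>\<^bsub>Q\<^esub> (W +>\<^bsub>V\<^esub> v) = W +>\<^bsub>V\<^esub> (c \<odot>\<^bsub>V\<^esub> v)"
proof -
  \<comment> \<open>\<open>quot_alg\<close> multiplies a coset by a scalar by taking a union over
    all its elements, so each of them has to give the same coset.\<close>
  have *: "W +>\<^bsub>V\<^esub> (c \<odot>\<^bsub>V\<^esub> x) = W +>\<^bsub>V\<^esub> (c \<odot>\<^bsub>V\<^esub> v)" if "x \<in> W +>\<^bsub>V\<^esub> v" for x
  proof -
    have x: "x \<in> carrier V" "x \<ominus>\<^bsub>V\<^esub> v \<in> W"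
      using that assms mem_coset_iff by auto
    have "c \<odot>\<^bsub>V\<^esub> x \<ominus>\<^bsub>V\<^esub> c \<odot>\<^bsub>V\<^esub> v = c \<odot>\<^bsub>V\<^esub> (x \<ominus>\<^bsub>V\<^esub> v)"
      using x assms by (simp add: a_minus_def V.smult_r_distr V.smult_r_minus)
    also have "\<dots> \<in> W"
      using x assms W_module by (simp add: LinearCombinations.submodule.smult_closed)
    finally show ?thesis
      using x assms coset_eq_iff by simp
  qed
  have "(\<Union>x\<in>W +>\<^bsub>V\<^esub> v. W +>\<^bsub>V\<^esub> (c \<odot>\<^bsub>V\<^esub> x)) = W +>\<^bsub>V\<^esub> (c \<odot>\<^bsub>V\<^esub> v)"
    using * A.a_rcos_self[OF assms(2)] by blast
  then show ?thesis
    by (simp add: quot_alg_def ring.defs module.defs)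
qed

lemma quot_vectorspace: "vectorspace K Q"
proof (rule vs_criteria)
  show "field K" by (rule V.field_axioms)
  have z: "\<zero>\<^bsub>Q\<^esub> = W +>\<^bsub>V\<^esub> \<zero>\<^bsub>V\<^esub>"
    using V.M.a_coset_add_zero[OF W_subset] by (simp add: quot_zero)
  show "\<zero>\<^bsub>Q\<^esub> \<in> carrier Q" by (simp add: z)
  show "\<forall>v w. v \<in> carrier Q \<and> w \<in> carrier Q \<longrightarrow> v \<oplus>\<^bsub>Q\<^esub> w \<in> carrier Q"
    by (auto simp: quot_carrier quot_add)
  show "\<forall>v\<in>carrier Q. \<exists>neg_v\<in>carrier Q. v \<oplus>\<^bsub>Q\<^esub> neg_v = \<zero>\<^bsub>Q\<^esub>"
  proof
    fix v assume "v \<in> carrier Q"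
    then obtain x where x: "x \<in> carrier V" "v = W +>\<^bsub>V\<^esub> x" by (auto simp: quot_carrier)
    then show "\<exists>neg_v\<in>carrier Q. v \<oplus>\<^bsub>Q\<^esub> neg_v = \<zero>\<^bsub>Q\<^esub>"
      by (intro bexI[of _ "W +>\<^bsub>V\<^esub> (\<ominus>\<^bsub>V\<^esub> x)"]) (auto simp: quot_add z V.M.r_neg)
  qed
  show "\<forall>c v. c \<in> carrier K \<and> v \<in> carrier Q \<longrightarrow> c \<odot>\<^bsub>Q\<^esub> v \<in> carrier Q"
    by (auto simp: quot_carrier quot_smult)
  show "\<forall>v w. v \<in> carrier Q \<and> w \<in> carrier Q \<longrightarrow> v \<oplus>\<^bsub>Q\<^esub> w = w \<oplus>\<^bsub>Q\<^esub> v"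
    by (auto simp: quot_carrier quot_add V.M.a_comm)
  show "\<forall>v w x. v \<in> carrier Q \<and> w \<in> carrier Q \<and> x \<in> carrier Q \<longrightarrow>
      v \<oplus>\<^bsub>Q\<^esub> w \<oplus>\<^bsub>Q\<^esub> x = v \<oplus>\<^bsub>Q\<^esub> (w \<oplus>\<^bsub>Q\<^esub> x)"
    by (auto simp: quot_carrier quot_add V.M.a_assoc)
  show "\<forall>v\<in>carrier Q. v \<oplus>\<^bsub>Q\<^esub> \<zero>\<^bsub>Q\<^esub> = v"
    by (auto simp: quot_carrier quot_add z)
  show "\<forall>a b v. a \<in> carrier K \<and> b \<in> carrier K \<and> v \<in> carrier Q \<longrightarrow>
      (a \<otimes>\<^bsub>K\<^esub> b) \<odot>\<^bsub>Q\<^esub> v = a \<odot>\<^bsub>Q\<^esub> (b \<odot>\<^bsub>Q\<^esub> v)"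
    by (auto simp: quot_carrier quot_smult V.smult_assoc1)
  show "\<forall>v\<in>carrier Q. \<one>\<^bsub>K\<^esub> \<odot>\<^bsub>Q\<^esub> v = v"
    by (auto simp: quot_carrier quot_smult)
  show "\<forall>a b v. a \<in> carrier K \<and> b \<in> carrier K \<and> v \<in> carrier Q \<longrightarrow>
      (a \<oplus>\<^bsub>K\<^esub> b) \<odot>\<^bsub>Q\<^esub> v = a \<odot>\<^bsub>Q\<^esub> v \<oplus>\<^bsub>Q\<^esub> b \<odot>\<^bsub>Q\<^esub> v"
    by (auto simp: quot_carrier quot_smult quot_add V.smult_l_distr)
  show "\<forall>a v w. a \<in> carrier K \<and> v \<in> carrier Q \<and> w \<in> carrier Q \<longrightarrow>
      a \<odot>\<^bsub>Q\<^esub> (v \<oplus>\<^bsub>Q\<^esub> w) = a \<odot>\<^bsub>Q\<^esub> v \<oplus>\<^bsub>Q\<^esub> a \<odot>\<^bsub>Q\<^esub> w"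
    by (auto simp: quot_carrier quot_smult quot_add V.smult_r_distr)
qed

lemma coset_linear: "(\<lambda>v. W +>\<^bsub>V\<^esub> v) \<in> module_hom K V Q"
  by (auto intro!: module_homI simp: quot_add quot_smult)

end

section \<open>Finitely supported functions and their linear extensions\<close>

section \<open>Free spaces\<close>

text \<open>Linear extension from the free generators, summed over the support so that it is
  literally the sum evaluated inside \<open>tensor_lift\<close>.\<close>

definition free_lift ::
  "('k, 'm) ring_scheme \<Rightarrow> 'x set \<Rightarrow> ('k, 'u, 'z) module_scheme \<Rightarrow> ('x \<Rightarrow> 'u) \<Rightarrow> ('x \<Rightarrow> 'k) \<Rightarrow> 'u"
  where
  "free_lift K X U b f = (\<Oplus>\<^bsub>U\<^esub>p\<in>{p \<in> X. f p \<noteq> \<zero>\<^bsub>K\<^esub>}. f p \<odot>\<^bsub>U\<^esub> b p)"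

lemma free_space_simps:
  "carrier (free_space K X) = {f \<in> X \<rightarrow>\<^sub>E carrier K. finite {x \<in> X. f x \<noteq> \<zero>\<^bsub>K\<^esub>}}"
  "\<zero>\<^bsub>free_space K X\<^esub> = (\<lambda>x\<in>X. \<zero>\<^bsub>K\<^esub>)"
  "f \<oplus>\<^bsub>free_space K X\<^esub> g = (\<lambda>x\<in>X. f x \<oplus>\<^bsub>K\<^esub> g x)"
  "c \<odot>\<^bsub>free_space K X\<^esub> f = (\<lambda>x\<in>X. c \<otimes>\<^bsub>K\<^esub> f x)"
  if "ring K"
  using that by (simp_all add: free_space_def ring.func_space_def)

lemma free_space_vectorspace:
  assumes "field K"
  shows "vectorspace K (free_space K X)"
proof -
  interpret K: field K by fact
  have "vectorspace K (ring.func_space K X)"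
    using K.func_space_is_module[of X] by (intro vectorspace.intro K.field_axioms)
  moreover have "subspace K {f \<in> X \<rightarrow>\<^sub>E carrier K. finite {x \<in> X. f x \<noteq> \<zero>\<^bsub>K\<^esub>}} (ring.func_space K X)"
  proof (intro subspace.intro LinearCombinations.submodule.intro)
    fix v w assume v: "v \<in> {f \<in> X \<rightarrow>\<^sub>E carrier K. finite {x \<in> X. f x \<noteq> \<zero>\<^bsub>K\<^esub>}}"
      and w: "w \<in> {f \<in> X \<rightarrow>\<^sub>E carrier K. finite {x \<in> X. f x \<noteq> \<zero>\<^bsub>K\<^esub>}}"
    have "finite {x \<in> X. v x \<oplus>\<^bsub>K\<^esub> w x \<noteq> \<zero>\<^bsub>K\<^esub>}"
      by (rule finite_subset[of _ "{x \<in> X. v x \<noteq> \<zero>\<^bsub>K\<^esub>} \<union> {x \<in> X. w x \<noteq> \<zero>\<^bsub>K\<^esub>}"])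
        (use v w in auto)
    then show "v \<oplus>\<^bsub>ring.func_space K X\<^esub> w \<in>
        {f \<in> X \<rightarrow>\<^sub>E carrier K. finite {x \<in> X. f x \<noteq> \<zero>\<^bsub>K\<^esub>}}"
      using v w by (auto simp: K.func_space_def cong: conj_cong)
  next
    fix c v assume c: "c \<in> carrier K"
      and v: "v \<in> {f \<in> X \<rightarrow>\<^sub>E carrier K. finite {x \<in> X. f x \<noteq> \<zero>\<^bsub>K\<^esub>}}"
    have "finite {x \<in> X. c \<otimes>\<^bsub>K\<^esub> v x \<noteq> \<zero>\<^bsub>K\<^esub>}"
      by (rule finite_subset[of _ "{x \<in> X. v x \<noteq> \<zero>\<^bsub>K\<^esub>}"]) (use c v in auto)
    then show "c \<odot>\<^bsub>ring.func_space K X\<^esub> v \<in>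
        {f \<in> X \<rightarrow>\<^sub>E carrier K. finite {x \<in> X. f x \<noteq> \<zero>\<^bsub>K\<^esub>}}"
      using c v by (auto simp: K.func_space_def cong: conj_cong)
  qed (use K.func_space_is_module[of X] calculation in \<open>auto simp: K.func_space_def\<close>)
  ultimately show ?thesis
    unfolding free_space_def by (rule vectorspace.subspace_is_vs)
qed

lemma free_gen_closed [simp]:
  assumes "field K" "x \<in> X"
  shows "free_gen K X x \<in> carrier (free_space K X)"
proof -
  interpret K: field K by fact
  have "{y \<in> X. (if y = x then \<one>\<^bsub>K\<^esub> else \<zero>\<^bsub>K\<^esub>) \<noteq> \<zero>\<^bsub>K\<^esub>} = {x}"
    using assms by auto
  then have "{y \<in> X. free_gen K X x y \<noteq> \<zero>\<^bsub>K\<^esub>} = {x}"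
    by (auto simp: free_gen_def)
  then show ?thesis
    by (auto simp: free_space_simps[OF K.ring_axioms] free_gen_def)
qed

text \<open>Supports change under addition because terms may cancel; any finite superset serves as a
  common index set in the proof of linearity.\<close>

lemma free_lift_superset:
  assumes U: "vectorspace K U" and b: "b \<in> X \<rightarrow> carrier U" and f: "f \<in> X \<rightarrow> carrier K"
    and A: "finite A" "A \<subseteq> X" "{p \<in> X. f p \<noteq> \<zero>\<^bsub>K\<^esub>} \<subseteq> A"
  shows "free_lift K X U b f = (\<Oplus>\<^bsub>U\<^esub>p\<in>A. f p \<odot>\<^bsub>U\<^esub> b p)"
proof -
  interpret U: vectorspace K U by fact
  have cl: "b p \<in> carrier U" "f p \<in> carrier K" if "p \<in> X" for p using b f that by auto
  show ?thesis
    unfolding free_lift_def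
  proof (rule U.M.add.finprod_mono_neutral_cong_left[OF A(1,3)])
    fix i assume "i \<in> A - {p \<in> X. f p \<noteq> \<zero>\<^bsub>K\<^esub>}"
    then show "f i \<odot>\<^bsub>U\<^esub> b i = \<zero>\<^bsub>U\<^esub>" using A cl by auto
  qed (use cl A in auto)
qed

lemma free_lift_linear:
  assumes U: "vectorspace K U" and b: "b \<in> X \<rightarrow> carrier U"
  shows "free_lift K X U b \<in> module_hom K (free_space K X) U"
proof -
  interpret U: vectorspace K U by fact
  note fs = free_space_simps[OF U.R.ring_axioms]
  have cl: "b p \<in> carrier U" if "p \<in> X" for p using b that by auto
  show ?thesis
  proof (rule module_homI)
    fix f assume "f \<in> carrier (free_space K X)"
    then show "free_lift K X U b f \<in> carrier U"
      using cl by (auto simp: free_lift_def fs intro!: U.M.finsum_closed)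
  next
    fix f g assume fg: "f \<in> carrier (free_space K X)" "g \<in> carrier (free_space K X)"
    define A where "A = {p \<in> X. f p \<noteq> \<zero>\<^bsub>K\<^esub>} \<union> {p \<in> X. g p \<noteq> \<zero>\<^bsub>K\<^esub>}"
    have A: "finite A" "A \<subseteq> X" using fg by (auto simp: A_def fs)
    have f: "f p \<in> carrier K" "g p \<in> carrier K" if "p \<in> X" for p
      using fg that by (auto simp: fs)
    have "free_lift K X U b f = (\<Oplus>\<^bsub>U\<^esub>p\<in>A. f p \<odot>\<^bsub>U\<^esub> b p)"
      "free_lift K X U b g = (\<Oplus>\<^bsub>U\<^esub>p\<in>A. g p \<odot>\<^bsub>U\<^esub> b p)"
      using f A by (auto intro!: free_lift_superset[OF U b] simp: A_def)
    moreover have "free_lift K X U b (f \<oplus>\<^bsub>free_space K X\<^esub> g) =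
        (\<Oplus>\<^bsub>U\<^esub>p\<in>A. (f \<oplus>\<^bsub>free_space K X\<^esub> g) p \<odot>\<^bsub>U\<^esub> b p)"
      using f A by (intro free_lift_superset[OF U b]) (auto simp: A_def fs)
    moreover have "\<dots> = (\<Oplus>\<^bsub>U\<^esub>p\<in>A. f p \<odot>\<^bsub>U\<^esub> b p \<oplus>\<^bsub>U\<^esub> g p \<odot>\<^bsub>U\<^esub> b p)"
      using A f cl by (intro U.M.finsum_cong') (auto simp: fs U.smult_l_distr subsetD)
    moreover have "\<dots> = (\<Oplus>\<^bsub>U\<^esub>p\<in>A. f p \<odot>\<^bsub>U\<^esub> b p) \<oplus>\<^bsub>U\<^esub> (\<Oplus>\<^bsub>U\<^esub>p\<in>A. g p \<odot>\<^bsub>U\<^esub> b p)"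
      using A f cl by (intro U.M.finsum_addf) auto
    ultimately show "free_lift K X U b (f \<oplus>\<^bsub>free_space K X\<^esub> g) =
        free_lift K X U b f \<oplus>\<^bsub>U\<^esub> free_lift K X U b g"
      by simp
  next
    fix c f assume c: "c \<in> carrier K" and fg: "f \<in> carrier (free_space K X)"
    define A where "A = {p \<in> X. f p \<noteq> \<zero>\<^bsub>K\<^esub>}"
    have A: "finite A" "A \<subseteq> X" using fg by (auto simp: A_def fs)
    have f: "f p \<in> carrier K" if "p \<in> X" for p
      using fg that by (auto simp: fs)
    have "free_lift K X U b (c \<odot>\<^bsub>free_space K X\<^esub> f) =
        (\<Oplus>\<^bsub>U\<^esub>p\<in>A. (c \<odot>\<^bsub>free_space K X\<^esub> f) p \<odot>\<^bsub>U\<^esub> b p)"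
      using f A c by (intro free_lift_superset[OF U b]) (auto simp: A_def fs)
    also have "\<dots> = (\<Oplus>\<^bsub>U\<^esub>p\<in>A. c \<odot>\<^bsub>U\<^esub> (f p \<odot>\<^bsub>U\<^esub> b p))"
      using A f cl c by (intro U.M.finsum_cong') (auto simp: fs U.smult_assoc1 subsetD)
    also have "\<dots> = c \<odot>\<^bsub>U\<^esub> (\<Oplus>\<^bsub>U\<^esub>p\<in>A. f p \<odot>\<^bsub>U\<^esub> b p)"
      using A f cl c by (intro U.finsum_smult_ldistr[symmetric]) auto
    finally show "free_lift K X U b (c \<odot>\<^bsub>free_space K X\<^esub> f) = c \<odot>\<^bsub>U\<^esub> free_lift K X U b f"
      by (simp add: free_lift_def A_def)
  qed
qed

lemma free_lift_gen:
  assumes U: "vectorspace K U" and b: "b \<in> X \<rightarrow> carrier U" and x: "x \<in> X"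
  shows "free_lift K X U b (free_gen K X x) = b x"
proof -
  interpret U: vectorspace K U by fact
  have cl: "b p \<in> carrier U" if "p \<in> X" for p using b that by auto
  have "{y \<in> X. free_gen K X x y \<noteq> \<zero>\<^bsub>K\<^esub>} = {x}"
    using x by (auto simp: free_gen_def split: if_splits)
  then have "free_lift K X U b (free_gen K X x) = (\<Oplus>\<^bsub>U\<^esub>p\<in>{x}. free_gen K X x p \<odot>\<^bsub>U\<^esub> b p)"
    by (simp add: free_lift_def)
  also have "\<dots> = b x"
    using x cl by (simp add: free_gen_def)
  finally show ?thesis .
qed

text \<open>Induction on a finite set containing the support: splitting off the term at one point
  shrinks this set.\<close>

lemma free_space_induct:
  assumes K: "field K" and f: "f \<in> carrier (free_space K X)"
    and T: "LinearCombinations.submodule K T (free_space K X)"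
    and gen: "\<And>x. x \<in> X \<Longrightarrow> free_gen K X x \<in> T"
  shows "f \<in> T"
proof -
  interpret K: field K by fact
  interpret T: LinearCombinations.submodule K T "free_space K X" by fact
  note fs = free_space_simps[OF K.ring_axioms]
  have "\<forall>f. f \<in> carrier (free_space K X) \<longrightarrow> {x \<in> X. f x \<noteq> \<zero>\<^bsub>K\<^esub>} \<subseteq> A \<longrightarrow> f \<in> T" if "finite A" for A
    using that
  proof (induction A rule: finite_induct)
    case empty
    have "f = \<zero>\<^bsub>free_space K X\<^esub>"
      if "f \<in> carrier (free_space K X)" "{x \<in> X. f x \<noteq> \<zero>\<^bsub>K\<^esub>} \<subseteq> {}" for f
      using that by (auto simp: fs PiE_def extensional_def)
    then show ?case using T.zero_closed by metis
  next
    case (insert a A)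
    show ?case
    proof (intro allI impI)
      fix f assume f: "f \<in> carrier (free_space K X)" and sub: "{x \<in> X. f x \<noteq> \<zero>\<^bsub>K\<^esub>} \<subseteq> insert a A"
      show "f \<in> T"
      proof (cases "a \<in> X")
        case True
        define g where "g = f(a := \<zero>\<^bsub>K\<^esub>)"
        have g: "g \<in> carrier (free_space K X)" "{x \<in> X. g x \<noteq> \<zero>\<^bsub>K\<^esub>} \<subseteq> A"
          using f sub True
          by (auto simp: fs g_def PiE_def extensional_def elim!: rev_finite_subset)
        have fa: "f a \<in> carrier K" and fx: "\<And>x. x \<in> X \<Longrightarrow> f x \<in> carrier K"
          using f True by (auto simp: fs)
        have "f = g \<oplus>\<^bsub>free_space K X\<^esub> (f a \<odot>\<^bsub>free_space K X\<^esub> free_gen K X a)"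
        proof (rule ext)
          fix x
          show "f x = (g \<oplus>\<^bsub>free_space K X\<^esub> (f a \<odot>\<^bsub>free_space K X\<^esub> free_gen K X a)) x"
            using f True fa fx by (auto simp: fs g_def free_gen_def PiE_def extensional_def)
        qed
        then show ?thesis
          using insert.IH g gen[OF True] fa by (metis T.m_closed T.smult_closed)
      next
        case False
        then show ?thesis using insert f sub by blast
      qed
    qed
  qed
  from this[of "{x \<in> X. f x \<noteq> \<zero>\<^bsub>K\<^esub>}"] show ?thesis using f by (auto simp: fs)
qed

section \<open>The universal property of the tensor product\<close>

section \<open>Tensor products\<close>

definition bilin ::
  "('k, 'm) ring_scheme \<Rightarrow> ('k, 'v, 'x) module_scheme \<Rightarrow> ('k, 'w, 'y) module_scheme
    \<Rightarrow> ('k, 'u, 'z) module_scheme \<Rightarrow> ('v \<Rightarrow> 'w \<Rightarrow> 'u) \<Rightarrow> bool" where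
  "bilin K V W U \<beta> \<longleftrightarrow>
     (\<forall>v\<in>carrier V. \<beta> v \<in> module_hom K W U) \<and>
     (\<forall>w\<in>carrier W. (\<lambda>v. \<beta> v w) \<in> module_hom K V U)"

lemma bilinI:
  assumes "\<And>v. v \<in> carrier V \<Longrightarrow> (\<lambda>w. \<beta> v w) \<in> module_hom K W U"
    and "\<And>w. w \<in> carrier W \<Longrightarrow> (\<lambda>v. \<beta> v w) \<in> module_hom K V U"
  shows "bilin K V W U \<beta>"
  using assms by (simp add: bilin_def)

lemma bilinD:
  assumes "bilin K V W U \<beta>"
  shows "v \<in> carrier V \<Longrightarrow> \<beta> v \<in> module_hom K W U"
    and "w \<in> carrier W \<Longrightarrow> (\<lambda>v. \<beta> v w) \<in> module_hom K V U"
    and "v \<in> carrier V \<Longrightarrow> w \<in> carrier W \<Longrightarrow> \<beta> v w \<in> carrier U"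
  using assms module_hom_mem by (fastforce simp: bilin_def)+

locale tensor =
  fixes K :: "('k, 'm) ring_scheme" (structure)
    and V :: "('k, 'v, 'x) module_scheme" and W :: "('k, 'w, 'y) module_scheme"
  assumes V: "vectorspace K V" and W: "vectorspace K W"
begin

abbreviation X where "X \<equiv> carrier V \<times> carrier W"
abbreviation F where "F \<equiv> free_space K X"
abbreviation R where "R \<equiv> tensor_relations K V W"
abbreviation T where "T \<equiv> tensor_space K V W"
abbreviation e where "e v w \<equiv> free_gen K X (v, w)"
abbreviation pure where "pure \<equiv> pure_tensor K V W"
abbreviation tl where "tl \<equiv> tensor_lift K V W"

lemma field_K: "field K"
  using V by (rule vectorspaceD)

sublocale F: vectorspace K F
  by (rule free_space_vectorspace[OF field_K])

sublocale V: vectorspace K V by (rule V)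
sublocale W: vectorspace K W by (rule W)

definition gens where "gens =
         {e (v \<oplus>\<^bsub>V\<^esub> v') w \<ominus>\<^bsub>F\<^esub> (e v w \<oplus>\<^bsub>F\<^esub> e v' w) | v v' w.
              v \<in> carrier V \<and> v' \<in> carrier V \<and> w \<in> carrier W} \<union>
          {e v (w \<oplus>\<^bsub>W\<^esub> w') \<ominus>\<^bsub>F\<^esub> (e v w \<oplus>\<^bsub>F\<^esub> e v w') | v w w'.
              v \<in> carrier V \<and> w \<in> carrier W \<and> w' \<in> carrier W} \<union>
          {e (c \<odot>\<^bsub>V\<^esub> v) w \<ominus>\<^bsub>F\<^esub> (c \<odot>\<^bsub>F\<^esub> e v w) | c v w.
              c \<in> carrier K \<and> v \<in> carrier V \<and> w \<in> carrier W} \<union>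
          {e v (c \<odot>\<^bsub>W\<^esub> w) \<ominus>\<^bsub>F\<^esub> (c \<odot>\<^bsub>F\<^esub> e v w) | c v w.
              c \<in> carrier K \<and> v \<in> carrier V \<and> w \<in> carrier W}"

lemma R_eq: "R = F.span gens"
  by (simp add: tensor_relations_def gens_def Let_def)

lemma e_closed: "v \<in> carrier V \<Longrightarrow> w \<in> carrier W \<Longrightarrow> e v w \<in> carrier F"
  using field_K by simp

lemma gens_subset: "gens \<subseteq> carrier F"
  by (auto simp: gens_def e_closed)

lemma R_subspace: "subspace K R F"
  unfolding R_eq by (rule F.span_is_subspace[OF gens_subset])

sublocale Q: quotient_space K F R
  by (intro quotient_space.intro F.vectorspace_axioms R_subspace)

lemma T_eq: "T = quot_alg F R"
  by (simp add: tensor_space_def)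

lemma T_vectorspace: "vectorspace K T"
  unfolding T_eq by (rule Q.quot_vectorspace)

lemma pure_eq: "pure v w = R +>\<^bsub>F\<^esub> e v w"
  by (simp add: pure_tensor_def)

lemma pure_closed [simp]: "v \<in> carrier V \<Longrightarrow> w \<in> carrier W \<Longrightarrow> pure v w \<in> carrier T"
  by (simp add: pure_eq T_eq e_closed)

lemma gens_R: "gens \<subseteq> R"
  unfolding R_eq by (rule F.in_own_span[OF gens_subset])

lemma pure_add_left:
  assumes "v \<in> carrier V" "v' \<in> carrier V" "w \<in> carrier W"
  shows "pure (v \<oplus>\<^bsub>V\<^esub> v') w = pure v w \<oplus>\<^bsub>T\<^esub> pure v' w"
proof -
  have "e (v \<oplus>\<^bsub>V\<^esub> v') w \<ominus>\<^bsub>F\<^esub> (e v w \<oplus>\<^bsub>F\<^esub> e v' w) \<in> gens"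
    using assms unfolding gens_def by blast
  then show ?thesis
    using assms gens_R by (simp add: pure_eq T_eq Q.quot_add e_closed Q.coset_eq_iff subsetD)
qed

lemma pure_add_right:
  assumes "v \<in> carrier V" "w \<in> carrier W" "w' \<in> carrier W"
  shows "pure v (w \<oplus>\<^bsub>W\<^esub> w') = pure v w \<oplus>\<^bsub>T\<^esub> pure v w'"
proof -
  have "e v (w \<oplus>\<^bsub>W\<^esub> w') \<ominus>\<^bsub>F\<^esub> (e v w \<oplus>\<^bsub>F\<^esub> e v w') \<in> gens"
    using assms unfolding gens_def by blast
  then show ?thesis
    using assms gens_R by (simp add: pure_eq T_eq Q.quot_add e_closed Q.coset_eq_iff subsetD)
qed

lemma pure_smult_left:
  assumes "c \<in> carrier K" "v \<in> carrier V" "w \<in> carrier W"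
  shows "pure (c \<odot>\<^bsub>V\<^esub> v) w = c \<odot>\<^bsub>T\<^esub> pure v w"
proof -
  have "e (c \<odot>\<^bsub>V\<^esub> v) w \<ominus>\<^bsub>F\<^esub> (c \<odot>\<^bsub>F\<^esub> e v w) \<in> gens"
    using assms unfolding gens_def by blast
  then show ?thesis
    using assms gens_R by (simp add: pure_eq T_eq Q.quot_smult e_closed Q.coset_eq_iff subsetD)
qed

lemma pure_smult_right:
  assumes "c \<in> carrier K" "v \<in> carrier V" "w \<in> carrier W"
  shows "pure v (c \<odot>\<^bsub>W\<^esub> w) = c \<odot>\<^bsub>T\<^esub> pure v w"
proof -
  have "e v (c \<odot>\<^bsub>W\<^esub> w) \<ominus>\<^bsub>F\<^esub> (c \<odot>\<^bsub>F\<^esub> e v w) \<in> gens"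
    using assms unfolding gens_def by blast
  then show ?thesis
    using assms gens_R by (simp add: pure_eq T_eq Q.quot_smult e_closed Q.coset_eq_iff subsetD)
qed

lemma pure_bilin: "bilin K V W T pure"
  by (auto intro!: bilinI module_homI
      simp: pure_add_left pure_add_right pure_smult_left pure_smult_right)

text \<open>There is no case for scalar multiples, because a multiple of a pure tensor is again a
  pure tensor.\<close>

lemma T_induct [consumes 1, case_names add pure]:
  assumes "x \<in> carrier T"
    and add: "\<And>x y. x \<in> carrier T \<Longrightarrow> y \<in> carrier T \<Longrightarrow> P x \<Longrightarrow> P y \<Longrightarrow> P (x \<oplus>\<^bsub>T\<^esub> y)"
    and pure: "\<And>v w. v \<in> carrier V \<Longrightarrow> w \<in> carrier W \<Longrightarrow> P (pure v w)"
  shows "P x"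
proof -
  interpret T: vectorspace K T by (rule T_vectorspace)
  note fs = free_space_simps[OF F.R.ring_axioms]
  obtain f where f: "f \<in> carrier F" "x = R +>\<^bsub>F\<^esub> f"
    using assms(1) by (auto simp: T_eq Q.quot_carrier)
  \<comment> \<open>\<open>P\<close> is only closed under sums. Carrying all scalar multiples along
    makes the set of such \<open>f\<close> a submodule of the free space.\<close>
  define C where "C f \<longleftrightarrow> f \<in> carrier F \<and> (\<forall>c\<in>carrier K. P (c \<odot>\<^bsub>T\<^esub> (R +>\<^bsub>F\<^esub> f)))" for f
  have e: "C (e v w)" if "v \<in> carrier V" "w \<in> carrier W" for v w
  proof -
    have "c \<odot>\<^bsub>T\<^esub> (R +>\<^bsub>F\<^esub> e v w) = pure (c \<odot>\<^bsub>V\<^esub> v) w" if "c \<in> carrier K" for c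
      using that \<open>v \<in> _\<close> \<open>w \<in> _\<close> pure_smult_left pure_eq by simp
    then show ?thesis using that pure by (auto simp: C_def e_closed)
  qed
  have "LinearCombinations.submodule K {f. C f} F"
  proof (rule LinearCombinations.submodule.intro)
    fix f g assume "f \<in> {f. C f}" "g \<in> {f. C f}"
    then have fg: "C f" "C g" by auto
    then have "c \<odot>\<^bsub>T\<^esub> (R +>\<^bsub>F\<^esub> (f \<oplus>\<^bsub>F\<^esub> g)) = c \<odot>\<^bsub>T\<^esub> (R +>\<^bsub>F\<^esub> f) \<oplus>\<^bsub>T\<^esub> c \<odot>\<^bsub>T\<^esub> (R +>\<^bsub>F\<^esub> g)"
      if "c \<in> carrier K" for c
      using that by (simp add: C_def T_eq Q.quot_smult Q.quot_add F.smult_r_distr)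
    then show "f \<oplus>\<^bsub>F\<^esub> g \<in> {f. C f}"
      using fg add by (auto simp: C_def T_eq Q.quot_smult)
  next
    have "pure \<zero>\<^bsub>V\<^esub> \<zero>\<^bsub>W\<^esub> = \<zero>\<^bsub>T\<^esub>"
      using pure_smult_left[of "\<zero>\<^bsub>K\<^esub>" "\<zero>\<^bsub>V\<^esub>" "\<zero>\<^bsub>W\<^esub>"] by simp
    then have P0: "P \<zero>\<^bsub>T\<^esub>" using pure[of "\<zero>\<^bsub>V\<^esub>" "\<zero>\<^bsub>W\<^esub>"] by simp
    have "R +>\<^bsub>F\<^esub> \<zero>\<^bsub>F\<^esub> = \<zero>\<^bsub>T\<^esub>"
      using F.M.a_coset_add_zero[OF Q.W_subset] by (simp add: T_eq Q.quot_zero)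
    then show "\<zero>\<^bsub>F\<^esub> \<in> {f. C f}"
      using P0 by (auto simp: C_def)
  next
    fix c f assume "c \<in> carrier K" "f \<in> {f. C f}"
    then show "c \<odot>\<^bsub>F\<^esub> f \<in> {f. C f}"
      by (auto simp: C_def T_eq Q.quot_smult F.smult_assoc_simp)
  qed (auto simp: C_def F.module_axioms)
  then have "f \<in> {f. C f}"
    by (rule free_space_induct[OF field_K f(1)]) (use e in auto)
  then have "P (\<one>\<^bsub>K\<^esub> \<odot>\<^bsub>T\<^esub> x)"
    using f by (auto simp: C_def)
  then show ?thesis using assms(1) by simp
qed

text \<open>\<open>tensor_lift\<close> evaluates the free extension of \<open>\<beta>\<close> at an
  arbitrarily chosen element of the coset. Bilinearity makes this extension vanish on
  \<open>gens\<close>, hence on their span, so the choice does not matter.\<close>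

lemma tl_coset:
  assumes U: "vectorspace K U" and b: "bilin K V W U \<beta>" and f: "f \<in> carrier F"
  shows "tl U \<beta> (R +>\<^bsub>F\<^esub> f) = free_lift K X U (\<lambda>p. \<beta> (fst p) (snd p)) f"
proof -
  interpret U: vectorspace K U by (rule U)
  interpret T: vectorspace K T by (rule T_vectorspace)
  let ?b = "\<lambda>p. \<beta> (fst p) (snd p)"
  let ?L = "free_lift K X U ?b"
  have bX: "?b \<in> X \<rightarrow> carrier U"
    using bilinD(3)[OF b] by auto
  have L: "?L \<in> module_hom K F U" by (rule free_lift_linear[OF U bX])
  interpret L: linear_map K F U ?L
    by (intro linear_map.intro mod_hom.intro mod_hom_axioms.intro F.vectorspace_axioms U
        F.module_axioms U.module_axioms L)
  have Le: "?L (e v w) = \<beta> v w" if "v \<in> carrier V" "w \<in> carrier W" for v w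
    using free_lift_gen[OF U bX, of "(v, w)"] that by simp
  note b' = bilinD[OF b] module_hom_add[OF bilinD(1)[OF b]] module_hom_add[OF bilinD(2)[OF b]]
    module_hom_smult[OF bilinD(1)[OF b]] module_hom_smult[OF bilinD(2)[OF b]]
  have "gens \<subseteq> L.kerT"
    unfolding gens_def L.ker_def
    by (auto simp: e_closed Le b' U.smult_closed)
  then have R: "R \<subseteq> L.kerT"
    unfolding R_eq using F.span_is_subset[OF _ L.ker_is_submodule] by blast
  define g where "g = (SOME g. g \<in> R +>\<^bsub>F\<^esub> f)"
  have "g \<in> R +>\<^bsub>F\<^esub> f"
    unfolding g_def
    by (rule someI[of "\<lambda>g. g \<in> R +>\<^bsub>F\<^esub> f" f, OF Q.A.a_rcos_self[OF f]])
  then have g: "g \<in> carrier F" "g \<ominus>\<^bsub>F\<^esub> f \<in> R"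
    using Q.mem_coset_iff[OF f] by auto
  then have "?L (g \<ominus>\<^bsub>F\<^esub> f) = \<zero>\<^bsub>U\<^esub>"
    using R by (auto simp: L.ker_def)
  then have "?L g = ?L f"
    using g f L.f_im by simp
  then show ?thesis
    by (simp add: tensor_lift_def g_def[symmetric] free_lift_def)
qed

lemma tl_linear:
  assumes U: "vectorspace K U" and b: "bilin K V W U \<beta>"
  shows "tl U \<beta> \<in> module_hom K T U"
proof -
  let ?b = "\<lambda>p. \<beta> (fst p) (snd p)"
  have bX: "?b \<in> X \<rightarrow> carrier U"
    using bilinD(3)[OF b] by auto
  have L: "free_lift K X U ?b \<in> module_hom K F U" by (rule free_lift_linear[OF U bX])
  show ?thesis
  proof (rule module_homI)
    fix x assume "x \<in> carrier T"
    then show "tl U \<beta> x \<in> carrier U"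
      by (auto simp: T_eq Q.quot_carrier tl_coset[OF U b] module_hom_mem[OF L])
  next
    fix x y assume "x \<in> carrier T" "y \<in> carrier T"
    then show "tl U \<beta> (x \<oplus>\<^bsub>T\<^esub> y) = tl U \<beta> x \<oplus>\<^bsub>U\<^esub> tl U \<beta> y"
      by (auto simp: T_eq Q.quot_carrier Q.quot_add tl_coset[OF U b] module_hom_add[OF L])
  next
    fix c x assume "c \<in> carrier K" "x \<in> carrier T"
    then show "tl U \<beta> (c \<odot>\<^bsub>T\<^esub> x) = c \<odot>\<^bsub>U\<^esub> tl U \<beta> x"
      by (auto simp: T_eq Q.quot_carrier Q.quot_smult tl_coset[OF U b] module_hom_smult[OF L])
  qed
qed

lemma tl_pure:
  assumes U: "vectorspace K U" and b: "bilin K V W U \<beta>" and "v \<in> carrier V" "w \<in> carrier W"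
  shows "tl U \<beta> (pure v w) = \<beta> v w"
proof -
  have bX: "(\<lambda>p. \<beta> (fst p) (snd p)) \<in> X \<rightarrow> carrier U"
    using bilinD(3)[OF b] by auto
  show ?thesis
    using free_lift_gen[OF U bX, of "(v, w)"] assms(3,4)
    by (simp add: pure_eq tl_coset[OF U b] e_closed)
qed

text \<open>Uniqueness in the universal property; the rules for \<open>tensor_lift\<close> that
  follow are reduced to pure tensors by it.\<close>

lemma T_ext:
  assumes f: "f \<in> module_hom K T U" and g: "g \<in> module_hom K T U"
    and eq: "\<And>v w. v \<in> carrier V \<Longrightarrow> w \<in> carrier W \<Longrightarrow> f (pure v w) = g (pure v w)"
    and x: "x \<in> carrier T"
  shows "f x = g x"
  using x
  by (induction rule: T_induct)
    (auto simp: module_hom_add[OF f] module_hom_add[OF g] eq)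

lemma tl_comp:
  assumes U: "vectorspace K U" and U': "vectorspace K U'"
    and b: "bilin K V W U \<beta>" and h: "h \<in> module_hom K U U'" and x: "x \<in> carrier T"
  shows "h (tl U \<beta> x) = tl U' (\<lambda>v w. h (\<beta> v w)) x"
proof (rule T_ext[OF _ _ _ x])
  have b': "bilin K V W U' (\<lambda>v w. h (\<beta> v w))"
    by (intro bilinI lin_comp[OF h] bilinD[OF b])
  show "(\<lambda>x. h (tl U \<beta> x)) \<in> module_hom K T U'"
    by (rule lin_comp[OF h tl_linear[OF U b]])
  show "tl U' (\<lambda>v w. h (\<beta> v w)) \<in> module_hom K T U'"
    by (rule tl_linear[OF U' b'])
  show "h (tl U \<beta> (pure v w)) = tl U' (\<lambda>v w. h (\<beta> v w)) (pure v w)"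
    if "v \<in> carrier V" "w \<in> carrier W" for v w
    using that by (simp add: tl_pure[OF U b] tl_pure[OF U' b'])
qed

lemma tl_cong:
  assumes U: "vectorspace K U" and b: "bilin K V W U \<beta>"
    and eq: "\<And>v w. v \<in> carrier V \<Longrightarrow> w \<in> carrier W \<Longrightarrow> \<beta> v w = \<gamma> v w"
    and x: "x \<in> carrier T"
  shows "tl U \<beta> x = tl U \<gamma> x"
proof (rule T_ext[OF _ _ _ x])
  have b': "bilin K V W U \<gamma>"
  proof (rule bilinI)
    fix v assume v: "v \<in> carrier V"
    show "(\<lambda>w. \<gamma> v w) \<in> module_hom K W U"
      by (rule module_hom_cong[OF bilinD(1)[OF b v]]) (auto simp: eq v)
  next
    fix w assume w: "w \<in> carrier W"
    show "(\<lambda>v. \<gamma> v w) \<in> module_hom K V U"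
      by (rule module_hom_cong[OF bilinD(2)[OF b w]]) (auto simp: eq w)
  qed
  show "tl U \<beta> \<in> module_hom K T U" by (rule tl_linear[OF U b])
  show "tl U \<gamma> \<in> module_hom K T U" by (rule tl_linear[OF U b'])
  show "tl U \<beta> (pure v w) = tl U \<gamma> (pure v w)" if "v \<in> carrier V" "w \<in> carrier W" for v w
    using that by (simp add: tl_pure[OF U b] tl_pure[OF U b'] eq)
qed

text \<open>Linearity in a variable that occurs inside the bilinear map. Nested Sweedler sums need
  it for the bilinearity of their outer sum.\<close>

lemma tl_linear_param:
  assumes P: "vectorspace K P" and U: "vectorspace K U"
    and b: "\<And>p. p \<in> carrier P \<Longrightarrow> bilin K V W U (\<beta> p)"
    and l: "\<And>v w. v \<in> carrier V \<Longrightarrow> w \<in> carrier W \<Longrightarrow> (\<lambda>p. \<beta> p v w) \<in> module_hom K P U"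
    and x: "x \<in> carrier T"
  shows "(\<lambda>p. tl U (\<beta> p) x) \<in> module_hom K P U"
proof -
  interpret P: vectorspace K P by (rule P)
  interpret U: vectorspace K U by (rule U)
  have t: "tl U (\<beta> p) \<in> module_hom K T U" if "p \<in> carrier P" for p
    by (rule tl_linear[OF U b[OF that]])
  show ?thesis
  proof (rule module_homI)
    fix p assume "p \<in> carrier P"
    then show "tl U (\<beta> p) x \<in> carrier U" using module_hom_mem[OF t x] by simp
  next
    fix p q assume pq: "p \<in> carrier P" "q \<in> carrier P"
    show "tl U (\<beta> (p \<oplus>\<^bsub>P\<^esub> q)) x = tl U (\<beta> p) x \<oplus>\<^bsub>U\<^esub> tl U (\<beta> q) x"
    proof (rule T_ext[OF _ _ _ x])
      show "tl U (\<beta> (p \<oplus>\<^bsub>P\<^esub> q)) \<in> module_hom K T U" using pq t by simp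
      show "(\<lambda>x. tl U (\<beta> p) x \<oplus>\<^bsub>U\<^esub> tl U (\<beta> q) x) \<in> module_hom K T U"
        using pq t by (intro lin_add T_vectorspace U)
    qed (use pq in \<open>simp add: tl_pure[OF U b] module_hom_add[OF l]\<close>)
  next
    fix c p assume cp: "c \<in> carrier K" "p \<in> carrier P"
    show "tl U (\<beta> (c \<odot>\<^bsub>P\<^esub> p)) x = c \<odot>\<^bsub>U\<^esub> tl U (\<beta> p) x"
    proof (rule T_ext[OF _ _ _ x])
      show "tl U (\<beta> (c \<odot>\<^bsub>P\<^esub> p)) \<in> module_hom K T U" using cp t by simp
      show "(\<lambda>x. c \<odot>\<^bsub>U\<^esub> tl U (\<beta> p) x) \<in> module_hom K T U"
        using cp t by (intro lin_smult U)
    qed (use cp in \<open>simp add: tl_pure[OF U b] module_hom_smult[OF l]\<close>)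
  qed
qed

end

text \<open>Interchange of two independent formal sums: for fixed \<open>y\<close> both sides are
  linear in \<open>x\<close> and agree on pure tensors.\<close>

lemma tensor_lift_swap:
  assumes V: "vectorspace K V" and W: "vectorspace K W"
    and V': "vectorspace K V'" and W': "vectorspace K W'" and U: "vectorspace K U"
    and 1: "\<And>v w. v \<in> carrier V \<Longrightarrow> w \<in> carrier W \<Longrightarrow> bilin K V' W' U (\<gamma> v w)"
    and 2: "\<And>v' w'. v' \<in> carrier V' \<Longrightarrow> w' \<in> carrier W' \<Longrightarrow> bilin K V W U (\<lambda>v w. \<gamma> v w v' w')"
    and x: "x \<in> carrier (tensor_space K V W)" and y: "y \<in> carrier (tensor_space K V' W')"
  shows "tensor_lift K V W U (\<lambda>v w. tensor_lift K V' W' U (\<gamma> v w) y) x =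
    tensor_lift K V' W' U (\<lambda>v' w'. tensor_lift K V W U (\<lambda>v w. \<gamma> v w v' w') x) y"
proof -
  interpret A: tensor K V W by (intro tensor.intro V W)
  interpret B: tensor K V' W' by (intro tensor.intro V' W')
  have b1: "bilin K V W U (\<lambda>v w. tensor_lift K V' W' U (\<gamma> v w) y)"
    by (intro bilinI B.tl_linear_param V W U 1 y bilinD[OF 2])
  have b2: "bilin K V' W' U (\<lambda>v' w'. tensor_lift K V W U (\<lambda>v w. \<gamma> v w v' w') x)"
    if "x \<in> carrier (tensor_space K V W)" for x
    by (intro bilinI A.tl_linear_param V' W' U 2 that bilinD[OF 1])
  show ?thesis
  proof (rule A.T_ext[OF _ _ _ x])
    show "tensor_lift K V W U (\<lambda>v w. tensor_lift K V' W' U (\<gamma> v w) y) \<in> module_hom K A.T U"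
      by (rule A.tl_linear[OF U b1])
    show "(\<lambda>x. tensor_lift K V' W' U (\<lambda>v' w'. tensor_lift K V W U (\<lambda>v w. \<gamma> v w v' w') x) y)
        \<in> module_hom K A.T U"
      by (intro B.tl_linear_param A.T_vectorspace U b2 y A.tl_linear 2)
    fix v w assume vw: "v \<in> carrier V" "w \<in> carrier W"
    have "tensor_lift K V W U (\<lambda>v w. tensor_lift K V' W' U (\<gamma> v w) y) (A.pure v w) =
        tensor_lift K V' W' U (\<gamma> v w) y"
      using vw by (simp add: A.tl_pure[OF U b1])
    also have "\<dots> = tensor_lift K V' W' U
        (\<lambda>v' w'. tensor_lift K V W U (\<lambda>v w. \<gamma> v w v' w') (A.pure v w)) y"
      using vw by (intro B.tl_cong U 1 y) (simp_all add: A.tl_pure[OF U 2])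
    finally show "tensor_lift K V W U (\<lambda>v w. tensor_lift K V' W' U (\<gamma> v w) y) (A.pure v w) =
      tensor_lift K V' W' U
        (\<lambda>v' w'. tensor_lift K V W U (\<lambda>v w. \<gamma> v w v' w') (A.pure v w)) y" .
  qed
qed

section \<open>Sweedler calculus: the Hopf algebra axioms tested against multilinear maps\<close>

section \<open>Hopf algebras\<close>

text \<open>Rules that follow the syntax of an expression and reduce its linearity in one variable
  to carrier membership of the other parts. Every rewriting under a Sweedler sum has such a side
  condition.\<close>

named_theorems lin_intros

lemmas [lin_intros] = lin_id bilinI

lemma regular_module_simps [simp]:
  "carrier (regular_module R) = carrier R" "zero (regular_module R) = zero R"
  "add (regular_module R) = add R" "smult (regular_module R) = mult R"
  "mult (regular_module R) = mult R" "one (regular_module R) = one R"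
  by (simp_all add: regular_module_def)

text \<open>The field as a space over itself is the target of functionals, which are thereby
  ordinary members of \<open>module_hom\<close>.\<close>

lemma regular_vectorspace:
  assumes "field K"
  shows "vectorspace K (regular_module K)"
proof -
  interpret K: field K by fact
  show ?thesis
    by (rule vs_criteria)
      (auto simp: K.field_axioms K.a_ac K.m_assoc K.l_distr K.r_distr intro!: bexI[of _ "\<ominus>\<^bsub>K\<^esub> _"] K.r_neg)
qed

lemma lin_mult_left:
  assumes "assoc_algebra K A" "f \<in> module_hom K P A" "a \<in> carrier A"
  shows "(\<lambda>x. f x \<otimes>\<^bsub>A\<^esub> a) \<in> module_hom K P A"
proof -
  interpret assoc_algebra K A by fact
  interpret ring A by (rule ring)
  show ?thesis
    using module_hom_mem[OF assms(2)] assms(3)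
    by (intro module_homI) (auto simp: module_hom_add[OF assms(2)] module_hom_smult[OF assms(2)]
        l_distr smult_mult_left)
qed

lemma lin_mult_right:
  assumes "assoc_algebra K A" "f \<in> module_hom K P A" "a \<in> carrier A"
  shows "(\<lambda>x. a \<otimes>\<^bsub>A\<^esub> f x) \<in> module_hom K P A"
proof -
  interpret assoc_algebra K A by fact
  interpret ring A by (rule ring)
  show ?thesis
    using module_hom_mem[OF assms(2)] assms(3)
    by (intro module_homI) (auto simp: module_hom_add[OF assms(2)] module_hom_smult[OF assms(2)]
        r_distr smult_mult_right)
qed

lemma lin_smult_left:
  assumes "vectorspace K V" "p \<in> module_hom K P (regular_module K)" "v \<in> carrier V"
  shows "(\<lambda>x. p x \<odot>\<^bsub>V\<^esub> v) \<in> module_hom K P V"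
proof -
  interpret V: vectorspace K V by fact
  have p: "p x \<in> carrier K" if "x \<in> carrier P" for x
    using module_hom_mem[OF assms(2) that] by simp
  show ?thesis
    using p assms(3)
    by (intro module_homI) (auto simp: module_hom_add[OF assms(2)] module_hom_smult[OF assms(2)]
        V.smult_l_distr V.smult_assoc1)
qed

lemma bilin_lin:
  assumes "bilin K V W U \<beta>"
  shows "f \<in> module_hom K P V \<Longrightarrow> a \<in> carrier W \<Longrightarrow> (\<lambda>x. \<beta> (f x) a) \<in> module_hom K P U"
    and "g \<in> module_hom K P W \<Longrightarrow> b \<in> carrier V \<Longrightarrow> (\<lambda>x. \<beta> b (g x)) \<in> module_hom K P U"
  using lin_comp[OF bilinD(1)[OF assms]] lin_comp[OF bilinD(2)[OF assms]] by auto

lemma field_mult_assoc_algebra: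
  assumes "field K"
  shows "assoc_algebra K (regular_module K)"
proof -
  interpret K: field K by fact
  have "ring (regular_module K)"
    by (rule ringI; (intro abelian_groupI monoidI)?)
      (auto simp: K.a_ac K.m_assoc K.l_distr K.r_distr intro!: bexI[of _ "\<ominus>\<^bsub>K\<^esub> _"] K.l_neg)
  then show ?thesis
    by (intro assoc_algebra.intro regular_vectorspace assms) (auto simp: K.m_ac)
qed

context hopf_algebra
begin

sublocale H: vectorspace K H
  using algebra by (rule assoc_algebra.vectorspace)

sublocale HR: ring H
  using algebra by (rule assoc_algebra.ring)

sublocale HH: tensor K H H
  by (intro tensor.intro H.vectorspace_axioms)

abbreviation \<epsilon> where "\<epsilon> \<equiv> counit H"
abbreviation (input) sw where "sw U \<beta> h \<equiv> tensor_lift K H H U \<beta> (comult H h)"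
abbreviation K1 where "K1 \<equiv> regular_module K"

lemma vectorspace_facts [simp, lin_intros]:
  "vectorspace K H" "vectorspace K HH.T" "vectorspace K K1"
  by (simp_all add: H.vectorspace_axioms HH.T_vectorspace regular_vectorspace H.field_axioms)

lemma comult_closed [simp]: "h \<in> carrier H \<Longrightarrow> comult H h \<in> carrier HH.T"
  using module_hom_mem[OF comult_linear] .

lemma sw_closed [simp, intro]:
  "vectorspace K U \<Longrightarrow> bilin K H H U \<beta> \<Longrightarrow> h \<in> carrier H \<Longrightarrow> sw U \<beta> h \<in> carrier U"
  by (rule module_hom_mem[OF HH.tl_linear comult_closed])

lemma sw_lin_arg [lin_intros]:
  "vectorspace K U \<Longrightarrow> bilin K H H U \<beta> \<Longrightarrow> f \<in> module_hom K P H \<Longrightarrow>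
    (\<lambda>x. sw U \<beta> (f x)) \<in> module_hom K P U"
  by (rule lin_comp[OF lin_comp[OF HH.tl_linear comult_linear]])

lemma sw_lin_param [lin_intros]:
  assumes "vectorspace K P" "vectorspace K U"
    "\<And>p. p \<in> carrier P \<Longrightarrow> bilin K H H U (\<beta> p)"
    "\<And>a b. a \<in> carrier H \<Longrightarrow> b \<in> carrier H \<Longrightarrow> (\<lambda>p. \<beta> p a b) \<in> module_hom K P U"
    "h \<in> carrier H"
  shows "(\<lambda>p. sw U (\<beta> p) h) \<in> module_hom K P U"
  using assms by (intro HH.tl_linear_param) auto

lemma sw_comp:
  assumes "vectorspace K U" "vectorspace K U'" "bilin K H H U \<beta>" "F \<in> module_hom K U U'"
    "h \<in> carrier H"
  shows "F (sw U \<beta> h) = sw U' (\<lambda>a b. F (\<beta> a b)) h"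
  using assms by (intro HH.tl_comp) auto

lemma sw_cong:
  assumes "vectorspace K U" "bilin K H H U \<beta>" "h \<in> carrier H"
    "\<And>a b. a \<in> carrier H \<Longrightarrow> b \<in> carrier H \<Longrightarrow> \<beta> a b = \<gamma> a b"
  shows "sw U \<beta> h = sw U \<gamma> h"
  using assms by (intro HH.tl_cong) auto

lemma sw_one:
  assumes "vectorspace K U" "bilin K H H U \<beta>"
  shows "sw U \<beta> \<one>\<^bsub>H\<^esub> = \<beta> \<one>\<^bsub>H\<^esub> \<one>\<^bsub>H\<^esub>"
proof -
  have "comult H \<one>\<^bsub>H\<^esub> = pure_tensor K H H \<one>\<^bsub>H\<^esub> \<one>\<^bsub>H\<^esub>"
    using ring_hom_one[OF comult_ring_hom] by (simp add: tensor_algebra_def)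
  then show ?thesis using assms by (simp add: HH.tl_pure)
qed

lemma mult_lin [lin_intros]:
  "f \<in> module_hom K P H \<Longrightarrow> a \<in> carrier H \<Longrightarrow> (\<lambda>x. f x \<otimes>\<^bsub>H\<^esub> a) \<in> module_hom K P H"
  "f \<in> module_hom K P H \<Longrightarrow> a \<in> carrier H \<Longrightarrow> (\<lambda>x. a \<otimes>\<^bsub>H\<^esub> f x) \<in> module_hom K P H"
  by (simp_all add: lin_mult_left[OF algebra] lin_mult_right[OF algebra])

lemma pure_lin [lin_intros]:
  "f \<in> module_hom K P H \<Longrightarrow> a \<in> carrier H \<Longrightarrow> (\<lambda>x. pure_tensor K H H (f x) a) \<in> module_hom K P HH.T"
  "f \<in> module_hom K P H \<Longrightarrow> a \<in> carrier H \<Longrightarrow> (\<lambda>x. pure_tensor K H H a (f x)) \<in> module_hom K P HH.T"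
  using lin_comp[OF bilinD(1)[OF HH.pure_bilin]] lin_comp[OF bilinD(2)[OF HH.pure_bilin]] by auto

text \<open>Multiplicativity of the coproduct. The product of \<open>tensor_algebra\<close> is a
  double \<open>tensor_lift\<close>, and the linear map induced by \<open>\<beta>\<close> is pushed
  through it one sum at a time.\<close>

lemma sw_mult:
  assumes U: "vectorspace K U" and b: "bilin K H H U \<beta>" and g: "g \<in> carrier H" and h: "h \<in> carrier H"
  shows "sw U \<beta> (g \<otimes>\<^bsub>H\<^esub> h) =
    sw U (\<lambda>a b. sw U (\<lambda>c d. \<beta> (a \<otimes>\<^bsub>H\<^esub> c) (b \<otimes>\<^bsub>H\<^esub> d)) h) g"
proof -
  note [lin_intros] = bilin_lin[OF b]
  have 1: "bilin K H H HH.T (\<lambda>c d. pure_tensor K H H (a \<otimes>\<^bsub>H\<^esub> c) (b \<otimes>\<^bsub>H\<^esub> d))"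
    if "a \<in> carrier H" "b \<in> carrier H" for a b
    using that by (auto intro!: lin_intros)
  have "1'": "bilin K H H HH.T (\<lambda>a b. pure_tensor K H H (a \<otimes>\<^bsub>H\<^esub> c) (b \<otimes>\<^bsub>H\<^esub> d))"
    if "c \<in> carrier H" "d \<in> carrier H" for c d
    using that by (auto intro!: lin_intros)
  have 2: "bilin K H H HH.T (\<lambda>a b. sw HH.T (\<lambda>c d. pure_tensor K H H (a \<otimes>\<^bsub>H\<^esub> c) (b \<otimes>\<^bsub>H\<^esub> d)) h)"
    using h by (auto intro!: lin_intros)
  have L: "HH.tl U \<beta> \<in> module_hom K HH.T U"
    by (rule HH.tl_linear[OF U b])
  have "comult H (g \<otimes>\<^bsub>H\<^esub> h) =
      sw HH.T (\<lambda>a b. sw HH.T (\<lambda>c d. pure_tensor K H H (a \<otimes>\<^bsub>H\<^esub> c) (b \<otimes>\<^bsub>H\<^esub> d)) h) g"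
    using ring_hom_mult[OF comult_ring_hom g h] by (simp add: tensor_algebra_def)
  then have "sw U \<beta> (g \<otimes>\<^bsub>H\<^esub> h) =
      sw U (\<lambda>a b. HH.tl U \<beta> (sw HH.T (\<lambda>c d. pure_tensor K H H (a \<otimes>\<^bsub>H\<^esub> c) (b \<otimes>\<^bsub>H\<^esub> d)) h)) g"
    using sw_comp[OF _ U 2 L g] by simp
  also have "\<dots> = sw U (\<lambda>a b. sw U (\<lambda>c d. \<beta> (a \<otimes>\<^bsub>H\<^esub> c) (b \<otimes>\<^bsub>H\<^esub> d)) h) g"
  proof (rule sw_cong[OF U _ g])
    show "bilin K H H U
        (\<lambda>a b. HH.tl U \<beta> (sw HH.T (\<lambda>c d. pure_tensor K H H (a \<otimes>\<^bsub>H\<^esub> c) (b \<otimes>\<^bsub>H\<^esub> d)) h))"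
      by (intro bilinI lin_comp[OF L] bilinD[OF 2])
    fix a b'  assume ab: "a \<in> carrier H" "b' \<in> carrier H"
    have "HH.tl U \<beta> (sw HH.T (\<lambda>c d. pure_tensor K H H (a \<otimes>\<^bsub>H\<^esub> c) (b' \<otimes>\<^bsub>H\<^esub> d)) h) =
        sw U (\<lambda>c d. HH.tl U \<beta> (pure_tensor K H H (a \<otimes>\<^bsub>H\<^esub> c) (b' \<otimes>\<^bsub>H\<^esub> d))) h"
      by (rule sw_comp[OF _ U 1[OF ab] L h]) simp
    also have "\<dots> = sw U (\<lambda>c d. \<beta> (a \<otimes>\<^bsub>H\<^esub> c) (b' \<otimes>\<^bsub>H\<^esub> d)) h"
    proof (rule sw_cong[OF U _ h])
      show "bilin K H H U (\<lambda>c d. HH.tl U \<beta> (pure_tensor K H H (a \<otimes>\<^bsub>H\<^esub> c) (b' \<otimes>\<^bsub>H\<^esub> d)))"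
        by (intro bilinI lin_comp[OF L] bilinD[OF 1[OF ab]])
    qed (use ab in \<open>simp add: HH.tl_pure[OF U b]\<close>)
    finally show "HH.tl U \<beta> (sw HH.T (\<lambda>c d. pure_tensor K H H (a \<otimes>\<^bsub>H\<^esub> c) (b' \<otimes>\<^bsub>H\<^esub> d)) h) =
        sw U (\<lambda>c d. \<beta> (a \<otimes>\<^bsub>H\<^esub> c) (b' \<otimes>\<^bsub>H\<^esub> d)) h" .
  qed
  finally show ?thesis .
qed

definition trilin where
  "trilin U \<gamma> \<longleftrightarrow>
    (\<forall>a\<in>carrier H. bilin K H H U (\<gamma> a)) \<and>
    (\<forall>b\<in>carrier H. \<forall>c\<in>carrier H. (\<lambda>a. \<gamma> a b c) \<in> module_hom K H U)"

lemma trilinI: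
  assumes "\<And>a b. a \<in> carrier H \<Longrightarrow> b \<in> carrier H \<Longrightarrow> (\<lambda>c. \<gamma> a b c) \<in> module_hom K H U"
    and "\<And>a c. a \<in> carrier H \<Longrightarrow> c \<in> carrier H \<Longrightarrow> (\<lambda>b. \<gamma> a b c) \<in> module_hom K H U"
    and "\<And>b c. b \<in> carrier H \<Longrightarrow> c \<in> carrier H \<Longrightarrow> (\<lambda>a. \<gamma> a b c) \<in> module_hom K H U"
  shows "trilin U \<gamma>"
  using assms by (simp add: trilin_def bilin_def)

text \<open>The axiom is an equation in \<open>H \<otimes> (H \<otimes> H)\<close>. The linear map
  \<open>G\<close> that \<open>\<gamma>\<close> induces on this space turns its two sides into the
  two iterated sums.\<close>

lemma sw_coassoc:
  assumes U: "vectorspace K U" and g: "trilin U \<gamma>" and h: "h \<in> carrier H"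
  shows "sw U (\<lambda>a b. sw U (\<lambda>a1 a2. \<gamma> a1 a2 b) a) h = sw U (\<lambda>a b. sw U (\<lambda>b1 b2. \<gamma> a b1 b2) b) h"
proof -
  interpret HHH: tensor K H HH.T by (intro tensor.intro) auto
  have T: "vectorspace K HHH.T" by (rule HHH.T_vectorspace)
  have g1: "bilin K H H U (\<gamma> a)" if "a \<in> carrier H" for a using g that by (simp add: trilin_def)
  have g2: "(\<lambda>a. \<gamma> a b c) \<in> module_hom K H U" if "b \<in> carrier H" "c \<in> carrier H" for b c
    using g that by (simp add: trilin_def)
  define G where "G = tensor_lift K H HH.T U (\<lambda>a X. HH.tl U (\<gamma> a) X)"
  have b: "bilin K H HH.T U (\<lambda>a X. HH.tl U (\<gamma> a) X)"
    by (intro bilinI HH.tl_linear U g1 HH.tl_linear_param g2) auto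
  have G: "G \<in> module_hom K HHH.T U"
    unfolding G_def by (rule HHH.tl_linear[OF U b])
  have Gp: "G (HHH.pure a X) = HH.tl U (\<gamma> a) X" if "a \<in> carrier H" "X \<in> carrier HH.T" for a X
    unfolding G_def using that by (simp add: HHH.tl_pure[OF U b])
  note p = bilin_lin[OF HHH.pure_bilin]
  have c1: "bilin K H H HHH.T (\<lambda>a1 a2. HHH.pure a1 (HH.pure a2 b))" if "b \<in> carrier H" for b
    using that by (intro bilinI p pure_lin lin_id) auto
  have c2: "bilin K H H HHH.T (\<lambda>a b. sw HHH.T (\<lambda>a1 a2. HHH.pure a1 (HH.pure a2 b)) a)"
    using T by (intro bilinI sw_lin_arg sw_lin_param p pure_lin lin_id c1) auto
  have c3: "bilin K H H HHH.T (\<lambda>a b. HHH.pure a (comult H b))"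
    using T by (intro bilinI p comult_linear lin_id) auto
  have d1: "bilin K H H U (\<lambda>a b. sw U (\<lambda>a1 a2. \<gamma> a1 a2 b) a)"
  proof (intro bilinI sw_lin_arg sw_lin_param U g2 lin_id)
    show "(\<lambda>b. \<gamma> v b w) \<in> module_hom K H U" if "v \<in> carrier H" "w \<in> carrier H" for v w
      using bilinD(2)[OF g1[OF that(1)] that(2)] .
    then show "(\<lambda>b. \<gamma> v b w) \<in> module_hom K H U" if "w \<in> carrier H" "v \<in> carrier H" for v w
      using that by simp
    show "(\<gamma> a b) \<in> module_hom K H U" if "a \<in> carrier H" "b \<in> carrier H" for a b
      using bilinD(1)[OF g1[OF that(1)] that(2)] .
  qed auto
  have "G (sw HHH.T (\<lambda>a b. sw HHH.T (\<lambda>a1 a2. HHH.pure a1 (HH.pure a2 b)) a) h) =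
      sw U (\<lambda>a b. G (sw HHH.T (\<lambda>a1 a2. HHH.pure a1 (HH.pure a2 b)) a)) h"
    by (rule sw_comp[OF T U c2 G h])
  also have "\<dots> = sw U (\<lambda>a b. sw U (\<lambda>a1 a2. \<gamma> a1 a2 b) a) h"
  proof (rule sw_cong[OF U _ h])
    show "bilin K H H U (\<lambda>a b. G (sw HHH.T (\<lambda>a1 a2. HHH.pure a1 (HH.pure a2 b)) a))"
      by (intro bilinI lin_comp[OF G] bilinD[OF c2])
    fix a b assume ab: "a \<in> carrier H" "b \<in> carrier H"
    have "G (sw HHH.T (\<lambda>a1 a2. HHH.pure a1 (HH.pure a2 b)) a) =
        sw U (\<lambda>a1 a2. G (HHH.pure a1 (HH.pure a2 b))) a"
      by (rule sw_comp[OF T U c1[OF ab(2)] G ab(1)])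
    also have "\<dots> = sw U (\<lambda>a1 a2. \<gamma> a1 a2 b) a"
    proof (rule sw_cong[OF U _ ab(1)])
      show "bilin K H H U (\<lambda>a1 a2. G (HHH.pure a1 (HH.pure a2 b)))"
        by (intro bilinI lin_comp[OF G] bilinD[OF c1[OF ab(2)]])
    qed (use ab in \<open>simp add: Gp HH.tl_pure[OF U g1]\<close>)
    finally show "G (sw HHH.T (\<lambda>a1 a2. HHH.pure a1 (HH.pure a2 b)) a) = sw U (\<lambda>a1 a2. \<gamma> a1 a2 b) a" .
  qed
  finally have L: "G (sw HHH.T (\<lambda>a b. sw HHH.T (\<lambda>a1 a2. HHH.pure a1 (HH.pure a2 b)) a) h) =
    sw U (\<lambda>a b. sw U (\<lambda>a1 a2. \<gamma> a1 a2 b) a) h" .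
  have "G (sw HHH.T (\<lambda>a b. HHH.pure a (comult H b)) h) = sw U (\<lambda>a b. G (HHH.pure a (comult H b))) h"
    by (rule sw_comp[OF T U c3 G h])
  also have "\<dots> = sw U (\<lambda>a b. sw U (\<lambda>b1 b2. \<gamma> a b1 b2) b) h"
  proof (rule sw_cong[OF U _ h])
    show "bilin K H H U (\<lambda>a b. G (HHH.pure a (comult H b)))"
      by (intro bilinI lin_comp[OF G] bilinD[OF c3])
  qed (simp add: Gp)
  finally show ?thesis
    using L coassoc[OF h] by simp
qed

lemma counit_lin: "\<epsilon> \<in> module_hom K H K1"
  using ring_hom_closed[OF counit_ring_hom] ring_hom_add[OF counit_ring_hom] counit_linear
  by (intro module_homI) auto

lemma counit_closed [simp]: "h \<in> carrier H \<Longrightarrow> \<epsilon> h \<in> carrier K"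
  using ring_hom_closed[OF counit_ring_hom] .

lemma counit_one: "\<epsilon> \<one>\<^bsub>H\<^esub> = \<one>"
  using ring_hom_one[OF counit_ring_hom] .

lemma sw_counit_left:
  assumes U: "vectorspace K U" and f: "f \<in> module_hom K H U" and h: "h \<in> carrier H"
  shows "sw U (\<lambda>a b. \<epsilon> a \<odot>\<^bsub>U\<^esub> f b) h = f h"
proof -
  have b: "bilin K H H H (\<lambda>a b. \<epsilon> a \<odot>\<^bsub>H\<^esub> b)"
    by (intro bilinI lin_smult_left lin_smult lin_id counit_lin) auto
  have "f h = f (sw H (\<lambda>a b. \<epsilon> a \<odot>\<^bsub>H\<^esub> b) h)" using counit_left[OF h] by simp
  also have "\<dots> = sw U (\<lambda>a b. f (\<epsilon> a \<odot>\<^bsub>H\<^esub> b)) h"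
    by (rule sw_comp[OF _ U b f h]) simp
  also have "\<dots> = sw U (\<lambda>a b. \<epsilon> a \<odot>\<^bsub>U\<^esub> f b) h"
    by (rule sw_cong[OF U _ h])
      (auto intro!: bilinI lin_comp[OF f] bilinD[OF b] simp: module_hom_smult[OF f])
  finally show ?thesis by simp
qed

lemma sw_counit_right:
  assumes U: "vectorspace K U" and f: "f \<in> module_hom K H U" and h: "h \<in> carrier H"
  shows "sw U (\<lambda>a b. \<epsilon> b \<odot>\<^bsub>U\<^esub> f a) h = f h"
proof -
  have b: "bilin K H H H (\<lambda>a b. \<epsilon> b \<odot>\<^bsub>H\<^esub> a)"
    by (intro bilinI lin_smult_left lin_smult lin_id counit_lin) auto
  have "f h = f (sw H (\<lambda>a b. \<epsilon> b \<odot>\<^bsub>H\<^esub> a) h)" using counit_right[OF h] by simp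
  also have "\<dots> = sw U (\<lambda>a b. f (\<epsilon> b \<odot>\<^bsub>H\<^esub> a)) h"
    by (rule sw_comp[OF _ U b f h]) simp
  also have "\<dots> = sw U (\<lambda>a b. \<epsilon> b \<odot>\<^bsub>U\<^esub> f a) h"
    by (rule sw_cong[OF U _ h])
      (auto intro!: bilinI lin_comp[OF f] bilinD[OF b] simp: module_hom_smult[OF f])
  finally show ?thesis by simp
qed

end

context hopf_algebra
begin

lemma more_lin_intros [lin_intros]:
  "f \<in> module_hom K P H \<Longrightarrow> (\<lambda>x. antipode H (f x)) \<in> module_hom K P H"
  "f \<in> module_hom K P H \<Longrightarrow> (\<lambda>x. \<epsilon> (f x)) \<in> module_hom K P K1"
  "vectorspace K U \<Longrightarrow> p \<in> module_hom K P K1 \<Longrightarrow> u \<in> carrier U \<Longrightarrow>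
    (\<lambda>x. p x \<odot>\<^bsub>U\<^esub> u) \<in> module_hom K P U"
  "vectorspace K U \<Longrightarrow> g \<in> module_hom K P U \<Longrightarrow> c \<in> carrier K \<Longrightarrow>
    (\<lambda>x. c \<odot>\<^bsub>U\<^esub> g x) \<in> module_hom K P U"
  "q \<in> module_hom K P K1 \<Longrightarrow> c \<in> carrier K \<Longrightarrow> (\<lambda>x. q x \<otimes>\<^bsub>K\<^esub> c) \<in> module_hom K P K1"
  "q \<in> module_hom K P K1 \<Longrightarrow> c \<in> carrier K \<Longrightarrow> (\<lambda>x. c \<otimes>\<^bsub>K\<^esub> q x) \<in> module_hom K P K1"
  using lin_comp[OF antipode_linear] lin_comp[OF counit_lin] lin_smult_left lin_smult
    lin_mult_left[OF field_mult_assoc_algebra[OF H.field_axioms]]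
    lin_mult_right[OF field_mult_assoc_algebra[OF H.field_axioms]]
  by auto

lemma antipode_closed [simp]: "h \<in> carrier H \<Longrightarrow> antipode H h \<in> carrier H"
  using module_hom_mem[OF antipode_linear] .

lemma functional_closed: "p \<in> module_hom K H K1 \<Longrightarrow> h \<in> carrier H \<Longrightarrow> p h \<in> carrier K"
  using module_hom_mem by force

lemma sw_antipode_left:
  assumes U: "vectorspace K U" and f: "f \<in> module_hom K H U" and h: "h \<in> carrier H"
  shows "sw U (\<lambda>a b. f (antipode H a \<otimes>\<^bsub>H\<^esub> b)) h = \<epsilon> h \<odot>\<^bsub>U\<^esub> f \<one>\<^bsub>H\<^esub>"
proof -
  have b: "bilin K H H H (\<lambda>a b. antipode H a \<otimes>\<^bsub>H\<^esub> b)"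
    by (auto intro!: lin_intros)
  have "sw U (\<lambda>a b. f (antipode H a \<otimes>\<^bsub>H\<^esub> b)) h = f (sw H (\<lambda>a b. antipode H a \<otimes>\<^bsub>H\<^esub> b) h)"
    using sw_comp[OF _ U b f h] by simp
  then show ?thesis
    using antipode_left[OF h] h by (simp add: module_hom_smult[OF f])
qed

end

locale hopf_integral = hopf_algebra +
  fixes t
  assumes fin_dim: "vectorspace.fin_dim K H"
    and t_integral: "left_integral H t" and t_nonzero: "t \<noteq> \<zero>\<^bsub>H\<^esub>"
begin

lemma t_closed [simp]: "t \<in> carrier H"
  using t_integral by (simp add: left_integral_def)

lemma mult_t: "h \<in> carrier H \<Longrightarrow> h \<otimes>\<^bsub>H\<^esub> t = \<epsilon> h \<odot>\<^bsub>H\<^esub> t"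
  using t_integral by (simp add: left_integral_def)

text \<open>\<open>\<Sum> t\<^sub>1 \<otimes> h t\<^sub>2 = \<Sum> S(h) t\<^sub>1 \<otimes> t\<^sub>2\<close>, tested against a functional in the first factor.\<close>

lemma integral_antipode:
  assumes p: "p \<in> module_hom K H K1" and h: "h \<in> carrier H"
  shows "sw H (\<lambda>a b. p a \<odot>\<^bsub>H\<^esub> (h \<otimes>\<^bsub>H\<^esub> b)) t =
    sw H (\<lambda>a b. p (antipode H h \<otimes>\<^bsub>H\<^esub> a) \<odot>\<^bsub>H\<^esub> b) t"
proof -
  note [lin_intros] = lin_comp[OF p]
  note [simp] = functional_closed[OF p]
  define G where "G x = sw H (\<lambda>a b. p (x \<otimes>\<^bsub>H\<^esub> a) \<odot>\<^bsub>H\<^esub> b) t" for x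
  have bG: "bilin K H H H (\<lambda>a b. p (x \<otimes>\<^bsub>H\<^esub> a) \<odot>\<^bsub>H\<^esub> b)" if "x \<in> carrier H" for x
    using that by (auto intro!: lin_intros)
  have G: "(\<lambda>x. G (f x)) \<in> module_hom K P H" if "f \<in> module_hom K P H" for f P
    unfolding G_def by (rule lin_comp[OF _ that]) (auto intro!: lin_intros)
  have Gc: "G x \<in> carrier H" if "x \<in> carrier H" for x
    using module_hom_mem[OF G[OF lin_id] that] .
  define M where "M b x = sw H (\<lambda>c d. p (x \<otimes>\<^bsub>H\<^esub> c) \<odot>\<^bsub>H\<^esub> (b \<otimes>\<^bsub>H\<^esub> d)) t" for b x
  have M: "M b \<in> module_hom K H H" if "b \<in> carrier H" for b
    unfolding M_def using that by (auto intro!: lin_intros)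
  have "sw H (\<lambda>a b. p (antipode H h \<otimes>\<^bsub>H\<^esub> a) \<odot>\<^bsub>H\<^esub> b) t = G (antipode H h)"
    by (simp add: G_def)
  \<comment> \<open>The counit of the second leg of \<open>h\<close> is inserted and absorbed into
    \<open>t\<close> by the integral property, so that \<open>t\<close> is replaced by
    \<open>b t\<close>. Multiplicativity and coassociativity then bring the antipode next to the
    neighbouring leg of \<open>h\<close>, where it cancels.\<close>
  also have "\<dots> = sw H (\<lambda>a b. \<epsilon> b \<odot>\<^bsub>H\<^esub> G (antipode H a)) h"
    by (rule sw_counit_right[symmetric]) (auto intro!: G lin_intros simp: h)
  also have "\<dots> = sw H (\<lambda>a b. sw H (\<lambda>b1 b2. sw H (\<lambda>c d.
      p (antipode H a \<otimes>\<^bsub>H\<^esub> (b1 \<otimes>\<^bsub>H\<^esub> c)) \<odot>\<^bsub>H\<^esub> (b2 \<otimes>\<^bsub>H\<^esub> d)) t) b) h"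
  proof (rule sw_cong[OF _ _ h])
    show "bilin K H H H (\<lambda>a b. \<epsilon> b \<odot>\<^bsub>H\<^esub> G (antipode H a))"
      by (auto intro!: G lin_intros simp: Gc)
    fix a b assume ab: "a \<in> carrier H" "b \<in> carrier H"
    let ?\<beta> = "\<lambda>c d. p (antipode H a \<otimes>\<^bsub>H\<^esub> c) \<odot>\<^bsub>H\<^esub> d"
    have "\<epsilon> b \<odot>\<^bsub>H\<^esub> G (antipode H a) = sw H ?\<beta> (\<epsilon> b \<odot>\<^bsub>H\<^esub> t)"
      unfolding G_def using ab
      by (subst module_hom_smult[OF sw_lin_arg[OF _ bG lin_id]]) auto
    also have "\<dots> = sw H ?\<beta> (b \<otimes>\<^bsub>H\<^esub> t)" using ab by (simp add: mult_t)
    also have "\<dots> = sw H (\<lambda>b1 b2. sw H (\<lambda>c d.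
      p (antipode H a \<otimes>\<^bsub>H\<^esub> (b1 \<otimes>\<^bsub>H\<^esub> c)) \<odot>\<^bsub>H\<^esub> (b2 \<otimes>\<^bsub>H\<^esub> d)) t) b"
      using ab by (intro sw_mult bG) auto
    finally show "\<epsilon> b \<odot>\<^bsub>H\<^esub> G (antipode H a) = sw H (\<lambda>b1 b2. sw H (\<lambda>c d.
      p (antipode H a \<otimes>\<^bsub>H\<^esub> (b1 \<otimes>\<^bsub>H\<^esub> c)) \<odot>\<^bsub>H\<^esub> (b2 \<otimes>\<^bsub>H\<^esub> d)) t) b" .
  qed auto
  also have "\<dots> = sw H (\<lambda>a b. sw H (\<lambda>a1 a2. sw H (\<lambda>c d.
      p (antipode H a1 \<otimes>\<^bsub>H\<^esub> (a2 \<otimes>\<^bsub>H\<^esub> c)) \<odot>\<^bsub>H\<^esub> (b \<otimes>\<^bsub>H\<^esub> d)) t) a) h"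
    by (rule sw_coassoc[symmetric, OF _ _ h]) (auto intro!: trilinI lin_intros)
  also have "\<dots> = sw H (\<lambda>a b. \<epsilon> a \<odot>\<^bsub>H\<^esub> sw H (\<lambda>c d. p c \<odot>\<^bsub>H\<^esub> (b \<otimes>\<^bsub>H\<^esub> d)) t) h"
  proof (rule sw_cong[OF _ _ h])
    show "bilin K H H H (\<lambda>a b. sw H (\<lambda>a1 a2. sw H (\<lambda>c d.
      p (antipode H a1 \<otimes>\<^bsub>H\<^esub> (a2 \<otimes>\<^bsub>H\<^esub> c)) \<odot>\<^bsub>H\<^esub> (b \<otimes>\<^bsub>H\<^esub> d)) t) a)"
      by (auto intro!: lin_intros)
    fix a b assume ab: "a \<in> carrier H" "b \<in> carrier H"
    have "sw H (\<lambda>a1 a2. sw H (\<lambda>c d.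
        p (antipode H a1 \<otimes>\<^bsub>H\<^esub> (a2 \<otimes>\<^bsub>H\<^esub> c)) \<odot>\<^bsub>H\<^esub> (b \<otimes>\<^bsub>H\<^esub> d)) t) a =
      sw H (\<lambda>a1 a2. M b (antipode H a1 \<otimes>\<^bsub>H\<^esub> a2)) a"
    proof (rule sw_cong[OF _ _ ab(1)])
      show "bilin K H H H (\<lambda>a1 a2. sw H (\<lambda>c d.
        p (antipode H a1 \<otimes>\<^bsub>H\<^esub> (a2 \<otimes>\<^bsub>H\<^esub> c)) \<odot>\<^bsub>H\<^esub> (b \<otimes>\<^bsub>H\<^esub> d)) t)"
        using ab by (auto intro!: lin_intros)
      fix a1 a2 assume a: "a1 \<in> carrier H" "a2 \<in> carrier H"
      show "sw H (\<lambda>c d. p (antipode H a1 \<otimes>\<^bsub>H\<^esub> (a2 \<otimes>\<^bsub>H\<^esub> c)) \<odot>\<^bsub>H\<^esub> (b \<otimes>\<^bsub>H\<^esub> d)) t =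
        M b (antipode H a1 \<otimes>\<^bsub>H\<^esub> a2)"
        unfolding M_def
        by (rule sw_cong) (use a ab in \<open>auto intro!: lin_intros simp: HR.m_assoc\<close>)
    qed auto
    also have "\<dots> = \<epsilon> a \<odot>\<^bsub>H\<^esub> M b \<one>\<^bsub>H\<^esub>"
      using ab by (intro sw_antipode_left M) auto
    also have "M b \<one>\<^bsub>H\<^esub> = sw H (\<lambda>c d. p c \<odot>\<^bsub>H\<^esub> (b \<otimes>\<^bsub>H\<^esub> d)) t"
      unfolding M_def by (rule sw_cong) (use ab in \<open>auto intro!: lin_intros\<close>)
    finally show "sw H (\<lambda>a1 a2. sw H (\<lambda>c d.
        p (antipode H a1 \<otimes>\<^bsub>H\<^esub> (a2 \<otimes>\<^bsub>H\<^esub> c)) \<odot>\<^bsub>H\<^esub> (b \<otimes>\<^bsub>H\<^esub> d)) t) a =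
      \<epsilon> a \<odot>\<^bsub>H\<^esub> sw H (\<lambda>c d. p c \<odot>\<^bsub>H\<^esub> (b \<otimes>\<^bsub>H\<^esub> d)) t" .
  qed auto
  also have "\<dots> = sw H (\<lambda>c d. p c \<odot>\<^bsub>H\<^esub> (h \<otimes>\<^bsub>H\<^esub> d)) t"
    by (rule sw_counit_left[OF _ _ h]) (auto intro!: lin_intros)
  finally show ?thesis by simp
qed

end

section \<open>Coordinate functionals and biorthogonal families in finite dimension\<close>

section \<open>Dual bases\<close>

definition dual_basis ::
  "('k, 'm) ring_scheme \<Rightarrow> ('k, 'v, 'x) module_scheme \<Rightarrow> 'v set \<Rightarrow> ('v \<Rightarrow> 'v \<Rightarrow> 'k) \<Rightarrow> bool" where
  "dual_basis K V E p \<longleftrightarrow> finite E \<and> E \<subseteq> carrier V \<and> vectorspace.basis K V E \<and>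
     (\<forall>e\<in>E. p e \<in> module_hom K V (regular_module K)) \<and>
     (\<forall>v\<in>carrier V. v = (\<Oplus>\<^bsub>V\<^esub>e\<in>E. p e v \<odot>\<^bsub>V\<^esub> e)) \<and>
     (\<forall>e\<in>E. \<forall>e'\<in>E. p e e' = (if e = e' then \<one>\<^bsub>K\<^esub> else \<zero>\<^bsub>K\<^esub>))"

lemma dual_basisD:
  assumes "dual_basis K V E p"
  shows "finite E" "E \<subseteq> carrier V" "vectorspace.basis K V E"
    "\<And>e. e \<in> E \<Longrightarrow> p e \<in> module_hom K V (regular_module K)"
    "\<And>v. v \<in> carrier V \<Longrightarrow> v = (\<Oplus>\<^bsub>V\<^esub>e\<in>E. p e v \<odot>\<^bsub>V\<^esub> e)"
    "\<And>e e'. e \<in> E \<Longrightarrow> e' \<in> E \<Longrightarrow> p e e' = (if e = e' then \<one>\<^bsub>K\<^esub> else \<zero>\<^bsub>K\<^esub>)"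
  using assms unfolding dual_basis_def by blast+

lemma dual_basis_exists:
  assumes V: "vectorspace K V" and fd: "vectorspace.fin_dim K V"
  obtains E p where "dual_basis K V E p"
proof -
  interpret V: vectorspace K V by fact
  obtain E where E: "finite E" "V.basis E" using V.finite_basis_exists[OF fd] by blast
  have EV: "E \<subseteq> carrier V" using E(2) by (simp add: V.basis_def)
  have uniq: "\<exists>!a. a \<in> E \<rightarrow>\<^sub>E carrier K \<and> V.lincomb a E = v" if "v \<in> carrier V" for v
    using V.basis_criterion[OF E(1) EV] E(2) that by blast
  \<comment> \<open>Coefficient functions are unique once they are extensional on \<open>E\<close>;
    this uniqueness also gives the linearity of the coordinates.\<close>
  define q where "q v = (THE a. a \<in> E \<rightarrow>\<^sub>E carrier K \<and> V.lincomb a E = v)" for v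
  have q: "q v \<in> E \<rightarrow>\<^sub>E carrier K" "V.lincomb (q v) E = v" if "v \<in> carrier V" for v
    using theI'[OF uniq[OF that]] by (auto simp: q_def)
  have qI: "q v = a" if "a \<in> E \<rightarrow>\<^sub>E carrier K" "V.lincomb a E = v" for a v
  proof -
    have "v \<in> carrier V" using that EV by (metis PiE_iff Pi_I V.lincomb_closed)
    then show ?thesis using that uniq q by blast
  qed
  have qE: "q v e \<in> carrier K" if "v \<in> carrier V" "e \<in> E" for v e
    using q(1)[OF that(1)] that(2) by auto
  have add: "q (v \<oplus>\<^bsub>V\<^esub> w) = (\<lambda>e\<in>E. q v e \<oplus>\<^bsub>K\<^esub> q w e)" if "v \<in> carrier V" "w \<in> carrier V" for v w
  proof (rule qI)
    have "V.lincomb (\<lambda>e\<in>E. q v e \<oplus>\<^bsub>K\<^esub> q w e) E = V.lincomb (\<lambda>e. q v e \<oplus>\<^bsub>K\<^esub> q w e) E"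
      by (rule V.lincomb_cong) (use EV that qE in auto)
    also have "\<dots> = V.lincomb (q v) E \<oplus>\<^bsub>V\<^esub> V.lincomb (q w) E"
      by (rule V.lincomb_sum) (use EV that qE E in auto)
    finally show "V.lincomb (\<lambda>e\<in>E. q v e \<oplus>\<^bsub>K\<^esub> q w e) E = v \<oplus>\<^bsub>V\<^esub> w"
      using that q by simp
  qed (use that qE in auto)
  have smult: "q (c \<odot>\<^bsub>V\<^esub> v) = (\<lambda>e\<in>E. c \<otimes>\<^bsub>K\<^esub> q v e)" if "c \<in> carrier K" "v \<in> carrier V" for c v
  proof (rule qI)
    have "V.lincomb (\<lambda>e\<in>E. c \<otimes>\<^bsub>K\<^esub> q v e) E = V.lincomb (\<lambda>e. c \<otimes>\<^bsub>K\<^esub> q v e) E"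
      by (rule V.lincomb_cong) (use EV that qE in auto)
    also have "\<dots> = c \<odot>\<^bsub>V\<^esub> V.lincomb (q v) E"
      by (rule V.lincomb_smult) (use EV that qE E in auto)
    finally show "V.lincomb (\<lambda>e\<in>E. c \<otimes>\<^bsub>K\<^esub> q v e) E = c \<odot>\<^bsub>V\<^esub> v"
      using that q by simp
  qed (use that qE in auto)
  have basis: "q e' = (\<lambda>e\<in>E. if e = e' then \<one>\<^bsub>K\<^esub> else \<zero>\<^bsub>K\<^esub>)" if "e' \<in> E" for e'
  proof (rule qI)
    have "V.lincomb (\<lambda>e\<in>E. if e = e' then \<one>\<^bsub>K\<^esub> else \<zero>\<^bsub>K\<^esub>) E =
        (\<Oplus>\<^bsub>V\<^esub>e\<in>E. if e' = e then e else \<zero>\<^bsub>V\<^esub>)"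
      unfolding V.lincomb_def by (rule V.M.finsum_cong') (use EV in auto)
    also have "\<dots> = e'" using that EV E by (intro V.M.add.finprod_singleton) auto
    finally show "V.lincomb (\<lambda>e\<in>E. if e = e' then \<one>\<^bsub>K\<^esub> else \<zero>\<^bsub>K\<^esub>) E = e'" .
  qed auto
  have "dual_basis K V E (\<lambda>e v. q v e)"
    unfolding dual_basis_def
  proof (intro conjI ballI)
    show "(\<lambda>v. q v e) \<in> module_hom K V (regular_module K)" if "e \<in> E" for e
      using that qE by (intro module_homI) (auto simp: add smult)
    show "v = (\<Oplus>\<^bsub>V\<^esub>e\<in>E. q v e \<odot>\<^bsub>V\<^esub> e)" if "v \<in> carrier V" for v
      using q(2)[OF that] by (simp add: V.lincomb_def)
    show "q e' e = (if e = e' then \<one>\<^bsub>K\<^esub> else \<zero>\<^bsub>K\<^esub>)" if "e \<in> E" "e' \<in> E" for e e'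
      using that by (simp add: basis)
  qed (fact E(1) EV E(2))+
  then show thesis by (rule that)
qed

text \<open>Evaluating the functionals shows that a biorthogonal family is injective and
  independent. It is indexed by a basis, so it has as many members as the dimension and is itself a
  basis.\<close>

lemma dual_family_spans:
  assumes V: "vectorspace K V" and E: "finite E" "vectorspace.basis K V E"
    and u: "\<And>e. e \<in> E \<Longrightarrow> u e \<in> carrier V"
    and p: "\<And>e. e \<in> E \<Longrightarrow> p e \<in> module_hom K V (regular_module K)"
    and pu: "\<And>e e'. e \<in> E \<Longrightarrow> e' \<in> E \<Longrightarrow> p e (u e') = (if e = e' then \<one>\<^bsub>K\<^esub> else \<zero>\<^bsub>K\<^esub>)"
    and v: "v \<in> carrier V"
  shows "v = (\<Oplus>\<^bsub>V\<^esub>e\<in>E. p e v \<odot>\<^bsub>V\<^esub> u e)"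
proof -
  interpret V: vectorspace K V by fact
  have inj: "inj_on u E"
    using pu by (intro inj_onI) (metis V.zero_not_one)
  have uV: "u ` E \<subseteq> carrier V" using u by auto
  have fin: "finite (u ` E)" using E by simp
  have comb: "V.lincomb a (u ` E) = (\<Oplus>\<^bsub>V\<^esub>e\<in>E. a (u e) \<odot>\<^bsub>V\<^esub> u e)" if "a \<in> u ` E \<rightarrow> carrier K" for a
    unfolding V.lincomb_def using that u inj by (subst V.M.finsum_reindex) auto
  have coeff: "p e (V.lincomb a (u ` E)) = a (u e)" if "a \<in> u ` E \<rightarrow> carrier K" "e \<in> E" for a e
  proof -
    interpret K1: vectorspace K "regular_module K" by (rule regular_vectorspace[OF V.field_axioms])
    have aE: "a (u e) \<in> carrier K" if "e \<in> E" for e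
      using \<open>a \<in> _\<close> that by auto
    have "p e (V.lincomb a (u ` E)) =
        (\<Oplus>\<^bsub>regular_module K\<^esub>e'\<in>E. p e (a (u e') \<odot>\<^bsub>V\<^esub> u e'))"
      unfolding comb[OF that(1)]
      by (rule module_hom_finsum[OF V.M.abelian_group_axioms K1.M.abelian_group_axioms p[OF that(2)]])
        (use that u in auto)
    also have "\<dots> = (\<Oplus>\<^bsub>regular_module K\<^esub>e'\<in>E. if e = e' then a (u e') else \<zero>\<^bsub>K\<^esub>)"
      by (rule K1.M.finsum_cong') (use that(2) u pu aE in \<open>auto simp: module_hom_smult[OF p]\<close>)
    also have "\<dots> = a (u e)"
      using K1.M.add.finprod_singleton[of e E "\<lambda>e. a (u e)"] that(2) aE E
      by (simp add: Pi_def cong del: if_weak_cong)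
    finally show ?thesis .
  qed
  have "V.lin_indpt (u ` E)"
  proof (rule V.finite_lin_indpt2[OF fin uV])
    fix a assume a: "a \<in> u ` E \<rightarrow> carrier K" "V.lincomb a (u ` E) = \<zero>\<^bsub>V\<^esub>"
    have "p e \<zero>\<^bsub>V\<^esub> = \<zero>\<^bsub>K\<^esub>" if "e \<in> E" for e
      using module_hom_zero[OF V.M.abelian_group_axioms vectorspaceD(4)[OF regular_vectorspace[OF V.field_axioms]] p[OF that]]
      by simp
    then show "\<forall>v\<in>u ` E. a v = \<zero>\<^bsub>K\<^esub>" using coeff[OF a(1)] a(2) by auto
  qed
  moreover have "V.dim = card (u ` E)"
    using V.dim_basis[OF E] card_image[OF inj] by simp
  moreover have "V.fin_dim"
    using E by (auto simp: V.fin_dim_def V.basis_def)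
  ultimately have "V.basis (u ` E)"
    using V.dim_li_is_basis[OF _ fin uV] by simp
  then have "v \<in> V.span (u ` E)" using v by (simp add: V.basis_def)
  then obtain a where a: "a \<in> u ` E \<rightarrow> carrier K" "V.lincomb a (u ` E) = v"
    using V.finite_in_span[OF fin uV] by blast
  have "(\<Oplus>\<^bsub>V\<^esub>e\<in>E. p e v \<odot>\<^bsub>V\<^esub> u e) = (\<Oplus>\<^bsub>V\<^esub>e\<in>E. a (u e) \<odot>\<^bsub>V\<^esub> u e)"
    by (rule V.M.finsum_cong') (use a coeff[OF a(1)] u in auto)
  then show ?thesis using comb[OF a(1)] a(2) by simp
qed

section \<open>From the integral \<open>t\<close> to integrals of the dual and a Frobenius
  form\<close>

section \<open>Integrals and the Frobenius form\<close>

context hopf_algebra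
begin

lemma sw_finsum:
  assumes U: "vectorspace K U" and b: "\<And>i. i \<in> I \<Longrightarrow> bilin K H H U (\<beta> i)" and h: "h \<in> carrier H"
  shows "sw U (\<lambda>a b. \<Oplus>\<^bsub>U\<^esub>i\<in>I. \<beta> i a b) h = (\<Oplus>\<^bsub>U\<^esub>i\<in>I. sw U (\<beta> i) h)"
proof (rule HH.T_ext[OF _ _ _ comult_closed[OF h]])
  interpret U: vectorspace K U by fact
  have B: "bilin K H H U (\<lambda>a b. \<Oplus>\<^bsub>U\<^esub>i\<in>I. \<beta> i a b)"
    using U b by (intro bilinI lin_finsum bilinD(1)[OF b] bilinD(2)[OF b]) auto
  show "HH.tl U (\<lambda>a b. \<Oplus>\<^bsub>U\<^esub>i\<in>I. \<beta> i a b) \<in> module_hom K HH.T U"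
    by (rule HH.tl_linear[OF U B])
  show "(\<lambda>x. \<Oplus>\<^bsub>U\<^esub>i\<in>I. HH.tl U (\<beta> i) x) \<in> module_hom K HH.T U"
    using U b by (intro lin_finsum HH.tl_linear) auto
  fix v w assume vw: "v \<in> carrier H" "w \<in> carrier H"
  show "HH.tl U (\<lambda>a b. \<Oplus>\<^bsub>U\<^esub>i\<in>I. \<beta> i a b) (HH.pure v w) = (\<Oplus>\<^bsub>U\<^esub>i\<in>I. HH.tl U (\<beta> i) (HH.pure v w))"
    using vw by (auto simp: HH.tl_pure[OF U B] HH.tl_pure[OF U b] bilinD(3)[OF b] intro!: U.M.finsum_cong')
qed

end

context hopf_integral
begin

text \<open>\<open>lt\<close> and \<open>rt\<close> are the two maps from the dual of
  \<open>H\<close> to \<open>H\<close> that contract the left or the right leg of the coproduct of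
  \<open>t\<close>. Each is the transpose of the other.\<close>

definition lt where "lt p = sw H (\<lambda>a b. p a \<odot>\<^bsub>H\<^esub> b) t"
definition rt where "rt p = sw H (\<lambda>a b. p b \<odot>\<^bsub>H\<^esub> a) t"

lemma lt_comp:
  assumes p: "p \<in> module_hom K H K1" and U: "vectorspace K U" and f: "f \<in> module_hom K H U"
  shows "f (lt p) = sw U (\<lambda>a b. p a \<odot>\<^bsub>U\<^esub> f b) t"
proof -
  note [lin_intros] = lin_comp[OF p] lin_comp[OF f]
  note [simp] = functional_closed[OF p] module_hom_smult[OF f]
  have "f (lt p) = sw U (\<lambda>a b. f (p a \<odot>\<^bsub>H\<^esub> b)) t"
    unfolding lt_def using U by (intro sw_comp[OF _ U _ f]) (auto intro!: lin_intros)
  also have "\<dots> = sw U (\<lambda>a b. p a \<odot>\<^bsub>U\<^esub> f b) t"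
    by (rule sw_cong[OF U]) (auto intro!: lin_intros)
  finally show ?thesis .
qed

lemma rt_comp:
  assumes p: "p \<in> module_hom K H K1" and U: "vectorspace K U" and f: "f \<in> module_hom K H U"
  shows "f (rt p) = sw U (\<lambda>a b. p b \<odot>\<^bsub>U\<^esub> f a) t"
proof -
  note [lin_intros] = lin_comp[OF p] lin_comp[OF f]
  note [simp] = functional_closed[OF p] module_hom_smult[OF f]
  have "f (rt p) = sw U (\<lambda>a b. f (p b \<odot>\<^bsub>H\<^esub> a)) t"
    unfolding rt_def using U by (intro sw_comp[OF _ U _ f]) (auto intro!: lin_intros)
  also have "\<dots> = sw U (\<lambda>a b. p b \<odot>\<^bsub>U\<^esub> f a) t"
    by (rule sw_cong[OF U]) (auto intro!: lin_intros)
  finally show ?thesis .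
qed

lemma lt_rt_closed [simp]:
  assumes "p \<in> module_hom K H K1"
  shows "lt p \<in> carrier H" "rt p \<in> carrier H"
proof -
  note [lin_intros] = lin_comp[OF assms]
  note [simp] = functional_closed[OF assms]
  show "lt p \<in> carrier H" "rt p \<in> carrier H"
    unfolding lt_def rt_def by (auto intro!: lin_intros)
qed

text \<open>Both sides pair the two legs of the coproduct of \<open>t\<close> with \<open>p\<close>
  and \<open>q\<close>.\<close>

lemma lt_rt_dual:
  assumes p: "p \<in> module_hom K H K1" and q: "q \<in> module_hom K H K1"
  shows "q (lt p) = p (rt q)"
proof -
  note [lin_intros] = lin_comp[OF p] lin_comp[OF q]
  note [simp] = functional_closed[OF p] functional_closed[OF q]
  have "q (lt p) = sw K1 (\<lambda>a b. p a \<otimes> q b) t"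
    using lt_comp[OF p _ q] by simp
  also have "\<dots> = sw K1 (\<lambda>a b. q b \<otimes> p a) t"
    by (rule sw_cong) (auto intro!: lin_intros simp: H.R.m_comm)
  also have "\<dots> = p (rt q)"
    using rt_comp[OF q _ p] by simp
  finally show ?thesis .
qed

lemma counit_lt: "p \<in> module_hom K H K1 \<Longrightarrow> \<epsilon> (lt p) = p t"
  using lt_rt_dual[OF _ counit_lin, of p] counit_right[OF t_closed] by (simp add: rt_def)

lemma counit_rt: "p \<in> module_hom K H K1 \<Longrightarrow> \<epsilon> (rt p) = p t"
  using lt_rt_dual[OF counit_lin, of p] counit_left[OF t_closed] by (simp add: lt_def)

text \<open>It makes the image of \<open>lt\<close> closed under left multiplication, so the image
  is all of \<open>H\<close> as soon as it contains \<open>1\<close>.\<close>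

lemma lt_left_ideal:
  assumes p: "p \<in> module_hom K H K1" and h: "h \<in> carrier H"
  shows "h \<otimes>\<^bsub>H\<^esub> lt p = lt (\<lambda>x. p (antipode H h \<otimes>\<^bsub>H\<^esub> x))"
proof -
  have "h \<otimes>\<^bsub>H\<^esub> lt p = sw H (\<lambda>a b. p a \<odot>\<^bsub>H\<^esub> (h \<otimes>\<^bsub>H\<^esub> b)) t"
    using h by (intro lt_comp[OF p]) (auto intro!: lin_intros)
  then show ?thesis
    unfolding integral_antipode[OF p h] by (simp add: lt_def)
qed

lemma lt_add:
  assumes p: "p \<in> module_hom K H K1" and q: "q \<in> module_hom K H K1"
  shows "lt (\<lambda>x. p x \<oplus> q x) = lt p \<oplus>\<^bsub>H\<^esub> lt q"
proof -
  note [lin_intros] = lin_comp[OF p] lin_comp[OF q]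
  note [simp] = functional_closed[OF p] functional_closed[OF q]
  have bp: "bilin K H H H (\<lambda>a b. p a \<odot>\<^bsub>H\<^esub> b)" and bq: "bilin K H H H (\<lambda>a b. q a \<odot>\<^bsub>H\<^esub> b)"
    by (auto intro!: lin_intros)
  have b: "bilin K H H H (\<lambda>a b. p a \<odot>\<^bsub>H\<^esub> b \<oplus>\<^bsub>H\<^esub> q a \<odot>\<^bsub>H\<^esub> b)"
    by (intro bilinI lin_add bilinD[OF bp] bilinD[OF bq]) auto
  have "lt p \<oplus>\<^bsub>H\<^esub> lt q = sw H (\<lambda>a b. p a \<odot>\<^bsub>H\<^esub> b \<oplus>\<^bsub>H\<^esub> q a \<odot>\<^bsub>H\<^esub> b) t"
    unfolding lt_def
  proof (rule HH.T_ext[OF _ _ _ comult_closed[OF t_closed]])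
    show "(\<lambda>x. HH.tl H (\<lambda>a. (\<odot>\<^bsub>H\<^esub>) (p a)) x \<oplus>\<^bsub>H\<^esub> HH.tl H (\<lambda>a. (\<odot>\<^bsub>H\<^esub>) (q a)) x) \<in> module_hom K HH.T H"
      by (intro lin_add HH.tl_linear bp bq) auto
    show "HH.tl H (\<lambda>a b. p a \<odot>\<^bsub>H\<^esub> b \<oplus>\<^bsub>H\<^esub> q a \<odot>\<^bsub>H\<^esub> b) \<in> module_hom K HH.T H"
      by (intro HH.tl_linear b) simp
  qed (simp add: HH.tl_pure[OF _ bp] HH.tl_pure[OF _ bq] HH.tl_pure[OF _ b])
  also have "\<dots> = lt (\<lambda>x. p x \<oplus> q x)"
    unfolding lt_def by (rule sw_cong) (auto simp: b H.smult_l_distr)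
  finally show ?thesis by simp
qed

lemma zero_functional: "(\<lambda>x. \<zero>) \<in> module_hom K H K1"
  by (auto intro!: module_homI)

lemma lt_zero: "lt (\<lambda>x. \<zero>) = \<zero>\<^bsub>H\<^esub>"
proof -
  have "lt (\<lambda>x. \<zero>) \<oplus>\<^bsub>H\<^esub> lt (\<lambda>x. \<zero>) = lt (\<lambda>x. \<zero>)"
    using lt_add[OF zero_functional zero_functional] by simp
  then show ?thesis
    using lt_rt_closed(1)[OF zero_functional] by (simp add: H.M.add.l_cancel_one)
qed

lemma functional_add:
  "p \<in> module_hom K H K1 \<Longrightarrow> q \<in> module_hom K H K1 \<Longrightarrow> (\<lambda>x. p x \<oplus> q x) \<in> module_hom K H K1"
  using lin_add[of K H K1 p q] by simp

lemma lt_finsum: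
  assumes "finite I" "\<And>i. i \<in> I \<Longrightarrow> \<exists>p\<in>module_hom K H K1. f i = lt p"
  shows "\<exists>p\<in>module_hom K H K1. (\<Oplus>\<^bsub>H\<^esub>i\<in>I. f i) = lt p"
  using assms
proof (induction I rule: finite_induct)
  case empty
  then show ?case using bexI[of "\<lambda>p. \<zero>\<^bsub>H\<^esub> = lt p", OF lt_zero[symmetric] zero_functional] by simp
next
  case (insert i I)
  obtain p where p: "p \<in> module_hom K H K1" "(\<Oplus>\<^bsub>H\<^esub>i\<in>I. f i) = lt p" using insert by auto
  obtain q where q: "q \<in> module_hom K H K1" "f i = lt q" using insert by auto
  have "f \<in> I \<rightarrow> carrier H"
  proof
    fix i assume "i \<in> I"
    then obtain r where "r \<in> module_hom K H K1" "f i = lt r" using insert.prems by auto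
    then show "f i \<in> carrier H" by simp
  qed
  then have "(\<Oplus>\<^bsub>H\<^esub>i\<in>insert i I. f i) = lt q \<oplus>\<^bsub>H\<^esub> lt p"
    using insert p q by (simp add: q)
  also have "\<dots> = lt (\<lambda>x. q x \<oplus> p x)"
    by (rule lt_add[symmetric, OF q(1) p(1)])
  finally show ?case
    using functional_add[OF q(1) p(1)] by blast
qed

text \<open>It suffices to reach \<open>1\<close>. With \<open>p t = 1\<close> the antipode axiom
  for \<open>lt p\<close> writes \<open>1\<close> as a threefold sum over \<open>t\<close>, with
  \<open>p\<close> on the first leg and the antipode on the second. Coassociativity combines these
  two into \<open>g\<close>, so \<open>1\<close> is the sum of the terms \<open>g(a) b\<close> over
  the coproduct of \<open>t\<close>. Expanding \<open>g(a)\<close> in a basis leaves terms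
  \<open>e b\<close> weighted by functionals of \<open>a\<close>, and these lie in the image because
  it is a left ideal.\<close>

lemma lt_surj:
  assumes h: "h \<in> carrier H"
  shows "\<exists>p\<in>module_hom K H K1. lt p = h"
proof -
  obtain E co where D: "dual_basis K H E co"
    by (rule dual_basis_exists[OF H.vectorspace_axioms fin_dim])
  note E = dual_basisD(1,2)[OF D] and co = dual_basisD(4)[OF D] and ex = dual_basisD(5)[OF D]
  have "\<exists>e\<in>E. co e t \<noteq> \<zero>"
  proof (rule ccontr)
    assume "\<not> ?thesis"
    then have "(\<Oplus>\<^bsub>H\<^esub>e\<in>E. co e t \<odot>\<^bsub>H\<^esub> e) = \<zero>\<^bsub>H\<^esub>"
      using E(2) by (intro H.M.add.finprod_one_eqI) auto
    then show False using ex[OF t_closed] t_nonzero by simp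
  qed
  then obtain e0 where e0: "e0 \<in> E" "co e0 t \<noteq> \<zero>" by blast
  \<comment> \<open>A coordinate that does not vanish at the nonzero element \<open>t\<close>,
    scaled so that \<open>p t\<close> is one.\<close>
  define p where "p x = inv (co e0 t) \<otimes> co e0 x" for x
  have ct: "co e0 t \<in> carrier K" "inv (co e0 t) \<in> carrier K"
    using functional_closed[OF co[OF e0(1)] t_closed] e0(2) by auto
  have p: "p \<in> module_hom K H K1"
    unfolding p_def using co[OF e0(1)] ct by (auto intro!: lin_intros)
  have pt: "p t = \<one>"
    using ct e0(2) H.field_Units by (simp add: p_def H.R.Units_l_inv)
  note [lin_intros] = lin_comp[OF p]
  note [simp] = functional_closed[OF p]
  define g where "g a = sw H (\<lambda>a1 a2. p a1 \<odot>\<^bsub>H\<^esub> antipode H a2) a" for a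
  have g: "g \<in> module_hom K H H" unfolding g_def by (auto intro!: lin_intros)
  note [lin_intros] = lin_comp[OF g]
  note [simp] = module_hom_mem[OF g]
  have co': "(\<lambda>a. co e (g a)) \<in> module_hom K H K1" if "e \<in> E" for e
    using lin_comp[OF co[OF that] g] .
  have "\<one>\<^bsub>H\<^esub> = \<epsilon> (lt p) \<odot>\<^bsub>H\<^esub> \<one>\<^bsub>H\<^esub>"
    by (simp add: counit_lt[OF p] pt)
  also have "\<dots> = sw H (\<lambda>a b. antipode H a \<otimes>\<^bsub>H\<^esub> b) (lt p)"
    using antipode_left[of "lt p"] p by simp
  also have "\<dots> = sw H (\<lambda>a b. p a \<odot>\<^bsub>H\<^esub> sw H (\<lambda>b1 b2. antipode H b1 \<otimes>\<^bsub>H\<^esub> b2) b) t"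
    by (rule lt_comp[OF p]) (auto intro!: lin_intros)
  also have "\<dots> = sw H (\<lambda>a b. sw H (\<lambda>b1 b2. p a \<odot>\<^bsub>H\<^esub> (antipode H b1 \<otimes>\<^bsub>H\<^esub> b2)) b) t"
  proof (rule sw_cong)
    fix a b assume ab: "a \<in> carrier H" "b \<in> carrier H"
    show "p a \<odot>\<^bsub>H\<^esub> sw H (\<lambda>b1 b2. antipode H b1 \<otimes>\<^bsub>H\<^esub> b2) b =
        sw H (\<lambda>b1 b2. p a \<odot>\<^bsub>H\<^esub> (antipode H b1 \<otimes>\<^bsub>H\<^esub> b2)) b"
      using ab by (intro sw_comp) (auto intro!: lin_intros)
  qed (auto intro!: lin_intros)
  also have "\<dots> = sw H (\<lambda>a b. sw H (\<lambda>a1 a2. p a1 \<odot>\<^bsub>H\<^esub> (antipode H a2 \<otimes>\<^bsub>H\<^esub> b)) a) t"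
    by (rule sw_coassoc[symmetric]) (auto intro!: trilinI lin_intros)
  also have "\<dots> = sw H (\<lambda>a b. g a \<otimes>\<^bsub>H\<^esub> b) t"
  proof (rule sw_cong)
    fix a b assume ab: "a \<in> carrier H" "b \<in> carrier H"
    have "g a \<otimes>\<^bsub>H\<^esub> b = sw H (\<lambda>a1 a2. (p a1 \<odot>\<^bsub>H\<^esub> antipode H a2) \<otimes>\<^bsub>H\<^esub> b) a"
      unfolding g_def using ab by (intro sw_comp[of H H _ "\<lambda>x. x \<otimes>\<^bsub>H\<^esub> b"]) (auto intro!: lin_intros)
    also have "\<dots> = sw H (\<lambda>a1 a2. p a1 \<odot>\<^bsub>H\<^esub> (antipode H a2 \<otimes>\<^bsub>H\<^esub> b)) a"
      using ab by (intro sw_cong) (auto intro!: lin_intros simp: assoc_algebra.smult_mult_left[OF algebra])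
    finally show "sw H (\<lambda>a1 a2. p a1 \<odot>\<^bsub>H\<^esub> (antipode H a2 \<otimes>\<^bsub>H\<^esub> b)) a = g a \<otimes>\<^bsub>H\<^esub> b" by simp
  qed (auto intro!: lin_intros)
  also have "\<dots> = sw H (\<lambda>a b. \<Oplus>\<^bsub>H\<^esub>e\<in>E. co e (g a) \<odot>\<^bsub>H\<^esub> (e \<otimes>\<^bsub>H\<^esub> b)) t"
  proof (rule sw_cong)
    fix a b assume ab: "a \<in> carrier H" "b \<in> carrier H"
    have cc: "co e (g a) \<in> carrier K" if "e \<in> E" for e
      using functional_closed[OF co[OF that]] ab by simp
    have "g a \<otimes>\<^bsub>H\<^esub> b = (\<Oplus>\<^bsub>H\<^esub>e\<in>E. co e (g a) \<odot>\<^bsub>H\<^esub> e) \<otimes>\<^bsub>H\<^esub> b"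
      using ex[of "g a"] ab by simp
    also have "\<dots> = (\<Oplus>\<^bsub>H\<^esub>e\<in>E. (co e (g a) \<odot>\<^bsub>H\<^esub> e) \<otimes>\<^bsub>H\<^esub> b)"
      using ab E(2) cc by (intro HR.finsum_ldistr[OF E(1)]) auto
    also have "\<dots> = (\<Oplus>\<^bsub>H\<^esub>e\<in>E. co e (g a) \<odot>\<^bsub>H\<^esub> (e \<otimes>\<^bsub>H\<^esub> b))"
      using ab E(2) cc
      by (intro H.M.finsum_cong') (auto simp: assoc_algebra.smult_mult_left[OF algebra] subsetD)
    finally show "g a \<otimes>\<^bsub>H\<^esub> b = (\<Oplus>\<^bsub>H\<^esub>e\<in>E. co e (g a) \<odot>\<^bsub>H\<^esub> (e \<otimes>\<^bsub>H\<^esub> b))" .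
  qed (auto intro!: lin_intros)
  also have "\<dots> = (\<Oplus>\<^bsub>H\<^esub>e\<in>E. sw H (\<lambda>a b. co e (g a) \<odot>\<^bsub>H\<^esub> (e \<otimes>\<^bsub>H\<^esub> b)) t)"
    using E(2) functional_closed[OF co] by (intro sw_finsum) (auto intro!: lin_intros co')
  finally have one: "\<one>\<^bsub>H\<^esub> = (\<Oplus>\<^bsub>H\<^esub>e\<in>E. sw H (\<lambda>a b. co e (g a) \<odot>\<^bsub>H\<^esub> (e \<otimes>\<^bsub>H\<^esub> b)) t)" .
  have "\<exists>q\<in>module_hom K H K1. (\<Oplus>\<^bsub>H\<^esub>e\<in>E. sw H (\<lambda>a b. co e (g a) \<odot>\<^bsub>H\<^esub> (e \<otimes>\<^bsub>H\<^esub> b)) t) = lt q"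
  proof (rule lt_finsum[OF E(1)])
    fix e assume e: "e \<in> E"
    \<comment> \<open>The factor \<open>e\<close> is moved from the second leg of \<open>t\<close>
      into the functional on the first leg by \<open>integral_antipode\<close>.\<close>
    have "sw H (\<lambda>a b. co e (g a) \<odot>\<^bsub>H\<^esub> (e \<otimes>\<^bsub>H\<^esub> b)) t =
        lt (\<lambda>x. co e (g (antipode H e \<otimes>\<^bsub>H\<^esub> x)))"
      using integral_antipode[OF co'[OF e]] e E(2) by (auto simp: lt_def)
    moreover have "(\<lambda>x. co e (g (antipode H e \<otimes>\<^bsub>H\<^esub> x))) \<in> module_hom K H K1"
      using e E(2) by (intro lin_comp[OF co[OF e]]) (auto intro!: lin_intros)
    ultimately show "\<exists>p\<in>module_hom K H K1. sw H (\<lambda>a b. co e (g a) \<odot>\<^bsub>H\<^esub> (e \<otimes>\<^bsub>H\<^esub> b)) t = lt p"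
      by blast
  qed
  then obtain q where q: "q \<in> module_hom K H K1" "\<one>\<^bsub>H\<^esub> = lt q" using one by auto
  have "lt (\<lambda>x. q (antipode H h \<otimes>\<^bsub>H\<^esub> x)) = h"
    using lt_left_ideal[OF q(1) h] q(2)[symmetric] h by simp
  moreover have "(\<lambda>x. q (antipode H h \<otimes>\<^bsub>H\<^esub> x)) \<in> module_hom K H K1"
    using h by (intro lin_comp[OF q(1)]) (auto intro!: lin_intros)
  ultimately show ?thesis by (rule bexI)
qed

end

context hopf_integral
begin

text \<open>The functionals \<open>p e\<close> are preimages of the basis under \<open>lt\<close>.
  Since \<open>rt\<close> is the transpose of \<open>lt\<close>, the elements
  \<open>rt (co e)\<close> are biorthogonal to them.\<close>

lemma rt_dual_basis:
  assumes D: "dual_basis K H E co"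
  shows "\<exists>p. (\<forall>e\<in>E. p e \<in> module_hom K H K1) \<and>
    (\<forall>h\<in>carrier H. h = (\<Oplus>\<^bsub>H\<^esub>e\<in>E. p e h \<odot>\<^bsub>H\<^esub> rt (co e)))"
proof -
  note E = dual_basisD(1-3)[OF D] and co = dual_basisD(4)[OF D] and dual = dual_basisD(6)[OF D]
  have "\<forall>e\<in>E. \<exists>p. p \<in> module_hom K H K1 \<and> lt p = e"
  proof
    fix e assume "e \<in> E"
    then have "e \<in> carrier H" using E(2) by (rule subsetD[rotated])
    from lt_surj[OF this] show "\<exists>p. p \<in> module_hom K H K1 \<and> lt p = e"
      unfolding Bex_def .
  qed
  from bchoice[OF this] obtain p
    where "\<forall>e\<in>E. p e \<in> module_hom K H K1 \<and> lt (p e) = e" ..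
  then have p: "\<And>e. e \<in> E \<Longrightarrow> p e \<in> module_hom K H K1 \<and> lt (p e) = e" by (rule bspec)
  have d: "p e (rt (co e')) = (if e = e' then \<one> else \<zero>)" if "e \<in> E" "e' \<in> E" for e e'
  proof -
    have "p e (rt (co e')) = co e' (lt (p e))"
      using lt_rt_dual[OF conjunct1[OF p[OF that(1)]] co[OF that(2)]] by (rule sym)
    also have "\<dots> = co e' e"
      unfolding conjunct2[OF p[OF that(1)]] ..
    also have "\<dots> = (if e = e' then \<one> else \<zero>)"
      using dual[OF that(2,1)] by auto
    finally show ?thesis .
  qed
  have "h = (\<Oplus>\<^bsub>H\<^esub>e\<in>E. p e h \<odot>\<^bsub>H\<^esub> rt (co e))" if "h \<in> carrier H" for h
  proof (rule dual_family_spans[where u = "\<lambda>e. rt (co e)" and p = p, OF H.vectorspace_axioms E(1,3)])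
    show "rt (co e) \<in> carrier H" "p e \<in> module_hom K H K1" if "e \<in> E" for e
      using co[OF that] p[OF that] by auto
  qed (use that d in auto)
  then show ?thesis using p by (intro exI[of _ p]) simp
qed

lemma rt_add_smult:
  assumes p: "p \<in> module_hom K H K1" and q: "q \<in> module_hom K H K1" and c: "c \<in> carrier K"
  shows "rt (\<lambda>x. p x \<oplus> c \<otimes> q x) = rt p \<oplus>\<^bsub>H\<^esub> c \<odot>\<^bsub>H\<^esub> rt q"
proof -
  note [lin_intros] = lin_comp[OF p] lin_comp[OF q]
  note [simp] = functional_closed[OF p] functional_closed[OF q]
  have bp: "bilin K H H H (\<lambda>a b. p b \<odot>\<^bsub>H\<^esub> a)" and bq: "bilin K H H H (\<lambda>a b. q b \<odot>\<^bsub>H\<^esub> a)"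
    by (auto intro!: lin_intros)
  have b: "bilin K H H H (\<lambda>a b. p b \<odot>\<^bsub>H\<^esub> a \<oplus>\<^bsub>H\<^esub> c \<odot>\<^bsub>H\<^esub> (q b \<odot>\<^bsub>H\<^esub> a))"
    using c by (intro bilinI lin_add lin_smult bilinD[OF bp] bilinD[OF bq]) auto
  have "rt p \<oplus>\<^bsub>H\<^esub> c \<odot>\<^bsub>H\<^esub> rt q = sw H (\<lambda>a b. p b \<odot>\<^bsub>H\<^esub> a \<oplus>\<^bsub>H\<^esub> c \<odot>\<^bsub>H\<^esub> (q b \<odot>\<^bsub>H\<^esub> a)) t"
    unfolding rt_def
  proof (rule HH.T_ext[OF _ _ _ comult_closed[OF t_closed]])
    show "(\<lambda>x. HH.tl H (\<lambda>a b. p b \<odot>\<^bsub>H\<^esub> a) x \<oplus>\<^bsub>H\<^esub> c \<odot>\<^bsub>H\<^esub> HH.tl H (\<lambda>a b. q b \<odot>\<^bsub>H\<^esub> a) x)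
      \<in> module_hom K HH.T H"
      using c by (intro lin_add lin_smult HH.tl_linear bp bq) auto
    show "HH.tl H (\<lambda>a b. p b \<odot>\<^bsub>H\<^esub> a \<oplus>\<^bsub>H\<^esub> c \<odot>\<^bsub>H\<^esub> (q b \<odot>\<^bsub>H\<^esub> a)) \<in> module_hom K HH.T H"
      by (intro HH.tl_linear b) simp
  qed (simp add: HH.tl_pure[OF _ bp] HH.tl_pure[OF _ bq] HH.tl_pure[OF _ b])
  also have "\<dots> = rt (\<lambda>x. p x \<oplus> c \<otimes> q x)"
    unfolding rt_def by (rule sw_cong) (use c in \<open>auto simp: b H.smult_l_distr H.smult_assoc1\<close>)
  finally show ?thesis by simp
qed

lemma rt_zero: "rt (\<lambda>x. \<zero>) = \<zero>\<^bsub>H\<^esub>"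
proof -
  have "rt (\<lambda>x. \<zero>) \<oplus>\<^bsub>H\<^esub> rt (\<lambda>x. \<zero>) = rt (\<lambda>x. \<zero>)"
    using rt_add_smult[OF zero_functional zero_functional H.R.one_closed] zero_functional by simp
  then show ?thesis
    using lt_rt_closed(2)[OF zero_functional] by (simp add: H.M.add.l_cancel_one)
qed

lemma rt_lincomb:
  assumes "finite I" "\<And>i. i \<in> I \<Longrightarrow> c i \<in> carrier K" "\<And>i. i \<in> I \<Longrightarrow> p i \<in> module_hom K H K1"
  shows "\<exists>q\<in>module_hom K H K1. (\<Oplus>\<^bsub>H\<^esub>i\<in>I. c i \<odot>\<^bsub>H\<^esub> rt (p i)) = rt q"
  using assms
proof (induction I rule: finite_induct)
  case empty
  show ?case using bexI[of "\<lambda>p. \<zero>\<^bsub>H\<^esub> = rt p", OF rt_zero[symmetric] zero_functional] by simp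
next
  case (insert i I)
  obtain q where q: "q \<in> module_hom K H K1" "(\<Oplus>\<^bsub>H\<^esub>i\<in>I. c i \<odot>\<^bsub>H\<^esub> rt (p i)) = rt q"
    using insert by auto
  have ci: "c i \<in> carrier K" and pI: "p i \<in> module_hom K H K1" using insert by auto
  have "(\<lambda>i. c i \<odot>\<^bsub>H\<^esub> rt (p i)) \<in> I \<rightarrow> carrier H" using insert.prems by auto
  then have "(\<Oplus>\<^bsub>H\<^esub>i\<in>insert i I. c i \<odot>\<^bsub>H\<^esub> rt (p i)) = c i \<odot>\<^bsub>H\<^esub> rt (p i) \<oplus>\<^bsub>H\<^esub> rt q"
    using insert.hyps q ci pI by simp
  also have "\<dots> = rt q \<oplus>\<^bsub>H\<^esub> c i \<odot>\<^bsub>H\<^esub> rt (p i)"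
    using q ci pI by (simp add: H.M.a_comm)
  also have "\<dots> = rt (\<lambda>x. q x \<oplus> c i \<otimes> p i x)"
    by (rule rt_add_smult[symmetric, OF q(1) pI ci])
  finally show ?case
    using functional_add[OF q(1) more_lin_intros(6)[OF pI ci]] by blast
qed

text \<open>The transpose of a surjection between spaces of equal finite dimension is again onto;
  concretely, every element is a combination of the \<open>rt (co e)\<close>.\<close>

lemma rt_surj:
  assumes h: "h \<in> carrier H"
  shows "\<exists>q\<in>module_hom K H K1. rt q = h"
proof -
  obtain E co where D: "dual_basis K H E co"
    by (rule dual_basis_exists[OF H.vectorspace_axioms fin_dim])
  from rt_dual_basis[OF D] obtain p where p: "\<forall>e\<in>E. p e \<in> module_hom K H K1"
    "\<forall>h\<in>carrier H. h = (\<Oplus>\<^bsub>H\<^esub>e\<in>E. p e h \<odot>\<^bsub>H\<^esub> rt (co e))"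
    by (elim exE conjE)
  have "\<exists>q\<in>module_hom K H K1. (\<Oplus>\<^bsub>H\<^esub>e\<in>E. p e h \<odot>\<^bsub>H\<^esub> rt (co e)) = rt q"
    using functional_closed[OF bspec[OF p(1)] h] dual_basisD(4)[OF D]
    by (intro rt_lincomb dual_basisD(1)[OF D])
  then show ?thesis unfolding bspec[OF p(2) h, symmetric] by auto
qed

text \<open>\<open>lam\<close> is the form that enters \<open>\<Lambda>\<close>. Its mirror image
  \<open>rho\<close> supplies the inverse of the antipode and the second of the two dual
  bases.\<close>

definition lam where "lam = (SOME q. q \<in> module_hom K H K1 \<and> rt q = \<one>\<^bsub>H\<^esub>)"
definition rho where "rho = (SOME q. q \<in> module_hom K H K1 \<and> lt q = \<one>\<^bsub>H\<^esub>)"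

lemma lam_linear: "lam \<in> module_hom K H K1" and rt_lam: "rt lam = \<one>\<^bsub>H\<^esub>"
proof -
  have "\<exists>q. q \<in> module_hom K H K1 \<and> rt q = \<one>\<^bsub>H\<^esub>"
    using rt_surj[OF HR.one_closed] unfolding Bex_def .
  from someI_ex[OF this] have "lam \<in> module_hom K H K1 \<and> rt lam = \<one>\<^bsub>H\<^esub>"
    unfolding lam_def .
  then show "lam \<in> module_hom K H K1" "rt lam = \<one>\<^bsub>H\<^esub>" by auto
qed

lemma rho_linear: "rho \<in> module_hom K H K1" and lt_rho: "lt rho = \<one>\<^bsub>H\<^esub>"
proof -
  have "\<exists>q. q \<in> module_hom K H K1 \<and> lt q = \<one>\<^bsub>H\<^esub>"
    using lt_surj[OF HR.one_closed] unfolding Bex_def .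
  from someI_ex[OF this] have "rho \<in> module_hom K H K1 \<and> lt rho = \<one>\<^bsub>H\<^esub>"
    unfolding rho_def .
  then show "rho \<in> module_hom K H K1" "lt rho = \<one>\<^bsub>H\<^esub>" by auto
qed

lemma lam_rho_simps [simp]:
  "h \<in> carrier H \<Longrightarrow> lam h \<in> carrier K" "h \<in> carrier H \<Longrightarrow> rho h \<in> carrier K"
  "lam t = \<one>" "rho t = \<one>"
  using functional_closed[OF lam_linear] functional_closed[OF rho_linear]
    counit_rt[OF lam_linear] counit_lt[OF rho_linear]
  by (simp_all add: rt_lam lt_rho counit_one)

lemma lam_rho_intros [lin_intros]:
  "f \<in> module_hom K P H \<Longrightarrow> (\<lambda>x. lam (f x)) \<in> module_hom K P K1"
  "f \<in> module_hom K P H \<Longrightarrow> (\<lambda>x. rho (f x)) \<in> module_hom K P K1"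
  by (rule lin_comp[OF lam_linear] lin_comp[OF rho_linear]; assumption)+

text \<open>\<open>\<rho>\<close> is a right and \<open>\<lambda>\<close> a left integral of the dual Hopf algebra.\<close>

lemma rho_integral:
  assumes h: "h \<in> carrier H"
  shows "sw H (\<lambda>a b. rho a \<odot>\<^bsub>H\<^esub> b) h = rho h \<odot>\<^bsub>H\<^esub> \<one>\<^bsub>H\<^esub>"
proof -
  \<comment> \<open>With \<open>h\<close> written as \<open>rt q\<close>, the left side becomes a
    sum over the iterated coproduct of \<open>t\<close>, in which coassociativity isolates
    \<open>lt rho\<close>, that is, \<open>1\<close>.\<close>
  obtain q where q: "q \<in> module_hom K H K1" "rt q = h" using rt_surj[OF h] ..
  note [lin_intros] = lin_comp[OF q(1)]
  note [simp] = functional_closed[OF q(1)]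
  define f where "f x = sw H (\<lambda>b1 b2. q b2 \<odot>\<^bsub>H\<^esub> b1) x" for x
  have f: "f \<in> module_hom K H H" unfolding f_def by (auto intro!: lin_intros)
  have "sw H (\<lambda>a b. rho a \<odot>\<^bsub>H\<^esub> b) (rt q) =
      sw H (\<lambda>a b. q b \<odot>\<^bsub>H\<^esub> sw H (\<lambda>a1 a2. rho a1 \<odot>\<^bsub>H\<^esub> a2) a) t"
    by (rule rt_comp[OF q(1)]) (auto intro!: lin_intros)
  also have "\<dots> = sw H (\<lambda>a b. sw H (\<lambda>a1 a2. q b \<odot>\<^bsub>H\<^esub> (rho a1 \<odot>\<^bsub>H\<^esub> a2)) a) t"
  proof (rule sw_cong)
    fix a b assume ab: "a \<in> carrier H" "b \<in> carrier H"
    show "q b \<odot>\<^bsub>H\<^esub> sw H (\<lambda>a1 a2. rho a1 \<odot>\<^bsub>H\<^esub> a2) a = sw H (\<lambda>a1 a2. q b \<odot>\<^bsub>H\<^esub> (rho a1 \<odot>\<^bsub>H\<^esub> a2)) a"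
      using ab by (intro sw_comp) (auto intro!: lin_intros)
  qed (auto intro!: lin_intros)
  also have "\<dots> = sw H (\<lambda>a b. sw H (\<lambda>b1 b2. q b2 \<odot>\<^bsub>H\<^esub> (rho a \<odot>\<^bsub>H\<^esub> b1)) b) t"
    by (rule sw_coassoc) (auto intro!: trilinI lin_intros)
  also have "\<dots> = sw H (\<lambda>a b. rho a \<odot>\<^bsub>H\<^esub> f b) t"
  proof (rule sw_cong)
    fix a b assume ab: "a \<in> carrier H" "b \<in> carrier H"
    have "rho a \<odot>\<^bsub>H\<^esub> f b = sw H (\<lambda>b1 b2. rho a \<odot>\<^bsub>H\<^esub> (q b2 \<odot>\<^bsub>H\<^esub> b1)) b"
      unfolding f_def using ab by (intro sw_comp) (auto intro!: lin_intros)
    also have "\<dots> = sw H (\<lambda>b1 b2. q b2 \<odot>\<^bsub>H\<^esub> (rho a \<odot>\<^bsub>H\<^esub> b1)) b"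
      using ab by (intro sw_cong) (auto intro!: lin_intros simp: H.smult_assoc_simp H.R.m_comm)
    finally show "sw H (\<lambda>b1 b2. q b2 \<odot>\<^bsub>H\<^esub> (rho a \<odot>\<^bsub>H\<^esub> b1)) b = rho a \<odot>\<^bsub>H\<^esub> f b" by simp
  qed (auto intro!: lin_intros)
  also have "\<dots> = f (lt rho)"
    by (rule lt_comp[OF rho_linear _ f, symmetric]) simp
  also have "\<dots> = q \<one>\<^bsub>H\<^esub> \<odot>\<^bsub>H\<^esub> \<one>\<^bsub>H\<^esub>"
    unfolding lt_rho f_def by (rule sw_one) (auto intro!: lin_intros)
  also have "q \<one>\<^bsub>H\<^esub> = rho (rt q)"
    using lt_rt_dual[OF rho_linear q(1)] by (simp add: lt_rho)
  finally show ?thesis using q(2) by simp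
qed

lemma lam_integral:
  assumes h: "h \<in> carrier H"
  shows "sw H (\<lambda>a b. lam b \<odot>\<^bsub>H\<^esub> a) h = lam h \<odot>\<^bsub>H\<^esub> \<one>\<^bsub>H\<^esub>"
proof -
  \<comment> \<open>The mirror image of the previous argument: \<open>h\<close> is written as
    \<open>lt p\<close>, and \<open>rt lam\<close> is isolated.\<close>
  obtain p where p: "p \<in> module_hom K H K1" "lt p = h" using lt_surj[OF h] ..
  note [lin_intros] = lin_comp[OF p(1)]
  note [simp] = functional_closed[OF p(1)]
  define f where "f x = sw H (\<lambda>b1 b2. p b1 \<odot>\<^bsub>H\<^esub> b2) x" for x
  have f: "f \<in> module_hom K H H" unfolding f_def by (auto intro!: lin_intros)
  have "sw H (\<lambda>a b. lam b \<odot>\<^bsub>H\<^esub> a) (lt p) =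
      sw H (\<lambda>a b. p a \<odot>\<^bsub>H\<^esub> sw H (\<lambda>b1 b2. lam b2 \<odot>\<^bsub>H\<^esub> b1) b) t"
    by (rule lt_comp[OF p(1)]) (auto intro!: lin_intros)
  also have "\<dots> = sw H (\<lambda>a b. sw H (\<lambda>b1 b2. p a \<odot>\<^bsub>H\<^esub> (lam b2 \<odot>\<^bsub>H\<^esub> b1)) b) t"
  proof (rule sw_cong)
    fix a b assume ab: "a \<in> carrier H" "b \<in> carrier H"
    show "p a \<odot>\<^bsub>H\<^esub> sw H (\<lambda>b1 b2. lam b2 \<odot>\<^bsub>H\<^esub> b1) b = sw H (\<lambda>b1 b2. p a \<odot>\<^bsub>H\<^esub> (lam b2 \<odot>\<^bsub>H\<^esub> b1)) b"
      using ab by (intro sw_comp) (auto intro!: lin_intros)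
  qed (auto intro!: lin_intros)
  also have "\<dots> = sw H (\<lambda>a b. sw H (\<lambda>a1 a2. p a1 \<odot>\<^bsub>H\<^esub> (lam b \<odot>\<^bsub>H\<^esub> a2)) a) t"
    by (rule sw_coassoc[symmetric]) (auto intro!: trilinI lin_intros)
  also have "\<dots> = sw H (\<lambda>a b. lam b \<odot>\<^bsub>H\<^esub> f a) t"
  proof (rule sw_cong)
    fix a b assume ab: "a \<in> carrier H" "b \<in> carrier H"
    have "lam b \<odot>\<^bsub>H\<^esub> f a = sw H (\<lambda>a1 a2. lam b \<odot>\<^bsub>H\<^esub> (p a1 \<odot>\<^bsub>H\<^esub> a2)) a"
      unfolding f_def using ab by (intro sw_comp) (auto intro!: lin_intros)
    also have "\<dots> = sw H (\<lambda>a1 a2. p a1 \<odot>\<^bsub>H\<^esub> (lam b \<odot>\<^bsub>H\<^esub> a2)) a"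
      using ab by (intro sw_cong) (auto intro!: lin_intros simp: H.smult_assoc_simp H.R.m_comm)
    finally show "sw H (\<lambda>a1 a2. p a1 \<odot>\<^bsub>H\<^esub> (lam b \<odot>\<^bsub>H\<^esub> a2)) a = lam b \<odot>\<^bsub>H\<^esub> f a" by simp
  qed (auto intro!: lin_intros)
  also have "\<dots> = f (rt lam)"
    by (rule rt_comp[OF lam_linear _ f, symmetric]) simp
  also have "\<dots> = p \<one>\<^bsub>H\<^esub> \<odot>\<^bsub>H\<^esub> \<one>\<^bsub>H\<^esub>"
    unfolding rt_lam f_def by (rule sw_one) (auto intro!: lin_intros)
  also have "p \<one>\<^bsub>H\<^esub> = lam (lt p)"
    using lt_rt_dual[OF p(1) lam_linear] by (simp add: rt_lam)
  finally show ?thesis using p(2) by simp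
qed

text \<open>An explicit formula for the inverse of the antipode under composition. It is used
  through the cancellation rule that follows, in which the two legs occur in opposite order.\<close>

definition antipode_inv where
  "antipode_inv h = sw H (\<lambda>a b. rho (h \<otimes>\<^bsub>H\<^esub> a) \<odot>\<^bsub>H\<^esub> b) t"

lemma antipode_inv_linear: "antipode_inv \<in> module_hom K H H"
  unfolding antipode_inv_def by (auto intro!: lin_intros)

lemma antipode_inv_closed [simp]: "h \<in> carrier H \<Longrightarrow> antipode_inv h \<in> carrier H"
  using module_hom_mem[OF antipode_inv_linear] .

lemma antipode_inv_intro [lin_intros]:
  "f \<in> module_hom K P H \<Longrightarrow> (\<lambda>x. antipode_inv (f x)) \<in> module_hom K P H"
  by (rule lin_comp[OF antipode_inv_linear])

text \<open>After pulling \<open>b\<close> under the sum over \<open>t\<close>, the double sum is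
  the one for the coproduct of \<open>h t\<close>. The integral property of \<open>rho\<close>
  evaluates it to \<open>rho (h t)\<close>, and \<open>h t\<close> is \<open>\<epsilon> h\<close>
  times \<open>t\<close>.\<close>

lemma antipode_inv:
  assumes h: "h \<in> carrier H"
  shows "sw H (\<lambda>a b. b \<otimes>\<^bsub>H\<^esub> antipode_inv a) h = \<epsilon> h \<odot>\<^bsub>H\<^esub> \<one>\<^bsub>H\<^esub>"
proof -
  have "sw H (\<lambda>a b. b \<otimes>\<^bsub>H\<^esub> antipode_inv a) h =
      sw H (\<lambda>a b. sw H (\<lambda>c d. rho (a \<otimes>\<^bsub>H\<^esub> c) \<odot>\<^bsub>H\<^esub> (b \<otimes>\<^bsub>H\<^esub> d)) t) h"
  proof (rule sw_cong)
    fix a b assume ab: "a \<in> carrier H" "b \<in> carrier H"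
    have "b \<otimes>\<^bsub>H\<^esub> antipode_inv a = sw H (\<lambda>c d. b \<otimes>\<^bsub>H\<^esub> (rho (a \<otimes>\<^bsub>H\<^esub> c) \<odot>\<^bsub>H\<^esub> d)) t"
      unfolding antipode_inv_def using ab
      by (intro sw_comp[of H H _ "\<lambda>x. b \<otimes>\<^bsub>H\<^esub> x"]) (auto intro!: lin_intros)
    also have "\<dots> = sw H (\<lambda>c d. rho (a \<otimes>\<^bsub>H\<^esub> c) \<odot>\<^bsub>H\<^esub> (b \<otimes>\<^bsub>H\<^esub> d)) t"
      using ab by (intro sw_cong) (auto intro!: lin_intros simp: assoc_algebra.smult_mult_right[OF algebra])
    finally show "b \<otimes>\<^bsub>H\<^esub> antipode_inv a = sw H (\<lambda>c d. rho (a \<otimes>\<^bsub>H\<^esub> c) \<odot>\<^bsub>H\<^esub> (b \<otimes>\<^bsub>H\<^esub> d)) t" .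
  qed (use h in \<open>auto intro!: lin_intros\<close>)
  also have "\<dots> = sw H (\<lambda>a b. rho a \<odot>\<^bsub>H\<^esub> b) (h \<otimes>\<^bsub>H\<^esub> t)"
  proof -
    have "bilin K H H H (\<lambda>a b. rho a \<odot>\<^bsub>H\<^esub> b)" by (auto intro!: lin_intros)
    from sw_mult[OF _ this h t_closed] show ?thesis by simp
  qed
  also have "\<dots> = rho (h \<otimes>\<^bsub>H\<^esub> t) \<odot>\<^bsub>H\<^esub> \<one>\<^bsub>H\<^esub>"
    using h by (intro rho_integral) auto
  also have "\<dots> = \<epsilon> h \<odot>\<^bsub>H\<^esub> \<one>\<^bsub>H\<^esub>"
    using h by (simp add: mult_t module_hom_smult[OF rho_linear])
  finally show ?thesis .
qed

text \<open>The counit inserted next to the antipode is written as \<open>lam (y t)\<close>, which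
  the integral property of \<open>lam\<close> expands into legs of \<open>y t\<close>. The first leg
  of \<open>y\<close> then meets the antipode and cancels.\<close>

lemma antipode_eq:
  assumes k: "k \<in> carrier H"
  shows "antipode H k = sw H (\<lambda>a b. lam (k \<otimes>\<^bsub>H\<^esub> b) \<odot>\<^bsub>H\<^esub> a) t"
proof -
  define M where "M y x = sw H (\<lambda>c d. lam (y \<otimes>\<^bsub>H\<^esub> d) \<odot>\<^bsub>H\<^esub> (x \<otimes>\<^bsub>H\<^esub> c)) t" for y x
  have M: "M y \<in> module_hom K H H" if "y \<in> carrier H" for y
    unfolding M_def using that by (auto intro!: lin_intros)
  have "antipode H k = sw H (\<lambda>x y. \<epsilon> y \<odot>\<^bsub>H\<^esub> antipode H x) k"
    by (rule sw_counit_right[symmetric, OF _ antipode_linear k]) simp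
  also have "\<dots> = sw H (\<lambda>x y. sw H (\<lambda>y1 y2. sw H (\<lambda>c d.
      lam (y2 \<otimes>\<^bsub>H\<^esub> d) \<odot>\<^bsub>H\<^esub> ((antipode H x \<otimes>\<^bsub>H\<^esub> y1) \<otimes>\<^bsub>H\<^esub> c)) t) y) k"
  proof (rule sw_cong)
    fix x y assume xy: "x \<in> carrier H" "y \<in> carrier H"
    let ?f = "\<lambda>z. antipode H x \<otimes>\<^bsub>H\<^esub> z"
    have f: "?f \<in> module_hom K H H" using xy by (auto intro!: lin_intros)
    have "\<epsilon> y \<odot>\<^bsub>H\<^esub> antipode H x = ?f (lam (y \<otimes>\<^bsub>H\<^esub> t) \<odot>\<^bsub>H\<^esub> \<one>\<^bsub>H\<^esub>)"
      using xy by (simp add: mult_t module_hom_smult[OF lam_linear] module_hom_smult[OF f])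
    also have "\<dots> = ?f (sw H (\<lambda>a b. lam b \<odot>\<^bsub>H\<^esub> a) (y \<otimes>\<^bsub>H\<^esub> t))"
      using lam_integral[of "y \<otimes>\<^bsub>H\<^esub> t"] xy by simp
    also have "\<dots> = sw H (\<lambda>a b. ?f (lam b \<odot>\<^bsub>H\<^esub> a)) (y \<otimes>\<^bsub>H\<^esub> t)"
      using xy by (intro sw_comp f) (auto intro!: lin_intros)
    also have "\<dots> = sw H (\<lambda>a b. lam b \<odot>\<^bsub>H\<^esub> (antipode H x \<otimes>\<^bsub>H\<^esub> a)) (y \<otimes>\<^bsub>H\<^esub> t)"
      using xy by (intro sw_cong) (auto intro!: lin_intros simp: module_hom_smult[OF f])
    also have "\<dots> = sw H (\<lambda>y1 y2. sw H (\<lambda>c d.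
        lam (y2 \<otimes>\<^bsub>H\<^esub> d) \<odot>\<^bsub>H\<^esub> (antipode H x \<otimes>\<^bsub>H\<^esub> (y1 \<otimes>\<^bsub>H\<^esub> c))) t) y"
      using xy by (intro sw_mult) (auto intro!: lin_intros)
    also have "\<dots> = sw H (\<lambda>y1 y2. sw H (\<lambda>c d.
        lam (y2 \<otimes>\<^bsub>H\<^esub> d) \<odot>\<^bsub>H\<^esub> ((antipode H x \<otimes>\<^bsub>H\<^esub> y1) \<otimes>\<^bsub>H\<^esub> c)) t) y"
    proof (rule sw_cong)
      fix y1 y2 assume y: "y1 \<in> carrier H" "y2 \<in> carrier H"
      show "sw H (\<lambda>c d. lam (y2 \<otimes>\<^bsub>H\<^esub> d) \<odot>\<^bsub>H\<^esub> (antipode H x \<otimes>\<^bsub>H\<^esub> (y1 \<otimes>\<^bsub>H\<^esub> c))) t =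
        sw H (\<lambda>c d. lam (y2 \<otimes>\<^bsub>H\<^esub> d) \<odot>\<^bsub>H\<^esub> ((antipode H x \<otimes>\<^bsub>H\<^esub> y1) \<otimes>\<^bsub>H\<^esub> c)) t"
        using xy y by (intro sw_cong) (auto intro!: lin_intros simp: HR.m_assoc)
    qed (use xy in \<open>auto intro!: lin_intros\<close>)
    finally show "\<epsilon> y \<odot>\<^bsub>H\<^esub> antipode H x = sw H (\<lambda>y1 y2. sw H (\<lambda>c d.
      lam (y2 \<otimes>\<^bsub>H\<^esub> d) \<odot>\<^bsub>H\<^esub> ((antipode H x \<otimes>\<^bsub>H\<^esub> y1) \<otimes>\<^bsub>H\<^esub> c)) t) y" .
  qed (use k in \<open>auto intro!: lin_intros\<close>)
  also have "\<dots> = sw H (\<lambda>x y. sw H (\<lambda>x1 x2. M y (antipode H x1 \<otimes>\<^bsub>H\<^esub> x2)) x) k"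
    unfolding M_def using k by (intro sw_coassoc[symmetric]) (auto intro!: trilinI lin_intros)
  also have "\<dots> = sw H (\<lambda>x y. \<epsilon> x \<odot>\<^bsub>H\<^esub> M y \<one>\<^bsub>H\<^esub>) k"
  proof (rule sw_cong)
    show "bilin K H H H (\<lambda>x y. sw H (\<lambda>x1 x2. M y (antipode H x1 \<otimes>\<^bsub>H\<^esub> x2)) x)"
      unfolding M_def by (auto intro!: lin_intros)
    fix x y assume "x \<in> carrier H" "y \<in> carrier H"
    then show "sw H (\<lambda>x1 x2. M y (antipode H x1 \<otimes>\<^bsub>H\<^esub> x2)) x = \<epsilon> x \<odot>\<^bsub>H\<^esub> M y \<one>\<^bsub>H\<^esub>"
      by (intro sw_antipode_left M) auto
  qed (use k in auto)
  also have "\<dots> = M k \<one>\<^bsub>H\<^esub>"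
  proof (rule sw_counit_left[OF _ _ k])
    show "(\<lambda>y. M y \<one>\<^bsub>H\<^esub>) \<in> module_hom K H H" unfolding M_def by (auto intro!: lin_intros)
  qed simp
  also have "\<dots> = sw H (\<lambda>a b. lam (k \<otimes>\<^bsub>H\<^esub> b) \<odot>\<^bsub>H\<^esub> a) t"
    unfolding M_def using k by (intro sw_cong) (auto intro!: lin_intros)
  finally show ?thesis .
qed

text \<open>The bilinear form sending \<open>a, b\<close> to \<open>lam (a b)\<close> is
  nondegenerate, with \<open>E\<close> and \<open>hd\<close> as dual bases on its two sides. The
  point is to find \<open>hd e\<close> representing the coordinate \<open>co e\<close>.\<close>

lemma frobenius_form:
  obtains E hd where "finite E" "E \<subseteq> carrier H" "\<And>e. e \<in> E \<Longrightarrow> hd e \<in> carrier H"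
    "\<And>k. k \<in> carrier H \<Longrightarrow> k = (\<Oplus>\<^bsub>H\<^esub>e\<in>E. lam (k \<otimes>\<^bsub>H\<^esub> hd e) \<odot>\<^bsub>H\<^esub> e)"
    "\<And>k. k \<in> carrier H \<Longrightarrow> k = (\<Oplus>\<^bsub>H\<^esub>e\<in>E. lam (e \<otimes>\<^bsub>H\<^esub> k) \<odot>\<^bsub>H\<^esub> hd e)"
    "\<And>e e'. e \<in> E \<Longrightarrow> e' \<in> E \<Longrightarrow> lam (e \<otimes>\<^bsub>H\<^esub> hd e') = (if e = e' then \<one> else \<zero>)"
proof -
  obtain E co where D: "dual_basis K H E co"
    by (rule dual_basis_exists[OF H.vectorspace_axioms fin_dim])
  note E = dual_basisD(1-3)[OF D] and co = dual_basisD(4)[OF D] and ex = dual_basisD(5)[OF D]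
    and dual = dual_basisD(6)[OF D]
  define u where "u e = rt (co e)" for e
  have u: "u e \<in> carrier H" if "e \<in> E" for e using co[OF that] by (simp add: u_def)
  define hd where "hd e = sw H (\<lambda>a b. rho (a \<otimes>\<^bsub>H\<^esub> u e) \<odot>\<^bsub>H\<^esub> b) t" for e
  have hd_lt: "hd e = lt (\<lambda>a. rho (a \<otimes>\<^bsub>H\<^esub> u e))" for e by (simp add: hd_def lt_def)
  have hd_fun: "(\<lambda>a. rho (a \<otimes>\<^bsub>H\<^esub> u e)) \<in> module_hom K H K1" if "e \<in> E" for e
    using u[OF that] by (auto intro!: lin_intros)
  have hd: "hd e \<in> carrier H" if "e \<in> E" for e using hd_fun[OF that] by (simp add: hd_lt)
  \<comment> \<open>Since \<open>lt rho\<close> is \<open>1\<close>, the element \<open>k\<close>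
    equals \<open>k lt rho\<close>, in which \<open>k\<close> can be moved into the functional as
    its antipode. Transposing replaces \<open>co e\<close> by \<open>u e\<close>; expressing the
    antipode of \<open>k\<close> as an \<open>rt\<close> and transposing once more produces
    \<open>hd e\<close>.\<close>
  have key: "co e k = lam (k \<otimes>\<^bsub>H\<^esub> hd e)" if e: "e \<in> E" and k: "k \<in> carrier H" for e k
  proof -
    have 1: "(\<lambda>x. rho (antipode H k \<otimes>\<^bsub>H\<^esub> x)) \<in> module_hom K H K1"
      and 2: "(\<lambda>b. lam (k \<otimes>\<^bsub>H\<^esub> b)) \<in> module_hom K H K1"
      using k by (auto intro!: lin_intros)
    have "k = k \<otimes>\<^bsub>H\<^esub> lt rho" using k by (simp add: lt_rho)
    also have "\<dots> = lt (\<lambda>x. rho (antipode H k \<otimes>\<^bsub>H\<^esub> x))" by (rule lt_left_ideal[OF rho_linear k])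
    finally have "co e k = co e (lt (\<lambda>x. rho (antipode H k \<otimes>\<^bsub>H\<^esub> x)))" by (rule arg_cong)
    also have "\<dots> = rho (antipode H k \<otimes>\<^bsub>H\<^esub> u e)"
      using lt_rt_dual[OF 1 co[OF e]] by (simp add: u_def)
    also have "\<dots> = rho (rt (\<lambda>b. lam (k \<otimes>\<^bsub>H\<^esub> b)) \<otimes>\<^bsub>H\<^esub> u e)"
      unfolding antipode_eq[OF k] rt_def ..
    also have "\<dots> = lam (k \<otimes>\<^bsub>H\<^esub> hd e)"
      unfolding hd_lt by (rule lt_rt_dual[OF hd_fun[OF e] 2, symmetric])
    finally show ?thesis .
  qed
  have d: "lam (e \<otimes>\<^bsub>H\<^esub> hd e') = (if e = e' then \<one> else \<zero>)" if "e \<in> E" "e' \<in> E" for e e'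
  proof -
    have "lam (e \<otimes>\<^bsub>H\<^esub> hd e') = co e' e"
      using key[OF that(2)] that(1) E(2) by (simp add: subsetD)
    then show ?thesis using dual[OF that(2,1)] by auto
  qed
  show thesis
  proof (rule that[of E hd])
    fix k assume k: "k \<in> carrier H"
    have "(\<Oplus>\<^bsub>H\<^esub>e\<in>E. co e k \<odot>\<^bsub>H\<^esub> e) = (\<Oplus>\<^bsub>H\<^esub>e\<in>E. lam (k \<otimes>\<^bsub>H\<^esub> hd e) \<odot>\<^bsub>H\<^esub> e)"
      using key k E(2) hd by (intro H.M.finsum_cong') auto
    then show "k = (\<Oplus>\<^bsub>H\<^esub>e\<in>E. lam (k \<otimes>\<^bsub>H\<^esub> hd e) \<odot>\<^bsub>H\<^esub> e)"
      using ex[OF k] by simp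
    show "k = (\<Oplus>\<^bsub>H\<^esub>e\<in>E. lam (e \<otimes>\<^bsub>H\<^esub> k) \<odot>\<^bsub>H\<^esub> hd e)"
    \<comment> \<open>The second expansion follows from biorthogonality alone, by counting
      dimensions.\<close>
    proof (rule dual_family_spans[where u = hd and p = "\<lambda>e x. lam (e \<otimes>\<^bsub>H\<^esub> x)",
          OF H.vectorspace_axioms E(1,3)])
      show "(\<lambda>k. lam (e \<otimes>\<^bsub>H\<^esub> k)) \<in> module_hom K H K1" if "e \<in> E" for e
        using that E(2) by (auto intro!: lin_intros)
    qed (use hd d k in auto)
  qed (use E hd d in auto)
qed

end

section \<open>The smash product is an associative unital algebra\<close>

section \<open>The smash product\<close>

context module_algebra
begin

sublocale Hp: hopf_algebra K H by (rule hopf)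

sublocale S: vectorspace K S
  using algebra by (rule assoc_algebra.vectorspace)

sublocale SR: ring S
  using algebra by (rule assoc_algebra.ring)

sublocale SH: tensor K S H
  by (intro tensor.intro S.vectorspace_axioms Hp.H.vectorspace_axioms)

abbreviation B where "B \<equiv> smash K S H act"

abbreviation pr (infix "\<sharp>" 75) where "s \<sharp> h \<equiv> pure_tensor K S H s h"

lemma vectorspace_facts' [simp, lin_intros]: "vectorspace K S" "vectorspace K SH.T"
  by (simp_all add: S.vectorspace_axioms SH.T_vectorspace)

lemma act_closed [simp]: "h \<in> carrier H \<Longrightarrow> s \<in> carrier S \<Longrightarrow> act h s \<in> carrier S"
  using module_hom_mem[OF act_linear] .

lemma act_intros [lin_intros]:
  "f \<in> module_hom K P S \<Longrightarrow> h \<in> carrier H \<Longrightarrow> (\<lambda>x. act h (f x)) \<in> module_hom K P S"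
  "g \<in> module_hom K P H \<Longrightarrow> s \<in> carrier S \<Longrightarrow> (\<lambda>x. act (g x) s) \<in> module_hom K P S"
  by (rule lin_comp[OF act_linear] lin_comp[OF act_linear_left]; assumption)+

lemma S_mult_intros [lin_intros]:
  "f \<in> module_hom K P S \<Longrightarrow> a \<in> carrier S \<Longrightarrow> (\<lambda>x. f x \<otimes>\<^bsub>S\<^esub> a) \<in> module_hom K P S"
  "f \<in> module_hom K P S \<Longrightarrow> a \<in> carrier S \<Longrightarrow> (\<lambda>x. a \<otimes>\<^bsub>S\<^esub> f x) \<in> module_hom K P S"
  by (simp_all add: lin_mult_left[OF algebra] lin_mult_right[OF algebra])

lemma pr_intros [lin_intros]:
  "f \<in> module_hom K P S \<Longrightarrow> h \<in> carrier H \<Longrightarrow> (\<lambda>x. f x \<sharp> h) \<in> module_hom K P SH.T"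
  "g \<in> module_hom K P H \<Longrightarrow> s \<in> carrier S \<Longrightarrow> (\<lambda>x. s \<sharp> g x) \<in> module_hom K P SH.T"
  by (rule bilin_lin[OF SH.pure_bilin]; assumption)+

definition smash_term where
  "smash_term s h s' h' = Hp.sw SH.T (\<lambda>h1 h2. (s \<otimes>\<^bsub>S\<^esub> act h1 s') \<sharp> (h2 \<otimes>\<^bsub>H\<^esub> h')) h"

lemma smash_term_intros [lin_intros]:
  "\<lbrakk>f \<in> module_hom K P S; h \<in> carrier H; s' \<in> carrier S; h' \<in> carrier H\<rbrakk>
    \<Longrightarrow> (\<lambda>x. smash_term (f x) h s' h') \<in> module_hom K P SH.T"
  "\<lbrakk>s \<in> carrier S; g \<in> module_hom K P H; s' \<in> carrier S; h' \<in> carrier H\<rbrakk>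
    \<Longrightarrow> (\<lambda>x. smash_term s (g x) s' h') \<in> module_hom K P SH.T"
  "\<lbrakk>s \<in> carrier S; h \<in> carrier H; f \<in> module_hom K P S; h' \<in> carrier H\<rbrakk>
    \<Longrightarrow> (\<lambda>x. smash_term s h (f x) h') \<in> module_hom K P SH.T"
  "\<lbrakk>s \<in> carrier S; h \<in> carrier H; s' \<in> carrier S; g \<in> module_hom K P H\<rbrakk>
    \<Longrightarrow> (\<lambda>x. smash_term s h s' (g x)) \<in> module_hom K P SH.T"
proof -
  show "(\<lambda>x. smash_term (f x) h s' h') \<in> module_hom K P SH.T"
    if "f \<in> module_hom K P S" "h \<in> carrier H" "s' \<in> carrier S" "h' \<in> carrier H"
  proof (rule lin_comp[OF _ that(1), of "\<lambda>x. smash_term x h s' h'"])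
    show "(\<lambda>x. smash_term x h s' h') \<in> module_hom K S SH.T"
      unfolding smash_term_def using that by (auto intro!: lin_intros)
  qed
  show "(\<lambda>x. smash_term s (g x) s' h') \<in> module_hom K P SH.T"
    if "s \<in> carrier S" "g \<in> module_hom K P H" "s' \<in> carrier S" "h' \<in> carrier H"
  proof (rule lin_comp[OF _ that(2), of "\<lambda>x. smash_term s x s' h'"])
    show "(\<lambda>x. smash_term s x s' h') \<in> module_hom K H SH.T"
      unfolding smash_term_def using that by (auto intro!: lin_intros)
  qed
  show "(\<lambda>x. smash_term s h (f x) h') \<in> module_hom K P SH.T"
    if "s \<in> carrier S" "h \<in> carrier H" "f \<in> module_hom K P S" "h' \<in> carrier H"
  proof (rule lin_comp[OF _ that(3), of "\<lambda>x. smash_term s h x h'"])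
    show "(\<lambda>x. smash_term s h x h') \<in> module_hom K S SH.T"
      unfolding smash_term_def using that by (auto intro!: lin_intros)
  qed
  show "(\<lambda>x. smash_term s h s' (g x)) \<in> module_hom K P SH.T"
    if "s \<in> carrier S" "h \<in> carrier H" "s' \<in> carrier S" "g \<in> module_hom K P H"
  proof (rule lin_comp[OF _ that(4), of "\<lambda>x. smash_term s h s' x"])
    show "(\<lambda>x. smash_term s h s' x) \<in> module_hom K H SH.T"
      unfolding smash_term_def using that by (auto intro!: lin_intros)
  qed
qed

lemma B_simps [simp]:
  "carrier B = carrier SH.T" "zero B = zero SH.T" "add B = add SH.T" "smult B = smult SH.T"
  "one B = \<one>\<^bsub>S\<^esub> \<sharp> \<one>\<^bsub>H\<^esub>"
  by (simp_all add: smash_def)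

lemma B_mult: "mult B X Y = SH.tl SH.T (\<lambda>s h. SH.tl SH.T (\<lambda>s' h'. smash_term s h s' h') Y) X"
  by (simp add: smash_def smash_term_def)

lemma smash_term_bilin:
  "s \<in> carrier S \<Longrightarrow> h \<in> carrier H \<Longrightarrow> bilin K S H SH.T (smash_term s h)"
  "s' \<in> carrier S \<Longrightarrow> h' \<in> carrier H \<Longrightarrow> bilin K S H SH.T (\<lambda>s h. smash_term s h s' h')"
  by (auto intro!: lin_intros)

lemma mult_bilin': "Y \<in> carrier SH.T \<Longrightarrow> bilin K S H SH.T (\<lambda>s h. SH.tl SH.T (smash_term s h) Y)"
  by (intro bilinI SH.tl_linear_param smash_term_bilin lin_intros) auto

lemma B_mult_bilin: "bilin K SH.T SH.T SH.T (mult B)"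
proof (rule bilinI)
  fix X assume X: "X \<in> carrier SH.T"
  show "(\<lambda>Y. mult B X Y) \<in> module_hom K SH.T SH.T"
    unfolding B_mult
    by (rule SH.tl_linear_param[OF _ _ mult_bilin' SH.tl_linear[OF _ smash_term_bilin(1)] X]) auto
next
  fix Y assume Y: "Y \<in> carrier SH.T"
  show "(\<lambda>X. mult B X Y) \<in> module_hom K SH.T SH.T"
    unfolding B_mult by (rule SH.tl_linear[OF _ mult_bilin'[OF Y]]) simp
qed

lemmas B_mult_lin = bilinD(1,2)[OF B_mult_bilin]
lemmas B_mult_add = module_hom_add[OF B_mult_lin(1)] module_hom_add[OF B_mult_lin(2)]
lemmas B_mult_smult = module_hom_smult[OF B_mult_lin(1)] module_hom_smult[OF B_mult_lin(2)]

lemma B_mult_closed [simp]: "X \<in> carrier SH.T \<Longrightarrow> Y \<in> carrier SH.T \<Longrightarrow> mult B X Y \<in> carrier SH.T"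
  using bilinD(3)[OF B_mult_bilin] .

lemma B_mult_pure:
  assumes "s \<in> carrier S" "h \<in> carrier H" "s' \<in> carrier S" "h' \<in> carrier H"
  shows "mult B (s \<sharp> h) (s' \<sharp> h') = Hp.sw SH.T (\<lambda>h1 h2. (s \<otimes>\<^bsub>S\<^esub> act h1 s') \<sharp> (h2 \<otimes>\<^bsub>H\<^esub> h')) h"
proof -
  have "mult B (s \<sharp> h) (s' \<sharp> h') = smash_term s h s' h'"
    unfolding B_mult using assms
    by (simp add: SH.tl_pure[OF _ mult_bilin'] SH.tl_pure[OF _ smash_term_bilin(1)])
  then show ?thesis by (simp add: smash_term_def)
qed

text \<open>Both products are brought to the same triple sum: the left one by multiplicativity of
  the coproduct and two interchanges, the right one by the module algebra rule for products and
  coassociativity.\<close>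

lemma B_assoc_pure:
  assumes s: "s \<in> carrier S" "s' \<in> carrier S" "s'' \<in> carrier S"
    and h: "h \<in> carrier H" "h' \<in> carrier H" "h'' \<in> carrier H"
  shows "mult B (mult B (s \<sharp> h) (s' \<sharp> h')) (s'' \<sharp> h'') = mult B (s \<sharp> h) (mult B (s' \<sharp> h') (s'' \<sharp> h''))"
proof -
  \<comment> \<open>The common normal form: \<open>a\<close>, \<open>b1\<close>, \<open>b2\<close>
    are the three legs of \<open>h\<close>, and \<open>c\<close>, \<open>d\<close> the two legs of
    \<open>h'\<close>.\<close>
  let ?Z = "\<lambda>a b1 b2 c d. (s \<otimes>\<^bsub>S\<^esub> act a s' \<otimes>\<^bsub>S\<^esub> act (b1 \<otimes>\<^bsub>H\<^esub> c) s'') \<sharp> (b2 \<otimes>\<^bsub>H\<^esub> d \<otimes>\<^bsub>H\<^esub> h'')"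
  have r: "(\<lambda>X. mult B X (s'' \<sharp> h'')) \<in> module_hom K SH.T SH.T"
    by (rule B_mult_lin(2)) (simp add: s h)
  have l: "mult B (s \<sharp> h) \<in> module_hom K SH.T SH.T"
    by (rule B_mult_lin(1)) (simp add: s h)
  have "mult B (mult B (s \<sharp> h) (s' \<sharp> h')) (s'' \<sharp> h'') =
      Hp.sw SH.T (\<lambda>a b. mult B ((s \<otimes>\<^bsub>S\<^esub> act a s') \<sharp> (b \<otimes>\<^bsub>H\<^esub> h')) (s'' \<sharp> h'')) h"
    unfolding B_mult_pure[OF s(1) h(1) s(2) h(2)]
    by (rule Hp.sw_comp[OF _ _ _ r]) (auto intro!: lin_intros simp: s h)
  also have "\<dots> = Hp.sw SH.T (\<lambda>a b. Hp.sw SH.T (\<lambda>b1 b2. Hp.sw SH.T (\<lambda>c d. ?Z a b1 b2 c d) h') b) h"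
  proof (rule Hp.sw_cong)
    have b0: "bilin K H H SH.T (\<lambda>a b. (s \<otimes>\<^bsub>S\<^esub> act a s') \<sharp> (b \<otimes>\<^bsub>H\<^esub> h'))"
      using s h by (auto intro!: lin_intros)
    show "bilin K H H SH.T (\<lambda>a b. mult B ((s \<otimes>\<^bsub>S\<^esub> act a s') \<sharp> (b \<otimes>\<^bsub>H\<^esub> h')) (s'' \<sharp> h''))"
      by (intro bilinI lin_comp[OF r] bilinD[OF b0])
    fix a b assume ab: "a \<in> carrier H" "b \<in> carrier H"
    have "mult B ((s \<otimes>\<^bsub>S\<^esub> act a s') \<sharp> (b \<otimes>\<^bsub>H\<^esub> h')) (s'' \<sharp> h'') =
        Hp.sw SH.T (\<lambda>c d. (s \<otimes>\<^bsub>S\<^esub> act a s' \<otimes>\<^bsub>S\<^esub> act c s'') \<sharp> (d \<otimes>\<^bsub>H\<^esub> h'')) (b \<otimes>\<^bsub>H\<^esub> h')"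
      using ab s h by (intro B_mult_pure) auto
    also have "\<dots> = Hp.sw SH.T (\<lambda>b1 b2. Hp.sw SH.T (\<lambda>c d. ?Z a b1 b2 c d) h') b"
      using ab s h by (intro Hp.sw_mult) (auto intro!: lin_intros)
    finally show "mult B ((s \<otimes>\<^bsub>S\<^esub> act a s') \<sharp> (b \<otimes>\<^bsub>H\<^esub> h')) (s'' \<sharp> h'') =
      Hp.sw SH.T (\<lambda>b1 b2. Hp.sw SH.T (\<lambda>c d. ?Z a b1 b2 c d) h') b" .
  qed (use h in auto)
  also have "\<dots> = Hp.sw SH.T (\<lambda>a b. Hp.sw SH.T (\<lambda>c d. Hp.sw SH.T (\<lambda>b1 b2. ?Z a b1 b2 c d) b) h') h"
  proof (rule Hp.sw_cong)
    show "bilin K H H SH.T (\<lambda>a b. Hp.sw SH.T (\<lambda>b1 b2. Hp.sw SH.T (\<lambda>c d. ?Z a b1 b2 c d) h') b)"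
      using s h by (auto intro!: lin_intros)
    fix a b assume ab: "a \<in> carrier H" "b \<in> carrier H"
    show "Hp.sw SH.T (\<lambda>b1 b2. Hp.sw SH.T (\<lambda>c d. ?Z a b1 b2 c d) h') b =
      Hp.sw SH.T (\<lambda>c d. Hp.sw SH.T (\<lambda>b1 b2. ?Z a b1 b2 c d) b) h'"
      by (rule tensor_lift_swap) (use ab s h in \<open>auto intro!: lin_intros\<close>)
  qed (use h in auto)
  also have "\<dots> = Hp.sw SH.T (\<lambda>c d. Hp.sw SH.T (\<lambda>a b. Hp.sw SH.T (\<lambda>b1 b2. ?Z a b1 b2 c d) b) h) h'"
    by (rule tensor_lift_swap) (use s h in \<open>auto intro!: lin_intros\<close>)
  finally have L: "mult B (mult B (s \<sharp> h) (s' \<sharp> h')) (s'' \<sharp> h'') =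
    Hp.sw SH.T (\<lambda>c d. Hp.sw SH.T (\<lambda>a b. Hp.sw SH.T (\<lambda>b1 b2. ?Z a b1 b2 c d) b) h) h'" .
  have b1: "bilin K H H SH.T (\<lambda>c d. (s' \<otimes>\<^bsub>S\<^esub> act c s'') \<sharp> (d \<otimes>\<^bsub>H\<^esub> h''))"
    using s h by (auto intro!: lin_intros)
  have "mult B (s \<sharp> h) (mult B (s' \<sharp> h') (s'' \<sharp> h'')) =
      Hp.sw SH.T (\<lambda>c d. mult B (s \<sharp> h) ((s' \<otimes>\<^bsub>S\<^esub> act c s'') \<sharp> (d \<otimes>\<^bsub>H\<^esub> h''))) h'"
    unfolding B_mult_pure[OF s(2) h(2) s(3) h(3)]
    by (rule Hp.sw_comp[OF _ _ b1 l]) (auto simp: s h)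
  also have "\<dots> = Hp.sw SH.T (\<lambda>c d. Hp.sw SH.T (\<lambda>a b. Hp.sw SH.T (\<lambda>b1 b2. ?Z a b1 b2 c d) b) h) h'"
  proof (rule Hp.sw_cong)
    show "bilin K H H SH.T (\<lambda>c d. mult B (s \<sharp> h) ((s' \<otimes>\<^bsub>S\<^esub> act c s'') \<sharp> (d \<otimes>\<^bsub>H\<^esub> h'')))"
      by (intro bilinI lin_comp[OF l] bilinD[OF b1])
    fix c d assume cd: "c \<in> carrier H" "d \<in> carrier H"
    let ?X = "\<lambda>a1 a2 b. (s \<otimes>\<^bsub>S\<^esub> (act a1 s' \<otimes>\<^bsub>S\<^esub> act a2 (act c s''))) \<sharp> (b \<otimes>\<^bsub>H\<^esub> (d \<otimes>\<^bsub>H\<^esub> h''))"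
    have "mult B (s \<sharp> h) ((s' \<otimes>\<^bsub>S\<^esub> act c s'') \<sharp> (d \<otimes>\<^bsub>H\<^esub> h'')) =
        Hp.sw SH.T (\<lambda>a b. (s \<otimes>\<^bsub>S\<^esub> act a (s' \<otimes>\<^bsub>S\<^esub> act c s'')) \<sharp> (b \<otimes>\<^bsub>H\<^esub> (d \<otimes>\<^bsub>H\<^esub> h''))) h"
      using cd s h by (intro B_mult_pure) auto
    also have "\<dots> = Hp.sw SH.T (\<lambda>a b. Hp.sw SH.T (\<lambda>a1 a2. ?X a1 a2 b) a) h"
    proof (rule Hp.sw_cong)
      show "bilin K H H SH.T
          (\<lambda>a b. (s \<otimes>\<^bsub>S\<^esub> act a (s' \<otimes>\<^bsub>S\<^esub> act c s'')) \<sharp> (b \<otimes>\<^bsub>H\<^esub> (d \<otimes>\<^bsub>H\<^esub> h'')))"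
        using cd s h by (auto intro!: lin_intros)
      fix a b assume ab: "a \<in> carrier H" "b \<in> carrier H"
      have "(s \<otimes>\<^bsub>S\<^esub> act a (s' \<otimes>\<^bsub>S\<^esub> act c s'')) \<sharp> (b \<otimes>\<^bsub>H\<^esub> (d \<otimes>\<^bsub>H\<^esub> h'')) =
          (s \<otimes>\<^bsub>S\<^esub> Hp.sw S (\<lambda>a1 a2. act a1 s' \<otimes>\<^bsub>S\<^esub> act a2 (act c s'')) a) \<sharp> (b \<otimes>\<^bsub>H\<^esub> (d \<otimes>\<^bsub>H\<^esub> h''))"
        using ab cd s h by (simp add: act_prod)
      also have "\<dots> = Hp.sw SH.T (\<lambda>a1 a2. ?X a1 a2 b) a"
        by (rule Hp.sw_comp[of S SH.T _ "\<lambda>y. (s \<otimes>\<^bsub>S\<^esub> y) \<sharp> (b \<otimes>\<^bsub>H\<^esub> (d \<otimes>\<^bsub>H\<^esub> h''))"])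
          (use ab cd s h in \<open>auto intro!: lin_intros\<close>)
      finally show "(s \<otimes>\<^bsub>S\<^esub> act a (s' \<otimes>\<^bsub>S\<^esub> act c s'')) \<sharp> (b \<otimes>\<^bsub>H\<^esub> (d \<otimes>\<^bsub>H\<^esub> h'')) =
        Hp.sw SH.T (\<lambda>a1 a2. ?X a1 a2 b) a" .
    qed (use h in auto)
    also have "\<dots> = Hp.sw SH.T (\<lambda>a b. Hp.sw SH.T (\<lambda>b1 b2. ?X a b1 b2) b) h"
      by (rule Hp.sw_coassoc) (use cd s h in \<open>auto intro!: Hp.trilinI lin_intros\<close>)
    also have "\<dots> = Hp.sw SH.T (\<lambda>a b. Hp.sw SH.T (\<lambda>b1 b2. ?Z a b1 b2 c d) b) h"
    proof (rule Hp.sw_cong)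
      show "bilin K H H SH.T (\<lambda>a b. Hp.sw SH.T (\<lambda>b1 b2. ?X a b1 b2) b)"
        using cd s h by (auto intro!: lin_intros)
      fix a b assume ab: "a \<in> carrier H" "b \<in> carrier H"
      show "Hp.sw SH.T (\<lambda>b1 b2. ?X a b1 b2) b = Hp.sw SH.T (\<lambda>b1 b2. ?Z a b1 b2 c d) b"
      proof (rule Hp.sw_cong)
        show "bilin K H H SH.T (\<lambda>b1 b2. ?X a b1 b2)"
          using ab cd s h by (auto intro!: lin_intros)
      qed (use ab cd s h in \<open>auto simp: SR.m_assoc Hp.HR.m_assoc act_mult\<close>)
    qed (use h in auto)
    finally show "mult B (s \<sharp> h) ((s' \<otimes>\<^bsub>S\<^esub> act c s'') \<sharp> (d \<otimes>\<^bsub>H\<^esub> h'')) =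
      Hp.sw SH.T (\<lambda>a b. Hp.sw SH.T (\<lambda>b1 b2. ?Z a b1 b2 c d) b) h" .
  qed (use h in auto)
  finally show ?thesis using L by simp
qed

lemma B_assoc:
  assumes "X \<in> carrier SH.T" "Y \<in> carrier SH.T" "Z \<in> carrier SH.T"
  shows "mult B (mult B X Y) Z = mult B X (mult B Y Z)"
  using assms(1)
proof (induction rule: SH.T_induct)
  case (pure s h)
  note sh = pure
  show ?case using assms(2)
  proof (induction rule: SH.T_induct)
    case (pure s' h')
    note sh' = pure
    show ?case using assms(3)
    proof (induction rule: SH.T_induct)
      case (pure s'' h'')
      then show ?case using sh sh' by (intro B_assoc_pure)
    qed (use sh sh' in \<open>simp add: B_mult_add\<close>)
  qed (use sh assms in \<open>simp add: B_mult_add\<close>)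
qed (use assms in \<open>simp add: B_mult_add\<close>)

lemma one_pure_mult:
  assumes "s \<in> carrier S" "h \<in> carrier H"
  shows "mult B (\<one>\<^bsub>S\<^esub> \<sharp> \<one>\<^bsub>H\<^esub>) (s \<sharp> h) = s \<sharp> h"
proof -
  have b: "bilin K H H SH.T (\<lambda>h1 h2. (\<one>\<^bsub>S\<^esub> \<otimes>\<^bsub>S\<^esub> act h1 s) \<sharp> (h2 \<otimes>\<^bsub>H\<^esub> h))"
    using assms by (auto intro!: lin_intros)
  show ?thesis
    using assms by (simp add: B_mult_pure Hp.sw_one[OF _ b] act_one)
qed

lemma pure_mult_one:
  assumes "s \<in> carrier S" "h \<in> carrier H" "k \<in> carrier H"
  shows "mult B (s \<sharp> h) (\<one>\<^bsub>S\<^esub> \<sharp> k) = s \<sharp> (h \<otimes>\<^bsub>H\<^esub> k)"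
proof -
  have f: "(\<lambda>x. s \<sharp> (x \<otimes>\<^bsub>H\<^esub> k)) \<in> module_hom K H SH.T"
    using assms by (auto intro!: lin_intros)
  have "mult B (s \<sharp> h) (\<one>\<^bsub>S\<^esub> \<sharp> k) = Hp.sw SH.T (\<lambda>a b. (s \<otimes>\<^bsub>S\<^esub> act a \<one>\<^bsub>S\<^esub>) \<sharp> (b \<otimes>\<^bsub>H\<^esub> k)) h"
    using assms by (intro B_mult_pure) auto
  also have "\<dots> = Hp.sw SH.T (\<lambda>a b. Hp.\<epsilon> a \<odot>\<^bsub>SH.T\<^esub> (s \<sharp> (b \<otimes>\<^bsub>H\<^esub> k))) h"
    by (rule Hp.sw_cong)
      (use assms in \<open>auto intro!: lin_intros simp: act_unit SH.pure_smult_left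
        assoc_algebra.smult_mult_right[OF algebra]\<close>)
  also have "\<dots> = s \<sharp> (h \<otimes>\<^bsub>H\<^esub> k)"
    using assms by (intro Hp.sw_counit_left f) auto
  finally show ?thesis .
qed

text \<open>\<open>smash\<close> agrees with the tensor space in carrier, addition and scalars but
  is a different record, so the axioms are transferred.\<close>

lemma B_vectorspace: "vectorspace K B"
proof -
  interpret T: vectorspace K SH.T by simp
  have "abelian_group B"
  proof (rule abelian_groupI)
    show "\<exists>y\<in>carrier B. y \<oplus>\<^bsub>B\<^esub> x = \<zero>\<^bsub>B\<^esub>" if "x \<in> carrier B" for x
      using that by (intro bexI[of _ "\<ominus>\<^bsub>SH.T\<^esub> x"]) (simp_all add: T.M.l_neg)
  qed (simp_all add: T.M.a_ac)
  then have "Module.module K B"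
    by (rule moduleI[OF vectorspaceD(2)[OF vectorspace_facts'(1)]])
      (simp_all add: T.smult_l_distr T.smult_r_distr T.smult_assoc1)
  then show ?thesis by (intro vectorspace.intro vectorspaceD(1)[OF vectorspace_facts'(1)])
qed

lemma B_ring: "ring B"
proof (rule ringI)
  show "abelian_group B" using vectorspaceD(4)[OF B_vectorspace] .
  show "Group.monoid B"
  proof (rule monoidI)
    fix X assume "X \<in> carrier B"
    then have X: "X \<in> carrier SH.T" by simp
    show "mult B (one B) X = X"
      using X by (induction rule: SH.T_induct) (auto simp: B_mult_add one_pure_mult)
    show "mult B X (one B) = X"
      using X by (induction rule: SH.T_induct) (auto simp: B_mult_add pure_mult_one)
  qed (auto simp: B_assoc)
qed (auto simp: B_mult_add)

lemma B_algebra: "assoc_algebra K B"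
  by (intro assoc_algebra.intro B_vectorspace B_ring) (auto simp: B_mult_smult)

end

section \<open>The Auslander map as an algebra homomorphism, and two ideals attached to it\<close>

section \<open>The Auslander map\<close>

context module_algebra
begin

abbreviation \<phi> where "\<phi> \<equiv> auslander_map K S H act"
abbreviation inv_ring where "inv_ring \<equiv> invariants H S act"
abbreviation Endo where "Endo \<equiv> right_End S inv_ring"

lemma phi_eq: "x \<in> carrier S \<Longrightarrow> \<phi> X x = SH.tl S (\<lambda>s h. s \<otimes>\<^bsub>S\<^esub> act h x) X"
  by (simp add: auslander_map_def)

lemma phi_bilin: "x \<in> carrier S \<Longrightarrow> bilin K S H S (\<lambda>s h. s \<otimes>\<^bsub>S\<^esub> act h x)"
  by (auto intro!: lin_intros)

lemma phi_linear: "x \<in> carrier S \<Longrightarrow> (\<lambda>X. \<phi> X x) \<in> module_hom K SH.T S"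
  unfolding phi_eq by (rule SH.tl_linear[OF _ phi_bilin]) auto

lemmas phi_add = module_hom_add[OF phi_linear]
lemmas phi_smult = module_hom_smult[OF phi_linear]

lemma phi_closed [simp]: "X \<in> carrier SH.T \<Longrightarrow> x \<in> carrier S \<Longrightarrow> \<phi> X x \<in> carrier S"
  using module_hom_mem[OF phi_linear] .

lemma phi_pure [simp]:
  "s \<in> carrier S \<Longrightarrow> h \<in> carrier H \<Longrightarrow> x \<in> carrier S \<Longrightarrow> \<phi> (s \<sharp> h) x = s \<otimes>\<^bsub>S\<^esub> act h x"
  by (simp add: phi_eq SH.tl_pure[OF _ phi_bilin])

lemma phi_additive:
  assumes "X \<in> carrier SH.T" "x \<in> carrier S" "y \<in> carrier S"
  shows "\<phi> X (x \<oplus>\<^bsub>S\<^esub> y) = \<phi> X x \<oplus>\<^bsub>S\<^esub> \<phi> X y"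
  using assms(1)
proof (induction rule: SH.T_induct)
  case (add X Y)
  then show ?case using assms by (simp add: phi_add S.M.add.m_ac)
next
  case (pure s h)
  then show ?case using assms by (simp add: module_hom_add[OF act_linear] SR.r_distr)
qed

text \<open>The second leg of \<open>h\<close> acts on the invariant factor by its counit, and the
  counit axiom then restores \<open>h\<close> in the first leg.\<close>

lemma act_mult_invariant:
  assumes "h \<in> carrier H" "x \<in> carrier S" "r \<in> inv_ring"
  shows "act h (x \<otimes>\<^bsub>S\<^esub> r) = act h x \<otimes>\<^bsub>S\<^esub> r"
proof -
  have r: "r \<in> carrier S" "\<And>h. h \<in> carrier H \<Longrightarrow> act h r = Hp.\<epsilon> h \<odot>\<^bsub>S\<^esub> r"
    using assms(3) by (auto simp: invariants_def)
  have "act h (x \<otimes>\<^bsub>S\<^esub> r) = Hp.sw S (\<lambda>a b. act a x \<otimes>\<^bsub>S\<^esub> act b r) h"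
    using assms r by (intro act_prod) auto
  also have "\<dots> = Hp.sw S (\<lambda>a b. Hp.\<epsilon> b \<odot>\<^bsub>S\<^esub> (act a x \<otimes>\<^bsub>S\<^esub> r)) h"
    by (rule Hp.sw_cong)
      (use assms r in \<open>auto intro!: lin_intros simp: assoc_algebra.smult_mult_right[OF algebra]\<close>)
  also have "\<dots> = act h x \<otimes>\<^bsub>S\<^esub> r"
    by (rule Hp.sw_counit_right[of S "\<lambda>a. act a x \<otimes>\<^bsub>S\<^esub> r"]) (use assms r in \<open>auto intro!: lin_intros\<close>)
  finally show ?thesis .
qed

lemma phi_invariant:
  assumes "X \<in> carrier SH.T" "x \<in> carrier S" "r \<in> inv_ring"
  shows "\<phi> X (x \<otimes>\<^bsub>S\<^esub> r) = \<phi> X x \<otimes>\<^bsub>S\<^esub> r"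
proof -
  have r: "r \<in> carrier S" using assms by (simp add: invariants_def)
  show ?thesis
    using assms(1)
    by (induction rule: SH.T_induct)
      (use assms r in \<open>simp_all add: phi_add SR.l_distr act_mult_invariant SR.m_assoc\<close>)
qed

lemma right_End_carrier:
  "f \<in> carrier Endo \<longleftrightarrow> f \<in> carrier S \<rightarrow>\<^sub>E carrier S \<and>
    (\<forall>x\<in>carrier S. \<forall>y\<in>carrier S. f (x \<oplus>\<^bsub>S\<^esub> y) = f x \<oplus>\<^bsub>S\<^esub> f y) \<and>
    (\<forall>x\<in>carrier S. \<forall>b\<in>inv_ring. f (x \<otimes>\<^bsub>S\<^esub> b) = f x \<otimes>\<^bsub>S\<^esub> b)"
  by (simp add: right_End_def)

lemma phi_End: "X \<in> carrier SH.T \<Longrightarrow> \<phi> X \<in> carrier Endo"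
  unfolding right_End_carrier
  by (auto simp: phi_additive phi_invariant) (auto simp: auslander_map_def)

lemma phi_mult:
  assumes "X \<in> carrier SH.T" "Y \<in> carrier SH.T" "x \<in> carrier S"
  shows "\<phi> (mult B X Y) x = \<phi> X (\<phi> Y x)"
  using assms(1)
proof (induction rule: SH.T_induct)
  case (add X X')
  then show ?case using assms by (simp add: B_mult_add phi_add)
next
  case (pure s h)
  note sh = pure
  show ?case using assms(2)
  proof (induction rule: SH.T_induct)
    case (add Y Y')
    then show ?case using assms sh
      by (simp add: B_mult_add phi_add module_hom_add[OF act_linear] SR.r_distr)
  next
    case (pure s' h')
    note h = sh(2) pure(2)
    have b0: "bilin K H H S (\<lambda>a b. act a s' \<otimes>\<^bsub>S\<^esub> act b (act h' x))"
      using sh pure assms by (auto intro!: lin_intros)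
    have b1: "bilin K H H SH.T (\<lambda>a b. (s \<otimes>\<^bsub>S\<^esub> act a s') \<sharp> (b \<otimes>\<^bsub>H\<^esub> h'))"
      using sh pure assms by (auto intro!: lin_intros)
    have "\<phi> (mult B (s \<sharp> h) (s' \<sharp> h')) x = Hp.sw S (\<lambda>a b. \<phi> ((s \<otimes>\<^bsub>S\<^esub> act a s') \<sharp> (b \<otimes>\<^bsub>H\<^esub> h')) x) h"
      unfolding B_mult_pure[OF sh pure]
      by (rule Hp.sw_comp[OF _ _ b1 phi_linear[OF assms(3)]]) (auto simp: sh)
    also have "\<dots> = Hp.sw S (\<lambda>a b. s \<otimes>\<^bsub>S\<^esub> (act a s' \<otimes>\<^bsub>S\<^esub> act b (act h' x))) h"
    proof (rule Hp.sw_cong)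
      show "bilin K H H S (\<lambda>a b. \<phi> ((s \<otimes>\<^bsub>S\<^esub> act a s') \<sharp> (b \<otimes>\<^bsub>H\<^esub> h')) x)"
        by (intro bilinI lin_comp[OF phi_linear[OF assms(3)]] bilinD[OF b1])
    qed (use sh pure assms in \<open>auto simp: act_mult SR.m_assoc\<close>)
    also have "\<dots> = s \<otimes>\<^bsub>S\<^esub> Hp.sw S (\<lambda>a b. act a s' \<otimes>\<^bsub>S\<^esub> act b (act h' x)) h"
    proof (rule Hp.sw_comp[OF _ _ b0, symmetric])
      show "(\<otimes>\<^bsub>S\<^esub>) s \<in> module_hom K S S" using sh by (auto intro!: lin_intros)
    qed (use sh in auto)
    also have "\<dots> = \<phi> (s \<sharp> h) (\<phi> (s' \<sharp> h') x)"
      using sh pure assms by (simp add: act_prod)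
    finally show ?case .
  qed
qed

lemma phi_one: "\<phi> (one B) = (\<lambda>x\<in>carrier S. x)"
proof
  fix x
  show "\<phi> (one B) x = (\<lambda>x\<in>carrier S. x) x"
    by (cases "x \<in> carrier S") (simp_all add: act_one, simp add: auslander_map_def)
qed

lemma phi_hom: "\<phi> \<in> ring_hom B Endo" "\<phi> \<in> module_hom K B Endo"
proof -
  \<comment> \<open>Endomorphisms are extensional on \<open>carrier S\<close>; equality as functions
    also concerns the value \<open>undefined\<close> outside.\<close>
  have u: "\<phi> X x = undefined" if "x \<notin> carrier S" for X x
    using that by (simp add: auslander_map_def)
  have add: "\<phi> (X \<oplus>\<^bsub>B\<^esub> Y) = \<phi> X \<oplus>\<^bsub>Endo\<^esub> \<phi> Y" if "X \<in> carrier B" "Y \<in> carrier B" for X Y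
    by (rule ext) (use that u in \<open>auto simp: right_End_def phi_add\<close>)
  show "\<phi> \<in> ring_hom B Endo"
  proof (rule ring_hom_memI)
    show "\<phi> (X \<otimes>\<^bsub>B\<^esub> Y) = \<phi> X \<otimes>\<^bsub>Endo\<^esub> \<phi> Y" if "X \<in> carrier B" "Y \<in> carrier B" for X Y
      by (rule ext) (use that u in \<open>auto simp: right_End_def phi_mult compose_def\<close>)
    show "\<phi> \<one>\<^bsub>B\<^esub> = \<one>\<^bsub>Endo\<^esub>" unfolding phi_one by (simp add: right_End_def)
  qed (use phi_End add in auto)
  show "\<phi> \<in> module_hom K B Endo"
  proof (rule module_homI)
    show "\<phi> (c \<odot>\<^bsub>B\<^esub> X) = c \<odot>\<^bsub>Endo\<^esub> \<phi> X" if "c \<in> carrier K" "X \<in> carrier B" for c X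
      by (rule ext) (use that u in \<open>auto simp: right_End_def phi_smult\<close>)
  qed (use phi_End add in auto)
qed

end

locale hopf_action = module_algebra +
  fixes t
  assumes fin_dim_H: "vectorspace.fin_dim K H"
    and integral: "left_integral H t" and nonzero: "t \<noteq> \<zero>\<^bsub>H\<^esub>"
begin

sublocale I: hopf_integral K H t
  by (intro hopf_integral.intro hopf hopf_integral_axioms.intro fin_dim_H integral nonzero)

abbreviation e_t where "e_t \<equiv> \<one>\<^bsub>S\<^esub> \<sharp> t"

lemma act_t_invariant: "x \<in> carrier S \<Longrightarrow> act t x \<in> inv_ring"
  by (auto simp: invariants_def act_mult[symmetric] I.mult_t module_hom_smult[OF act_linear_left])

text \<open>A pure tensor enters both sides only through \<open>s\<close> scaled by the counit of
  \<open>h\<close>: on the left because \<open>t\<close> is an integral, on the right because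
  \<open>h\<close> acts on \<open>1\<close> by its counit.\<close>

lemma mult_e_t:
  assumes "X \<in> carrier SH.T"
  shows "mult B X e_t = \<phi> X \<one>\<^bsub>S\<^esub> \<sharp> t"
  using assms
proof (induction rule: SH.T_induct)
  case (add X Y)
  then show ?case by (simp add: B_mult_add phi_add SH.pure_add_left)
next
  case (pure s h)
  then show ?case
    by (simp add: pure_mult_one I.mult_t act_unit SH.pure_smult_left SH.pure_smult_right
        assoc_algebra.smult_mult_right[OF algebra])
qed

text \<open>Turning the property into an ideal of \<open>B\<close> reduces its proof for all of
  \<open>J\<close> to the single generator \<open>e_t\<close>. The same device is used for
  \<open>absorb\<close>.\<close>

definition ann where
  "ann = {Y \<in> carrier SH.T. \<forall>Z\<in>carrier SH.T.
     (\<forall>x\<in>carrier S. \<phi> Z x = \<zero>\<^bsub>S\<^esub>) \<longrightarrow> mult B Z Y = \<zero>\<^bsub>SH.T\<^esub>}"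

definition absorb where
  "absorb = {Y \<in> carrier SH.T. \<forall>f\<in>carrier Endo. \<exists>Z\<in>carrier SH.T. \<forall>x\<in>carrier S. \<phi> Z x = f (\<phi> Y x)}"

lemma B_idealI:
  assumes sub: "J \<subseteq> carrier SH.T" and ne: "Y0 \<in> J"
    and add: "\<And>X Y. X \<in> J \<Longrightarrow> Y \<in> J \<Longrightarrow> X \<oplus>\<^bsub>SH.T\<^esub> Y \<in> J"
    and left: "\<And>X Y. X \<in> carrier SH.T \<Longrightarrow> Y \<in> J \<Longrightarrow> mult B X Y \<in> J"
    and right: "\<And>X Y. X \<in> carrier SH.T \<Longrightarrow> Y \<in> J \<Longrightarrow> mult B Y X \<in> J"
  shows "ideal J B"
proof -
  interpret B: ring B by (rule B_ring)
  show ?thesis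
  proof (rule idealI[OF B_ring])
    show "subgroup J (add_monoid B)"
    proof (rule B.add.subgroupI)
      show "J \<noteq> {}" using ne by auto
      fix X assume X: "X \<in> J"
      then have XT: "X \<in> carrier B" using sub by auto
      have "\<ominus>\<^bsub>B\<^esub> X = mult B (\<ominus>\<^bsub>B\<^esub> \<one>\<^bsub>B\<^esub>) X"
        using B.l_minus[OF B.one_closed XT] B.l_one[OF XT] by argo
      moreover have "mult B (\<ominus>\<^bsub>B\<^esub> \<one>\<^bsub>B\<^esub>) X \<in> J"
        using B.a_inv_closed[OF B.one_closed] X by (intro left) (simp_all only: B_simps)
      ultimately show "\<ominus>\<^bsub>B\<^esub> X \<in> J" by (simp only:)
    qed (use sub add in auto)
  qed (use left right in auto)
qed

lemma ann_ideal: "ideal ann B"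
proof (rule B_idealI)
  interpret T: vectorspace K SH.T by simp
  show "\<zero>\<^bsub>SH.T\<^esub> \<in> ann"
    using module_hom_zero[OF _ _ B_mult_lin(1)] by (auto simp: ann_def T.M.abelian_group_axioms)
  show "X \<oplus>\<^bsub>SH.T\<^esub> Y \<in> ann" if "X \<in> ann" "Y \<in> ann" for X Y
    using that by (auto simp: ann_def B_mult_add)
  show "mult B X Y \<in> ann" if X: "X \<in> carrier SH.T" and Y: "Y \<in> ann" for X Y
  proof -
    have "mult B Z (mult B X Y) = \<zero>\<^bsub>SH.T\<^esub>"
      if Z: "Z \<in> carrier SH.T" and "\<forall>x\<in>carrier S. \<phi> Z x = \<zero>\<^bsub>S\<^esub>" for Z
    proof -
      \<comment> \<open>The kernel of \<open>\<phi>\<close> is closed under right multiplication, so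
        \<open>X\<close> may be shifted onto \<open>Z\<close>.\<close>
      have "\<forall>x\<in>carrier S. \<phi> (mult B Z X) x = \<zero>\<^bsub>S\<^esub>" using that X by (simp add: phi_mult)
      then have "mult B (mult B Z X) Y = \<zero>\<^bsub>SH.T\<^esub>" using X Y Z by (simp add: ann_def)
      then show ?thesis using X Y Z by (simp add: B_assoc ann_def)
    qed
    then show ?thesis using X Y by (simp add: ann_def)
  qed
  show "mult B Y X \<in> ann" if X: "X \<in> carrier SH.T" and Y: "Y \<in> ann" for X Y
  proof -
    have "mult B Z (mult B Y X) = \<zero>\<^bsub>SH.T\<^esub>"
      if Z: "Z \<in> carrier SH.T" and "\<forall>x\<in>carrier S. \<phi> Z x = \<zero>\<^bsub>S\<^esub>" for Z
    proof -
      have "mult B Z (mult B Y X) = mult B (mult B Z Y) X" using X Y Z by (simp add: B_assoc ann_def)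
      also have "mult B Z Y = \<zero>\<^bsub>SH.T\<^esub>" using that Y by (simp add: ann_def)
      also have "mult B \<zero>\<^bsub>SH.T\<^esub> X = \<zero>\<^bsub>SH.T\<^esub>"
        using module_hom_zero[OF _ _ B_mult_lin(2)[OF X]] by (simp add: T.M.abelian_group_axioms)
      finally show ?thesis .
    qed
    then show ?thesis using X Y by (simp add: ann_def)
  qed
qed (auto simp: ann_def)

lemma e_t_ann: "e_t \<in> ann"
proof -
  have "\<zero>\<^bsub>S\<^esub> \<sharp> t = \<zero>\<^bsub>SH.T\<^esub>"
    using module_hom_zero[OF vectorspaceD(4)[of K S] vectorspaceD(4)[of K SH.T] bilinD(2)[OF SH.pure_bilin I.t_closed]] by simp
  then show ?thesis by (auto simp: ann_def mult_e_t)
qed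

lemma e_t_absorb: "e_t \<in> absorb"
proof -
  have "\<exists>Z\<in>carrier SH.T. \<forall>x\<in>carrier S. \<phi> Z x = f (\<phi> e_t x)" if f: "f \<in> carrier Endo" for f
  proof -
    have f1: "f \<one>\<^bsub>S\<^esub> \<in> carrier S" using f SR.one_closed unfolding right_End_carrier by auto
    have "\<phi> (f \<one>\<^bsub>S\<^esub> \<sharp> t) x = f (\<phi> e_t x)" if x: "x \<in> carrier S" for x
    proof -
      have "f (\<one>\<^bsub>S\<^esub> \<otimes>\<^bsub>S\<^esub> act t x) = f \<one>\<^bsub>S\<^esub> \<otimes>\<^bsub>S\<^esub> act t x"
        using f act_t_invariant[OF x] unfolding right_End_carrier by auto
      then show ?thesis using x f1 by simp
    qed
    then show ?thesis using f1 by (intro bexI[of _ "f \<one>\<^bsub>S\<^esub> \<sharp> t"]) auto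
  qed
  then show ?thesis by (simp add: absorb_def)
qed

lemma absorb_ideal: "ideal absorb B"
proof (rule B_idealI)
  interpret T: vectorspace K SH.T by simp
  have Endo: "f x \<in> carrier S" "f (x \<oplus>\<^bsub>S\<^esub> y) = f x \<oplus>\<^bsub>S\<^esub> f y"
    if "f \<in> carrier Endo" "x \<in> carrier S" "y \<in> carrier S" for f x y
    using that unfolding right_End_carrier by auto
  have "Z \<in> absorb" if "\<And>f. f \<in> carrier Endo \<Longrightarrow> \<exists>Z'\<in>carrier SH.T. \<forall>x\<in>carrier S. \<phi> Z' x = f (\<phi> Z x)"
    "Z \<in> carrier SH.T" for Z
    using that by (simp add: absorb_def)
  note absorbI = this
  have absorbD: "\<exists>Z'\<in>carrier SH.T. \<forall>x\<in>carrier S. \<phi> Z' x = f (\<phi> Z x)" "Z \<in> carrier SH.T"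
    if "Z \<in> absorb" "f \<in> carrier Endo" for Z f
    using that by (simp_all add: absorb_def)
  show "e_t \<in> absorb" by (rule e_t_absorb)
  show "X \<oplus>\<^bsub>SH.T\<^esub> Y \<in> absorb" if X: "X \<in> absorb" and Y: "Y \<in> absorb" for X Y
  proof (rule absorbI)
    fix f assume f: "f \<in> carrier Endo"
    obtain Z where Z: "Z \<in> carrier SH.T" "\<forall>x\<in>carrier S. \<phi> Z x = f (\<phi> X x)"
      using absorbD(1)[OF X f] by auto
    obtain W where W: "W \<in> carrier SH.T" "\<forall>x\<in>carrier S. \<phi> W x = f (\<phi> Y x)"
      using absorbD(1)[OF Y f] by auto
    show "\<exists>Z'\<in>carrier SH.T. \<forall>x\<in>carrier S. \<phi> Z' x = f (\<phi> (X \<oplus>\<^bsub>SH.T\<^esub> Y) x)"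
      using Z W X Y f by (intro bexI[of _ "Z \<oplus>\<^bsub>SH.T\<^esub> W"]) (auto simp: phi_add absorb_def Endo)
  qed (use X Y in \<open>simp add: absorb_def\<close>)
  show "mult B X Y \<in> absorb" if X: "X \<in> carrier SH.T" and Y: "Y \<in> absorb" for X Y
  proof (rule absorbI)
    fix f assume f: "f \<in> carrier Endo"
    have YT: "Y \<in> carrier SH.T" using Y by (simp add: absorb_def)
    \<comment> \<open>Absorption for \<open>X Y\<close> and \<open>f\<close> is absorption for
      \<open>Y\<close> and the endomorphism obtained by applying \<open>\<phi> X\<close> first and
      then \<open>f\<close>.\<close>
    have g: "compose (carrier S) f (\<phi> X) \<in> carrier Endo"
      using f phi_End[OF X] X unfolding right_End_carrier
      by (auto simp: compose_def phi_additive phi_invariant invariants_def)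
    then obtain Z where Z: "Z \<in> carrier SH.T" "\<forall>x\<in>carrier S. \<phi> Z x = compose (carrier S) f (\<phi> X) (\<phi> Y x)"
      using absorbD(1)[OF Y] by auto
    then show "\<exists>Z'\<in>carrier SH.T. \<forall>x\<in>carrier S. \<phi> Z' x = f (\<phi> (mult B X Y) x)"
      using X YT by (intro bexI[of _ Z]) (auto simp: phi_mult compose_def)
  qed (use X Y in \<open>simp add: absorb_def\<close>)
  show "mult B Y X \<in> absorb" if X: "X \<in> carrier SH.T" and Y: "Y \<in> absorb" for X Y
  proof (rule absorbI)
    fix f assume f: "f \<in> carrier Endo"
    have YT: "Y \<in> carrier SH.T" using Y by (simp add: absorb_def)
    obtain Z where "Z \<in> carrier SH.T" "\<forall>x\<in>carrier S. \<phi> Z x = f (\<phi> Y x)"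
      using absorbD(1)[OF Y f] by auto
    then show "\<exists>Z'\<in>carrier SH.T. \<forall>x\<in>carrier S. \<phi> Z' x = f (\<phi> (mult B Y X) x)"
      using X YT by (intro bexI[of _ "mult B Z X"]) (auto simp: phi_mult)
  qed (use X Y in \<open>simp add: absorb_def\<close>)
qed (auto simp: absorb_def)

end

section \<open>The Frobenius form of \<open>S # H\<close> over \<open>S\<close>, and generators as a
  right \<open>S\<close>-module\<close>

context hopf_action
begin

lemma lam_intros [lin_intros]:
  "f \<in> module_hom K P H \<Longrightarrow> (\<lambda>x. I.lam (f x)) \<in> module_hom K P Hp.K1"
  by (rule I.lam_rho_intros(1))

lemma S_smult_intros [lin_intros]:
  "p \<in> module_hom K P Hp.K1 \<Longrightarrow> u \<in> carrier S \<Longrightarrow> (\<lambda>x. p x \<odot>\<^bsub>S\<^esub> u) \<in> module_hom K P S"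
  "g \<in> module_hom K P S \<Longrightarrow> c \<in> carrier K \<Longrightarrow> (\<lambda>x. c \<odot>\<^bsub>S\<^esub> g x) \<in> module_hom K P S"
  by (auto intro!: lin_smult_left lin_smult)

definition \<Lambda> where "\<Lambda> X = SH.tl S (\<lambda>s h. I.lam h \<odot>\<^bsub>S\<^esub> s) X"

lemma Lam_bilin: "bilin K S H S (\<lambda>s h. I.lam h \<odot>\<^bsub>S\<^esub> s)"
  by (auto intro!: lin_intros)

lemma Lam_linear: "\<Lambda> \<in> module_hom K SH.T S"
  unfolding \<Lambda>_def by (rule SH.tl_linear[OF _ Lam_bilin]) simp

lemma Lam_closed [simp]: "X \<in> carrier SH.T \<Longrightarrow> \<Lambda> X \<in> carrier S"
  using module_hom_mem[OF Lam_linear] .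

lemma Lam_pure [simp]: "s \<in> carrier S \<Longrightarrow> h \<in> carrier H \<Longrightarrow> \<Lambda> (s \<sharp> h) = I.lam h \<odot>\<^bsub>S\<^esub> s"
  by (simp add: \<Lambda>_def SH.tl_pure[OF _ Lam_bilin])

lemma Lam_add: "X \<in> carrier SH.T \<Longrightarrow> Y \<in> carrier SH.T \<Longrightarrow> \<Lambda> (X \<oplus>\<^bsub>SH.T\<^esub> Y) = \<Lambda> X \<oplus>\<^bsub>S\<^esub> \<Lambda> Y"
  using module_hom_add[OF Lam_linear] .

text \<open>Right \<open>S\<close>-linearity of \<open>\<Lambda>\<close> is the left integral property of \<open>\<lambda>\<close>.\<close>

lemma Lam_mult_right:
  assumes "X \<in> carrier SH.T" "a \<in> carrier S"
  shows "\<Lambda> (mult B X (a \<sharp> \<one>\<^bsub>H\<^esub>)) = \<Lambda> X \<otimes>\<^bsub>S\<^esub> a"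
  using assms(1)
proof (induction rule: SH.T_induct)
  case (add X Y)
  then show ?case using assms by (simp add: B_mult_add Lam_add SR.l_distr)
next
  case (pure s h)
  note a = assms(2)
  have b1: "bilin K H H SH.T (\<lambda>x y. (s \<otimes>\<^bsub>S\<^esub> act x a) \<sharp> (y \<otimes>\<^bsub>H\<^esub> \<one>\<^bsub>H\<^esub>))"
    using pure a by (auto intro!: lin_intros)
  have b2: "bilin K H H H (\<lambda>x y. I.lam y \<odot>\<^bsub>H\<^esub> x)"
    by (auto intro!: Hp.more_lin_intros lin_intros)
  have F: "(\<lambda>z. s \<otimes>\<^bsub>S\<^esub> act z a) \<in> module_hom K H S"
    using pure a by (auto intro!: lin_intros)
  have "\<Lambda> (mult B (s \<sharp> h) (a \<sharp> \<one>\<^bsub>H\<^esub>)) =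
      Hp.sw S (\<lambda>x y. \<Lambda> ((s \<otimes>\<^bsub>S\<^esub> act x a) \<sharp> (y \<otimes>\<^bsub>H\<^esub> \<one>\<^bsub>H\<^esub>))) h"
    unfolding B_mult_pure[OF pure a Hp.HR.one_closed]
    by (rule Hp.sw_comp[OF _ _ b1 Lam_linear]) (auto simp: pure)
  also have "\<dots> = Hp.sw S (\<lambda>x y. s \<otimes>\<^bsub>S\<^esub> act (I.lam y \<odot>\<^bsub>H\<^esub> x) a) h"
  proof (rule Hp.sw_cong)
    show "bilin K H H S (\<lambda>x y. \<Lambda> ((s \<otimes>\<^bsub>S\<^esub> act x a) \<sharp> (y \<otimes>\<^bsub>H\<^esub> \<one>\<^bsub>H\<^esub>)))"
      by (intro bilinI lin_comp[OF Lam_linear] bilinD[OF b1])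
  qed (use pure a in \<open>auto simp: module_hom_smult[OF act_linear_left]
      assoc_algebra.smult_mult_right[OF algebra]\<close>)
  also have "\<dots> = s \<otimes>\<^bsub>S\<^esub> act (Hp.sw H (\<lambda>x y. I.lam y \<odot>\<^bsub>H\<^esub> x) h) a"
    by (rule Hp.sw_comp[OF _ _ b2 F, symmetric]) (auto simp: pure)
  also have "\<dots> = \<Lambda> (s \<sharp> h) \<otimes>\<^bsub>S\<^esub> a"
    using pure a by (simp add: I.lam_integral module_hom_smult[OF act_linear_left] act_one
        assoc_algebra.smult_mult_right[OF algebra] assoc_algebra.smult_mult_left[OF algebra])
  finally show ?case .
qed

text \<open>Bundles the conclusions of \<open>frobenius_form\<close>, so that one choice of dual
  bases can be fixed by a single hypothesis.\<close>

definition frob_basis where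
  "frob_basis E hh \<longleftrightarrow> finite E \<and> E \<subseteq> carrier H \<and> (\<forall>e\<in>E. hh e \<in> carrier H) \<and>
    (\<forall>k\<in>carrier H. k = (\<Oplus>\<^bsub>H\<^esub>e\<in>E. I.lam (k \<otimes>\<^bsub>H\<^esub> hh e) \<odot>\<^bsub>H\<^esub> e)) \<and>
    (\<forall>k\<in>carrier H. k = (\<Oplus>\<^bsub>H\<^esub>e\<in>E. I.lam (e \<otimes>\<^bsub>H\<^esub> k) \<odot>\<^bsub>H\<^esub> hh e)) \<and>
    (\<forall>e\<in>E. \<forall>e'\<in>E. I.lam (e \<otimes>\<^bsub>H\<^esub> hh e') = (if e = e' then \<one> else \<zero>))"

lemma frob_basis_exists: "\<exists>E hh. frob_basis E hh"
proof (rule I.frobenius_form)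
  fix E hh
  assume a: "finite E" "E \<subseteq> carrier H" "\<And>e. e \<in> E \<Longrightarrow> hh e \<in> carrier H"
    "\<And>k. k \<in> carrier H \<Longrightarrow> k = (\<Oplus>\<^bsub>H\<^esub>e\<in>E. I.lam (k \<otimes>\<^bsub>H\<^esub> hh e) \<odot>\<^bsub>H\<^esub> e)"
    "\<And>k. k \<in> carrier H \<Longrightarrow> k = (\<Oplus>\<^bsub>H\<^esub>e\<in>E. I.lam (e \<otimes>\<^bsub>H\<^esub> k) \<odot>\<^bsub>H\<^esub> hh e)"
    "\<And>e e'. e \<in> E \<Longrightarrow> e' \<in> E \<Longrightarrow> I.lam (e \<otimes>\<^bsub>H\<^esub> hh e') = (if e = e' then \<one> else \<zero>)"
  have "frob_basis E hh"
    unfolding frob_basis_def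
    by (intro conjI ballI) (rule a; assumption)+
  then show "\<exists>E hh. frob_basis E hh" by blast
qed

context
  fixes E hh
  assumes frob: "frob_basis E hh"
begin

lemma fE: "finite E" and EH: "E \<subseteq> carrier H" and hdH: "\<And>e. e \<in> E \<Longrightarrow> hh e \<in> carrier H"
  and fr1: "\<And>k. k \<in> carrier H \<Longrightarrow> k = (\<Oplus>\<^bsub>H\<^esub>e\<in>E. I.lam (k \<otimes>\<^bsub>H\<^esub> hh e) \<odot>\<^bsub>H\<^esub> e)"
  and fr2: "\<And>k. k \<in> carrier H \<Longrightarrow> k = (\<Oplus>\<^bsub>H\<^esub>e\<in>E. I.lam (e \<otimes>\<^bsub>H\<^esub> k) \<odot>\<^bsub>H\<^esub> hh e)"
  and fr3: "\<And>e e'. e \<in> E \<Longrightarrow> e' \<in> E \<Longrightarrow> I.lam (e \<otimes>\<^bsub>H\<^esub> hh e') = (if e = e' then \<one> else \<zero>)"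
  using frob unfolding frob_basis_def by blast+

lemma EH': "e \<in> E \<Longrightarrow> e \<in> carrier H" using EH by auto

text \<open>On a pure tensor this is the first expansion of the Frobenius form applied to
  \<open>h\<close>, because multiplication by \<open>1 # k\<close> from the right only affects the
  \<open>H\<close> factor.\<close>

lemma expand_Lam:
  assumes "X \<in> carrier SH.T"
  shows "X = (\<Oplus>\<^bsub>SH.T\<^esub>e\<in>E. \<Lambda> (mult B X (\<one>\<^bsub>S\<^esub> \<sharp> hh e)) \<sharp> e)"
  using assms
proof (induction rule: SH.T_induct)
  interpret T: vectorspace K SH.T by simp
  case (add X Y)
  have "X \<oplus>\<^bsub>SH.T\<^esub> Y = (\<Oplus>\<^bsub>SH.T\<^esub>e\<in>E. \<Lambda> (mult B X (\<one>\<^bsub>S\<^esub> \<sharp> hh e)) \<sharp> e) \<oplus>\<^bsub>SH.T\<^esub>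
      (\<Oplus>\<^bsub>SH.T\<^esub>e\<in>E. \<Lambda> (mult B Y (\<one>\<^bsub>S\<^esub> \<sharp> hh e)) \<sharp> e)"
    using add(3,4) by (rule arg_cong2)
  also have "\<dots> = (\<Oplus>\<^bsub>SH.T\<^esub>e\<in>E. \<Lambda> (mult B X (\<one>\<^bsub>S\<^esub> \<sharp> hh e)) \<sharp> e \<oplus>\<^bsub>SH.T\<^esub> \<Lambda> (mult B Y (\<one>\<^bsub>S\<^esub> \<sharp> hh e)) \<sharp> e)"
    using add(1,2) hdH EH' by (intro T.M.finsum_addf[symmetric]) auto
  also have "\<dots> = (\<Oplus>\<^bsub>SH.T\<^esub>e\<in>E. \<Lambda> (mult B (X \<oplus>\<^bsub>SH.T\<^esub> Y) (\<one>\<^bsub>S\<^esub> \<sharp> hh e)) \<sharp> e)"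
    using add(1,2) hdH EH'
    by (intro T.M.finsum_cong') (auto simp: B_mult_add Lam_add SH.pure_add_left)
  finally show ?case .
next
  interpret T: vectorspace K SH.T by simp
  case (pure s h)
  have f: "(\<lambda>k. s \<sharp> k) \<in> module_hom K H SH.T" using pure by (auto intro!: lin_intros)
  have "s \<sharp> h = s \<sharp> (\<Oplus>\<^bsub>H\<^esub>e\<in>E. I.lam (h \<otimes>\<^bsub>H\<^esub> hh e) \<odot>\<^bsub>H\<^esub> e)"
    using fr1[OF pure(2)] by (rule arg_cong)
  also have "\<dots> = (\<Oplus>\<^bsub>SH.T\<^esub>e\<in>E. s \<sharp> (I.lam (h \<otimes>\<^bsub>H\<^esub> hh e) \<odot>\<^bsub>H\<^esub> e))"
    using pure hdH EH' by (intro module_hom_finsum[OF _ _ f] vectorspaceD(4)[of K]) auto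
  also have "\<dots> = (\<Oplus>\<^bsub>SH.T\<^esub>e\<in>E. \<Lambda> (mult B (s \<sharp> h) (\<one>\<^bsub>S\<^esub> \<sharp> hh e)) \<sharp> e)"
    using pure hdH EH'
    by (intro T.M.finsum_cong') (auto simp: pure_mult_one SH.pure_smult_left SH.pure_smult_right)
  finally show ?case .
qed

lemma Lam_nondegenerate:
  assumes X: "X \<in> carrier SH.T" and "\<And>e. e \<in> E \<Longrightarrow> \<Lambda> (mult B X (\<one>\<^bsub>S\<^esub> \<sharp> hh e)) = \<zero>\<^bsub>S\<^esub>"
  shows "X = \<zero>\<^bsub>SH.T\<^esub>"
proof -
  interpret T: vectorspace K SH.T by simp
  have z: "\<zero>\<^bsub>S\<^esub> \<sharp> e = \<zero>\<^bsub>SH.T\<^esub>" if "e \<in> E" for e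
    using module_hom_zero[OF vectorspaceD(4)[of K S] vectorspaceD(4)[of K SH.T] bilinD(2)[OF SH.pure_bilin EH'[OF that]]] by simp
  have "(\<Oplus>\<^bsub>SH.T\<^esub>e\<in>E. \<Lambda> (mult B X (\<one>\<^bsub>S\<^esub> \<sharp> hh e)) \<sharp> e) = \<zero>\<^bsub>SH.T\<^esub>"
    by (rule T.M.add.finprod_one_eqI) (simp add: assms(2) z)
  then show ?thesis using expand_Lam[OF X] by argo
qed

text \<open>Biorthogonality of \<open>E\<close> and \<open>hh\<close> lets the values be prescribed.
  This is what represents a right linear map from \<open>B\<close> to \<open>S\<close> by an element
  of \<open>B\<close>: its values on the generators \<open>1 # hh e\<close> are taken as the
  coefficients \<open>g e\<close>.\<close>

lemma Lam_prescribed: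
  assumes g: "\<And>e. e \<in> E \<Longrightarrow> g e \<in> carrier S"
  defines "b \<equiv> (\<Oplus>\<^bsub>SH.T\<^esub>e\<in>E. g e \<sharp> e)"
  shows "b \<in> carrier SH.T"
    and "\<And>e. e \<in> E \<Longrightarrow> \<Lambda> (mult B b (\<one>\<^bsub>S\<^esub> \<sharp> hh e)) = g e"
proof -
  interpret T: vectorspace K SH.T by simp
  have cl: "(\<lambda>e. g e \<sharp> e) \<in> E \<rightarrow> carrier SH.T" using g EH' by auto
  then show "b \<in> carrier SH.T" unfolding b_def by (rule T.M.finsum_closed)
  fix e assume e: "e \<in> E"
  let ?f = "\<lambda>X. \<Lambda> (mult B X (\<one>\<^bsub>S\<^esub> \<sharp> hh e))"
  have f: "?f \<in> module_hom K SH.T S"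
    by (intro lin_comp[OF Lam_linear] B_mult_lin(2)) (simp add: hdH e)
  have "?f b = (\<Oplus>\<^bsub>S\<^esub>e'\<in>E. ?f (g e' \<sharp> e'))"
    unfolding b_def by (rule module_hom_finsum[OF _ _ f cl]) (auto intro: vectorspaceD(4)[of K])
  also have "\<dots> = (\<Oplus>\<^bsub>S\<^esub>e'\<in>E. if e = e' then g e' else \<zero>\<^bsub>S\<^esub>)"
    using g EH' hdH e by (intro S.M.finsum_cong') (auto simp: pure_mult_one fr3)
  also have "\<dots> = g e"
    using S.M.add.finprod_singleton[OF e fE, of g] g by (simp add: Pi_def)
  finally show "?f b = g e" .
qed

text \<open>The map from \<open>S^E\<close> to \<open>B\<close> whose coordinates stand on the
  right; it presents \<open>B\<close> as a right \<open>S\<close>-module with generators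
  \<open>1 # hh e\<close>.\<close>

definition \<Psi> where "\<Psi> x = (\<Oplus>\<^bsub>SH.T\<^esub>e\<in>E. mult B (\<one>\<^bsub>S\<^esub> \<sharp> hh e) (x e \<sharp> \<one>\<^bsub>H\<^esub>))"

lemma psi_summand: "x \<in> E \<rightarrow> carrier S \<Longrightarrow> (\<lambda>e. mult B (\<one>\<^bsub>S\<^esub> \<sharp> hh e) (x e \<sharp> \<one>\<^bsub>H\<^esub>)) \<in> E \<rightarrow> carrier SH.T"
  using hdH by (simp add: Pi_iff)

lemma psi_closed [simp]: "x \<in> E \<rightarrow> carrier S \<Longrightarrow> \<Psi> x \<in> carrier SH.T"
  unfolding \<Psi>_def
  by (rule abelian_monoid.finsum_closed[OF vectorspaceD(5)[OF vectorspace_facts'(2)] psi_summand])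

lemma psi_add:
  assumes "x \<in> E \<rightarrow> carrier S" "y \<in> E \<rightarrow> carrier S"
  shows "\<Psi> (\<lambda>e. x e \<oplus>\<^bsub>S\<^esub> y e) = \<Psi> x \<oplus>\<^bsub>SH.T\<^esub> \<Psi> y"
proof -
  interpret T: vectorspace K SH.T by simp
  have "\<Psi> x \<oplus>\<^bsub>SH.T\<^esub> \<Psi> y = (\<Oplus>\<^bsub>SH.T\<^esub>e\<in>E. mult B (\<one>\<^bsub>S\<^esub> \<sharp> hh e) (x e \<sharp> \<one>\<^bsub>H\<^esub>) \<oplus>\<^bsub>SH.T\<^esub>
      mult B (\<one>\<^bsub>S\<^esub> \<sharp> hh e) (y e \<sharp> \<one>\<^bsub>H\<^esub>))"
    unfolding \<Psi>_def by (rule T.M.finsum_addf[symmetric]) (use assms psi_summand in auto)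
  also have "\<dots> = \<Psi> (\<lambda>e. x e \<oplus>\<^bsub>S\<^esub> y e)"
    unfolding \<Psi>_def using assms hdH
    by (intro T.M.finsum_cong') (auto simp: B_mult_add[symmetric] SH.pure_add_left Pi_def)
  finally show ?thesis by simp
qed

lemma mult_pure_one:
  assumes "s \<in> carrier S" "s' \<in> carrier S"
  shows "mult B (s \<sharp> \<one>\<^bsub>H\<^esub>) (s' \<sharp> \<one>\<^bsub>H\<^esub>) = (s \<otimes>\<^bsub>S\<^esub> s') \<sharp> \<one>\<^bsub>H\<^esub>"
proof -
  have b: "bilin K H H SH.T (\<lambda>h1 h2. (s \<otimes>\<^bsub>S\<^esub> act h1 s') \<sharp> (h2 \<otimes>\<^bsub>H\<^esub> \<one>\<^bsub>H\<^esub>))"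
    using assms by (auto intro!: lin_intros)
  show ?thesis using assms by (simp add: B_mult_pure Hp.sw_one[OF _ b] act_one)
qed

lemma psi_mult_right:
  assumes "x \<in> E \<rightarrow> carrier S" "a \<in> carrier S"
  shows "\<Psi> (\<lambda>e. x e \<otimes>\<^bsub>S\<^esub> a) = mult B (\<Psi> x) (a \<sharp> \<one>\<^bsub>H\<^esub>)"
proof -
  interpret T: vectorspace K SH.T by simp
  have r: "(\<lambda>X. mult B X (a \<sharp> \<one>\<^bsub>H\<^esub>)) \<in> module_hom K SH.T SH.T"
    by (rule B_mult_lin(2)) (simp add: assms)
  have "mult B (\<Psi> x) (a \<sharp> \<one>\<^bsub>H\<^esub>) =
      (\<Oplus>\<^bsub>SH.T\<^esub>e\<in>E. mult B (mult B (\<one>\<^bsub>S\<^esub> \<sharp> hh e) (x e \<sharp> \<one>\<^bsub>H\<^esub>)) (a \<sharp> \<one>\<^bsub>H\<^esub>))"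
    unfolding \<Psi>_def by (rule module_hom_finsum[OF _ _ r psi_summand[OF assms(1)]])
      (auto intro: T.M.abelian_group_axioms)
  also have "\<dots> = \<Psi> (\<lambda>e. x e \<otimes>\<^bsub>S\<^esub> a)"
    unfolding \<Psi>_def using assms hdH
    by (intro T.M.finsum_cong') (auto simp: B_assoc mult_pure_one Pi_def)
  finally show ?thesis by simp
qed

text \<open>Moves \<open>s\<close> to the other side of \<open>h\<close>. After multiplying out and
  regrouping by coassociativity, two neighbouring legs act on \<open>s\<close> through the
  combination that \<open>antipode_inv\<close> contracts to the counit.\<close>

lemma pure_right_decomposition:
  assumes s: "s \<in> carrier S" and h: "h \<in> carrier H"
  shows "s \<sharp> h = Hp.sw SH.T (\<lambda>a b. mult B (\<one>\<^bsub>S\<^esub> \<sharp> b) (act (I.antipode_inv a) s \<sharp> \<one>\<^bsub>H\<^esub>)) h"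
proof -
  note [lin_intros] = I.antipode_inv_intro
  have cp: "mult B (\<one>\<^bsub>S\<^esub> \<sharp> b) (y \<sharp> \<one>\<^bsub>H\<^esub>) = Hp.sw SH.T (\<lambda>b1 b2. act b1 y \<sharp> b2) b"
    if "b \<in> carrier H" "y \<in> carrier S" for b y
  proof -
    have "mult B (\<one>\<^bsub>S\<^esub> \<sharp> b) (y \<sharp> \<one>\<^bsub>H\<^esub>) = Hp.sw SH.T (\<lambda>b1 b2. (\<one>\<^bsub>S\<^esub> \<otimes>\<^bsub>S\<^esub> act b1 y) \<sharp> (b2 \<otimes>\<^bsub>H\<^esub> \<one>\<^bsub>H\<^esub>)) b"
      using that by (intro B_mult_pure) auto
    also have "\<dots> = Hp.sw SH.T (\<lambda>b1 b2. act b1 y \<sharp> b2) b"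
    proof (rule Hp.sw_cong)
      show "bilin K H H SH.T (\<lambda>b1 b2. (\<one>\<^bsub>S\<^esub> \<otimes>\<^bsub>S\<^esub> act b1 y) \<sharp> (b2 \<otimes>\<^bsub>H\<^esub> \<one>\<^bsub>H\<^esub>))"
        using that by (auto intro!: lin_intros)
    qed (use that in auto)
    finally show ?thesis .
  qed
  have b3: "bilin K H H SH.T (\<lambda>a b. Hp.sw SH.T (\<lambda>b1 b2. act b1 (act (I.antipode_inv a) s) \<sharp> b2) b)"
    using s by (auto intro!: lin_intros)
  have "Hp.sw SH.T (\<lambda>a b. mult B (\<one>\<^bsub>S\<^esub> \<sharp> b) (act (I.antipode_inv a) s \<sharp> \<one>\<^bsub>H\<^esub>)) h =
      Hp.sw SH.T (\<lambda>a b. Hp.sw SH.T (\<lambda>b1 b2. act b1 (act (I.antipode_inv a) s) \<sharp> b2) b) h"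
    by (rule Hp.sw_cong[OF _ b3 h, symmetric]) (use s in \<open>simp_all add: cp\<close>)
  also have "\<dots> = Hp.sw SH.T (\<lambda>a b. Hp.sw SH.T (\<lambda>a1 a2. act a2 (act (I.antipode_inv a1) s) \<sharp> b) a) h"
    by (rule Hp.sw_coassoc[symmetric, OF _ _ h]) (use s in \<open>auto intro!: Hp.trilinI lin_intros\<close>)
  also have "\<dots> = Hp.sw SH.T (\<lambda>a b. Hp.\<epsilon> a \<odot>\<^bsub>SH.T\<^esub> (s \<sharp> b)) h"
  proof (rule Hp.sw_cong[OF _ _ h])
    show "bilin K H H SH.T (\<lambda>a b. Hp.sw SH.T (\<lambda>a1 a2. act a2 (act (I.antipode_inv a1) s) \<sharp> b) a)"
      using s by (auto intro!: lin_intros)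
    fix a b assume ab: "a \<in> carrier H" "b \<in> carrier H"
    have b0: "bilin K H H H (\<lambda>a b. b \<otimes>\<^bsub>H\<^esub> I.antipode_inv a)"
      by (auto intro!: Hp.mult_lin lin_intros)
    have F: "(\<lambda>z. act z s \<sharp> b) \<in> module_hom K H SH.T"
      using s ab by (auto intro!: lin_intros)
    have "Hp.sw SH.T (\<lambda>a1 a2. act a2 (act (I.antipode_inv a1) s) \<sharp> b) a =
        Hp.sw SH.T (\<lambda>a1 a2. act (a2 \<otimes>\<^bsub>H\<^esub> I.antipode_inv a1) s \<sharp> b) a"
    proof (rule Hp.sw_cong)
      show "bilin K H H SH.T (\<lambda>a1 a2. act a2 (act (I.antipode_inv a1) s) \<sharp> b)"
        using s ab by (auto intro!: lin_intros)
    qed (use s ab in \<open>auto simp: act_mult\<close>)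
    also have "\<dots> = act (Hp.sw H (\<lambda>a1 a2. a2 \<otimes>\<^bsub>H\<^esub> I.antipode_inv a1) a) s \<sharp> b"
      by (rule Hp.sw_comp[OF _ _ b0 F ab(1), symmetric]) simp_all
    also have "\<dots> = Hp.\<epsilon> a \<odot>\<^bsub>SH.T\<^esub> (s \<sharp> b)"
      using s ab by (simp add: I.antipode_inv module_hom_smult[OF act_linear_left] act_one SH.pure_smult_left)
    finally show "Hp.sw SH.T (\<lambda>a1 a2. act a2 (act (I.antipode_inv a1) s) \<sharp> b) a =
      Hp.\<epsilon> a \<odot>\<^bsub>SH.T\<^esub> (s \<sharp> b)" .
  qed simp
  also have "\<dots> = s \<sharp> h"
    by (rule Hp.sw_counit_left[OF _ _ h]) (use s in \<open>auto intro!: lin_intros\<close>)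
  finally show ?thesis by simp
qed

lemma B_mult_intros:
  "f \<in> module_hom K P SH.T \<Longrightarrow> Y \<in> carrier SH.T \<Longrightarrow> (\<lambda>x. mult B (f x) Y) \<in> module_hom K P SH.T"
  "f \<in> module_hom K P SH.T \<Longrightarrow> Y \<in> carrier SH.T \<Longrightarrow> (\<lambda>x. mult B Y (f x)) \<in> module_hom K P SH.T"
  by (rule lin_comp[OF B_mult_lin(2)] lin_comp[OF B_mult_lin(1)]; assumption)+

text \<open>For a pure tensor, the leg \<open>b\<close> in the decomposition with \<open>s\<close>
  on the right is expanded in the elements \<open>hh e\<close>. The sum over the coproduct of
  \<open>h\<close> then collects their coefficients into the coordinates \<open>x e\<close>.\<close>

lemma psi_surj:
  assumes "X \<in> carrier SH.T"
  shows "\<exists>x\<in>E \<rightarrow> carrier S. X = \<Psi> x"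
  using assms
proof (induction rule: SH.T_induct)
  case (add X Y)
  then obtain x y where xy: "x \<in> E \<rightarrow> carrier S" "X = \<Psi> x" "y \<in> E \<rightarrow> carrier S" "Y = \<Psi> y" by auto
  then show ?case
    using psi_add[OF xy(1,3)] by (intro bexI[of _ "\<lambda>e. x e \<oplus>\<^bsub>S\<^esub> y e"]) (auto simp: Pi_def)
next
  case (pure s h)
  interpret T: vectorspace K SH.T by simp
  note [lin_intros] = I.antipode_inv_intro Hp.mult_lin
  define y where "y e a b = I.lam (e \<otimes>\<^bsub>H\<^esub> b) \<odot>\<^bsub>S\<^esub> act (I.antipode_inv a) s" for e a b
  have y: "bilin K H H S (y e)" if "e \<in> E" for e
    unfolding y_def using pure EH'[OF that] by (auto intro!: lin_intros)
  define x where "x e = Hp.sw S (y e) h" for e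
  have xS: "x \<in> E \<rightarrow> carrier S" unfolding x_def using y pure by auto
  have F: "(\<lambda>z. mult B (\<one>\<^bsub>S\<^esub> \<sharp> hh e) (z \<sharp> \<one>\<^bsub>H\<^esub>)) \<in> module_hom K S SH.T" if "e \<in> E" for e
    using hdH[OF that] by (intro lin_comp[OF B_mult_lin(1)] pr_intros lin_id) auto
  have "s \<sharp> h = Hp.sw SH.T (\<lambda>a b. mult B (\<one>\<^bsub>S\<^esub> \<sharp> b) (act (I.antipode_inv a) s \<sharp> \<one>\<^bsub>H\<^esub>)) h"
    by (rule pure_right_decomposition[OF pure])
  also have "\<dots> = Hp.sw SH.T (\<lambda>a b. \<Oplus>\<^bsub>SH.T\<^esub>e\<in>E. mult B (\<one>\<^bsub>S\<^esub> \<sharp> hh e) (y e a b \<sharp> \<one>\<^bsub>H\<^esub>)) h"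
  proof (rule Hp.sw_cong)
    show "bilin K H H SH.T (\<lambda>a b. mult B (\<one>\<^bsub>S\<^esub> \<sharp> b) (act (I.antipode_inv a) s \<sharp> \<one>\<^bsub>H\<^esub>))"
      using pure by (intro bilinI B_mult_intros pr_intros act_intros I.antipode_inv_intro lin_id) auto
    fix a b assume ab: "a \<in> carrier H" "b \<in> carrier H"
    let ?s = "act (I.antipode_inv a) s"
    have G: "(\<lambda>k. mult B (\<one>\<^bsub>S\<^esub> \<sharp> k) (?s \<sharp> \<one>\<^bsub>H\<^esub>)) \<in> module_hom K H SH.T"
      using ab pure by (intro B_mult_intros pr_intros lin_id) auto
    have "mult B (\<one>\<^bsub>S\<^esub> \<sharp> b) (?s \<sharp> \<one>\<^bsub>H\<^esub>) =
        mult B (\<one>\<^bsub>S\<^esub> \<sharp> (\<Oplus>\<^bsub>H\<^esub>e\<in>E. I.lam (e \<otimes>\<^bsub>H\<^esub> b) \<odot>\<^bsub>H\<^esub> hh e)) (?s \<sharp> \<one>\<^bsub>H\<^esub>)"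
      using fr2[OF ab(2)] by (rule arg_cong)
    also have "\<dots> = (\<Oplus>\<^bsub>SH.T\<^esub>e\<in>E. mult B (\<one>\<^bsub>S\<^esub> \<sharp> (I.lam (e \<otimes>\<^bsub>H\<^esub> b) \<odot>\<^bsub>H\<^esub> hh e)) (?s \<sharp> \<one>\<^bsub>H\<^esub>))"
      using ab hdH EH' by (intro module_hom_finsum[OF _ _ G] vectorspaceD(4)[of K]) auto
    also have "\<dots> = (\<Oplus>\<^bsub>SH.T\<^esub>e\<in>E. mult B (\<one>\<^bsub>S\<^esub> \<sharp> hh e) (y e a b \<sharp> \<one>\<^bsub>H\<^esub>))"
      using ab hdH EH' pure unfolding y_def
      by (intro T.M.finsum_cong') (auto simp: SH.pure_smult_left SH.pure_smult_right B_mult_smult)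
    finally show "mult B (\<one>\<^bsub>S\<^esub> \<sharp> b) (?s \<sharp> \<one>\<^bsub>H\<^esub>) =
      (\<Oplus>\<^bsub>SH.T\<^esub>e\<in>E. mult B (\<one>\<^bsub>S\<^esub> \<sharp> hh e) (y e a b \<sharp> \<one>\<^bsub>H\<^esub>))" .
  qed (use pure in auto)
  also have "\<dots> = (\<Oplus>\<^bsub>SH.T\<^esub>e\<in>E. Hp.sw SH.T (\<lambda>a b. mult B (\<one>\<^bsub>S\<^esub> \<sharp> hh e) (y e a b \<sharp> \<one>\<^bsub>H\<^esub>)) h)"
  proof (rule Hp.sw_finsum)
    show "bilin K H H SH.T (\<lambda>a b. mult B (\<one>\<^bsub>S\<^esub> \<sharp> hh e) (y e a b \<sharp> \<one>\<^bsub>H\<^esub>))" if "e \<in> E" for e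
      by (intro bilinI lin_comp[OF F[OF that]] bilinD[OF y[OF that]])
  qed (use pure in auto)
  also have "\<dots> = \<Psi> x"
    unfolding \<Psi>_def x_def
  proof (intro T.M.finsum_cong' refl)
    fix e assume e: "e \<in> E"
    show "Hp.sw SH.T (\<lambda>a b. mult B (\<one>\<^bsub>S\<^esub> \<sharp> hh e) (y e a b \<sharp> \<one>\<^bsub>H\<^esub>)) h =
        mult B (\<one>\<^bsub>S\<^esub> \<sharp> hh e) (Hp.sw S (y e) h \<sharp> \<one>\<^bsub>H\<^esub>)"
      by (rule Hp.sw_comp[OF _ _ y[OF e] F[OF e] pure(2), symmetric]) simp_all
  qed (use psi_summand[OF xS] in \<open>simp add: x_def\<close>)
  finally show ?case using xS by blast
qed

end

end

section \<open>Left modules, submodules, images and kernels\<close>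

section \<open>Modules over noncommutative rings\<close>

context left_module
begin

sublocale M: abelian_group M by (rule abelian_group)
sublocale R: ring R by (rule ring)

lemma smult_r_zero [simp]: "a \<in> carrier R \<Longrightarrow> a \<odot>\<^bsub>M\<^esub> \<zero>\<^bsub>M\<^esub> = \<zero>\<^bsub>M\<^esub>"
  using additive_zero[OF M.abelian_group_axioms M.abelian_group_axioms, of "\<lambda>x. a \<odot>\<^bsub>M\<^esub> x"]
    smult_closed smult_r_distr by simp

lemma smult_l_zero [simp]: "x \<in> carrier M \<Longrightarrow> \<zero>\<^bsub>R\<^esub> \<odot>\<^bsub>M\<^esub> x = \<zero>\<^bsub>M\<^esub>"
  using additive_zero[OF R.abelian_group_axioms M.abelian_group_axioms, of "\<lambda>a. a \<odot>\<^bsub>M\<^esub> x"]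
    smult_closed smult_l_distr by simp

lemma smult_minus_one: "x \<in> carrier M \<Longrightarrow> (\<ominus>\<^bsub>R\<^esub> \<one>\<^bsub>R\<^esub>) \<odot>\<^bsub>M\<^esub> x = \<ominus>\<^bsub>M\<^esub> x"
  using additive_uminus[OF R.abelian_group_axioms M.abelian_group_axioms, of "\<lambda>a. a \<odot>\<^bsub>M\<^esub> x" "\<one>\<^bsub>R\<^esub>"]
    smult_closed smult_l_distr smult_one by simp

lemma smult_diff:
  "a \<in> carrier R \<Longrightarrow> x \<in> carrier M \<Longrightarrow> y \<in> carrier M \<Longrightarrow>
    a \<odot>\<^bsub>M\<^esub> (x \<ominus>\<^bsub>M\<^esub> y) = a \<odot>\<^bsub>M\<^esub> x \<ominus>\<^bsub>M\<^esub> a \<odot>\<^bsub>M\<^esub> y"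
  using additive_uminus[OF M.abelian_group_axioms M.abelian_group_axioms, of "\<lambda>x. a \<odot>\<^bsub>M\<^esub> x" y]
    smult_closed smult_r_distr by (simp add: a_minus_def)

text \<open>Closure under negation follows from the action of minus one.\<close>

lemma submodule_intro:
  assumes "N \<subseteq> carrier M" "\<zero>\<^bsub>M\<^esub> \<in> N" "\<And>x y. x \<in> N \<Longrightarrow> y \<in> N \<Longrightarrow> x \<oplus>\<^bsub>M\<^esub> y \<in> N"
    "\<And>a x. a \<in> carrier R \<Longrightarrow> x \<in> N \<Longrightarrow> a \<odot>\<^bsub>M\<^esub> x \<in> N"
  shows "Module.submodule N R M"
proof -
  have "\<ominus>\<^bsub>M\<^esub> x \<in> N" if "x \<in> N" for x
    using assms(4)[of "\<ominus>\<^bsub>R\<^esub> \<one>\<^bsub>R\<^esub>" x] that assms(1) smult_minus_one[of x] by auto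
  then show ?thesis
    using assms
    by (intro Module.submodule.intro Module.submodule_axioms.intro M.add.subgroupI)
      (auto simp: a_inv_def)
qed

lemma submodule_dest:
  assumes "Module.submodule N R M"
  shows "x \<in> N \<Longrightarrow> x \<in> carrier M" "\<zero>\<^bsub>M\<^esub> \<in> N" "x \<in> N \<Longrightarrow> y \<in> N \<Longrightarrow> x \<oplus>\<^bsub>M\<^esub> y \<in> N"
    "a \<in> carrier R \<Longrightarrow> x \<in> N \<Longrightarrow> a \<odot>\<^bsub>M\<^esub> x \<in> N" "x \<in> N \<Longrightarrow> \<ominus>\<^bsub>M\<^esub> x \<in> N"
    "x \<in> N \<Longrightarrow> y \<in> N \<Longrightarrow> x \<ominus>\<^bsub>M\<^esub> y \<in> N"
proof -
  interpret N: Module.submodule N R M by fact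
  show 1: "x \<in> N \<Longrightarrow> x \<in> carrier M" for x using N.subset by auto
  show "\<zero>\<^bsub>M\<^esub> \<in> N" using N.one_closed by simp
  show 2: "x \<in> N \<Longrightarrow> y \<in> N \<Longrightarrow> x \<oplus>\<^bsub>M\<^esub> y \<in> N" for x y using N.m_closed by simp
  show "a \<in> carrier R \<Longrightarrow> x \<in> N \<Longrightarrow> a \<odot>\<^bsub>M\<^esub> x \<in> N" by (rule N.smult_closed)
  show 3: "x \<in> N \<Longrightarrow> \<ominus>\<^bsub>M\<^esub> x \<in> N" for x using N.m_inv_closed by (simp add: a_inv_def)
  show "x \<in> N \<Longrightarrow> y \<in> N \<Longrightarrow> x \<ominus>\<^bsub>M\<^esub> y \<in> N" using 2 3 by (simp add: a_minus_def)
qed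

end

lemma image_submodule:
  assumes M: "left_module R M" and N: "left_module R N" and f: "f \<in> module_hom R M N"
  shows "Module.submodule (f ` carrier M) R N"
proof -
  interpret M: left_module R M by fact
  interpret N: left_module R N by fact
  show ?thesis
  proof (rule N.submodule_intro)
    show "\<zero>\<^bsub>N\<^esub> \<in> f ` carrier M"
      by (rule image_eqI[where x = "\<zero>\<^bsub>M\<^esub>"])
        (simp_all add: module_hom_zero[OF M.abelian_group N.abelian_group f])
  next
    fix x y assume "x \<in> f ` carrier M" "y \<in> f ` carrier M"
    then obtain u v where "u \<in> carrier M" "v \<in> carrier M" "x = f u" "y = f v" by auto
    then show "x \<oplus>\<^bsub>N\<^esub> y \<in> f ` carrier M"
      by (intro image_eqI[where x = "u \<oplus>\<^bsub>M\<^esub> v"]) (simp_all add: module_hom_add[OF f])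
  next
    fix a x assume "a \<in> carrier R" "x \<in> f ` carrier M"
    then obtain u where "u \<in> carrier M" "x = f u" by auto
    then show "a \<odot>\<^bsub>N\<^esub> x \<in> f ` carrier M"
      using \<open>a \<in> carrier R\<close>
      by (intro image_eqI[where x = "a \<odot>\<^bsub>M\<^esub> u"]) (simp_all add: module_hom_smult[OF f] M.smult_closed)
  qed (use module_hom_mem[OF f] in auto)
qed

lemma kernel_submodule:
  assumes M: "left_module R M" and N: "left_module R N" and f: "f \<in> module_hom R M N"
  shows "Module.submodule (a_kernel M N f) R M"
proof -
  interpret M: left_module R M by fact
  interpret N: left_module R N by fact
  show ?thesis
    by (rule M.submodule_intro)
      (auto simp: a_kernel_def' module_hom_zero[OF M.abelian_group N.abelian_group f]
        module_hom_add[OF f] module_hom_smult[OF f] M.smult_closed)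
qed

lemma left_module_submodule:
  assumes M: "left_module R M" and N: "Module.submodule N R M"
  shows "left_module R (M\<lparr>carrier := N\<rparr>)"
proof -
  interpret M: left_module R M by fact
  note d = M.submodule_dest[OF N]
  have "abelian_group (M\<lparr>carrier := N\<rparr>)"
  proof (rule abelian_groupI)
    show "\<exists>y\<in>carrier (M\<lparr>carrier := N\<rparr>). y \<oplus>\<^bsub>M\<lparr>carrier := N\<rparr>\<^esub> x = \<zero>\<^bsub>M\<lparr>carrier := N\<rparr>\<^esub>"
      if "x \<in> carrier (M\<lparr>carrier := N\<rparr>)" for x
      using that d(1) d(5) by (intro bexI[of _ "\<ominus>\<^bsub>M\<^esub> x"]) (auto simp: M.M.l_neg)
  qed (use d in \<open>auto simp: M.M.a_ac\<close>)
  then show ?thesis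
    using d by (intro left_module.intro M.ring)
      (auto simp: M.smult_l_distr M.smult_r_distr M.smult_assoc M.smult_one)
qed

lemma submodule_of_submodule:
  assumes M: "left_module R M" and N: "Module.submodule N R M"
    and "Module.submodule L R M" "L \<subseteq> N"
  shows "Module.submodule L R (M\<lparr>carrier := N\<rparr>)"
proof -
  interpret M: left_module R M by fact
  interpret N: left_module R "M\<lparr>carrier := N\<rparr>" by (rule left_module_submodule[OF M N])
  show ?thesis
    by (rule N.submodule_intro) (use assms(4) M.submodule_dest[OF assms(3)] in auto)
qed

lemma regular_left_module:
  fixes R (structure)
  assumes "ring R"
  shows "left_module R (regular_module R)"
proof -
  interpret ring R by fact
  have "abelian_group (regular_module R)"
  proof (rule abelian_groupI)
    show "\<exists>y\<in>carrier (regular_module R). y \<oplus>\<^bsub>regular_module R\<^esub> x = \<zero>\<^bsub>regular_module R\<^esub>"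
      if "x \<in> carrier (regular_module R)" for x
      using that by (intro bexI[of _ "\<ominus> x"]) (auto simp: regular_module_def l_neg)
  qed (auto simp: regular_module_def a_ac)
  then show ?thesis
    by (intro left_module.intro assms) (auto simp: regular_module_def l_distr r_distr m_assoc)
qed

section \<open>Free modules of finite rank and their lifting property\<close>

section \<open>Free modules\<close>

text \<open>Padding by zeros puts all finite ranks into the one type
  \<open>nat \<Rightarrow> 'r\<close>, which is the type of modules in
  \<open>GK_Cohen_Macaulay\<close> and therefore of the resolutions behind \<open>grade\<close>. The
  fields \<open>mult\<close> and \<open>one\<close> are placeholders.\<close>

definition free_module :: "('r, 'y) ring_scheme \<Rightarrow> nat \<Rightarrow> ('r, nat \<Rightarrow> 'r) module" where
  "free_module R n =
    \<lparr>carrier = {x. (\<forall>i<n. x i \<in> carrier R) \<and> (\<forall>i\<ge>n. x i = \<zero>\<^bsub>R\<^esub>)},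
     mult = (\<lambda>x y. x), one = (\<lambda>i. \<zero>\<^bsub>R\<^esub>), zero = (\<lambda>i. \<zero>\<^bsub>R\<^esub>),
     add = (\<lambda>x y i. x i \<oplus>\<^bsub>R\<^esub> y i), smult = (\<lambda>a x i. a \<otimes>\<^bsub>R\<^esub> x i)\<rparr>"

lemma free_module_simps [simp]:
  "carrier (free_module R n) = {x. (\<forall>i<n. x i \<in> carrier R) \<and> (\<forall>i\<ge>n. x i = \<zero>\<^bsub>R\<^esub>)}"
  "\<zero>\<^bsub>free_module R n\<^esub> = (\<lambda>i. \<zero>\<^bsub>R\<^esub>)"
  "x \<oplus>\<^bsub>free_module R n\<^esub> y = (\<lambda>i. x i \<oplus>\<^bsub>R\<^esub> y i)"
  "a \<odot>\<^bsub>free_module R n\<^esub> x = (\<lambda>i. a \<otimes>\<^bsub>R\<^esub> x i)"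
  by (simp_all add: free_module_def)

lemma free_module_nth:
  assumes "ring R" "x \<in> carrier (free_module R n)"
  shows "x i \<in> carrier R"
  using assms ring.ring_simprules(2)[OF assms(1)] by (cases "i < n") auto

lemma free_left_module:
  fixes R (structure)
  assumes "ring R"
  shows "left_module R (free_module R n)"
proof -
  interpret ring R by fact
  note nth = free_module_nth[OF assms]
  have "abelian_group (free_module R n)"
  proof (rule abelian_groupI)
    fix x assume x: "x \<in> carrier (free_module R n)"
    then show "\<exists>y\<in>carrier (free_module R n). y \<oplus>\<^bsub>free_module R n\<^esub> x = \<zero>\<^bsub>free_module R n\<^esub>"
      using nth[OF x] by (intro bexI[of _ "\<lambda>i. \<ominus> x i"]) (auto simp: l_neg)
    show "\<zero>\<^bsub>free_module R n\<^esub> \<oplus>\<^bsub>free_module R n\<^esub> x = x" using nth[OF x] by auto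
    fix y assume y: "y \<in> carrier (free_module R n)"
    show "x \<oplus>\<^bsub>free_module R n\<^esub> y \<in> carrier (free_module R n)" using x y by auto
    show "x \<oplus>\<^bsub>free_module R n\<^esub> y = y \<oplus>\<^bsub>free_module R n\<^esub> x"
      using nth[OF x] nth[OF y] by (auto simp: a_comm)
    fix z assume z: "z \<in> carrier (free_module R n)"
    show "x \<oplus>\<^bsub>free_module R n\<^esub> y \<oplus>\<^bsub>free_module R n\<^esub> z = x \<oplus>\<^bsub>free_module R n\<^esub> (y \<oplus>\<^bsub>free_module R n\<^esub> z)"
      using nth[OF x] nth[OF y] nth[OF z] by (auto simp: a_assoc)
  qed simp
  then show ?thesis
  proof (intro left_module.intro assms)
    fix a x assume a: "a \<in> carrier R" and x: "x \<in> carrier (free_module R n)"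
    show "a \<odot>\<^bsub>free_module R n\<^esub> x \<in> carrier (free_module R n)" using a x by auto
    fix b assume b: "b \<in> carrier R"
    show "(a \<oplus> b) \<odot>\<^bsub>free_module R n\<^esub> x = a \<odot>\<^bsub>free_module R n\<^esub> x \<oplus>\<^bsub>free_module R n\<^esub> b \<odot>\<^bsub>free_module R n\<^esub> x"
      using a b nth[OF x] by (auto simp: l_distr)
    show "(a \<otimes> b) \<odot>\<^bsub>free_module R n\<^esub> x = a \<odot>\<^bsub>free_module R n\<^esub> (b \<odot>\<^bsub>free_module R n\<^esub> x)"
      using a b nth[OF x] by (auto simp: m_assoc)
  next
    fix a x y assume a: "a \<in> carrier R" and x: "x \<in> carrier (free_module R n)"
      and y: "y \<in> carrier (free_module R n)"
    show "a \<odot>\<^bsub>free_module R n\<^esub> (x \<oplus>\<^bsub>free_module R n\<^esub> y) =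
      a \<odot>\<^bsub>free_module R n\<^esub> x \<oplus>\<^bsub>free_module R n\<^esub> a \<odot>\<^bsub>free_module R n\<^esub> y"
      using a nth[OF x] nth[OF y] by (auto simp: r_distr)
  next
    fix x assume x: "x \<in> carrier (free_module R n)"
    show "\<one> \<odot>\<^bsub>free_module R n\<^esub> x = x" using nth[OF x] by auto
  qed
qed

definition free_unit :: "('r, 'y) ring_scheme \<Rightarrow> nat \<Rightarrow> nat \<Rightarrow> 'r" where
  "free_unit R i = (\<lambda>j. if j = i then \<one>\<^bsub>R\<^esub> else \<zero>\<^bsub>R\<^esub>)"

lemma free_unit_closed: "ring R \<Longrightarrow> i < n \<Longrightarrow> free_unit R i \<in> carrier (free_module R n)"
  using ring.ring_simprules(2,6)[of R] by (auto simp: free_unit_def)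

definition free_ext :: "nat \<Rightarrow> ('r, 'm, 'z) module_scheme \<Rightarrow> (nat \<Rightarrow> 'm) \<Rightarrow> (nat \<Rightarrow> 'r) \<Rightarrow> 'm" where
  "free_ext n M m x = (\<Oplus>\<^bsub>M\<^esub>i\<in>{..<n}. x i \<odot>\<^bsub>M\<^esub> m i)"

lemma free_ext_hom:
  assumes M: "left_module R M" and m: "\<And>i. i < n \<Longrightarrow> m i \<in> carrier M"
  shows "free_ext n M m \<in> module_hom R (free_module R n) M"
    and "\<And>i. i < n \<Longrightarrow> free_ext n M m (free_unit R i) = m i"
proof -
  interpret M: left_module R M by fact
  note nth = free_module_nth[OF M.ring]
  show "free_ext n M m \<in> module_hom R (free_module R n) M"
  proof (rule module_homI)
    fix x assume x: "x \<in> carrier (free_module R n)"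
    show "free_ext n M m x \<in> carrier M"
      unfolding free_ext_def using nth[OF x] m by (intro M.M.finsum_closed) (auto intro: M.smult_closed)
    fix y assume y: "y \<in> carrier (free_module R n)"
    have "free_ext n M m x \<oplus>\<^bsub>M\<^esub> free_ext n M m y = (\<Oplus>\<^bsub>M\<^esub>i\<in>{..<n}. x i \<odot>\<^bsub>M\<^esub> m i \<oplus>\<^bsub>M\<^esub> y i \<odot>\<^bsub>M\<^esub> m i)"
      unfolding free_ext_def using nth[OF x] nth[OF y] m
      by (intro M.M.finsum_addf[symmetric]) (auto intro: M.smult_closed)
    also have "\<dots> = free_ext n M m (x \<oplus>\<^bsub>free_module R n\<^esub> y)"
      unfolding free_ext_def using nth[OF x] nth[OF y] m
      by (intro M.M.finsum_cong') (auto intro: M.smult_closed simp: M.smult_l_distr)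
    finally show "free_ext n M m (x \<oplus>\<^bsub>free_module R n\<^esub> y) = free_ext n M m x \<oplus>\<^bsub>M\<^esub> free_ext n M m y"
      by simp
  next
    fix a x assume a: "a \<in> carrier R" and x: "x \<in> carrier (free_module R n)"
    \<comment> \<open>Multiplication by \<open>a\<close> is additive but not
      \<open>R\<close>-linear. Over a dummy ring with empty carrier the scalar condition is vacuous,
      so the rule for finite sums applies.\<close>
    have f: "(\<lambda>v. a \<odot>\<^bsub>M\<^esub> v) \<in> module_hom \<lparr>carrier = {}, mult = (\<lambda>x y. x), one = undefined, zero = undefined, add = (\<lambda>x y. x)\<rparr> M M"
      using a by (auto intro!: module_homI M.smult_closed simp: M.smult_r_distr)
    have "a \<odot>\<^bsub>M\<^esub> free_ext n M m x = (\<Oplus>\<^bsub>M\<^esub>i\<in>{..<n}. a \<odot>\<^bsub>M\<^esub> (x i \<odot>\<^bsub>M\<^esub> m i))"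
      unfolding free_ext_def using nth[OF x] m
      by (intro module_hom_finsum[OF M.abelian_group M.abelian_group f]) (auto intro: M.smult_closed)
    also have "\<dots> = free_ext n M m (a \<odot>\<^bsub>free_module R n\<^esub> x)"
      unfolding free_ext_def using nth[OF x] m a
      by (intro M.M.finsum_cong') (auto intro: M.smult_closed simp: M.smult_assoc)
    finally show "free_ext n M m (a \<odot>\<^bsub>free_module R n\<^esub> x) = a \<odot>\<^bsub>M\<^esub> free_ext n M m x" by simp
  qed
  fix i assume i: "i < n"
  have "free_ext n M m (free_unit R i) = (\<Oplus>\<^bsub>M\<^esub>j\<in>{..<n}. if i = j then m j else \<zero>\<^bsub>M\<^esub>)"
    unfolding free_ext_def using m i
    by (intro M.M.finsum_cong') (auto simp: free_unit_def M.smult_one)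
  also have "\<dots> = m i" using m i by (intro M.M.add.finprod_singleton) auto
  finally show "free_ext n M m (free_unit R i) = m i" .
qed

lemma free_module_hom_eq:
  assumes M: "left_module R M" and f: "f \<in> module_hom R (free_module R n) M"
    and x: "x \<in> carrier (free_module R n)"
  shows "f x = (\<Oplus>\<^bsub>M\<^esub>i\<in>{..<n}. x i \<odot>\<^bsub>M\<^esub> f (free_unit R i))"
proof -
  interpret M: left_module R M by fact
  interpret F: left_module R "free_module R n" by (rule free_left_module[OF M.ring])
  note nth = free_module_nth[OF M.ring x]
  \<comment> \<open>Truncations of \<open>x\<close> after \<open>k\<close> coordinates; consecutive
    ones differ by a multiple of one unit vector.\<close>
  define tr where "tr k = (\<lambda>i. if i < k then x i else \<zero>\<^bsub>R\<^esub>)" for k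
  have tr: "tr k \<in> carrier (free_module R n)" for k
    using x by (auto simp: tr_def)
  have u: "free_unit R i \<in> carrier (free_module R n)" if "i < n" for i
    using free_unit_closed[OF M.ring that] .
  have fu: "f (free_unit R i) \<in> carrier M" if "i < n" for i
    using module_hom_mem[OF f u[OF that]] .
  have "k \<le> n \<Longrightarrow> f (tr k) = (\<Oplus>\<^bsub>M\<^esub>i\<in>{..<k}. x i \<odot>\<^bsub>M\<^esub> f (free_unit R i))" for k
  proof (induction k)
    case 0
    have "tr 0 = \<zero>\<^bsub>free_module R n\<^esub>" by (simp add: tr_def)
    then show ?case using module_hom_zero[OF F.abelian_group M.abelian_group f] by simp
  next
    case (Suc k)
    have "tr (Suc k) = tr k \<oplus>\<^bsub>free_module R n\<^esub> (x k \<odot>\<^bsub>free_module R n\<^esub> free_unit R k)"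
      using nth by (auto simp: tr_def free_unit_def less_Suc_eq)
    then have "f (tr (Suc k)) = f (tr k \<oplus>\<^bsub>free_module R n\<^esub> (x k \<odot>\<^bsub>free_module R n\<^esub> free_unit R k))"
      by (rule arg_cong)
    also have "\<dots> = f (tr k) \<oplus>\<^bsub>M\<^esub> x k \<odot>\<^bsub>M\<^esub> f (free_unit R k)"
      using module_hom_add[OF f tr F.smult_closed[OF nth u]] module_hom_smult[OF f nth u] Suc(2)
      by (simp del: free_module_simps)
    also have "\<dots> = (\<Oplus>\<^bsub>M\<^esub>i\<in>{..<Suc k}. x i \<odot>\<^bsub>M\<^esub> f (free_unit R i))"
    proof -
      have "(\<lambda>i. x i \<odot>\<^bsub>M\<^esub> f (free_unit R i)) \<in> {..<k} \<rightarrow> carrier M"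
        and "x k \<odot>\<^bsub>M\<^esub> f (free_unit R k) \<in> carrier M"
        using fu nth Suc(2) by (auto intro!: M.smult_closed)
      then show ?thesis using Suc by (simp add: lessThan_Suc M.M.a_comm)
    qed
    finally show ?case .
  qed
  from this[OF order_refl] have "f (tr n) = (\<Oplus>\<^bsub>M\<^esub>i\<in>{..<n}. x i \<odot>\<^bsub>M\<^esub> f (free_unit R i))" .
  moreover have "tr n = x" using x by (auto simp: tr_def)
  ultimately show ?thesis by simp
qed

lemma free_module_hom_eqI:
  assumes M: "left_module R M" and f: "f \<in> module_hom R (free_module R n) M"
    and g: "g \<in> module_hom R (free_module R n) M"
    and eq: "\<And>i. i < n \<Longrightarrow> f (free_unit R i) = g (free_unit R i)" and x: "x \<in> carrier (free_module R n)"
  shows "f x = g x"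
proof -
  interpret M: left_module R M by fact
  have "(\<Oplus>\<^bsub>M\<^esub>i\<in>{..<n}. x i \<odot>\<^bsub>M\<^esub> f (free_unit R i)) = (\<Oplus>\<^bsub>M\<^esub>i\<in>{..<n}. x i \<odot>\<^bsub>M\<^esub> g (free_unit R i))"
    using eq module_hom_mem[OF g free_unit_closed[OF M.ring]] free_module_nth[OF M.ring x]
    by (intro M.M.finsum_cong') (auto intro!: M.smult_closed)
  then show ?thesis
    using free_module_hom_eq[OF M f x] free_module_hom_eq[OF M g x] by simp
qed

lemma module_hom_comp:
  "g \<in> module_hom R M N \<Longrightarrow> f \<in> module_hom R L M \<Longrightarrow> (\<lambda>x. g (f x)) \<in> module_hom R L N"
  unfolding module_hom_def by (auto simp: Pi_def)

lemma free_lift_surj: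
  assumes M: "left_module R M" and N: "left_module R N"
    and g: "g \<in> module_hom R M N" "g ` carrier M = carrier N"
    and f: "f \<in> module_hom R (free_module R n) N"
  shows "\<exists>h\<in>module_hom R (free_module R n) M. \<forall>x\<in>carrier (free_module R n). g (h x) = f x"
proof -
  interpret M: left_module R M by fact
  have "\<forall>i\<in>{..<n}. \<exists>m. m \<in> carrier M \<and> g m = f (free_unit R i)"
  proof
    fix i assume "i \<in> {..<n}"
    then have "f (free_unit R i) \<in> carrier N"
      using module_hom_mem[OF f free_unit_closed[OF M.ring]] by simp
    then have "f (free_unit R i) \<in> g ` carrier M" by (simp only: g(2))
    then show "\<exists>m. m \<in> carrier M \<and> g m = f (free_unit R i)" by auto
  qed
  from bchoice[OF this] obtain m
    where m: "\<forall>i\<in>{..<n}. m i \<in> carrier M \<and> g (m i) = f (free_unit R i)" ..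
  have h: "free_ext n M m \<in> module_hom R (free_module R n) M"
    and hu: "\<And>i. i < n \<Longrightarrow> free_ext n M m (free_unit R i) = m i"
    using m by (auto intro!: free_ext_hom[OF M])
  have "g (free_ext n M m x) = f x" if "x \<in> carrier (free_module R n)" for x
    by (rule free_module_hom_eqI[OF N module_hom_comp[OF g(1) h] f _ that]) (use m hu in simp)
  then show ?thesis using h by (intro bexI[of _ "free_ext n M m"] ballI)
qed

lemma free_projective:
  assumes "ring R"
  shows "projective_module R (free_module R n)"
  unfolding projective_module_def
proof (intro conjI allI impI free_left_module[OF assms])
  fix M N :: "('a, nat \<Rightarrow> 'a) module" and g f
  assume "left_module R M \<and> left_module R N \<and> g \<in> module_hom R M N \<and>
    g ` carrier M = carrier N \<and> f \<in> module_hom R (free_module R n) N"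
  then show "\<exists>h\<in>module_hom R (free_module R n) M. \<forall>x\<in>carrier (free_module R n). g (h x) = f x"
    by (intro free_lift_surj) (elim conjE; assumption)+
qed

section \<open>Submodules of finite free modules over a noetherian ring\<close>

section \<open>Finite generation\<close>

text \<open>Generation is tested against submodules of the ambient module, so the generated
  submodule does not have to be turned into a module of its own.\<close>

definition fg_sub :: "('r, 'y) ring_scheme \<Rightarrow> ('r, 'm) module \<Rightarrow> 'm set \<Rightarrow> bool" where
  "fg_sub R M N \<longleftrightarrow>
    (\<exists>X. finite X \<and> X \<subseteq> N \<and> (\<forall>L. Module.submodule L R M \<and> X \<subseteq> L \<longrightarrow> N \<subseteq> L))"

lemma submodule_Int:
  assumes "left_module R M" "Module.submodule A R M" "Module.submodule B R M"
  shows "Module.submodule (A \<inter> B) R M"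
proof -
  interpret M: left_module R M by fact
  show ?thesis
    by (rule M.submodule_intro) (use M.submodule_dest[OF assms(2)] M.submodule_dest[OF assms(3)] in auto)
qed

text \<open>Induction on the rank. Generators of the left ideal of last coordinates are lifted to
  \<open>N\<close> and joined to generators of the part of \<open>N\<close> with last coordinate
  zero, which lies in a free module of smaller rank.\<close>

lemma free_submodule_fg:
  fixes R (structure)
  assumes R: "ring R" and noeth: "left_noetherian R"
  shows "Module.submodule N R (free_module R n) \<Longrightarrow> fg_sub R (free_module R n) N"
proof (induction n arbitrary: N)
  interpret ring R by fact
  case 0
  interpret F: left_module R "free_module R 0" by (rule free_left_module[OF R])
  have "N \<subseteq> {\<lambda>i. \<zero>}"
    using F.submodule_dest(1)[OF 0] by (auto intro!: ext)
  moreover have "(\<lambda>i. \<zero>) \<in> L" if "Module.submodule L R (free_module R 0)" for L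
    using F.submodule_dest(2)[OF that] by simp
  ultimately show ?case unfolding fg_sub_def by (intro exI[of _ "{}"]) blast
next
  interpret ring R by fact
  case (Suc n)
  let ?F = "free_module R (Suc n)" and ?G = "free_module R n"
  interpret F: left_module R ?F by (rule free_left_module[OF R])
  interpret F0: left_module R ?G by (rule free_left_module[OF R])
  interpret reg: left_module R "regular_module R" by (rule regular_left_module[OF R])
  have reg: "carrier (regular_module R) = carrier R" "\<zero>\<^bsub>regular_module R\<^esub> = \<zero>"
    "add (regular_module R) = add R" "smult (regular_module R) = mult R"
    by (simp_all add: regular_module_def)
  note N = F.submodule_dest[OF Suc.prems]
  \<comment> \<open>Shown for every submodule \<open>L\<close>, since it is applied both to
    \<open>N\<close> and to its intersection with a competing submodule.\<close>
  have lead: "Module.submodule ((\<lambda>x. x n) ` L) R (regular_module R)"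
    if "Module.submodule L R ?F" for L
  proof (rule reg.submodule_intro)
    note L = F.submodule_dest[OF that]
    show "(\<lambda>x. x n) ` L \<subseteq> carrier (regular_module R)"
      using L(1) by (auto simp: reg)
    show "\<zero>\<^bsub>regular_module R\<^esub> \<in> (\<lambda>x. x n) ` L"
      using L(2) by (auto simp: reg image_iff intro: bexI[of _ "\<lambda>i. \<zero>"])
    fix a b assume "a \<in> (\<lambda>x. x n) ` L" "b \<in> (\<lambda>x. x n) ` L"
    then obtain x y where "x \<in> L" "y \<in> L" "a = x n" "b = y n" by auto
    then show "a \<oplus>\<^bsub>regular_module R\<^esub> b \<in> (\<lambda>x. x n) ` L"
      using L(3)[of x y] by (auto simp: reg image_iff intro!: bexI[of _ "\<lambda>i. x i \<oplus> y i"])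
  next
    note L = F.submodule_dest[OF that]
    fix r a assume r: "r \<in> carrier R" and "a \<in> (\<lambda>x. x n) ` L"
    then obtain x where "x \<in> L" "a = x n" by auto
    then show "r \<odot>\<^bsub>regular_module R\<^esub> a \<in> (\<lambda>x. x n) ` L"
      using L(4)[OF r, of x] by (auto simp: reg image_iff intro!: bexI[of _ "\<lambda>i. r \<otimes> x i"])
  qed
  have low: "Module.submodule (L \<inter> carrier ?G) R ?G" if "Module.submodule L R ?F" for L
  proof (rule F0.submodule_intro)
    note L = F.submodule_dest[OF that]
    show "\<zero>\<^bsub>?G\<^esub> \<in> L \<inter> carrier ?G" using L(2) by simp
    show "x \<oplus>\<^bsub>?G\<^esub> y \<in> L \<inter> carrier ?G" if "x \<in> L \<inter> carrier ?G" "y \<in> L \<inter> carrier ?G" for x y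
      using L(3)[of x y] that F0.M.a_closed[of x y] by simp
    show "a \<odot>\<^bsub>?G\<^esub> x \<in> L \<inter> carrier ?G" if "a \<in> carrier R" "x \<in> L \<inter> carrier ?G" for a x
      using L(4)[of a x] that F0.smult_closed[of a x] by simp
  qed simp
  have "fin_gen_module R ((regular_module R)\<lparr>carrier := (\<lambda>x. x n) ` N\<rparr>)"
    by (rule noeth[unfolded left_noetherian_def, rule_format, OF lead[OF Suc.prems]])
  then obtain Y where Y: "finite Y" "Y \<subseteq> carrier ((regular_module R)\<lparr>carrier := (\<lambda>x. x n) ` N\<rparr>)"
    and genY': "\<forall>J. Module.submodule J R ((regular_module R)\<lparr>carrier := (\<lambda>x. x n) ` N\<rparr>) \<and> Y \<subseteq> J
      \<longrightarrow> J = carrier ((regular_module R)\<lparr>carrier := (\<lambda>x. x n) ` N\<rparr>)"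
    unfolding fin_gen_module_def by (elim exE conjE)
  have genY: "J = (\<lambda>x. x n) ` N"
    if "Module.submodule J R ((regular_module R)\<lparr>carrier := (\<lambda>x. x n) ` N\<rparr>)" "Y \<subseteq> J" for J
    using genY'[rule_format, OF conjI[OF that]] by simp
  have Y': "Y \<subseteq> (\<lambda>x. x n) ` N" using Y(2) by simp
  obtain X1 where X1: "X1 \<subseteq> N" "finite X1" "Y = (\<lambda>x. x n) ` X1"
    using finite_subset_image[OF Y(1) Y'] by blast
  obtain X2 where X2: "finite X2" "X2 \<subseteq> N \<inter> carrier ?G"
    and gen2': "\<forall>L. Module.submodule L R ?G \<and> X2 \<subseteq> L \<longrightarrow> N \<inter> carrier ?G \<subseteq> L"
    using Suc.IH[OF low[OF Suc.prems]] unfolding fg_sub_def by (elim exE conjE)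
  note gen2 = gen2'[rule_format, OF conjI]
  show ?case
    unfolding fg_sub_def
  proof (intro exI[of _ "X1 \<union> X2"] conjI allI impI)
    show "finite (X1 \<union> X2)" "X1 \<union> X2 \<subseteq> N" using X1 X2 by auto
    fix L assume "Module.submodule L R ?F \<and> X1 \<union> X2 \<subseteq> L"
    then have L: "Module.submodule L R ?F" and XL: "X1 \<subseteq> L" "X2 \<subseteq> L" by auto
    note Ld = F.submodule_dest[OF L]
    have LN: "Module.submodule (L \<inter> N) R ?F"
      by (rule submodule_Int[OF F.left_module_axioms L Suc.prems])
    have "Module.submodule ((\<lambda>x. x n) ` (L \<inter> N)) R ((regular_module R)\<lparr>carrier := (\<lambda>x. x n) ` N\<rparr>)"
      by (rule submodule_of_submodule[OF reg.left_module_axioms lead[OF Suc.prems] lead[OF LN]]) auto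
    then have eqN: "(\<lambda>x. x n) ` (L \<inter> N) = (\<lambda>x. x n) ` N"
      by (rule genY) (use X1 XL in auto)
    have N0: "N \<inter> carrier ?G \<subseteq> L \<inter> carrier ?G"
      by (rule gen2[OF low[OF L]]) (use X2 XL in auto)
    show "N \<subseteq> L"
    proof
      fix x assume x: "x \<in> N"
      then have "x n \<in> (\<lambda>x. x n) ` (L \<inter> N)" using eqN by auto
      then obtain y where y: "y \<in> L" "y \<in> N" "y n = x n" by auto
      have xF: "x \<in> carrier ?F" and yF: "y \<in> carrier ?F" by (rule N(1)[OF x] N(1)[OF y(2)])+
      \<comment> \<open>\<open>y\<close> has the same last coordinate as \<open>x\<close> and lies
        in \<open>L\<close>, so the difference falls under the induction hypothesis.\<close>
      define z where "z = x \<ominus>\<^bsub>?F\<^esub> y"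
      have zN: "z \<in> N" unfolding z_def using N(6) x y by simp
      have "z \<oplus>\<^bsub>?F\<^esub> y = x"
        unfolding z_def using xF yF by (simp only: a_minus_def F.M.a_assoc F.M.a_inv_closed F.M.l_neg F.M.r_zero)
      then have xz: "x = (\<lambda>i. z i \<oplus> y i)" by simp
      have zF: "z \<in> carrier ?F" by (rule N(1)[OF zN])
      have "z n \<oplus> y n = x n" using fun_cong[OF xz, of n] by simp
      then have zn: "z n = \<zero>"
        using y(3) free_module_nth[OF R zF, of n] free_module_nth[OF R xF, of n]
        by (simp add: local.add.r_cancel_one)
      have "z i = \<zero>" if "n \<le> i" for i
        using that zn zF by (cases "i = n") auto
      then have "z \<in> carrier ?G" using zF by auto
      then have "z \<in> L" using N0 zN by auto
      then show "x \<in> L" using Ld(3)[of z y] y xz by simp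
    qed
  qed
qed

text \<open>Sends the unit vectors to the finitely many generators. The image is a submodule
  containing the generators, which gives one inclusion.\<close>

lemma fg_surjection:
  assumes M: "left_module R M" and N: "Module.submodule N R M" and fg: "fg_sub R M N"
  shows "\<exists>m q. q \<in> module_hom R (free_module R m) M \<and> q ` carrier (free_module R m) = N"
proof -
  interpret M: left_module R M by fact
  obtain X where X: "finite X" "X \<subseteq> N"
    and gen': "\<forall>L. Module.submodule L R M \<and> X \<subseteq> L \<longrightarrow> N \<subseteq> L"
    using fg unfolding fg_sub_def by (elim exE conjE)
  note gen = gen'[rule_format, OF conjI]
  obtain g where g: "X = g ` {i::nat. i < card X}"
  proof -
    obtain h n where h: "X = h ` {i::nat. i < n}" "inj_on h {i. i < n}"
      using finite_imp_nat_seg_image_inj_on[OF X(1)] by blast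
    then have "card X = n" by (simp add: card_image)
    then show thesis using h that by simp
  qed
  let ?m = "card X"
  have gN: "g i \<in> N" if "i < ?m" for i using g X(2) that by blast
  have gM: "g i \<in> carrier M" if "i < ?m" for i using M.submodule_dest(1)[OF N gN[OF that]] .
  let ?q = "free_ext ?m M g"
  have q: "?q \<in> module_hom R (free_module R ?m) M"
    and qu: "\<And>i. i < ?m \<Longrightarrow> ?q (free_unit R i) = g i"
    by (rule free_ext_hom[OF M gM]; assumption)+
  have F: "left_module R (free_module R ?m)" by (rule free_left_module[OF M.ring])
  have im: "Module.submodule (?q ` carrier (free_module R ?m)) R M"
    by (rule image_submodule[OF F M q])
  have "X \<subseteq> ?q ` carrier (free_module R ?m)"
  proof
    fix x assume "x \<in> X"
    then obtain i where "i < ?m" "x = g i" using g by auto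
    then show "x \<in> ?q ` carrier (free_module R ?m)"
      using qu free_unit_closed[OF M.ring, of i ?m]
      by (intro image_eqI[where x = "free_unit R i"]) simp_all
  qed
  then have 1: "N \<subseteq> ?q ` carrier (free_module R ?m)" by (rule gen[OF im])
  have NM: "left_module R (M\<lparr>carrier := N\<rparr>)" by (rule left_module_submodule[OF M N])
  have "?q x \<in> N" if x: "x \<in> carrier (free_module R ?m)" for x
  proof -
    interpret NM: left_module R "M\<lparr>carrier := N\<rparr>" by (rule NM)
    \<comment> \<open>For the reverse inclusion the same extension is formed inside \<open>N\<close>
      as a module; both extensions agree on unit vectors, so \<open>?q\<close> takes values in
      \<open>N\<close>.\<close>
    let ?q' = "free_ext ?m (M\<lparr>carrier := N\<rparr>) g"
    have q': "?q' \<in> module_hom R (free_module R ?m) (M\<lparr>carrier := N\<rparr>)"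
      and qu': "\<And>i. i < ?m \<Longrightarrow> ?q' (free_unit R i) = g i"
      using gN by (auto intro!: free_ext_hom[OF NM])
    have q'M: "?q' \<in> module_hom R (free_module R ?m) M"
      using q' M.submodule_dest(1)[OF N] by (auto simp: module_hom_def)
    have "?q x = ?q' x"
      by (rule free_module_hom_eqI[OF M q q'M _ x]) (simp add: qu qu')
    also have "\<dots> \<in> N" using module_hom_mem[OF q' x] by simp
    finally show ?thesis .
  qed
  then have "?q ` carrier (free_module R ?m) = N" using 1 by auto
  then show ?thesis using q by (intro exI conjI)
qed

section \<open>Existence of resolutions by free modules of finite rank\<close>

section \<open>Free resolutions\<close>

lemma free_resolution_step:
  assumes R: "ring R" and noeth: "left_noetherian R"
    and N: "Module.submodule N R (free_module R n)"
  shows "\<exists>mq. snd mq \<in> module_hom R (free_module R (fst mq)) (free_module R n) \<and>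
    snd mq ` carrier (free_module R (fst mq)) = N"
proof -
  from fg_surjection[OF free_left_module[OF R] N free_submodule_fg[OF R noeth N]]
  obtain m q where "q \<in> module_hom R (free_module R m) (free_module R n)"
    "q ` carrier (free_module R m) = N"
    by (elim exE conjE)
  then show ?thesis by (intro exI[of _ "(m, q)"]) simp
qed

text \<open>\<open>Ext\<close> picks some projective resolution of this type; only the existence of
  one ensures that the picked object is a resolution. Kernels in finite free modules are covered
  repeatedly by finite free modules.\<close>

lemma free_resolution_exists:
  fixes R :: "('r, 'y) ring_scheme" and M :: "('r, nat \<Rightarrow> 'r) module"
  assumes R: "ring R" and noeth: "left_noetherian R" and M: "left_module R M"
    and p: "p \<in> module_hom R (free_module R n) M" "p ` carrier (free_module R n) = carrier M"
  shows "\<exists>P d. projective_resolution R M P d"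
proof -
  note FM = free_left_module[OF R]
  define step where "step = (\<lambda>(n, N). SOME mq. snd mq \<in> module_hom R (free_module R (fst mq)) (free_module R n) \<and>
    snd mq ` carrier (free_module R (fst mq)) = N)"
  have step: "snd (step (n, N)) \<in> module_hom R (free_module R (fst (step (n, N)))) (free_module R n) \<and>
    snd (step (n, N)) ` carrier (free_module R (fst (step (n, N)))) = N"
    if "Module.submodule N R (free_module R n)" for n N
    using someI_ex[OF free_resolution_step[OF R noeth that]] by (simp add: step_def)
  \<comment> \<open>A state consists of a rank and a submodule still to be covered. The next state
    is the rank of a free cover together with the kernel of the covering map.\<close>
  define next_st where "next_st st =
    (fst (step st), a_kernel (free_module R (fst (step st))) (free_module R (fst st)) (snd (step st)))" for st
  define st where "st i = (next_st ^^ i) (n, a_kernel (free_module R n) M p)" for i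
  have st0: "st 0 = (n, a_kernel (free_module R n) M p)" by (simp add: st_def)
  have stS: "st (Suc i) = next_st (st i)" for i by (simp add: st_def)
  have sub: "Module.submodule (snd (st i)) R (free_module R (fst (st i)))" for i
  proof (induction i)
    case 0
    then show ?case using kernel_submodule[OF FM M p(1)] by (simp add: st0)
  next
    case (Suc i)
    have "snd (step (st i)) \<in> module_hom R (free_module R (fst (step (st i)))) (free_module R (fst (st i)))"
      using step[OF Suc] by simp
    then show ?case
      unfolding stS next_st_def fst_conv snd_conv by (rule kernel_submodule[OF FM FM])
  qed
  define P where "P i = free_module R (fst (st i))" for i
  define d where "d i = (case i of 0 \<Rightarrow> p | Suc j \<Rightarrow> snd (step (st j)))" for i
  have PS: "P (Suc i) = free_module R (fst (step (st i)))" for i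
    by (simp add: P_def stS next_st_def)
  have d_hom: "d (Suc i) \<in> module_hom R (P (Suc i)) (P i)"
    and d_im: "d (Suc i) ` carrier (P (Suc i)) = snd (st i)" for i
    using step[of "snd (st i)" "fst (st i)", OF sub] unfolding PS by (simp_all add: d_def P_def)
  have ker: "snd (st i) = a_kernel (P i) (case_nat M P i) (d i)" for i
  proof (cases i)
    case 0
    then show ?thesis by (simp add: st0 P_def d_def)
  next
    case (Suc j)
    then show ?thesis by (simp add: stS next_st_def P_def d_def)
  qed
  have "projective_resolution R M P d"
    unfolding projective_resolution_def
  proof (intro conjI allI)
    show "projective_module R (P i)" for i unfolding P_def by (rule free_projective[OF R])
    show "d i \<in> module_hom R (P i) (case_nat M P i)" for i
    proof (cases i)
      case 0
      then show ?thesis using p(1) by (simp add: d_def P_def st0)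
    next
      case (Suc j)
      then show ?thesis using d_hom[of j] by simp
    qed
    show "d 0 ` carrier (P 0) = carrier M" using p(2) by (simp add: d_def P_def st0)
    show "d (Suc i) ` carrier (P (Suc i)) = a_kernel (P i) (case_nat M P i) (d i)" for i
      unfolding d_im ker ..
  qed
  then show ?thesis by (intro exI)
qed

section \<open>Consequences of trivial cohomology in degrees zero and one\<close>

section \<open>Vanishing of Ext\<close>

text \<open>The form in which \<open>grade\<close> tests that a degree of \<open>Ext\<close>
  vanishes.\<close>

definition trivial_group :: "'g monoid \<Rightarrow> bool" where
  "trivial_group G \<longleftrightarrow> carrier G = {one G}"

text \<open>In a trivial quotient every coset is \<open>B\<close> itself. That \<open>z\<close> lies
  in its own coset is a hypothesis here, taking the place of a subgroup property of
  \<open>B\<close>.\<close>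

lemma trivial_Mod:
  assumes "trivial_group (G Mod B)" "z \<in> carrier G" "z \<in> B #>\<^bsub>G\<^esub> z"
  shows "z \<in> B"
proof -
  have "B #>\<^bsub>G\<^esub> z \<in> rcosets\<^bsub>G\<^esub> B"
    using assms(2) by (auto simp: RCOSETS_def)
  then have "B #>\<^bsub>G\<^esub> z = B"
    using assms(1) by (auto simp: trivial_group_def FactGroup_def)
  then show ?thesis using assms(3) by simp
qed

context
  fixes R :: "('r, 'y) ring_scheme" and M :: "('r, 'm) module" and N :: "('r, 'n) module"
    and P d
  assumes M: "left_module R M" and N: "left_module R N"
    and res: "projective_resolution R M P d"
begin

interpretation M: left_module R M by (rule M)
interpretation N: left_module R N by (rule N)

lemma P_proj: "projective_module R (P i)" and P_mod: "left_module R (P i)"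
  and d0: "d 0 \<in> module_hom R (P 0) M" and dS: "d (Suc i) \<in> module_hom R (P (Suc i)) (P i)"
  and d0_surj: "d 0 ` carrier (P 0) = carrier M"
  and ex0: "d (Suc 0) ` carrier (P (Suc 0)) = a_kernel (P 0) M (d 0)"
  and exS: "d (Suc (Suc i)) ` carrier (P (Suc (Suc i))) = a_kernel (P (Suc i)) (P i) (d (Suc i))"
proof -
  from res have 1: "\<forall>i. projective_module R (P i)"
    and 2: "\<forall>i. d i \<in> module_hom R (P i) (case_nat M P i)"
    and 3: "d 0 ` carrier (P 0) = carrier M"
    and 4: "\<forall>i. d (Suc i) ` carrier (P (Suc i)) = a_kernel (P i) (case_nat M P i) (d i)"
    unfolding projective_resolution_def by simp_all
  show "projective_module R (P i)" using 1 ..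
  then show "left_module R (P i)" unfolding projective_module_def by (elim conjE)
  show "d 0 \<in> module_hom R (P 0) M" using spec[OF 2, of 0] by simp
  show "d (Suc i) \<in> module_hom R (P (Suc i)) (P i)" using spec[OF 2, of "Suc i"] by simp
  show "d 0 ` carrier (P 0) = carrier M" by (rule 3)
  show "d (Suc 0) ` carrier (P (Suc 0)) = a_kernel (P 0) M (d 0)" using spec[OF 4, of 0] by simp
  show "d (Suc (Suc i)) ` carrier (P (Suc (Suc i))) = a_kernel (P (Suc i)) (P i) (d (Suc i))"
    using spec[OF 4, of "Suc i"] by simp
qed

text \<open>\<open>f\<close> composed with the augmentation is a cocycle of degree zero, where the
  only coboundary is the zero map. It therefore vanishes, and the augmentation is onto.\<close>

lemma Ext_zero:
  assumes triv: "trivial_group (Hom_cohomology R P d N 0)"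
    and f: "f \<in> module_hom R M N" and x: "x \<in> carrier M"
  shows "f x = \<zero>\<^bsub>N\<^esub>"
proof -
  define C where "C j = Hom_group R (P j) N" for j
  define \<delta> where "\<delta> j f = compose (carrier (P (Suc j))) f (d (Suc j))" for j and f :: "'m \<Rightarrow> 'n"
  define G where "G = (C 0)\<lparr>carrier := kernel (C 0) (C (Suc 0)) (\<delta> 0)\<rparr>"
  have H: "Hom_cohomology R P d N 0 = G Mod {one (C 0)}"
    by (simp add: Hom_cohomology_def Let_def C_def \<delta>_def[abs_def] G_def)
  \<comment> \<open>Restricted to the carrier because the members of \<open>Hom_group\<close> are
    extensional.\<close>
  define z where "z = (\<lambda>x\<in>carrier (P 0). f (d 0 x))"
  have zc: "z \<in> carrier (C 0)"
  proof -
    have "z \<in> module_hom R (P 0) N"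
      unfolding z_def
      by (rule module_hom_cong[OF module_hom_comp[OF f d0]])
        (use left_module.smult_closed[OF P_mod] abelian_monoid.a_closed[OF abelian_group.axioms(1)[OF left_module.abelian_group[OF P_mod]]] in auto)
    then show ?thesis by (simp add: C_def Hom_group_def z_def)
  qed
  have "\<delta> 0 z = one (C (Suc 0))"
  proof -
    have "z (d (Suc 0) y) = \<zero>\<^bsub>N\<^esub>" if y: "y \<in> carrier (P (Suc 0))" for y
    proof -
      have "d (Suc 0) y \<in> a_kernel (P 0) M (d 0)" using y ex0 by blast
      then show ?thesis
        using module_hom_zero[OF M.abelian_group N.abelian_group f] by (simp add: a_kernel_def' z_def)
    qed
    then show ?thesis by (auto simp: \<delta>_def compose_def C_def Hom_group_def intro!: restrict_ext)
  qed
  then have zG: "z \<in> carrier G" using zc by (simp add: G_def kernel_def)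
  have "one (C 0) \<otimes>\<^bsub>C 0\<^esub> z = z"
  proof
    fix x
    have "x \<in> carrier (P 0) \<Longrightarrow> f (d 0 x) \<in> carrier N"
      using module_hom_mem[OF f module_hom_mem[OF d0]] .
    then show "(one (C 0) \<otimes>\<^bsub>C 0\<^esub> z) x = z x"
      by (simp add: C_def Hom_group_def z_def)
  qed
  then have "z \<in> {one (C 0)} #>\<^bsub>G\<^esub> z" by (simp add: G_def r_coset_def)
  then have z1: "z = one (C 0)"
    using trivial_Mod[OF triv[unfolded H] zG] by simp
  obtain y where y: "y \<in> carrier (P 0)" "x = d 0 y" using x d0_surj by auto
  then have "f x = z y" by (simp add: z_def)
  also have "\<dots> = \<zero>\<^bsub>N\<^esub>" using y by (simp add: z1 C_def Hom_group_def)
  finally show ?thesis .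
qed

text \<open>The hypothesis \<open>gd\<close> says that \<open>g\<close> is a cocycle; triviality
  makes it a coboundary, which is the stated factorisation through \<open>d (Suc 0)\<close>.\<close>

lemma Ext_one:
  assumes triv: "trivial_group (Hom_cohomology R P d N (Suc 0))"
    and g: "g \<in> module_hom R (P (Suc 0)) N"
    and gd: "\<And>x. x \<in> carrier (P (Suc (Suc 0))) \<Longrightarrow> g (d (Suc (Suc 0)) x) = \<zero>\<^bsub>N\<^esub>"
  shows "\<exists>h\<in>module_hom R (P 0) N. \<forall>x\<in>carrier (P (Suc 0)). g x = h (d (Suc 0) x)"
proof -
  define C where "C j = Hom_group R (P j) N" for j
  define \<delta> where "\<delta> j f = compose (carrier (P (Suc j))) f (d (Suc j))" for j and f :: "'m \<Rightarrow> 'n"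
  define G where "G = (C (Suc 0))\<lparr>carrier := kernel (C (Suc 0)) (C (Suc (Suc 0))) (\<delta> (Suc 0))\<rparr>"
  have H: "Hom_cohomology R P d N (Suc 0) = G Mod (\<delta> 0 ` carrier (C 0))"
    by (simp add: Hom_cohomology_def Let_def C_def \<delta>_def[abs_def] G_def)
  have closed: "x \<oplus>\<^bsub>P i\<^esub> y \<in> carrier (P i)" "a \<in> carrier R \<Longrightarrow> a \<odot>\<^bsub>P i\<^esub> x \<in> carrier (P i)"
    if "x \<in> carrier (P i)" "y \<in> carrier (P i)" for x y a i
    using that left_module.smult_closed[OF P_mod]
      abelian_monoid.a_closed[OF abelian_group.axioms(1)[OF left_module.abelian_group[OF P_mod]]] by auto
  define z where "z = (\<lambda>x\<in>carrier (P (Suc 0)). g x)"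
  have zc: "z \<in> carrier (C (Suc 0))"
  proof -
    have "z \<in> module_hom R (P (Suc 0)) N"
      unfolding z_def by (rule module_hom_cong[OF g]) (use closed in auto)
    then show ?thesis by (simp add: C_def Hom_group_def z_def)
  qed
  have "\<delta> (Suc 0) z = one (C (Suc (Suc 0)))"
    using gd module_hom_mem[OF dS]
    by (auto simp: \<delta>_def compose_def C_def Hom_group_def z_def intro!: restrict_ext)
  then have zG: "z \<in> carrier G" using zc by (simp add: G_def kernel_def)
  have one0: "one (C 0) \<in> carrier (C 0)"
  proof -
    have "(\<lambda>x\<in>carrier (P 0). \<zero>\<^bsub>N\<^esub>) \<in> module_hom R (P 0) N"
      by (rule module_homI) (use closed in auto)
    then show ?thesis by (simp add: C_def Hom_group_def)
  qed
  have "\<delta> 0 (one (C 0)) = one (C (Suc 0))"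
    using module_hom_mem[OF dS] by (auto simp: \<delta>_def compose_def C_def Hom_group_def intro!: restrict_ext)
  then have one1: "one (C (Suc 0)) \<in> \<delta> 0 ` carrier (C 0)"
    using one0 by (intro image_eqI[where x = "one (C 0)"]) simp_all
  have "one (C (Suc 0)) \<otimes>\<^bsub>C (Suc 0)\<^esub> z = z"
  proof
    fix x
    have "x \<in> carrier (P (Suc 0)) \<Longrightarrow> g x \<in> carrier N"
      using module_hom_mem[OF g] .
    then show "(one (C (Suc 0)) \<otimes>\<^bsub>C (Suc 0)\<^esub> z) x = z x"
      by (simp add: C_def Hom_group_def z_def)
  qed
  then have "z = one (C (Suc 0)) \<otimes>\<^bsub>G\<^esub> z" by (simp add: G_def)
  then have "z \<in> (\<delta> 0 ` carrier (C 0)) #>\<^bsub>G\<^esub> z"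
    unfolding r_coset_def using one1 by blast
  then have "z \<in> \<delta> 0 ` carrier (C 0)"
    by (rule trivial_Mod[OF triv[unfolded H] zG])
  then obtain h where h: "h \<in> carrier (C 0)" "z = \<delta> 0 h" by auto
  have "g x = h (d (Suc 0) x)" if x: "x \<in> carrier (P (Suc 0))" for x
  proof -
    have "z x = \<delta> 0 h x" using h(2) by simp
    then show ?thesis using x by (simp add: z_def \<delta>_def compose_def)
  qed
  moreover have "h \<in> module_hom R (P 0) N" using h(1) by (simp add: C_def Hom_group_def)
  ultimately show ?thesis by (intro bexI[of _ h]) auto
qed

end

text \<open>The maps \<open>\<alpha> : P\<^sub>0 \<rightarrow> R\<^sup>n\<close> and \<open>\<beta> : R\<^sup>n \<rightarrow> P\<^sub>0\<close> lift the identity of \<open>M\<close>. The cocycle \<open>f \<circ> \<alpha> \<circ> d\<^sub>1\<close> is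
  \<open>h \<circ> d\<^sub>1\<close> for some \<open>h\<close>, and \<open>x \<mapsto> h (\<beta> x) + f (x - \<alpha> (\<beta> x))\<close> extends \<open>f\<close>.\<close>

lemma Ext_one_extension:
  fixes R :: "('r, 'y) ring_scheme" and M :: "('r, nat \<Rightarrow> 'r) module" and N :: "('r, 'n) module"
  assumes M: "left_module R M" and N: "left_module R N"
    and res: "projective_resolution R M P d"
    and triv: "trivial_group (Hom_cohomology R P d N (Suc 0))"
    and p: "p \<in> module_hom R (free_module R n) M" "p ` carrier (free_module R n) = carrier M"
    and f: "f \<in> module_hom R ((free_module R n)\<lparr>carrier := a_kernel (free_module R n) M p\<rparr>) N"
  shows "\<exists>h\<in>module_hom R (free_module R n) N. \<forall>x\<in>a_kernel (free_module R n) M p. h x = f x"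
proof -
  let ?F = "free_module R n"
  let ?L = "a_kernel ?F M p"
  note P_proj = P_proj[OF M N res] and P_mod = P_mod[OF M N res] and d0 = d0[OF M N res]
    and dS = dS[OF M N res] and d0_surj = d0_surj[OF M N res] and ex0 = ex0[OF M N res]
    and exS = exS[OF M N res]
  interpret M: left_module R M by (rule M)
  interpret N: left_module R N by (rule N)
  have F: "left_module R ?F" by (rule free_left_module[OF M.ring])
  interpret F: left_module R ?F by (rule F)
  interpret P0: left_module R "P 0" by (rule P_mod)
  note Lsub = kernel_submodule[OF F M p(1)]
  note f_add = module_hom_add[OF f] and f_smult = module_hom_smult[OF f] and f_mem = module_hom_mem[OF f]
  have L: "x \<in> ?L \<longleftrightarrow> x \<in> carrier ?F \<and> p x = \<zero>\<^bsub>M\<^esub>" for x by (simp add: a_kernel_def')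
  \<comment> \<open>\<open>P 0\<close>, \<open>?F\<close> and \<open>M\<close> all have elements in
    \<open>nat \<Rightarrow> 'r\<close>, the type on which projectivity of \<open>P 0\<close> is
    tested.\<close>
  have "\<exists>\<alpha>\<in>module_hom R (P 0) ?F. \<forall>x\<in>carrier (P 0). p (\<alpha> x) = d 0 x"
    by (rule P_proj[of 0, unfolded projective_module_def, THEN conjunct2, rule_format, of ?F M p "d 0"])
      (intro conjI F M p d0)
  then obtain \<alpha> where a: "\<alpha> \<in> module_hom R (P 0) ?F" "\<forall>x\<in>carrier (P 0). p (\<alpha> x) = d 0 x" ..
  obtain \<beta> where b: "\<beta> \<in> module_hom R ?F (P 0)" "\<forall>x\<in>carrier ?F. d 0 (\<beta> x) = p x"
    using free_lift_surj[OF P_mod M d0 d0_surj p(1)] ..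
  have aL: "\<alpha> (d (Suc 0) x) \<in> ?L" if "x \<in> carrier (P (Suc 0))" for x
  proof -
    have "d (Suc 0) x \<in> a_kernel (P 0) M (d 0)" using that ex0 by blast
    then show ?thesis using a module_hom_mem[OF a(1)] by (simp add: a_kernel_def' del: free_module_simps)
  qed
  define g where "g x = f (\<alpha> (d (Suc 0) x))" for x
  have ad: "(\<lambda>x. \<alpha> (d (Suc 0) x)) \<in> module_hom R (P (Suc 0)) ?F"
    by (rule module_hom_comp[OF a(1) dS])
  have g: "g \<in> module_hom R (P (Suc 0)) N"
  proof (rule module_homI)
    show "g x \<in> carrier N" if "x \<in> carrier (P (Suc 0))" for x
      unfolding g_def using f_mem aL[OF that] by simp
    show "g (x \<oplus>\<^bsub>P (Suc 0)\<^esub> y) = g x \<oplus>\<^bsub>N\<^esub> g y"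
      if "x \<in> carrier (P (Suc 0))" "y \<in> carrier (P (Suc 0))" for x y
      unfolding g_def module_hom_add[OF ad that] using f_add[of "\<alpha> (d (Suc 0) x)" "\<alpha> (d (Suc 0) y)"] aL that
      by (simp del: free_module_simps add: free_module_def)
    show "g (r \<odot>\<^bsub>P (Suc 0)\<^esub> x) = r \<odot>\<^bsub>N\<^esub> g x"
      if "r \<in> carrier R" "x \<in> carrier (P (Suc 0))" for r x
      unfolding g_def module_hom_smult[OF ad that] using f_smult[of r "\<alpha> (d (Suc 0) x)"] aL that
      by (simp del: free_module_simps add: free_module_def)
  qed
  have gd: "g (d (Suc (Suc 0)) x) = \<zero>\<^bsub>N\<^esub>" if "x \<in> carrier (P (Suc (Suc 0)))" for x
  proof -
    have "d (Suc (Suc 0)) x \<in> a_kernel (P (Suc 0)) (P 0) (d (Suc 0))" using that exS[of 0] by blast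
    then have "d (Suc 0) (d (Suc (Suc 0)) x) = \<zero>\<^bsub>P 0\<^esub>" by (simp add: a_kernel_def')
    moreover have "\<alpha> \<zero>\<^bsub>P 0\<^esub> = \<zero>\<^bsub>?F\<^esub>"
      by (rule module_hom_zero[OF P0.abelian_group F.abelian_group a(1)])
    moreover have "f \<zero>\<^bsub>?F\<^esub> = \<zero>\<^bsub>N\<^esub>"
      using module_hom_zero[OF left_module.abelian_group[OF left_module_submodule[OF F Lsub]] N.abelian_group f]
      by simp
    ultimately show ?thesis by (simp add: g_def)
  qed
  obtain h where h: "h \<in> module_hom R (P 0) N" "\<forall>x\<in>carrier (P (Suc 0)). g x = h (d (Suc 0) x)"
    using Ext_one[OF M N res triv g, OF gd] ..
  \<comment> \<open>By exactness the kernel of the augmentation consists of boundaries, and on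
    boundaries the equation is the choice of \<open>h\<close>.\<close>
  have ker: "h y = f (\<alpha> y)" if "y \<in> carrier (P 0)" "d 0 y = \<zero>\<^bsub>M\<^esub>" for y
  proof -
    have "y \<in> d (Suc 0) ` carrier (P (Suc 0))"
      unfolding ex0 using that by (simp add: a_kernel_def')
    then show ?thesis using h(2) by (auto simp: g_def)
  qed
  define c where "c x = x \<ominus>\<^bsub>?F\<^esub> \<alpha> (\<beta> x)" for x
  have ab: "(\<lambda>x. \<alpha> (\<beta> x)) \<in> module_hom R ?F ?F" by (rule module_hom_comp[OF a(1) b(1)])
  have abm: "\<alpha> (\<beta> x) \<in> carrier ?F" if "x \<in> carrier ?F" for x using module_hom_mem[OF ab that] .
  have cL: "c x \<in> ?L" if x: "x \<in> carrier ?F" for x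
  proof -
    have "p (c x) = p x \<ominus>\<^bsub>M\<^esub> p (\<alpha> (\<beta> x))"
      unfolding c_def by (rule module_hom_diff[OF F.abelian_group M.abelian_group p(1) x abm[OF x]])
    also have "p (\<alpha> (\<beta> x)) = p x" using a(2) b(2) module_hom_mem[OF b(1) x] x by simp
    finally show ?thesis
      using x abm[OF x] module_hom_mem[OF p(1) x] unfolding L c_def
      by (simp only: F.M.minus_closed M.M.minus_other_side refl simp_thms)
  qed
  have c_add: "c (x \<oplus>\<^bsub>?F\<^esub> y) = c x \<oplus>\<^bsub>?F\<^esub> c y" if "x \<in> carrier ?F" "y \<in> carrier ?F" for x y
    unfolding c_def module_hom_add[OF ab that] a_minus_def using that abm
    by (simp only: F.M.minus_add F.M.a_ac F.M.a_closed F.M.a_inv_closed)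
  have c_smult: "c (r \<odot>\<^bsub>?F\<^esub> x) = r \<odot>\<^bsub>?F\<^esub> c x" if "r \<in> carrier R" "x \<in> carrier ?F" for r x
    unfolding c_def module_hom_smult[OF ab that] by (rule F.smult_diff[symmetric, OF that abm[OF that(2)]])
  define k where "k x = h (\<beta> x) \<oplus>\<^bsub>N\<^esub> f (c x)" for x
  have hb: "(\<lambda>x. h (\<beta> x)) \<in> module_hom R ?F N" by (rule module_hom_comp[OF h(1) b(1)])
  have hbm: "h (\<beta> x) \<in> carrier N" if "x \<in> carrier ?F" for x using module_hom_mem[OF hb that] .
  have fc: "f (c x) \<in> carrier N" if "x \<in> carrier ?F" for x using f_mem cL[OF that] by simp
  have fadd: "f (x \<oplus>\<^bsub>?F\<^esub> y) = f x \<oplus>\<^bsub>N\<^esub> f y" if "x \<in> ?L" "y \<in> ?L" for x y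
    using f_add[of x y] that by (simp add: free_module_def)
  have fsm: "f (r \<odot>\<^bsub>?F\<^esub> x) = r \<odot>\<^bsub>N\<^esub> f x" if "r \<in> carrier R" "x \<in> ?L" for x r
    using f_smult[of r x] that by (simp add: free_module_def)
  have k: "k \<in> module_hom R ?F N"
  proof (rule module_homI)
    show "k x \<in> carrier N" if "x \<in> carrier ?F" for x
      unfolding k_def using hbm fc that by blast
    show "k (x \<oplus>\<^bsub>?F\<^esub> y) = k x \<oplus>\<^bsub>N\<^esub> k y" if "x \<in> carrier ?F" "y \<in> carrier ?F" for x y
      unfolding k_def module_hom_add[OF hb that] c_add[OF that] fadd[OF cL[OF that(1)] cL[OF that(2)]]
      using hbm[OF that(1)] hbm[OF that(2)] fc[OF that(1)] fc[OF that(2)] by (simp add: N.M.a_ac)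
    show "k (r \<odot>\<^bsub>?F\<^esub> x) = r \<odot>\<^bsub>N\<^esub> k x" if "r \<in> carrier R" "x \<in> carrier ?F" for r x
      unfolding k_def module_hom_smult[OF hb that] c_smult[OF that] fsm[OF that(1) cL[OF that(2)]]
      using hbm[OF that(2)] fc[OF that(2)] that(1) by (simp add: N.smult_r_distr)
  qed
  have "k x = f x" if x: "x \<in> ?L" for x
  proof -
    have xF: "x \<in> carrier ?F" and px: "p x = \<zero>\<^bsub>M\<^esub>" using x L by auto
    have "d 0 (\<beta> x) = \<zero>\<^bsub>M\<^esub>" using b(2) xF px by simp
    then have hf: "h (\<beta> x) = f (\<alpha> (\<beta> x))" using ker module_hom_mem[OF b(1) xF] by simp
    have abL: "\<alpha> (\<beta> x) \<in> ?L"
      unfolding L using abm[OF xF] a(2) module_hom_mem[OF b(1) xF] \<open>d 0 (\<beta> x) = \<zero>\<^bsub>M\<^esub>\<close> by simp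
    \<comment> \<open>For \<open>x\<close> in the kernel, \<open>\<beta> x\<close> lies in the
      kernel of the augmentation. So \<open>h\<close> may be replaced by
      \<open>f \<circ> \<alpha>\<close>, and the two corrections in \<open>k\<close> recombine to
      \<open>f x\<close>.\<close>
    have "k x = f (\<alpha> (\<beta> x) \<oplus>\<^bsub>?F\<^esub> c x)"
      unfolding k_def hf by (rule fadd[symmetric, OF abL cL[OF xF]])
    also have "\<alpha> (\<beta> x) \<oplus>\<^bsub>?F\<^esub> c x = x"
      unfolding c_def a_minus_def using xF abm[OF xF]
      by (metis F.M.a_inv_closed F.M.a_lcomm F.M.r_neg F.M.r_zero)
    finally show ?thesis .
  qed
  then show ?thesis using k by (intro bexI[of _ k] ballI)
qed

section \<open>Quotients of a module realised inside its own type\<close>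

section \<open>Quotient modules on representatives\<close>

text \<open>A quotient by cosets would have sets as elements. Choosing one representative per coset
  keeps the quotient in the type of \<open>F\<close>, as \<open>GK_Cohen_Macaulay\<close> and the
  resolutions require.\<close>

definition coset_rep :: "('r, 'm, 'z) module_scheme \<Rightarrow> 'm set \<Rightarrow> 'm \<Rightarrow> 'm" where
  "coset_rep F N x = (SOME y. y \<in> carrier F \<and> y \<ominus>\<^bsub>F\<^esub> x \<in> N)"

definition rep_quotient :: "('r, 'm) module \<Rightarrow> 'm set \<Rightarrow> ('r, 'm) module" where
  "rep_quotient F N =
    \<lparr>carrier = coset_rep F N ` carrier F, mult = mult F, one = one F,
     zero = coset_rep F N \<zero>\<^bsub>F\<^esub>, add = (\<lambda>x y. coset_rep F N (x \<oplus>\<^bsub>F\<^esub> y)),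
     smult = (\<lambda>a x. coset_rep F N (a \<odot>\<^bsub>F\<^esub> x))\<rparr>"

lemma rep_quotient:
  assumes F: "left_module R F" and N: "Module.submodule N R F"
  shows rep_quotient_module: "left_module R (rep_quotient F N)"
    and coset_rep_hom: "coset_rep F N \<in> module_hom R F (rep_quotient F N)"
    and coset_rep_image: "coset_rep F N ` carrier F = carrier (rep_quotient F N)"
    and coset_rep_kernel: "a_kernel F (rep_quotient F N) (coset_rep F N) = N"
    and coset_rep_closed: "x \<in> carrier F \<Longrightarrow> coset_rep F N x \<in> carrier F"
    and coset_rep_diff: "x \<in> carrier F \<Longrightarrow> coset_rep F N x \<ominus>\<^bsub>F\<^esub> x \<in> N"
    and coset_rep_eq_iff: "x \<in> carrier F \<Longrightarrow> y \<in> carrier F \<Longrightarrow>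
      coset_rep F N x = coset_rep F N y \<longleftrightarrow> x \<ominus>\<^bsub>F\<^esub> y \<in> N"
    and rep_quotient_subset: "x \<in> carrier (rep_quotient F N) \<Longrightarrow> x \<in> carrier F"
    and coset_rep_id: "x \<in> carrier (rep_quotient F N) \<Longrightarrow> coset_rep F N x = x"
proof -
  interpret F: left_module R F by fact
  note d = F.submodule_dest[OF N]
  let ?r = "coset_rep F N" and ?Q = "rep_quotient F N"
  have zero: "\<ominus>\<^bsub>F\<^esub> \<zero>\<^bsub>F\<^esub> = \<zero>\<^bsub>F\<^esub>"
    by (rule F.M.minus_equality) simp_all
  show r: "?r x \<in> carrier F" "?r x \<ominus>\<^bsub>F\<^esub> x \<in> N" if "x \<in> carrier F" for x
  proof -
    have "x \<in> carrier F \<and> x \<ominus>\<^bsub>F\<^esub> x \<in> N" using that d(2) by (simp add: a_minus_def F.M.r_neg)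
    from someI[of "\<lambda>y. y \<in> carrier F \<and> y \<ominus>\<^bsub>F\<^esub> x \<in> N", OF this]
    show "?r x \<in> carrier F" "?r x \<ominus>\<^bsub>F\<^esub> x \<in> N" by (auto simp: coset_rep_def)
  qed
  have tri: "(x \<ominus>\<^bsub>F\<^esub> y) \<oplus>\<^bsub>F\<^esub> (y \<ominus>\<^bsub>F\<^esub> z) = x \<ominus>\<^bsub>F\<^esub> z"
    if "x \<in> carrier F" "y \<in> carrier F" "z \<in> carrier F" for x y z
  proof -
    have "(x \<ominus>\<^bsub>F\<^esub> y) \<oplus>\<^bsub>F\<^esub> (y \<ominus>\<^bsub>F\<^esub> z) = x \<oplus>\<^bsub>F\<^esub> ((\<ominus>\<^bsub>F\<^esub> y \<oplus>\<^bsub>F\<^esub> y) \<oplus>\<^bsub>F\<^esub> \<ominus>\<^bsub>F\<^esub> z)"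
      using that by (simp add: a_minus_def F.M.a_assoc)
    then show ?thesis using that by (simp add: F.M.l_neg a_minus_def)
  qed
  have neg: "\<ominus>\<^bsub>F\<^esub> (x \<ominus>\<^bsub>F\<^esub> y) = y \<ominus>\<^bsub>F\<^esub> x" if "x \<in> carrier F" "y \<in> carrier F" for x y
    using that by (simp add: a_minus_def F.M.minus_add F.M.a_comm)
  have eqI: "?r x = ?r y" if "x \<in> carrier F" "y \<in> carrier F" "x \<ominus>\<^bsub>F\<^esub> y \<in> N" for x y
  proof -
    have "u \<ominus>\<^bsub>F\<^esub> x \<in> N \<longleftrightarrow> u \<ominus>\<^bsub>F\<^esub> y \<in> N" if "u \<in> carrier F" for u
    proof
      assume "u \<ominus>\<^bsub>F\<^esub> x \<in> N"
      then have "(u \<ominus>\<^bsub>F\<^esub> x) \<oplus>\<^bsub>F\<^esub> (x \<ominus>\<^bsub>F\<^esub> y) \<in> N" using \<open>x \<ominus>\<^bsub>F\<^esub> y \<in> N\<close> d(3) by simp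
      then show "u \<ominus>\<^bsub>F\<^esub> y \<in> N" using tri that \<open>x \<in> _\<close> \<open>y \<in> _\<close> by simp
    next
      assume "u \<ominus>\<^bsub>F\<^esub> y \<in> N"
      moreover have "y \<ominus>\<^bsub>F\<^esub> x \<in> N" using d(5)[OF \<open>x \<ominus>\<^bsub>F\<^esub> y \<in> N\<close>] neg \<open>x \<in> _\<close> \<open>y \<in> _\<close> by simp
      ultimately have "(u \<ominus>\<^bsub>F\<^esub> y) \<oplus>\<^bsub>F\<^esub> (y \<ominus>\<^bsub>F\<^esub> x) \<in> N" using d(3) by simp
      then show "u \<ominus>\<^bsub>F\<^esub> x \<in> N" using tri that \<open>x \<in> _\<close> \<open>y \<in> _\<close> by simp
    qed
    \<comment> \<open>Congruent elements define the same predicate, so the choice operator returns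
      the same representative for both.\<close>
    then have "(\<lambda>u. u \<in> carrier F \<and> u \<ominus>\<^bsub>F\<^esub> x \<in> N) = (\<lambda>u. u \<in> carrier F \<and> u \<ominus>\<^bsub>F\<^esub> y \<in> N)" by auto
    then show ?thesis by (simp add: coset_rep_def)
  qed
  show "?r x = ?r y \<longleftrightarrow> x \<ominus>\<^bsub>F\<^esub> y \<in> N" if x: "x \<in> carrier F" and y: "y \<in> carrier F" for x y
  proof
    assume "?r x = ?r y"
    then have "(x \<ominus>\<^bsub>F\<^esub> ?r x) \<oplus>\<^bsub>F\<^esub> (?r x \<ominus>\<^bsub>F\<^esub> y) \<in> N"
      using d(3)[OF d(5)[OF r(2)[OF x]] r(2)[OF y]] neg[OF r(1)[OF x] x] by simp
    then show "x \<ominus>\<^bsub>F\<^esub> y \<in> N" unfolding tri[OF x r(1)[OF x] y] .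
  qed (rule eqI[OF x y])
  have rr: "?r (?r x) = ?r x" if "x \<in> carrier F" for x
    using eqI[OF r(1)[OF that] that r(2)[OF that]] .
  have add: "?r (?r x \<oplus>\<^bsub>F\<^esub> ?r y) = ?r (x \<oplus>\<^bsub>F\<^esub> y)" if "x \<in> carrier F" "y \<in> carrier F" for x y
  proof (rule eqI)
    have "(?r x \<oplus>\<^bsub>F\<^esub> ?r y) \<ominus>\<^bsub>F\<^esub> (x \<oplus>\<^bsub>F\<^esub> y) = (?r x \<ominus>\<^bsub>F\<^esub> x) \<oplus>\<^bsub>F\<^esub> (?r y \<ominus>\<^bsub>F\<^esub> y)"
      using r(1)[OF that(1)] r(1)[OF that(2)] that by (simp add: a_minus_def F.M.minus_add F.M.a_ac)
    then show "(?r x \<oplus>\<^bsub>F\<^esub> ?r y) \<ominus>\<^bsub>F\<^esub> (x \<oplus>\<^bsub>F\<^esub> y) \<in> N"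
      using r(2)[OF that(1)] r(2)[OF that(2)] d(3) by simp
  qed (use r that in auto)
  have smult: "?r (a \<odot>\<^bsub>F\<^esub> ?r x) = ?r (a \<odot>\<^bsub>F\<^esub> x)" if "a \<in> carrier R" "x \<in> carrier F" for a x
  proof (rule eqI)
    have "a \<odot>\<^bsub>F\<^esub> ?r x \<ominus>\<^bsub>F\<^esub> a \<odot>\<^bsub>F\<^esub> x = a \<odot>\<^bsub>F\<^esub> (?r x \<ominus>\<^bsub>F\<^esub> x)"
      by (rule F.smult_diff[symmetric, OF that(1) r(1)[OF that(2)] that(2)])
    then show "a \<odot>\<^bsub>F\<^esub> ?r x \<ominus>\<^bsub>F\<^esub> a \<odot>\<^bsub>F\<^esub> x \<in> N"
      using r(2)[OF that(2)] d(4)[OF that(1)] by simp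
  qed (use r that F.smult_closed in auto)
  have Q: "carrier ?Q = ?r ` carrier F" "\<zero>\<^bsub>?Q\<^esub> = ?r \<zero>\<^bsub>F\<^esub>"
    "\<And>x y. x \<in> carrier F \<Longrightarrow> y \<in> carrier F \<Longrightarrow> ?r x \<oplus>\<^bsub>?Q\<^esub> ?r y = ?r (x \<oplus>\<^bsub>F\<^esub> y)"
    "\<And>a x. a \<in> carrier R \<Longrightarrow> x \<in> carrier F \<Longrightarrow> a \<odot>\<^bsub>?Q\<^esub> ?r x = ?r (a \<odot>\<^bsub>F\<^esub> x)"
    using add smult by (simp_all add: rep_quotient_def)
  show "x \<in> carrier F" "?r x = x" if "x \<in> carrier ?Q" for x
    using that r(1) rr unfolding Q(1) by auto
  have "abelian_group ?Q"
  proof (rule abelian_groupI)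
    fix x assume "x \<in> carrier ?Q"
    then obtain u where u: "u \<in> carrier F" "x = ?r u" by (auto simp: Q)
    show "\<exists>y\<in>carrier ?Q. y \<oplus>\<^bsub>?Q\<^esub> x = \<zero>\<^bsub>?Q\<^esub>"
      using u by (intro bexI[of _ "?r (\<ominus>\<^bsub>F\<^esub> u)"]) (auto simp: Q F.M.l_neg)
  qed (auto simp: Q F.M.a_ac)
  then show "left_module R ?Q"
    by (intro left_module.intro F.ring)
      (auto simp: Q F.smult_closed F.smult_l_distr F.smult_r_distr F.smult_assoc F.smult_one)
  show "?r \<in> module_hom R F ?Q"
    by (rule module_homI) (auto simp: Q)
  show "?r ` carrier F = carrier ?Q" by (simp add: Q)
  have "?r x = ?r \<zero>\<^bsub>F\<^esub> \<longleftrightarrow> x \<in> N" if x: "x \<in> carrier F" for x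
  proof
    assume "?r x = ?r \<zero>\<^bsub>F\<^esub>"
    moreover have "?r \<zero>\<^bsub>F\<^esub> \<in> N" using r(2)[of "\<zero>\<^bsub>F\<^esub>"] r(1)[of "\<zero>\<^bsub>F\<^esub>"] by (simp add: a_minus_def zero)
    ultimately have "?r x \<in> N" by simp
    then have "?r x \<ominus>\<^bsub>F\<^esub> (?r x \<ominus>\<^bsub>F\<^esub> x) \<in> N" using d(6) r(2)[OF x] by simp
    moreover have "?r x \<ominus>\<^bsub>F\<^esub> (?r x \<ominus>\<^bsub>F\<^esub> x) = x"
      using x r(1)[OF x] by (simp add: a_minus_def F.M.minus_add F.M.a_assoc[symmetric] F.M.r_neg)
    ultimately show "x \<in> N" by simp
  next
    assume "x \<in> N"
    then show "?r x = ?r \<zero>\<^bsub>F\<^esub>" using eqI[OF x F.M.zero_closed] x by (simp add: a_minus_def zero)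
  qed
  then show "a_kernel F ?Q ?r = N"
    using d(1) by (auto simp: a_kernel_def' Q)
qed

text \<open>Elements of the quotient are elements of \<open>F\<close>, so the induced map is
  \<open>f\<close> itself.\<close>

lemma hom_rep_quotient:
  assumes F: "left_module R F" and N: "Module.submodule N R F" and L: "left_module R L"
    and f: "f \<in> module_hom R F L" and z: "\<And>x. x \<in> N \<Longrightarrow> f x = \<zero>\<^bsub>L\<^esub>"
  shows "f \<in> module_hom R (rep_quotient F N) L"
    and "\<And>x. x \<in> carrier F \<Longrightarrow> f (coset_rep F N x) = f x"
proof -
  interpret F: left_module R F by fact
  interpret L: left_module R L by fact
  note cr = coset_rep_closed[OF F N] coset_rep_diff[OF F N] rep_quotient_subset[OF F N]
  show e: "f (coset_rep F N x) = f x" if x: "x \<in> carrier F" for x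
  proof -
    have "f (coset_rep F N x \<ominus>\<^bsub>F\<^esub> x) = f (coset_rep F N x) \<ominus>\<^bsub>L\<^esub> f x"
      by (rule module_hom_diff[OF F.abelian_group L.abelian_group f cr(1)[OF x] x])
    then have "f (coset_rep F N x) \<ominus>\<^bsub>L\<^esub> f x = \<zero>\<^bsub>L\<^esub>" using z[OF cr(2)[OF x]] by simp
    then show ?thesis
      using L.M.minus_other_side[OF module_hom_mem[OF f cr(1)[OF x]] module_hom_mem[OF f x]] by simp
  qed
  show "f \<in> module_hom R (rep_quotient F N) L"
  proof (rule module_homI)
    fix x y assume x: "x \<in> carrier (rep_quotient F N)" and y: "y \<in> carrier (rep_quotient F N)"
    note xF = cr(3)[OF x] and yF = cr(3)[OF y]
    show "f x \<in> carrier L" by (rule module_hom_mem[OF f xF])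
    show "f (x \<oplus>\<^bsub>rep_quotient F N\<^esub> y) = f x \<oplus>\<^bsub>L\<^esub> f y"
      unfolding module_hom_add[OF f xF yF, symmetric] using e[of "x \<oplus>\<^bsub>F\<^esub> y"] xF yF
      by (simp add: rep_quotient_def)
  next
    fix a x assume a: "a \<in> carrier R" and x: "x \<in> carrier (rep_quotient F N)"
    note xF = cr(3)[OF x]
    show "f (a \<odot>\<^bsub>rep_quotient F N\<^esub> x) = a \<odot>\<^bsub>L\<^esub> f x"
      unfolding module_hom_smult[OF f a xF, symmetric] using e[of "a \<odot>\<^bsub>F\<^esub> x"] a xF
      by (simp add: rep_quotient_def F.smult_closed)
  qed
qed

lemma fin_gen_image_free:
  assumes M: "left_module R M"
    and p: "p \<in> module_hom R (free_module R n) M" "p ` carrier (free_module R n) = carrier M"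
  shows "fin_gen_module R M"
  unfolding fin_gen_module_def
proof (intro exI conjI allI impI)
  interpret M: left_module R M by fact
  let ?X = "(\<lambda>i. p (free_unit R i)) ` {..<n}"
  show "finite ?X" by simp
  show "?X \<subseteq> carrier M"
    by (intro image_subsetI module_hom_mem[OF p(1) free_unit_closed[OF M.ring]]) simp
  fix L assume L: "Module.submodule L R M \<and> ?X \<subseteq> L"
  have LM: "left_module R (M\<lparr>carrier := L\<rparr>)" using left_module_submodule[OF M] L by simp
  have LsubM: "x \<in> carrier M" if "x \<in> L" for x using M.submodule_dest(1)[OF conjunct1[OF L] that] .
  have pL: "p (free_unit R i) \<in> carrier (M\<lparr>carrier := L\<rparr>)" if "i < n" for i using L that by auto
  \<comment> \<open>As for \<open>fg_surjection\<close>: the map built inside \<open>L\<close> from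
    the images of the unit vectors coincides with \<open>p\<close>, which forces the image of
    \<open>p\<close> into \<open>L\<close>.\<close>
  let ?h = "free_ext n (M\<lparr>carrier := L\<rparr>) (\<lambda>i. p (free_unit R i))"
  have h: "?h \<in> module_hom R (free_module R n) (M\<lparr>carrier := L\<rparr>)"
    by (rule free_ext_hom(1)[OF LM pL])
  have hM: "?h \<in> module_hom R (free_module R n) M"
  proof (rule module_homI)
    show "?h x \<in> carrier M" if "x \<in> carrier (free_module R n)" for x
      using module_hom_mem[OF h that] by (intro LsubM) (simp del: free_module_simps)
    show "?h (x \<oplus>\<^bsub>free_module R n\<^esub> y) = ?h x \<oplus>\<^bsub>M\<^esub> ?h y"
      if "x \<in> carrier (free_module R n)" "y \<in> carrier (free_module R n)" for x y
      using module_hom_add[OF h that] by (simp del: free_module_simps)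
    show "?h (r \<odot>\<^bsub>free_module R n\<^esub> x) = r \<odot>\<^bsub>M\<^esub> ?h x"
      if "r \<in> carrier R" "x \<in> carrier (free_module R n)" for r x
      using module_hom_smult[OF h that] by (simp del: free_module_simps)
  qed
  have "p x \<in> L" if x: "x \<in> carrier (free_module R n)" for x
  proof -
    have "p x = ?h x"
      by (rule free_module_hom_eqI[OF M p(1) hM _ x]) (rule free_ext_hom(2)[OF LM pL, symmetric])
    then show ?thesis using module_hom_mem[OF h x] by simp
  qed
  then have "p ` carrier (free_module R n) \<subseteq> L" by (rule image_subsetI)
  then have "carrier M \<subseteq> L" by (simp only: p(2))
  moreover have "L \<subseteq> carrier M" by (rule subsetI) (rule LsubM)
  ultimately show "L = carrier M" by (intro equalityI)
qed

text \<open>The infimum in \<open>grade\<close> exceeds one only if degrees zero and one contribute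
  nothing. Both degrees use the same chosen resolution, which is a genuine one by
  \<open>ex\<close>.\<close>

lemma grade_gt_one:
  fixes R :: "('r, 'y) ring_scheme" and M :: "('r, nat \<Rightarrow> 'r) module"
  assumes ex: "\<exists>P d. projective_resolution R M P d" and gr: "grade R M > 1"
  shows "\<exists>P d. projective_resolution R M P d \<and>
    trivial_group (Hom_cohomology R P d (regular_module R) 0) \<and>
    trivial_group (Hom_cohomology R P d (regular_module R) (Suc 0))"
proof -
  define Pd where "Pd = (SOME (P, d). projective_resolution R M P d)"
  have "\<exists>x. case x of (P, d) \<Rightarrow> projective_resolution R M P d" using ex by simp
  then have res: "case Pd of (P, d) \<Rightarrow> projective_resolution R M P d"
    unfolding Pd_def by (rule someI_ex)
  have Ext: "Ext R i M (regular_module R) = (case Pd of (P, d) \<Rightarrow> Hom_cohomology R P d (regular_module R) i)" for i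
    unfolding Ext_def Pd_def Let_def by (rule refl)
  have triv: "carrier (Ext R i M (regular_module R)) = {one (Ext R i M (regular_module R))}" if "i \<le> 1" for i
  proof (rule ccontr)
    assume "carrier (Ext R i M (regular_module R)) \<noteq> {one (Ext R i M (regular_module R))}"
    then have "grade R M \<le> ereal (real i)"
      unfolding grade_def by (intro INF_lower) simp
    also have "\<dots> \<le> 1" using that by simp
    finally show False using gr by simp
  qed
  obtain P d where Pd: "Pd = (P, d)" by (cases Pd)
  show ?thesis
    using res triv[of 0] triv[of "Suc 0"] unfolding Ext Pd trivial_group_def
    by (intro exI[of _ P] exI[of _ d]) simp
qed

text \<open>Vanishing of Hom and first Ext of the quotient, restated for the free module and
  \<open>N\<close>. A zero quotient is treated apart: the grade condition says nothing about it, and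
  then \<open>N\<close> is everything and both claims are immediate.\<close>

lemma rep_quotient_grade:
  fixes R :: "('r, 'y) ring_scheme"
  assumes R: "ring R" and noeth: "left_noetherian R"
    and N: "Module.submodule N R (free_module R n)"
    and gr: "carrier (rep_quotient (free_module R n) N) \<noteq> {\<zero>\<^bsub>rep_quotient (free_module R n) N\<^esub>} \<longrightarrow>
      grade R (rep_quotient (free_module R n) N) > 1"
  shows "\<forall>f\<in>module_hom R (free_module R n) (regular_module R).
      (\<forall>x\<in>N. f x = \<zero>\<^bsub>R\<^esub>) \<longrightarrow> (\<forall>x\<in>carrier (free_module R n). f x = \<zero>\<^bsub>R\<^esub>)"
    and "\<forall>g\<in>module_hom R ((free_module R n)\<lparr>carrier := N\<rparr>) (regular_module R).
      \<exists>h\<in>module_hom R (free_module R n) (regular_module R). \<forall>x\<in>N. h x = g x"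
proof -
  let ?F = "free_module R n" and ?M = "rep_quotient (free_module R n) N"
  have F: "left_module R ?F" by (rule free_left_module[OF R])
  have Reg: "left_module R (regular_module R)" by (rule regular_left_module[OF R])
  note rq = rep_quotient[OF F N]
  interpret M: left_module R ?M by (rule rq(1))
  interpret F: left_module R ?F by (rule F)
  have zero: "N = carrier ?F" if "carrier ?M = {\<zero>\<^bsub>?M\<^esub>}"
  proof -
    have "coset_rep ?F N x = \<zero>\<^bsub>?M\<^esub>" if "x \<in> carrier ?F" for x
      using module_hom_mem[OF rq(2) that] \<open>carrier ?M = _\<close> by simp
    then have "a_kernel ?F ?M (coset_rep ?F N) = carrier ?F"
      by (auto simp: a_kernel_def' simp del: free_module_simps)
    then show ?thesis using rq(4) by simp
  qed
  have res: "\<exists>P d. projective_resolution R ?M P d \<and>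
    trivial_group (Hom_cohomology R P d (regular_module R) 0) \<and>
    trivial_group (Hom_cohomology R P d (regular_module R) (Suc 0))"
    if "carrier ?M \<noteq> {\<zero>\<^bsub>?M\<^esub>}"
    by (rule grade_gt_one[OF free_resolution_exists[OF R noeth rq(1) rq(2,3)] gr[rule_format, OF that]])
  have "f x = \<zero>\<^bsub>R\<^esub>" if f: "f \<in> module_hom R ?F (regular_module R)"
    and z: "\<forall>x\<in>N. f x = \<zero>\<^bsub>R\<^esub>" and x: "x \<in> carrier ?F" for f x
  proof (cases "carrier ?M = {\<zero>\<^bsub>?M\<^esub>}")
    case True
    then show ?thesis using zero z x by simp
  next
    case False
    from res[OF False] obtain P d where P: "projective_resolution R ?M P d"
      "trivial_group (Hom_cohomology R P d (regular_module R) 0)" by (elim exE conjE)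
    have z': "f x = \<zero>\<^bsub>regular_module R\<^esub>" if "x \<in> N" for x
      using z that by (simp add: regular_module_def)
    note q = hom_rep_quotient[OF F N Reg f z']
    have "f (coset_rep ?F N x) = \<zero>\<^bsub>regular_module R\<^esub>"
      by (rule Ext_zero[OF rq(1) Reg P q(1) module_hom_mem[OF rq(2) x]])
    then show ?thesis using q(2)[OF _ x] by (simp add: regular_module_def)
  qed
  then show "\<forall>f\<in>module_hom R ?F (regular_module R).
      (\<forall>x\<in>N. f x = \<zero>\<^bsub>R\<^esub>) \<longrightarrow> (\<forall>x\<in>carrier ?F. f x = \<zero>\<^bsub>R\<^esub>)" by (intro ballI impI)
  have "\<exists>h\<in>module_hom R ?F (regular_module R). \<forall>x\<in>N. h x = g x"
    if g: "g \<in> module_hom R (?F\<lparr>carrier := N\<rparr>) (regular_module R)" for g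
  proof (cases "carrier ?M = {\<zero>\<^bsub>?M\<^esub>}")
    case True
    then have "?F\<lparr>carrier := N\<rparr> = ?F" using zero by simp
    then show ?thesis using g by (intro bexI[of _ g]) simp_all
  next
    case False
    from res[OF False] obtain P d where P: "projective_resolution R ?M P d"
      "trivial_group (Hom_cohomology R P d (regular_module R) (Suc 0))" by (elim exE conjE)
    from Ext_one_extension[OF rq(1) Reg P rq(2,3), of g] show ?thesis
      using g unfolding rq(4) by simp
  qed
  then show "\<forall>g\<in>module_hom R (?F\<lparr>carrier := N\<rparr>) (regular_module R).
      \<exists>h\<in>module_hom R ?F (regular_module R). \<forall>x\<in>N. h x = g x" by (intro ballI)
qed

section \<open>Comparison of dimensions, growth functions and GK dimension\<close>

section \<open>Dimension and growth\<close>

text \<open>Finite dimension of \<open>V\<close> is part of the conclusion. Independent sets of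
  \<open>V\<close> have independent images, so their sizes are bounded, and a maximal one is a
  basis.\<close>

lemma inj_linear_dim:
  assumes V: "vectorspace K V" and V': "vectorspace K V'"
    and f: "f \<in> module_hom K V V'" and inj: "inj_on f (carrier V)"
    and fd: "vectorspace.fin_dim K V'"
  shows "vectorspace.fin_dim K V" "vectorspace.dim K V \<le> vectorspace.dim K V'"
proof -
  interpret V: vectorspace K V by fact
  interpret V': vectorspace K V' by fact
  have li: "V'.lin_indpt (f ` A)" if A: "A \<subseteq> carrier V" "V.lin_indpt A" for A
  proof
    assume "V'.lin_dep (f ` A)"
    then obtain C a v where C: "finite C" "C \<subseteq> f ` A" "a \<in> C \<rightarrow> carrier K"
      "V'.lincomb a C = \<zero>\<^bsub>V'\<^esub>" "v \<in> C" "a v \<noteq> \<zero>\<^bsub>K\<^esub>"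
      unfolding V'.lin_dep_def by (elim exE conjE)
    obtain A0 where A0: "A0 \<subseteq> A" "finite A0" "C = f ` A0" using finite_subset_image[OF C(1,2)] by blast
    have A0V: "A0 \<subseteq> carrier V" using A0 A by auto
    have inj0: "inj_on f A0" by (rule inj_on_subset[OF inj A0V])
    have aK: "a (f x) \<in> carrier K" if "x \<in> A0" for x using C(3) A0(3) that by auto
    have "f (V.lincomb (\<lambda>x. a (f x)) A0) = (\<Oplus>\<^bsub>V'\<^esub>x\<in>A0. f (a (f x) \<odot>\<^bsub>V\<^esub> x))"
      unfolding V.lincomb_def
      by (rule module_hom_finsum[OF V.M.abelian_group_axioms V'.M.abelian_group_axioms f])
        (use aK A0V in auto)
    also have "\<dots> = (\<Oplus>\<^bsub>V'\<^esub>x\<in>A0. a (f x) \<odot>\<^bsub>V'\<^esub> f x)"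
      by (rule V'.M.finsum_cong')
        (use aK A0V module_hom_mem[OF f] in \<open>auto simp: module_hom_smult[OF f] subsetD\<close>)
    also have "\<dots> = V'.lincomb a C"
      unfolding V'.lincomb_def A0(3)
      by (rule V'.M.add.finprod_reindex[symmetric])
        (use aK A0V module_hom_mem[OF f] inj0 in \<open>auto simp: subsetD\<close>)
    also have "\<dots> = f \<zero>\<^bsub>V\<^esub>"
      using C(4) module_hom_zero[OF V.M.abelian_group_axioms V'.M.abelian_group_axioms f] by simp
    finally have "V.lincomb (\<lambda>x. a (f x)) A0 = \<zero>\<^bsub>V\<^esub>"
      by (rule inj_onD[OF inj]) (use aK A0V in auto)
    moreover obtain x where "x \<in> A0" "v = f x" using C(5) A0(3) by auto
    ultimately have "V.lin_dep A"
      unfolding V.lin_dep_def using A0 aK C(6)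
      by (intro exI[of _ A0] exI[of _ "\<lambda>x. a (f x)"] exI[of _ x]) auto
    then show False using A(2) by simp
  qed
  have bound: "finite A \<and> card A \<le> V'.dim" if A: "A \<subseteq> carrier V \<and> V.lin_indpt A" for A
  proof -
    have fA: "f ` A \<subseteq> carrier V'" using A module_hom_mem[OF f] by auto
    have injA: "inj_on f A" using inj A by (auto intro: inj_on_subset)
    have "finite (f ` A)" "card (f ` A) \<le> V'.dim"
      using V'.li_le_dim[OF fd fA li] A by auto
    then show ?thesis using finite_imageD[OF _ injA] card_image[OF injA] by auto
  qed
  have empty: "{} \<subseteq> carrier V \<and> V.lin_indpt {}" by (simp add: V.lin_dep_def)
  obtain A where A: "finite A" "maximal A (\<lambda>S. S \<subseteq> carrier V \<and> V.lin_indpt S)"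
    using maximal_exists[of "\<lambda>S. S \<subseteq> carrier V \<and> V.lin_indpt S" "V'.dim" "{}", OF bound empty] by blast
  have B: "V.basis A" by (rule V.max_li_is_basis[OF A(2)])
  then show "V.fin_dim" using A(1) by (auto simp: V.fin_dim_def V.basis_def)
  have "A \<subseteq> carrier V \<and> V.lin_indpt A" using B by (simp add: V.basis_def)
  then show "V.dim \<le> V'.dim" using bound V.dim_basis[OF A(1) B] by simp
qed

lemma preimage_submodule:
  assumes V: "vectorspace K V" and V': "vectorspace K V'"
    and f: "f \<in> module_hom K V V'" and W: "LinearCombinations.submodule K W V'"
  shows "LinearCombinations.submodule K {x \<in> carrier V. f x \<in> W} V"
proof -
  interpret V: vectorspace K V by fact
  interpret V': vectorspace K V' by fact
  interpret W: LinearCombinations.submodule K W V' by fact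
  show ?thesis
    by (rule LinearCombinations.submodule.intro)
      (auto simp: module_hom_add[OF f] module_hom_smult[OF f] V.module_axioms
        module_hom_zero[OF V.M.abelian_group_axioms V'.M.abelian_group_axioms f])
qed

lemma span_vectorspace:
  assumes V: "vectorspace K V" and X: "X \<subseteq> carrier V"
  shows "vectorspace K (V\<lparr>carrier := LinearCombinations.module.span K V X\<rparr>)"
  using V X by (intro vectorspace.subspace_is_vs vectorspace.span_is_subspace)

lemma span_fin_dim:
  assumes V: "vectorspace K V" and X: "X \<subseteq> carrier V" "X \<subseteq> LinearCombinations.module.span K V Y"
    and Y: "finite Y" "Y \<subseteq> carrier V"
  shows "vectorspace.fin_dim K (V\<lparr>carrier := LinearCombinations.module.span K V X\<rparr>)"
proof -
  interpret V: vectorspace K V by fact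
  have sub: "LinearCombinations.submodule K (V.span Y) V" by (rule V.span_is_submodule[OF Y(2)])
  have incl: "V.span X \<subseteq> V.span Y" by (rule V.span_is_subset[OF X(2) sub])
  interpret SY: vectorspace K "V.vs (V.span Y)" by (rule span_vectorspace[OF V Y(2)])
  have "SY.span Y = V.span Y"
    by (rule V.span_li_not_depend(1)[OF V.in_own_span[OF Y(2)] sub])
  then have "SY.fin_dim"
    unfolding SY.fin_dim_def using Y V.in_own_span[OF Y(2)] by (intro exI[of _ Y]) simp
  then show ?thesis
    by (intro inj_linear_dim(1)[OF span_vectorspace[OF V X(1)] SY.vectorspace_axioms, of "\<lambda>x. x"])
      (use incl in \<open>auto intro!: module_homI inj_onI\<close>)
qed

text \<open>The comparison behind all growth estimates. Finite dimension of the larger span is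
  required because \<open>inj_linear_dim\<close> bounds independent sets by it.\<close>

lemma span_dim_le:
  assumes V: "vectorspace K V" and V': "vectorspace K V'"
    and f: "f \<in> module_hom K V V'" and inj: "inj_on f (carrier V)"
    and X: "X \<subseteq> carrier V" and X': "X' \<subseteq> carrier V'" and im: "f ` X \<subseteq> X'"
    and fd: "vectorspace.fin_dim K (V'\<lparr>carrier := LinearCombinations.module.span K V' X'\<rparr>)"
  shows "vectorspace.dim K (V\<lparr>carrier := LinearCombinations.module.span K V X\<rparr>) \<le>
    vectorspace.dim K (V'\<lparr>carrier := LinearCombinations.module.span K V' X'\<rparr>)"
proof -
  interpret V: vectorspace K V by fact
  interpret V': vectorspace K V' by fact
  have "LinearCombinations.submodule K {x \<in> carrier V. f x \<in> V'.span X'} V"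
    by (rule preimage_submodule[OF V V' f V'.span_is_submodule[OF X']])
  then have sp: "V.span X \<subseteq> {x \<in> carrier V. f x \<in> V'.span X'}"
    by (intro V.span_is_subset) (use X im V'.in_own_span[OF X'] in auto)
  have "f \<in> module_hom K (V.vs (V.span X)) (V'.vs (V'.span X'))"
    using sp by (intro module_homI) (auto simp: module_hom_add[OF f] module_hom_smult[OF f] subset_iff)
  moreover have "inj_on f (carrier (V.vs (V.span X)))"
    using sp by (auto intro: inj_on_subset[OF inj])
  ultimately show ?thesis
    by (rule inj_linear_dim(2)[OF span_vectorspace[OF V X] span_vectorspace[OF V' X'] _ _ fd])
qed

lemma fin_dim_subspaceD:
  assumes V: "vectorspace K V" and W: "W \<in> fin_dim_subspaces K V"
  shows "\<exists>G. finite G \<and> G \<subseteq> carrier V \<and> W = LinearCombinations.module.span K V G"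
proof -
  interpret V: vectorspace K V by fact
  have sub: "subspace K W V" and fd: "vectorspace.fin_dim K (V.vs W)"
    using W by (auto simp: fin_dim_subspaces_def)
  have Wm: "LinearCombinations.submodule K W V" using sub by (simp add: subspace_def)
  interpret W: vectorspace K "V.vs W" by (rule V.subspace_is_vs[OF sub])
  obtain G where G: "finite G" "G \<subseteq> W" "W.span G = W"
    using fd unfolding W.fin_dim_def by auto
  have "W.span G = V.span G" by (rule V.span_li_not_depend(1)[OF G(2) Wm])
  then show ?thesis using G Wm by (intro exI[of _ G]) (auto simp: LinearCombinations.submodule_def)
qed

lemma span_fin_dim_subspace:
  assumes V: "vectorspace K V" and G: "finite G" "G \<subseteq> carrier V"
  shows "LinearCombinations.module.span K V G \<in> fin_dim_subspaces K V"
proof -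
  interpret V: vectorspace K V by fact
  show ?thesis
    using span_fin_dim[OF V G(2) V.in_own_span[OF G(2)] G] V.span_is_subspace[OF G(2)]
    by (simp add: fin_dim_subspaces_def)
qed

lemma restrict_scalars_simps [simp]:
  "carrier (restrict_scalars A M) = carrier M" "zero (restrict_scalars A M) = zero M"
  "add (restrict_scalars A M) = add M"
  "smult (restrict_scalars A M) c m = smult M (smult A c (one A)) m"
  by (simp_all add: restrict_scalars_def)

lemma restrict_scalars_vectorspace:
  assumes A: "assoc_algebra K A" and M: "left_module A M"
  shows "vectorspace K (restrict_scalars A M)"
proof -
  interpret A: assoc_algebra K A by fact
  interpret V: vectorspace K A by (rule A.vectorspace)
  interpret AR: ring A by (rule A.ring)
  interpret M: left_module A M by fact
  have "abelian_group (restrict_scalars A M)"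
  proof (rule abelian_groupI)
    show "\<exists>y\<in>carrier (restrict_scalars A M).
        y \<oplus>\<^bsub>restrict_scalars A M\<^esub> x = \<zero>\<^bsub>restrict_scalars A M\<^esub>"
      if "x \<in> carrier (restrict_scalars A M)" for x
      using that by (intro bexI[of _ "\<ominus>\<^bsub>M\<^esub> x"]) (auto simp: M.M.l_neg)
  qed (auto simp: M.M.a_ac)
  moreover have "(a \<odot>\<^bsub>A\<^esub> \<one>\<^bsub>A\<^esub>) \<odot>\<^bsub>M\<^esub> ((b \<odot>\<^bsub>A\<^esub> \<one>\<^bsub>A\<^esub>) \<odot>\<^bsub>M\<^esub> x) = ((a \<otimes>\<^bsub>K\<^esub> b) \<odot>\<^bsub>A\<^esub> \<one>\<^bsub>A\<^esub>) \<odot>\<^bsub>M\<^esub> x"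
    if "a \<in> carrier K" "b \<in> carrier K" "x \<in> carrier M" for a b x
    using that by (simp add: M.smult_assoc[symmetric] A.smult_mult_left V.smult_assoc1)
  ultimately have "Module.module K (restrict_scalars A M)"
    by (intro moduleI vectorspaceD(2)[OF A.vectorspace])
      (auto simp: M.smult_closed M.smult_r_distr V.smult_l_distr M.smult_l_distr M.smult_one)
  then show ?thesis by (intro vectorspace.intro vectorspaceD(1)[OF A.vectorspace])
qed

context
  fixes K :: "('k, 'm) ring_scheme" and A :: "('k, 'a) module"
  assumes A: "assoc_algebra K A"
begin

interpretation A: assoc_algebra K A by (rule A)
interpretation V: vectorspace K A by (rule A.vectorspace)
interpretation AR: ring A by (rule A.ring)

abbreviation U where "U \<equiv> restrict_scalars A (regular_module A)"
abbreviation pow where "pow W i \<equiv> power_action (regular_module A) W {\<one>\<^bsub>A\<^esub>} i"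

lemma U_vectorspace: "vectorspace K U"
  by (rule restrict_scalars_vectorspace[OF A regular_left_module[OF A.ring]])

interpretation U: vectorspace K U by (rule U_vectorspace)

lemma U_carrier: "carrier U = carrier A" "\<zero>\<^bsub>U\<^esub> = \<zero>\<^bsub>A\<^esub>" "add U = add A"
  by (simp_all add: restrict_scalars_def regular_module_def)

lemma U_smult: "c \<in> carrier K \<Longrightarrow> x \<in> carrier A \<Longrightarrow> c \<odot>\<^bsub>U\<^esub> x = c \<odot>\<^bsub>A\<^esub> x"
  by (simp add: regular_module_def A.smult_mult_left)

lemma regular_smult: "smult (regular_module A) = mult A" by (simp add: regular_module_def)

lemma pow_closed: "W \<subseteq> carrier A \<Longrightarrow> pow W i \<subseteq> carrier A"
  by (induction i) (auto simp: regular_smult)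

text \<open>Powers are built by multiplying from the left, while a right module action turns into
  multiplication from the right; by associativity either leads to the next power.\<close>

lemma pow_right: "W \<subseteq> carrier A \<Longrightarrow> x \<in> pow W i \<Longrightarrow> w \<in> W \<Longrightarrow> x \<otimes>\<^bsub>A\<^esub> w \<in> pow W (Suc i)"
proof (induction i arbitrary: x)
  case 0
  then have "x \<otimes>\<^bsub>A\<^esub> w = w \<otimes>\<^bsub>A\<^esub> \<one>\<^bsub>A\<^esub>" by auto
  then show ?case using 0 by (auto simp: regular_smult)
next
  case (Suc i)
  then obtain v y where vy: "v \<in> W" "y \<in> pow W i" "x = v \<otimes>\<^bsub>A\<^esub> y" by (auto simp: regular_smult)
  have "y \<in> carrier A" using vy pow_closed[OF Suc.prems(1)] by blast
  then have "x \<otimes>\<^bsub>A\<^esub> w = v \<otimes>\<^bsub>A\<^esub> (y \<otimes>\<^bsub>A\<^esub> w)" using vy Suc.prems by (auto simp: AR.m_assoc subsetD)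
  moreover have "y \<otimes>\<^bsub>A\<^esub> w \<in> pow W (Suc i)" by (rule Suc.IH[OF Suc.prems(1) vy(2) Suc.prems(3)])
  ultimately show ?case using vy(1) unfolding power_action.simps(2)[of _ _ _ "Suc i"] regular_smult by blast
qed

text \<open>Products of elements of a span lie in the span of the products of generators. This
  bounds the spaces in the growth function by finite-dimensional ones.\<close>

lemma pow_span:
  assumes G: "finite G" "G \<subseteq> carrier A"
  shows "\<exists>Y. finite Y \<and> Y \<subseteq> carrier A \<and> pow (V.span G) i \<subseteq> U.span Y"
proof (induction i)
  case 0
  then show ?case
    using U.in_own_span[of "{\<one>\<^bsub>A\<^esub>}"] by (intro exI[of _ "{\<one>\<^bsub>A\<^esub>}"]) (auto simp: U_carrier)
next
  case (Suc i)
  then obtain Y where Y: "finite Y" "Y \<subseteq> carrier A" "pow (V.span G) i \<subseteq> U.span Y" by blast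
  define Z where "Z = (\<lambda>(g, y). g \<otimes>\<^bsub>A\<^esub> y) ` (G \<times> Y)"
  have Z: "finite Z" "Z \<subseteq> carrier A" using G Y by (auto simp: Z_def)
  have ZU: "Z \<subseteq> carrier U" and YU: "Y \<subseteq> carrier U" using Z Y by (simp_all add: U_carrier)
  interpret SZ: LinearCombinations.submodule K "U.span Z" U by (rule U.span_is_submodule[OF ZU])
  have SZ_smult: "c \<odot>\<^bsub>A\<^esub> x \<in> U.span Z" if "c \<in> carrier K" "x \<in> U.span Z" for c x
    using SZ.smult_closed[OF that] U_smult[OF that(1), of x] that SZ.subset by (auto simp: U_carrier subset_iff)
  have gU: "g \<otimes>\<^bsub>A\<^esub> y \<in> U.span Z" if g: "g \<in> G" and y: "y \<in> U.span Y" for g y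
  proof -
    have gA: "g \<in> carrier A" using g G by auto
    have "LinearCombinations.submodule K {y \<in> carrier A. g \<otimes>\<^bsub>A\<^esub> y \<in> U.span Z} U"
    proof (rule LinearCombinations.submodule.intro)
      show "x \<oplus>\<^bsub>U\<^esub> y \<in> {y \<in> carrier A. g \<otimes>\<^bsub>A\<^esub> y \<in> U.span Z}"
        if "x \<in> {y \<in> carrier A. g \<otimes>\<^bsub>A\<^esub> y \<in> U.span Z}" "y \<in> {y \<in> carrier A. g \<otimes>\<^bsub>A\<^esub> y \<in> U.span Z}" for x y
        using that gA SZ.m_closed[of "g \<otimes>\<^bsub>A\<^esub> x" "g \<otimes>\<^bsub>A\<^esub> y"] by (simp add: U_carrier AR.r_distr)
      show "c \<odot>\<^bsub>U\<^esub> x \<in> {y \<in> carrier A. g \<otimes>\<^bsub>A\<^esub> y \<in> U.span Z}"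
        if "c \<in> carrier K" "x \<in> {y \<in> carrier A. g \<otimes>\<^bsub>A\<^esub> y \<in> U.span Z}" for c x
        using that gA SZ_smult[of c "g \<otimes>\<^bsub>A\<^esub> x"] U_smult[of c x] by (auto simp: A.smult_mult_right)
      show "\<zero>\<^bsub>U\<^esub> \<in> {y \<in> carrier A. g \<otimes>\<^bsub>A\<^esub> y \<in> U.span Z}"
        using SZ.zero_closed gA by (simp add: U_carrier)
    qed (auto simp: U_carrier U.module_axioms)
    then have "U.span Y \<subseteq> {y \<in> carrier A. g \<otimes>\<^bsub>A\<^esub> y \<in> U.span Z}"
      by (rule U.span_is_subset[rotated])
        (use U.in_own_span[OF ZU] g Y in \<open>auto simp: Z_def\<close>)
    then show ?thesis using y by auto
  qed
  have vU: "v \<otimes>\<^bsub>A\<^esub> y \<in> U.span Z" if v: "v \<in> V.span G" and y: "y \<in> U.span Y" for v y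
  proof -
    have yA: "y \<in> carrier A" using y U.span_closed[OF YU] by (simp add: U_carrier)
    have "LinearCombinations.submodule K {v \<in> carrier A. v \<otimes>\<^bsub>A\<^esub> y \<in> U.span Z} A"
    proof (rule LinearCombinations.submodule.intro)
      show "x \<oplus>\<^bsub>A\<^esub> x' \<in> {v \<in> carrier A. v \<otimes>\<^bsub>A\<^esub> y \<in> U.span Z}"
        if "x \<in> {v \<in> carrier A. v \<otimes>\<^bsub>A\<^esub> y \<in> U.span Z}" "x' \<in> {v \<in> carrier A. v \<otimes>\<^bsub>A\<^esub> y \<in> U.span Z}" for x x'
        using that yA SZ.m_closed[of "x \<otimes>\<^bsub>A\<^esub> y" "x' \<otimes>\<^bsub>A\<^esub> y"] by (simp add: U_carrier AR.l_distr)
      show "c \<odot>\<^bsub>A\<^esub> x \<in> {v \<in> carrier A. v \<otimes>\<^bsub>A\<^esub> y \<in> U.span Z}"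
        if "c \<in> carrier K" "x \<in> {v \<in> carrier A. v \<otimes>\<^bsub>A\<^esub> y \<in> U.span Z}" for c x
        using that yA SZ_smult[of c "x \<otimes>\<^bsub>A\<^esub> y"] by (auto simp: A.smult_mult_left)
      show "\<zero>\<^bsub>A\<^esub> \<in> {v \<in> carrier A. v \<otimes>\<^bsub>A\<^esub> y \<in> U.span Z}"
        using SZ.zero_closed yA by (simp add: U_carrier)
    qed (auto simp: V.module_axioms)
    then have "V.span G \<subseteq> {v \<in> carrier A. v \<otimes>\<^bsub>A\<^esub> y \<in> U.span Z}"
      by (rule V.span_is_subset[rotated]) (use gU y G in auto)
    then show ?thesis using v by auto
  qed
  have "pow (V.span G) (Suc i) \<subseteq> U.span Z"
    using vU Y(3) by (auto simp: regular_smult)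
  then show ?case using Z by blast
qed

lemma pow_span_fin_dim:
  assumes G: "finite G" "G \<subseteq> carrier A"
  shows "vectorspace.fin_dim K (U\<lparr>carrier := U.span (\<Union>i\<le>n. pow (V.span G) i)\<rparr>)"
proof -
  have "\<forall>i. \<exists>Y. finite Y \<and> Y \<subseteq> carrier A \<and> pow (V.span G) i \<subseteq> U.span Y"
    using pow_span[OF G] by blast
  from choice[OF this] obtain Y where
    Y: "\<forall>i. finite (Y i) \<and> Y i \<subseteq> carrier A \<and> pow (V.span G) i \<subseteq> U.span (Y i)" ..
  have "U.span (Y i) \<subseteq> U.span (\<Union>i\<le>n. Y i)" if "i \<le> n" for i
    by (rule U.span_is_monotone) (use that in auto)
  then have sub: "(\<Union>i\<le>n. pow (V.span G) i) \<subseteq> U.span (\<Union>i\<le>n. Y i)" using Y by fast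
  have cl: "(\<Union>i\<le>n. pow (V.span G) i) \<subseteq> carrier U"
    using pow_closed[OF V.span_is_subset2[OF G(2)]] by (auto simp: U_carrier)
  show ?thesis
    by (rule span_fin_dim[OF U_vectorspace cl sub]) (use Y in \<open>auto simp: U_carrier\<close>)
qed

text \<open>The power with exponent zero contributes the unit. The bound keeps the logarithm of the
  growth nonnegative.\<close>

lemma growth_regular_pos:
  assumes G: "finite G" "G \<subseteq> carrier A" and nz: "carrier A \<noteq> {\<zero>\<^bsub>A\<^esub>}"
  shows "growth K A (regular_module A) (V.span G) {\<one>\<^bsub>A\<^esub>} n \<ge> 1"
proof -
  let ?X = "\<Union>i\<le>n. pow (V.span G) i"
  have XU: "?X \<subseteq> carrier U"
    using pow_closed[OF V.span_is_subset2[OF G(2)]] by (auto simp: U_carrier)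
  interpret S: vectorspace K "U.vs (U.span ?X)" by (rule span_vectorspace[OF U_vectorspace XU])
  have fd: "S.fin_dim" by (rule pow_span_fin_dim[OF G])
  have "\<one>\<^bsub>A\<^esub> \<in> ?X" by (rule UN_I[of 0]) auto
  then have one: "\<one>\<^bsub>A\<^esub> \<in> U.span ?X" using U.in_own_span[OF XU] by auto
  have "S.dim \<noteq> 0"
  proof
    assume "S.dim = 0"
    obtain \<beta> where b: "finite \<beta>" "S.basis \<beta>" using S.finite_basis_exists[OF fd] by blast
    then have "\<beta> = {}" using S.dim_basis[OF b] \<open>S.dim = 0\<close> by simp
    then have "\<one>\<^bsub>A\<^esub> \<in> S.span {}" using b(2) one unfolding S.basis_def by simp
    then have "\<one>\<^bsub>A\<^esub> = \<zero>\<^bsub>A\<^esub>" unfolding S.span_empty by (simp add: U_carrier)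
    then show False using nz AR.one_zeroD by simp
  qed
  then show ?thesis by (simp add: growth_def Let_def)
qed

text \<open>Right modules are modules over the opposite algebra; \<open>\<rho>\<close> is the structure map of \<open>A\<close>
  over \<open>S\<close> and \<open>\<iota>\<close> embeds the right \<open>S\<close>-module \<open>M\<close> into \<open>A\<close>.\<close>

lemma growth_le:
  fixes S :: "('k, 's) module" and M :: "('s, 'v) module"
  assumes nz: "carrier A \<noteq> {\<zero>\<^bsub>A\<^esub>}"
    and S: "assoc_algebra K (opposite S)" and M: "left_module (opposite S) M"
    and \<rho>: "\<rho> \<in> module_hom K (opposite S) A" "\<rho> \<one>\<^bsub>opposite S\<^esub> = \<one>\<^bsub>A\<^esub>"
    and \<iota>: "\<And>x. x \<in> carrier M \<Longrightarrow> \<iota> x \<in> carrier A"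
      "\<And>x y. x \<in> carrier M \<Longrightarrow> y \<in> carrier M \<Longrightarrow> \<iota> (x \<oplus>\<^bsub>M\<^esub> y) = \<iota> x \<oplus>\<^bsub>A\<^esub> \<iota> y"
      "\<And>s x. s \<in> carrier (opposite S) \<Longrightarrow> x \<in> carrier M \<Longrightarrow> \<iota> (s \<odot>\<^bsub>M\<^esub> x) = \<iota> x \<otimes>\<^bsub>A\<^esub> \<rho> s"
      "inj_on \<iota> (carrier M)"
    and W: "W \<in> fin_dim_subspaces K (opposite S)"
    and F: "F \<in> fin_dim_subspaces K (restrict_scalars (opposite S) M)"
  shows "\<exists>V'\<in>fin_dim_subspaces K A.
    (\<forall>n. growth K (opposite S) M W F n \<le> growth K A (regular_module A) V' {\<one>\<^bsub>A\<^esub>} (Suc n)) \<and>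
    (\<forall>n. growth K A (regular_module A) V' {\<one>\<^bsub>A\<^esub>} n \<ge> 1)"
proof -
  let ?R = "opposite S" and ?M = "restrict_scalars (opposite S) M"
  interpret S: assoc_algebra K ?R by (rule S)
  interpret SV: vectorspace K ?R by (rule S.vectorspace)
  interpret SR: ring ?R by (rule S.ring)
  interpret M: left_module ?R M by (rule M)
  have MV: "vectorspace K ?M" by (rule restrict_scalars_vectorspace[OF S M])
  interpret MV: vectorspace K ?M by (rule MV)
  have rho_mem: "\<rho> s \<in> carrier A" if "s \<in> carrier ?R" for s using module_hom_mem[OF \<rho>(1) that] .
  have lin: "\<iota> \<in> module_hom K ?M A"
  proof (rule module_homI)
    fix c x assume c: "c \<in> carrier K" and x: "x \<in> carrier ?M"
    have "\<iota> (c \<odot>\<^bsub>?M\<^esub> x) = \<iota> x \<otimes>\<^bsub>A\<^esub> \<rho> (c \<odot>\<^bsub>?R\<^esub> \<one>\<^bsub>?R\<^esub>)" using c x \<iota>(3) by simp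
    also have "\<rho> (c \<odot>\<^bsub>?R\<^esub> \<one>\<^bsub>?R\<^esub>) = c \<odot>\<^bsub>A\<^esub> \<one>\<^bsub>A\<^esub>" using c by (simp add: module_hom_smult[OF \<rho>(1)] \<rho>(2))
    finally show "\<iota> (c \<odot>\<^bsub>?M\<^esub> x) = c \<odot>\<^bsub>A\<^esub> \<iota> x"
      using c x \<iota>(1) by (simp add: A.smult_mult_right)
  qed (use \<iota> in auto)
  have linU: "\<iota> \<in> module_hom K ?M U"
  proof (rule module_homI)
    fix c x assume c: "c \<in> carrier K" and x: "x \<in> carrier ?M"
    show "\<iota> (c \<odot>\<^bsub>?M\<^esub> x) = c \<odot>\<^bsub>U\<^esub> \<iota> x"
      unfolding module_hom_smult[OF lin c x] using U_smult[OF c \<iota>(1)] x by simp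
  qed (use \<iota> in \<open>auto simp: U_carrier\<close>)
  obtain GF where GF: "finite GF" "GF \<subseteq> carrier ?M" "F = MV.span GF"
    using fin_dim_subspaceD[OF MV F] by blast
  obtain GW where GW: "finite GW" "GW \<subseteq> carrier ?R" "W = SV.span GW"
    using fin_dim_subspaceD[OF S.vectorspace W] by blast
  \<comment> \<open>The test subspace of \<open>A\<close> is spanned by the images of generators of
    both \<open>F\<close> and \<open>W\<close>, so that it can imitate scalars and module elements
    alike.\<close>
  define G where "G = \<iota> ` GF \<union> \<rho> ` GW"
  have G: "finite G" "G \<subseteq> carrier A"
    using GF GW \<iota>(1) rho_mem by (auto simp: G_def)
  let ?V = "V.span G"
  have VA: "?V \<subseteq> carrier A" by (rule V.span_is_subset2[OF G(2)])
  have sub: "LinearCombinations.submodule K ?V A" by (rule V.span_is_submodule[OF G(2)])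
  have FW: "F \<subseteq> {x \<in> carrier ?M. \<iota> x \<in> ?V}"
    unfolding GF(3)
    by (rule MV.span_is_subset[OF _ preimage_submodule[OF MV A.vectorspace lin sub]])
      (use GF V.in_own_span[OF G(2)] in \<open>auto simp: G_def\<close>)
  have WW: "W \<subseteq> {x \<in> carrier ?R. \<rho> x \<in> ?V}"
    unfolding GW(3)
    by (rule SV.span_is_subset[OF _ preimage_submodule[OF S.vectorspace A.vectorspace \<rho>(1) sub]])
      (use GW V.in_own_span[OF G(2)] in \<open>auto simp: G_def\<close>)
  have Wc: "W \<subseteq> carrier ?R" and Fc: "F \<subseteq> carrier M" using WW FW by auto
  have pM: "power_action M W F i \<subseteq> carrier M" for i
  proof (induction i)
    case (Suc i)
    then show ?case using subsetD[OF Wc] subsetD[OF Suc.IH] M.smult_closed by auto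
  qed (use Fc in simp)
  \<comment> \<open>The exponent goes up by one because the element of \<open>F\<close> at which the
    product starts is itself one factor from \<open>?V\<close>.\<close>
  have pow: "x \<in> power_action M W F i \<Longrightarrow> \<iota> x \<in> pow ?V (Suc i)" for i x
  proof (induction i arbitrary: x)
    case 0
    then have "\<iota> x \<in> ?V" using FW by auto
    moreover have "\<iota> x = \<iota> x \<otimes>\<^bsub>A\<^esub> \<one>\<^bsub>A\<^esub>" using 0 Fc \<iota>(1) by auto
    ultimately show ?case by (auto simp: regular_smult)
  next
    case (Suc i)
    then obtain w y where wy: "w \<in> W" "y \<in> power_action M W F i" "x = w \<odot>\<^bsub>M\<^esub> y" by auto
    have "y \<in> carrier M" using pM wy by blast
    then have "\<iota> x = \<iota> y \<otimes>\<^bsub>A\<^esub> \<rho> w" using wy \<iota>(3) Wc by auto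
    moreover have "\<iota> y \<otimes>\<^bsub>A\<^esub> \<rho> w \<in> pow ?V (Suc (Suc i))"
      by (rule pow_right[OF VA Suc.IH[OF wy(2)]]) (use WW wy in auto)
    ultimately show ?case by (simp only:)
  qed
  have "growth K ?R M W F n \<le> growth K A (regular_module A) ?V {\<one>\<^bsub>A\<^esub>} (Suc n)" for n
    unfolding growth_def Let_def
  proof (rule span_dim_le[OF MV U_vectorspace linU])
    show "inj_on \<iota> (carrier ?M)" using \<iota>(4) by simp
    show "(\<Union>i\<le>n. power_action M W F i) \<subseteq> carrier ?M" using pM by auto
    show "(\<Union>i\<le>Suc n. pow ?V i) \<subseteq> carrier U" using pow_closed[OF VA] by (auto simp: U_carrier)
    show "\<iota> ` (\<Union>i\<le>n. power_action M W F i) \<subseteq> (\<Union>i\<le>Suc n. pow ?V i)"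
    proof
      fix z assume "z \<in> \<iota> ` (\<Union>i\<le>n. power_action M W F i)"
      then obtain i x where "i \<le> n" "x \<in> power_action M W F i" "z = \<iota> x" by auto
      then show "z \<in> (\<Union>i\<le>Suc n. pow ?V i)" using pow[of x i] by (intro UN_I[of "Suc i"]) auto
    qed
    show "vectorspace.fin_dim K (U\<lparr>carrier := U.span (\<Union>i\<le>Suc n. pow ?V i)\<rparr>)"
      by (rule pow_span_fin_dim[OF G])
  qed
  then show ?thesis
    using span_fin_dim_subspace[OF A.vectorspace G] growth_regular_pos[OF G nz]
    by (intro bexI[of _ ?V]) auto
qed

end

text \<open>Replacing \<open>n\<close> by \<open>n + 1\<close> multiplies the bound by
  \<open>ln (n + 1) / ln n\<close>, which tends to one. Working with real bounds \<open>C\<close>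
  and an added \<open>e\<close> avoids arithmetic with infinite values.\<close>

lemma growth_exponent_shift:
  assumes le: "\<And>n. g n \<le> g' (Suc n)" and pos: "\<And>n. g' n \<ge> 1"
  shows "growth_exponent g \<le> growth_exponent g'"
proof (rule ereal_le_real)
  fix C :: real assume C: "growth_exponent g' \<le> ereal C"
  show "growth_exponent g \<le> ereal C"
  proof (rule ereal_le_epsilon2)
    fix e :: real assume e: "0 < e"
    have "growth_exponent g' < ereal (C + e)" using C e by (simp add: le_less_trans)
    then have "\<forall>\<^sub>F n in sequentially. ereal (ln (real (g' n)) / ln (real n)) < ereal (C + e)"
      unfolding growth_exponent_def by (rule Limsup_lessD)
    then have "\<forall>\<^sub>F n in sequentially. ln (real (g' (Suc n))) / ln (real (Suc n)) < C + e"
      using eventually_sequentially_Suc[of "\<lambda>n. ln (real (g' n)) / ln (real n) < C + e"] by simp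
    then have "\<forall>\<^sub>F n in sequentially. ereal (ln (real (g n)) / ln (real n)) \<le>
        ereal ((C + e) * (ln (real (Suc n)) / ln (real n)))"
      using eventually_ge_at_top[of 2]
    proof eventually_elim
      case (elim n)
      have ln: "ln (real n) > 0" "ln (real (Suc n)) > 0" using elim by auto
      \<comment> \<open>If \<open>g n\<close> is zero, the left side is \<open>ln 0\<close>, which
        is zero by convention; the right side is nonnegative by \<open>pos\<close>.\<close>
      have "ln (real (g n)) \<le> ln (real (g' (Suc n)))"
        using le[of n] pos[of "Suc n"] by (cases "g n = 0") auto
      also have "\<dots> \<le> (C + e) * ln (real (Suc n))"
        using elim ln by (simp add: divide_less_eq less_imp_le)
      finally show ?case using ln by (simp add: divide_right_mono)
    qed
    then have "growth_exponent g \<le> limsup (\<lambda>n. ereal ((C + e) * (ln (real (Suc n)) / ln (real n))))"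
      unfolding growth_exponent_def by (rule Limsup_mono)
    also have "\<dots> = ereal ((C + e) * 1)"
    proof (rule lim_imp_Limsup)
      have "(\<lambda>n. ln (real (Suc n)) / ln (real n)) \<longlonglongrightarrow> 1" by real_asymp
      then have "(\<lambda>n. (C + e) * (ln (real (Suc n)) / ln (real n))) \<longlonglongrightarrow> (C + e) * 1"
        by (intro tendsto_mult tendsto_const)
      then show "(\<lambda>n. ereal ((C + e) * (ln (real (Suc n)) / ln (real n)))) \<longlonglongrightarrow> ereal ((C + e) * 1)"
        by simp
    qed simp
    finally show "growth_exponent g \<le> ereal C + ereal e" by simp
  qed
qed

lemma GKdim_module_le:
  fixes A :: "('k, 'a) module" and S :: "('k, 's) module" and M :: "('s, 'v) module"
  assumes A: "assoc_algebra K A"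
    and S: "assoc_algebra K (opposite S)" and M: "left_module (opposite S) M"
    and Mnz: "carrier M \<noteq> {\<zero>\<^bsub>M\<^esub>}"
    and \<rho>: "\<rho> \<in> module_hom K (opposite S) A" "\<rho> \<one>\<^bsub>opposite S\<^esub> = \<one>\<^bsub>A\<^esub>"
    and \<iota>: "\<And>x. x \<in> carrier M \<Longrightarrow> \<iota> x \<in> carrier A"
      "\<And>x y. x \<in> carrier M \<Longrightarrow> y \<in> carrier M \<Longrightarrow> \<iota> (x \<oplus>\<^bsub>M\<^esub> y) = \<iota> x \<oplus>\<^bsub>A\<^esub> \<iota> y"
      "\<And>s x. s \<in> carrier (opposite S) \<Longrightarrow> x \<in> carrier M \<Longrightarrow> \<iota> (s \<odot>\<^bsub>M\<^esub> x) = \<iota> x \<otimes>\<^bsub>A\<^esub> \<rho> s"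
      "inj_on \<iota> (carrier M)"
  shows "GKdim_module K (opposite S) M \<le> GKdim K A"
proof -
  interpret M: left_module "opposite S" M by (rule M)
  \<comment> \<open>An injection from the nonzero \<open>M\<close> excludes the zero algebra, whose
    GK dimension is set to minus infinity.\<close>
  have nz: "carrier A \<noteq> {\<zero>\<^bsub>A\<^esub>}"
  proof
    assume Az: "carrier A = {\<zero>\<^bsub>A\<^esub>}"
    have "carrier M \<subseteq> {\<zero>\<^bsub>M\<^esub>}"
    proof
      fix x assume x: "x \<in> carrier M"
      have "\<iota> x = \<iota> \<zero>\<^bsub>M\<^esub>"
        using \<iota>(1)[OF x] \<iota>(1)[OF M.M.zero_closed] unfolding Az by simp
      from inj_onD[OF \<iota>(4) this x M.M.zero_closed] show "x \<in> {\<zero>\<^bsub>M\<^esub>}" by simp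
    qed
    with M.M.zero_closed have "carrier M = {\<zero>\<^bsub>M\<^esub>}" by (intro equalityI) simp_all
    with Mnz show False ..
  qed
  let ?g = "growth K (opposite S) M" and ?g' = "\<lambda>V. growth K A (regular_module A) V {\<one>\<^bsub>A\<^esub>}"
  have "growth_exponent (?g W F) \<le> (SUP V \<in> fin_dim_subspaces K A. growth_exponent (?g' V))"
    if W: "W \<in> fin_dim_subspaces K (opposite S)"
      and F: "F \<in> fin_dim_subspaces K (restrict_scalars (opposite S) M)" for W F
  proof (rule bexE)
    show "\<exists>V'\<in>fin_dim_subspaces K A. (\<forall>n. ?g W F n \<le> ?g' V' (Suc n)) \<and> (\<forall>n. ?g' V' n \<ge> 1)"
    proof (rule growth_le[where \<rho> = \<rho> and \<iota> = \<iota> and W = W and F = F, OF A nz S M \<rho>])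
      show "\<iota> x \<in> carrier A" if "x \<in> carrier M" for x using \<iota>(1)[OF that] .
      show "\<iota> (x \<oplus>\<^bsub>M\<^esub> y) = \<iota> x \<oplus>\<^bsub>A\<^esub> \<iota> y" if "x \<in> carrier M" "y \<in> carrier M" for x y
        using \<iota>(2)[OF that] .
      show "\<iota> (s \<odot>\<^bsub>M\<^esub> x) = \<iota> x \<otimes>\<^bsub>A\<^esub> \<rho> s"
        if "s \<in> carrier (opposite S)" "x \<in> carrier M" for s x using \<iota>(3)[OF that] .
    qed (rule \<iota>(4) W F)+
    fix V' assume V': "V' \<in> fin_dim_subspaces K A"
      and le: "(\<forall>n. ?g W F n \<le> ?g' V' (Suc n)) \<and> (\<forall>n. ?g' V' n \<ge> 1)"
    have "growth_exponent (?g W F) \<le> growth_exponent (?g' V')"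
      using le[THEN conjunct1, rule_format] le[THEN conjunct2, rule_format]
      by (rule growth_exponent_shift[of "?g W F" "?g' V'"])
    also have "\<dots> \<le> (SUP V \<in> fin_dim_subspaces K A. growth_exponent (?g' V))"
      using V' by (rule SUP_upper)
    finally show "growth_exponent (?g W F) \<le> (SUP V \<in> fin_dim_subspaces K A. growth_exponent (?g' V))" .
  qed
  then have "\<forall>W\<in>fin_dim_subspaces K (opposite S).
      \<forall>F\<in>fin_dim_subspaces K (restrict_scalars (opposite S) M).
        growth_exponent (?g W F) \<le> (SUP V \<in> fin_dim_subspaces K A. growth_exponent (?g' V))"
    by (intro ballI)
  then have "(SUP W \<in> fin_dim_subspaces K (opposite S).
      SUP F \<in> fin_dim_subspaces K (restrict_scalars (opposite S) M). growth_exponent (?g W F)) \<le>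
      (SUP V \<in> fin_dim_subspaces K A. growth_exponent (?g' V))"
    by (simp only: SUP_le_iff)
  then show ?thesis
    by (simp only: GKdim_module_def GKdim_def Mnz nz if_False)
qed

section \<open>Algebra structures on opposites and on quotients by ideals\<close>

section \<open>Opposite and quotient algebras\<close>

lemma opposite_simps [simp]:
  "carrier (opposite A) = carrier A" "zero (opposite A) = zero A" "add (opposite A) = add A"
  "one (opposite A) = one A" "smult (opposite A) = smult A"
  "mult (opposite A) = (\<lambda>x y. y \<otimes>\<^bsub>A\<^esub> x)"
  by (simp_all add: opposite_def)

lemma opposite_ring:
  assumes "ring A"
  shows "ring (opposite A)"
proof -
  interpret ring A by fact
  have "abelian_group (opposite A)"
  proof (rule abelian_groupI)
    show "\<exists>y\<in>carrier (opposite A). y \<oplus>\<^bsub>opposite A\<^esub> x = \<zero>\<^bsub>opposite A\<^esub>"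
      if "x \<in> carrier (opposite A)" for x
      using that by (intro bexI[of _ "\<ominus>\<^bsub>A\<^esub> x"]) (simp_all add: l_neg)
  qed (simp_all add: a_ac)
  then show ?thesis
    by (intro ringI monoidI) (auto simp: m_assoc l_distr r_distr)
qed

lemma opposite_algebra:
  assumes "assoc_algebra K A"
  shows "assoc_algebra K (opposite A)"
proof -
  interpret assoc_algebra K A by fact
  interpret V: vectorspace K A by (rule vectorspace)
  interpret O: ring "opposite A" by (rule opposite_ring[OF ring])
  have "Module.module K (opposite A)"
    by (intro moduleI vectorspaceD(2)[OF vectorspace] O.abelian_group_axioms)
      (auto simp: V.smult_l_distr V.smult_r_distr V.smult_assoc1)
  then have "vectorspace K (opposite A)"
    by (intro vectorspace.intro vectorspaceD(1)[OF vectorspace])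
  then show ?thesis
    by (intro assoc_algebra.intro O.ring_axioms) (simp_all add: smult_mult_left smult_mult_right)
qed

lemma quot_alg_mult:
  assumes "ideal I A" "x \<in> carrier A" "y \<in> carrier A"
  shows "(I +>\<^bsub>A\<^esub> x) \<otimes>\<^bsub>quot_alg A I\<^esub> (I +>\<^bsub>A\<^esub> y) = I +>\<^bsub>A\<^esub> (x \<otimes>\<^bsub>A\<^esub> y)"
  using ideal.rcoset_mult_add[OF assms]
  by (simp add: quot_alg_def ring.defs module.defs FactRing_def)

lemma quot_alg_one: "\<one>\<^bsub>quot_alg A I\<^esub> = I +>\<^bsub>A\<^esub> \<one>\<^bsub>A\<^esub>"
  by (simp add: quot_alg_def ring.defs module.defs FactRing_def)

text \<open>Scalars act as multiplication by multiples of the unit, so a ring ideal is closed under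
  them.\<close>

lemma ideal_subspace:
  assumes A: "assoc_algebra K A" and I: "ideal I A"
  shows "subspace K I A"
proof -
  interpret A: assoc_algebra K A by fact
  interpret V: vectorspace K A by (rule A.vectorspace)
  interpret AR: ring A by (rule A.ring)
  interpret I: ideal I A by fact
  have "c \<odot>\<^bsub>A\<^esub> x \<in> I" if c: "c \<in> carrier K" and x: "x \<in> I" for c x
  proof -
    have xA: "x \<in> carrier A" using x I.a_subset by auto
    have "c \<odot>\<^bsub>A\<^esub> x = (c \<odot>\<^bsub>A\<^esub> \<one>\<^bsub>A\<^esub>) \<otimes>\<^bsub>A\<^esub> x"
      using c xA by (simp add: A.smult_mult_left)
    then show ?thesis using I.I_l_closed[OF x, of "c \<odot>\<^bsub>A\<^esub> \<one>\<^bsub>A\<^esub>"] c by simp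
  qed
  then have "LinearCombinations.submodule K I A"
    using I.a_subset by (intro LinearCombinations.submodule.intro V.module_axioms) auto
  then show ?thesis by (intro subspace.intro A.vectorspace)
qed

lemma quot_alg_algebra:
  assumes A: "assoc_algebra K A" and I: "ideal I A"
  shows "assoc_algebra K (quot_alg A I)"
proof -
  interpret A: assoc_algebra K A by fact
  interpret V: vectorspace K A by (rule A.vectorspace)
  interpret AR: ring A by (rule A.ring)
  interpret Q: quotient_space K A I
    by (intro quotient_space.intro A.vectorspace ideal_subspace[OF A I])
  note mult = quot_alg_mult[OF I]
  have "ring (quot_alg A I)"
    by (intro ringI monoidI vectorspaceD(4)[OF Q.quot_vectorspace])
      (auto simp: Q.quot_carrier quot_alg_one mult Q.quot_add AR.m_assoc AR.l_distr AR.r_distr)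
  then show ?thesis
    by (intro assoc_algebra.intro Q.quot_vectorspace)
      (auto simp: Q.quot_carrier mult Q.quot_smult A.smult_mult_left A.smult_mult_right)
qed

section \<open>The smash product as a quotient of a free right \<open>S\<close>-module\<close>

context hopf_action
begin

abbreviation S' where "S' \<equiv> opposite S"
abbreviation Fr where "Fr n \<equiv> free_module S' n"
abbreviation Reg where "Reg \<equiv> regular_module S'"

lemma S'_ring: "ring S'" by (rule opposite_ring[OF SR.ring_axioms])

context
  fixes E hh ix n
  assumes frob: "frob_basis E hh" and ix: "bij_betw ix E {..<n::nat}"
begin

interpretation F: left_module S' "Fr n" by (rule free_left_module[OF S'_ring])
interpretation T: vectorspace K SH.T by simp
interpretation BR: ring B by (rule B_ring)

text \<open>\<open>\<Psi>\<close> reindexed along \<open>ix\<close>, since the coordinates of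
  \<open>free_module\<close> are numbered.\<close>

definition \<psi> where "\<psi> x = \<Psi> E hh (\<lambda>e. x (ix e))"

lemma ix_less: "e \<in> E \<Longrightarrow> ix e < n"
  using bij_betwE[OF ix] by simp

lemma free_arg: "x \<in> carrier (Fr n) \<Longrightarrow> (\<lambda>e. x (ix e)) \<in> E \<rightarrow> carrier S"
  using ix_less by simp

lemma psi_free_closed: "x \<in> carrier (Fr n) \<Longrightarrow> \<psi> x \<in> carrier SH.T"
  unfolding \<psi>_def by (rule psi_closed[OF frob free_arg])

lemma psi_free_add:
  assumes "x \<in> carrier (Fr n)" "y \<in> carrier (Fr n)"
  shows "\<psi> (x \<oplus>\<^bsub>Fr n\<^esub> y) = \<psi> x \<oplus>\<^bsub>SH.T\<^esub> \<psi> y"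
  using psi_add[OF frob free_arg[OF assms(1)] free_arg[OF assms(2)]] by (simp add: \<psi>_def)

lemma psi_free_smult:
  assumes "a \<in> carrier S" "x \<in> carrier (Fr n)"
  shows "\<psi> (a \<odot>\<^bsub>Fr n\<^esub> x) = mult B (\<psi> x) (a \<sharp> \<one>\<^bsub>H\<^esub>)"
  using psi_mult_right[OF frob free_arg[OF assms(2)] assms(1)] by (simp add: \<psi>_def)

lemma psi_free_surj:
  assumes "X \<in> carrier SH.T"
  shows "\<exists>x\<in>carrier (Fr n). X = \<psi> x"
proof -
  obtain y where y: "y \<in> E \<rightarrow> carrier S" "X = \<Psi> E hh y"
    using psi_surj[OF frob assms] ..
  define x where "x i = (if i < n then y (inv_into E ix i) else \<zero>\<^bsub>S\<^esub>)" for i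
  have inv: "inv_into E ix i \<in> E" if "i < n" for i
    using bij_betwE[OF bij_betw_inv_into[OF ix]] that by simp
  have x: "x \<in> carrier (Fr n)" using y(1) inv by (auto simp: x_def)
  have xe: "x (ix e) = y e" if "e \<in> E" for e
    using ix_less[OF that] bij_betw_inv_into_left[OF ix that] by (simp add: x_def)
  have "\<psi> x = \<Psi> E hh y"
    unfolding \<psi>_def \<Psi>_def[OF frob]
  proof (rule T.M.finsum_cong')
    show "mult B (\<one>\<^bsub>S\<^esub> \<sharp> hh e) (x (ix e) \<sharp> \<one>\<^bsub>H\<^esub>) = mult B (\<one>\<^bsub>S\<^esub> \<sharp> hh e) (y e \<sharp> \<one>\<^bsub>H\<^esub>)"
      if "e \<in> E" for e by (simp only: xe[OF that])
  qed (use psi_summand[OF frob y(1)] in simp_all)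
  then show ?thesis using x y(2) by (intro bexI[of _ x]) simp_all
qed

lemma psi_free_unit:
  assumes e: "e \<in> E"
  shows "\<psi> (free_unit S' (ix e)) = \<one>\<^bsub>S\<^esub> \<sharp> hh e"
proof -
  note hd = hdH[OF frob]
  have z: "\<zero>\<^bsub>S\<^esub> \<sharp> \<one>\<^bsub>H\<^esub> = \<zero>\<^bsub>SH.T\<^esub>"
    using module_hom_zero[OF vectorspaceD(4)[of K S] vectorspaceD(4)[of K SH.T]
        bilinD(2)[OF SH.pure_bilin Hp.HR.one_closed]] by simp
  have one: "mult B (\<one>\<^bsub>S\<^esub> \<sharp> hh e') (\<one>\<^bsub>S\<^esub> \<sharp> \<one>\<^bsub>H\<^esub>) = \<one>\<^bsub>S\<^esub> \<sharp> hh e'" if "e' \<in> E" for e'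
    using BR.r_one[of "\<one>\<^bsub>S\<^esub> \<sharp> hh e'"] hd[OF that] by simp
  have zero: "mult B (\<one>\<^bsub>S\<^esub> \<sharp> hh e') \<zero>\<^bsub>SH.T\<^esub> = \<zero>\<^bsub>SH.T\<^esub>" if "e' \<in> E" for e'
    using BR.r_null[of "\<one>\<^bsub>S\<^esub> \<sharp> hh e'"] hd[OF that] by simp
  have "\<psi> (free_unit S' (ix e)) = (\<Oplus>\<^bsub>SH.T\<^esub>e'\<in>E. if e = e' then \<one>\<^bsub>S\<^esub> \<sharp> hh e' else \<zero>\<^bsub>SH.T\<^esub>)"
    unfolding \<psi>_def \<Psi>_def[OF frob]
  proof (rule T.M.finsum_cong')
    show "mult B (\<one>\<^bsub>S\<^esub> \<sharp> hh e') (free_unit S' (ix e) (ix e') \<sharp> \<one>\<^bsub>H\<^esub>) =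
        (if e = e' then \<one>\<^bsub>S\<^esub> \<sharp> hh e' else \<zero>\<^bsub>SH.T\<^esub>)" if e': "e' \<in> E" for e'
      using inj_on_eq_iff[OF bij_betw_imp_inj_on[OF ix] e' e] z one[OF e'] zero[OF e']
      by (simp add: free_unit_def)
  qed (use hd in simp_all)
  also have "\<dots> = \<one>\<^bsub>S\<^esub> \<sharp> hh e"
    by (rule T.M.add.finprod_singleton[OF e fE[OF frob]]) (use hd in simp)
  finally show ?thesis .
qed

text \<open>Linearity over the opposite ring is right \<open>S\<close>-linearity, which
  \<open>\<Lambda>\<close> has. These maps play the role of the functionals on \<open>B\<close>
  represented by \<open>b\<close>.\<close>

lemma Lam_psi_hom:
  assumes b: "b \<in> carrier SH.T"
  shows "(\<lambda>x. \<Lambda> (mult B b (\<psi> x))) \<in> module_hom S' (Fr n) Reg"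
proof (rule module_homI)
  fix x assume x: "x \<in> carrier (Fr n)"
  note px = psi_free_closed[OF x]
  show "\<Lambda> (mult B b (\<psi> x)) \<in> carrier Reg" using b px by simp
  show "\<Lambda> (mult B b (\<psi> (x \<oplus>\<^bsub>Fr n\<^esub> y))) = \<Lambda> (mult B b (\<psi> x)) \<oplus>\<^bsub>Reg\<^esub> \<Lambda> (mult B b (\<psi> y))"
    if y: "y \<in> carrier (Fr n)" for y
    using b px psi_free_closed[OF y] unfolding psi_free_add[OF x y] by (simp add: B_mult_add Lam_add)
  show "\<Lambda> (mult B b (\<psi> (a \<odot>\<^bsub>Fr n\<^esub> x))) = a \<odot>\<^bsub>Reg\<^esub> \<Lambda> (mult B b (\<psi> x))"
    if a: "a \<in> carrier S'" for a
  proof -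
    have "a \<in> carrier S" using a by simp
    then have "\<Lambda> (mult B b (\<psi> (a \<odot>\<^bsub>Fr n\<^esub> x))) = \<Lambda> (mult B b (\<psi> x)) \<otimes>\<^bsub>S\<^esub> a"
      using b px psi_free_smult[OF _ x, of a] by (simp add: B_assoc[symmetric] Lam_mult_right del: free_module_simps)
    then show ?thesis by simp
  qed
qed

text \<open>This is the kernel of the composite of \<open>\<psi>\<close> with the projection modulo
  \<open>I\<close>, so the quotient by it is a copy of \<open>B/I\<close> as a right
  \<open>S\<close>-module.\<close>

lemma N_submodule:
  assumes I: "ideal I B"
  shows "Module.submodule {x \<in> carrier (Fr n). \<psi> x \<in> I} S' (Fr n)"
proof -
  interpret I: ideal I B by fact
  show ?thesis
  proof (rule F.submodule_intro)
    have "\<psi> \<zero>\<^bsub>Fr n\<^esub> = \<zero>\<^bsub>SH.T\<^esub>"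
      by (rule additive_zero[of "Fr n" SH.T \<psi>])
        (rule F.abelian_group T.M.abelian_group_axioms psi_free_closed psi_free_add; assumption)+
    then show "\<zero>\<^bsub>Fr n\<^esub> \<in> {x \<in> carrier (Fr n). \<psi> x \<in> I}"
      using I.zero_closed F.M.zero_closed by (simp del: free_module_simps)
    show "x \<oplus>\<^bsub>Fr n\<^esub> y \<in> {x \<in> carrier (Fr n). \<psi> x \<in> I}"
      if "x \<in> {x \<in> carrier (Fr n). \<psi> x \<in> I}" "y \<in> {x \<in> carrier (Fr n). \<psi> x \<in> I}" for x y
      using that I.a_closed[of "\<psi> x" "\<psi> y"] F.M.a_closed[of x y]
      by (simp del: free_module_simps add: psi_free_add)
    show "a \<odot>\<^bsub>Fr n\<^esub> x \<in> {x \<in> carrier (Fr n). \<psi> x \<in> I}"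
      if "a \<in> carrier S'" "x \<in> {x \<in> carrier (Fr n). \<psi> x \<in> I}" for a x
      using that I.I_r_closed[of "\<psi> x" "a \<sharp> \<one>\<^bsub>H\<^esub>"] F.smult_closed[of a x]
      by (simp del: free_module_simps add: psi_free_smult)
  qed blast
qed

section \<open>Injectivity and surjectivity from the vanishing of Hom and first Ext\<close>

context
  fixes J
  assumes J: "ideal J B" and J_ann: "J \<subseteq> ann" and J_absorb: "J \<subseteq> absorb" and J_t: "e_t \<in> J"
    and hom0: "\<forall>f\<in>module_hom S' (Fr n) Reg.
      (\<forall>x\<in>{x \<in> carrier (Fr n). \<psi> x \<in> J}. f x = \<zero>\<^bsub>S'\<^esub>) \<longrightarrow> (\<forall>x\<in>carrier (Fr n). f x = \<zero>\<^bsub>S'\<^esub>)"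
    and ext: "\<forall>g\<in>module_hom S' ((Fr n)\<lparr>carrier := {x \<in> carrier (Fr n). \<psi> x \<in> J}\<rparr>) Reg.
      \<exists>h\<in>module_hom S' (Fr n) Reg. \<forall>x\<in>{x \<in> carrier (Fr n). \<psi> x \<in> J}. h x = g x"
begin

interpretation J: ideal J B by (rule J)

lemma J_T: "y \<in> J \<Longrightarrow> y \<in> carrier SH.T" using J.a_subset by auto

lemma phi_injective_zero:
  assumes z: "z \<in> carrier SH.T" and 0: "\<And>x. x \<in> carrier S \<Longrightarrow> \<phi> z x = \<zero>\<^bsub>S\<^esub>"
  shows "z = \<zero>\<^bsub>SH.T\<^esub>"
proof (rule Lam_nondegenerate[OF frob z])
  fix e assume e: "e \<in> E"
  have L0: "\<Lambda> \<zero>\<^bsub>SH.T\<^esub> = \<zero>\<^bsub>S\<^esub>"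
    by (rule module_hom_zero[OF T.M.abelian_group_axioms S.M.abelian_group_axioms Lam_linear])
  have u: "free_unit S' (ix e) \<in> carrier (Fr n)" by (rule free_unit_closed[OF S'_ring ix_less[OF e]])
  have "\<Lambda> (mult B z (\<psi> (free_unit S' (ix e)))) = \<zero>\<^bsub>S'\<^esub>"
  proof (rule hom0[THEN bspec, OF Lam_psi_hom[OF z], THEN mp, THEN bspec, OF ballI u])
    fix x assume "x \<in> {x \<in> carrier (Fr n). \<psi> x \<in> J}"
    then have "\<psi> x \<in> ann" using J_ann by auto
    then have "mult B z (\<psi> x) = \<zero>\<^bsub>SH.T\<^esub>" using z 0 unfolding ann_def by simp
    then show "\<Lambda> (mult B z (\<psi> x)) = \<zero>\<^bsub>S'\<^esub>" by (simp only: L0 opposite_simps)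
  qed
  then show "\<Lambda> (mult B z (\<one>\<^bsub>S\<^esub> \<sharp> hh e)) = \<zero>\<^bsub>S\<^esub>" by (simp only: psi_free_unit[OF e] opposite_simps)
qed

lemma phi_injective:
  assumes z: "z \<in> carrier SH.T" "z' \<in> carrier SH.T" and eq: "\<And>x. x \<in> carrier S \<Longrightarrow> \<phi> z x = \<phi> z' x"
  shows "z = z'"
proof -
  have "z \<ominus>\<^bsub>SH.T\<^esub> z' = \<zero>\<^bsub>SH.T\<^esub>"
  proof (rule phi_injective_zero)
    fix x assume x: "x \<in> carrier S"
    have "\<phi> (z \<ominus>\<^bsub>SH.T\<^esub> z') x = \<phi> z x \<ominus>\<^bsub>S\<^esub> \<phi> z' x"
      by (rule module_hom_diff[OF T.M.abelian_group_axioms S.M.abelian_group_axioms phi_linear[OF x] z])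
    also have "\<dots> = \<zero>\<^bsub>S\<^esub>" unfolding eq[OF x] using z x by simp
    finally show "\<phi> (z \<ominus>\<^bsub>SH.T\<^esub> z') x = \<zero>\<^bsub>S\<^esub>" .
  qed (use z in simp)
  then show ?thesis using T.M.minus_other_side[OF z] by simp
qed

text \<open>For \<open>y \<in> J\<close> let \<open>F y\<close> be the element with \<open>\<phi> (F y) = f \<circ> \<phi> y\<close>. The map \<open>\<Lambda> \<circ> F\<close> extends
  to \<open>B\<close>, hence \<open>F\<close> is left multiplication by some \<open>b\<close>.\<close>

lemma endo_eq_mult_on_ideal:
  assumes f: "f \<in> carrier Endo"
  shows "\<exists>b\<in>carrier SH.T. \<forall>y\<in>J. \<forall>x\<in>carrier S. f (\<phi> y x) = \<phi> b (\<phi> y x)"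
proof -
  let ?N = "{x \<in> carrier (Fr n). \<psi> x \<in> J}"
  have fadd: "f (x \<oplus>\<^bsub>S\<^esub> y) = f x \<oplus>\<^bsub>S\<^esub> f y" if "x \<in> carrier S" "y \<in> carrier S" for x y
    using f that unfolding right_End_carrier by auto
  have "\<forall>y\<in>J. \<exists>Z. Z \<in> carrier SH.T \<and> (\<forall>x\<in>carrier S. \<phi> Z x = f (\<phi> y x))"
  proof
    fix y assume "y \<in> J"
    then have "y \<in> absorb" using J_absorb by auto
    then have "\<exists>Z\<in>carrier SH.T. \<forall>x\<in>carrier S. \<phi> Z x = f (\<phi> y x)" using f unfolding absorb_def by simp
    then show "\<exists>Z. Z \<in> carrier SH.T \<and> (\<forall>x\<in>carrier S. \<phi> Z x = f (\<phi> y x))" by (simp only: Bex_def)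
  qed
  from bchoice[OF this] obtain G where
    G: "\<forall>y\<in>J. G y \<in> carrier SH.T \<and> (\<forall>x\<in>carrier S. \<phi> (G y) x = f (\<phi> y x))" ..
  have GT: "G y \<in> carrier SH.T" and Gp: "x \<in> carrier S \<Longrightarrow> \<phi> (G y) x = f (\<phi> y x)" if "y \<in> J" for y x
    using G that by simp_all
  \<comment> \<open>\<open>G\<close> is only a choice function. As \<open>\<phi>\<close> is
    injective, \<open>G y\<close> is determined by its action, and this makes \<open>G\<close>
    additive and right \<open>B\<close>-linear.\<close>
  have Gadd: "G (y \<oplus>\<^bsub>SH.T\<^esub> y') = G y \<oplus>\<^bsub>SH.T\<^esub> G y'" if y: "y \<in> J" "y' \<in> J" for y y'
  proof (rule phi_injective)
    have s: "y \<oplus>\<^bsub>SH.T\<^esub> y' \<in> J" using J.a_closed[OF y] by simp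
    show "G (y \<oplus>\<^bsub>SH.T\<^esub> y') \<in> carrier SH.T" by (rule GT[OF s])
    show "G y \<oplus>\<^bsub>SH.T\<^esub> G y' \<in> carrier SH.T" using GT[OF y(1)] GT[OF y(2)] by simp
    show "\<phi> (G (y \<oplus>\<^bsub>SH.T\<^esub> y')) x = \<phi> (G y \<oplus>\<^bsub>SH.T\<^esub> G y') x" if x: "x \<in> carrier S" for x
      using x GT[OF y(1)] GT[OF y(2)] J_T[OF y(1)] J_T[OF y(2)]
      by (simp add: Gp[OF s] Gp[OF y(1)] Gp[OF y(2)] phi_add fadd)
  qed
  have Gmult: "G (mult B y b) = mult B (G y) b" if y: "y \<in> J" and b: "b \<in> carrier SH.T" for y b
  proof (rule phi_injective)
    have s: "mult B y b \<in> J" using J.I_r_closed[OF y] b by simp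
    show "G (mult B y b) \<in> carrier SH.T" by (rule GT[OF s])
    show "mult B (G y) b \<in> carrier SH.T" using GT[OF y] b by simp
    show "\<phi> (G (mult B y b)) x = \<phi> (mult B (G y) b) x" if x: "x \<in> carrier S" for x
      using x b GT[OF y] J_T[OF y] by (simp add: Gp[OF s] Gp[OF y] phi_mult)
  qed
  have "(\<lambda>x. \<Lambda> (G (\<psi> x))) \<in> module_hom S' ((Fr n)\<lparr>carrier := ?N\<rparr>) Reg"
  proof (rule module_homI)
    fix x assume "x \<in> carrier ((Fr n)\<lparr>carrier := ?N\<rparr>)"
    then have x: "x \<in> carrier (Fr n)" "\<psi> x \<in> J" by auto
    show "\<Lambda> (G (\<psi> x)) \<in> carrier Reg" using GT[OF x(2)] by simp
    show "\<Lambda> (G (\<psi> (x \<oplus>\<^bsub>(Fr n)\<lparr>carrier := ?N\<rparr>\<^esub> y))) = \<Lambda> (G (\<psi> x)) \<oplus>\<^bsub>Reg\<^esub> \<Lambda> (G (\<psi> y))"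
      if "y \<in> carrier ((Fr n)\<lparr>carrier := ?N\<rparr>)" for y
    proof -
      have y: "y \<in> carrier (Fr n)" "\<psi> y \<in> J" using that by auto
      have "\<psi> (x \<oplus>\<^bsub>(Fr n)\<lparr>carrier := ?N\<rparr>\<^esub> y) = \<psi> x \<oplus>\<^bsub>SH.T\<^esub> \<psi> y"
        using psi_free_add[OF x(1) y(1)] by (simp del: free_module_simps)
      then show ?thesis using Lam_add[OF GT[OF x(2)] GT[OF y(2)]] by (simp add: Gadd[OF x(2) y(2)])
    qed
    show "\<Lambda> (G (\<psi> (a \<odot>\<^bsub>(Fr n)\<lparr>carrier := ?N\<rparr>\<^esub> x))) = a \<odot>\<^bsub>Reg\<^esub> \<Lambda> (G (\<psi> x))"
      if a: "a \<in> carrier S'" for a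
    proof -
      have a: "a \<in> carrier S" using a by simp
      have "\<psi> (a \<odot>\<^bsub>(Fr n)\<lparr>carrier := ?N\<rparr>\<^esub> x) = mult B (\<psi> x) (a \<sharp> \<one>\<^bsub>H\<^esub>)"
        using psi_free_smult[OF a x(1)] by (simp del: free_module_simps)
      then show ?thesis using a Lam_mult_right[OF GT[OF x(2)] a] by (simp add: Gmult[OF x(2)])
    qed
  qed
  from bspec[OF ext this] obtain h where h: "h \<in> module_hom S' (Fr n) Reg"
    and hN: "\<forall>x\<in>?N. h x = \<Lambda> (G (\<psi> x))" ..
  \<comment> \<open>The values of \<open>h\<close> on the unit vectors become the prescribed
    coefficients of \<open>b\<close>, which makes \<open>h\<close> the functional represented by
    \<open>b\<close>.\<close>
  define g where "g e = h (free_unit S' (ix e))" for e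
  have u: "free_unit S' i \<in> carrier (Fr n)" if "i < n" for i by (rule free_unit_closed[OF S'_ring that])
  have gS: "g e \<in> carrier S" if "e \<in> E" for e
    using module_hom_mem[OF h u[OF ix_less[OF that]]] by (simp add: g_def)
  define b where "b = (\<Oplus>\<^bsub>SH.T\<^esub>e\<in>E. g e \<sharp> e)"
  have bT: "b \<in> carrier SH.T" unfolding b_def by (rule Lam_prescribed(1)[OF frob gS])
  have bg: "\<Lambda> (mult B b (\<one>\<^bsub>S\<^esub> \<sharp> hh e)) = g e" if "e \<in> E" for e
    unfolding b_def by (rule Lam_prescribed(2)[OF frob gS that])
  have bh: "\<Lambda> (mult B b (\<psi> x)) = h x" if x: "x \<in> carrier (Fr n)" for x
  proof (rule free_module_hom_eqI[OF regular_left_module[OF S'_ring] Lam_psi_hom[OF bT] h _ x])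
    fix i assume "i < n"
    then have "i \<in> ix ` E" using bij_betw_imp_surj_on[OF ix] by simp
    then obtain e where e: "e \<in> E" "i = ix e" by auto
    show "\<Lambda> (mult B b (\<psi> (free_unit S' i))) = h (free_unit S' i)"
      unfolding e(2) psi_free_unit[OF e(1)] bg[OF e(1)] g_def ..
  qed
  have Gb: "G y = mult B b y" if y: "y \<in> J" for y
  proof -
    have yT: "y \<in> carrier SH.T" and byT: "mult B b y \<in> carrier SH.T"
      using J_T[OF y] bT by simp_all
    have "G y \<ominus>\<^bsub>SH.T\<^esub> mult B b y = \<zero>\<^bsub>SH.T\<^esub>"
    proof (rule Lam_nondegenerate[OF frob])
      show "G y \<ominus>\<^bsub>SH.T\<^esub> mult B b y \<in> carrier SH.T" using GT[OF y] byT by simp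
      fix e assume e: "e \<in> E"
      let ?k = "\<one>\<^bsub>S\<^esub> \<sharp> hh e"
      have k: "?k \<in> carrier SH.T" using hdH[OF frob e] by simp
      \<comment> \<open>Nondegeneracy tests against right multiples. These stay in \<open>J\<close>,
        where both functionals are computed by the same \<open>h\<close>.\<close>
      have ykJ: "mult B y ?k \<in> J" using J.I_r_closed[OF y] k by simp
      then obtain x where x: "x \<in> carrier (Fr n)" "mult B y ?k = \<psi> x"
        using psi_free_surj[OF J_T[OF ykJ]] by auto
      have xN: "x \<in> ?N" using x ykJ by simp
      have 1: "\<Lambda> (mult B (G y) ?k) = h x"
        unfolding Gmult[OF y k, symmetric] x(2) using hN xN by simp
      have 2: "\<Lambda> (mult B (mult B b y) ?k) = h x"
        unfolding B_assoc[OF bT yT k] x(2) by (rule bh[OF x(1)])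
      have L: "(\<lambda>X. \<Lambda> (mult B X ?k)) \<in> module_hom K SH.T S"
        by (intro lin_comp[OF Lam_linear] B_mult_lin(2) k)
      have "\<Lambda> (mult B (G y \<ominus>\<^bsub>SH.T\<^esub> mult B b y) ?k) =
          \<Lambda> (mult B (G y) ?k) \<ominus>\<^bsub>S\<^esub> \<Lambda> (mult B (mult B b y) ?k)"
        by (rule module_hom_diff[OF T.M.abelian_group_axioms S.M.abelian_group_axioms L GT[OF y] byT])
      also have "\<dots> = \<zero>\<^bsub>S\<^esub>"
        unfolding 1 2 using module_hom_mem[OF h x(1)] by simp
      finally show "\<Lambda> (mult B (G y \<ominus>\<^bsub>SH.T\<^esub> mult B b y) ?k) = \<zero>\<^bsub>S\<^esub>" .
    qed
    then show ?thesis using T.M.minus_other_side[OF GT[OF y] byT] by simp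
  qed
  show ?thesis
  proof (intro bexI[of _ b] bT ballI)
    fix y x assume y: "y \<in> J" and x: "x \<in> carrier S"
    show "f (\<phi> y x) = \<phi> b (\<phi> y x)"
      unfolding Gp[OF y x, symmetric] Gb[OF y] by (rule phi_mult[OF bT J_T[OF y] x])
  qed
qed

lemma phi_surjective:
  assumes f: "f \<in> carrier Endo" and faithful: "faithful_action H S act"
    and domain: "\<And>a b. a \<in> carrier S \<Longrightarrow> b \<in> carrier S \<Longrightarrow> a \<otimes>\<^bsub>S\<^esub> b = \<zero>\<^bsub>S\<^esub> \<Longrightarrow> a = \<zero>\<^bsub>S\<^esub> \<or> b = \<zero>\<^bsub>S\<^esub>"
  shows "\<exists>b\<in>carrier SH.T. \<phi> b = f"
proof -
  obtain b where b: "b \<in> carrier SH.T" and bJ: "\<forall>y\<in>J. \<forall>x\<in>carrier S. f (\<phi> y x) = \<phi> b (\<phi> y x)"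
    using endo_eq_mult_on_ideal[OF f] ..
  have fS: "f x \<in> carrier S" if "x \<in> carrier S" for x
    using f that unfolding right_End_carrier by auto
  \<comment> \<open>Faithfulness prevents the nonzero element \<open>t\<close> from acting as
    zero.\<close>
  have "\<not> (\<forall>x\<in>carrier S. act t x = \<zero>\<^bsub>S\<^esub>)"
    using faithful nonzero I.t_closed unfolding faithful_action_def by auto
  then obtain x where x: "x \<in> carrier S" "act t x \<noteq> \<zero>\<^bsub>S\<^esub>" by auto
  define w where "w = act t x"
  have w: "w \<in> carrier S" "w \<in> inv_ring" "w \<noteq> \<zero>\<^bsub>S\<^esub>"
    using x act_t_invariant[OF x(1)] by (simp_all add: w_def)
  have "f s = \<phi> b s" if s: "s \<in> carrier S" for s
  proof -
    have "mult B (s \<sharp> \<one>\<^bsub>H\<^esub>) e_t \<in> J" using J.I_l_closed[OF J_t, of "s \<sharp> \<one>\<^bsub>H\<^esub>"] s by simp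
    \<comment> \<open>\<open>s # t\<close> sends \<open>x\<close> to \<open>s w\<close>, so
      agreement on \<open>J\<close> is agreement at \<open>s w\<close>; both maps are linear over
      the invariant \<open>w\<close>, which can then be cancelled.\<close>
    then have "s \<sharp> t \<in> J" using s by (simp add: pure_mult_one)
    then have "f (\<phi> (s \<sharp> t) x) = \<phi> b (\<phi> (s \<sharp> t) x)" using bJ x(1) by simp
    then have "f (s \<otimes>\<^bsub>S\<^esub> w) = \<phi> b (s \<otimes>\<^bsub>S\<^esub> w)" using s x(1) by (simp add: w_def)
    moreover have "f (s \<otimes>\<^bsub>S\<^esub> w) = f s \<otimes>\<^bsub>S\<^esub> w" using f s w(2) unfolding right_End_carrier by simp
    moreover have "\<phi> b (s \<otimes>\<^bsub>S\<^esub> w) = \<phi> b s \<otimes>\<^bsub>S\<^esub> w" by (rule phi_invariant[OF b s w(2)])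
    ultimately have eq: "f s \<otimes>\<^bsub>S\<^esub> w = \<phi> b s \<otimes>\<^bsub>S\<^esub> w" by simp
    have c: "f s \<in> carrier S" "\<phi> b s \<in> carrier S" using fS[OF s] b s by simp_all
    have "(f s \<ominus>\<^bsub>S\<^esub> \<phi> b s) \<otimes>\<^bsub>S\<^esub> w = f s \<otimes>\<^bsub>S\<^esub> w \<ominus>\<^bsub>S\<^esub> \<phi> b s \<otimes>\<^bsub>S\<^esub> w"
      using c w(1) by (simp add: a_minus_def SR.l_distr SR.l_minus)
    also have "\<dots> = \<zero>\<^bsub>S\<^esub>" unfolding eq using c w(1) by simp
    finally have "f s \<ominus>\<^bsub>S\<^esub> \<phi> b s = \<zero>\<^bsub>S\<^esub>" using domain[OF _ w(1)] w(3) c by auto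
    then show ?thesis using S.M.minus_other_side[OF c] by simp
  qed
  then have "\<phi> b = f"
    using f phi_End[OF b] unfolding right_End_carrier by (intro PiE_ext[of _ "carrier S" "\<lambda>_. carrier S"]) auto
  then show ?thesis using b by (intro bexI[of _ b])
qed

end

end

end

section \<open>GK dimension and grade of the quotient module\<close>

context hopf_action
begin

context
  fixes E hh ix n
  assumes frob: "frob_basis E hh" and ix: "bij_betw ix E {..<n::nat}"
begin

abbreviation \<psi>' where "\<psi>' \<equiv> \<psi> E hh ix"
abbreviation N_of where "N_of J \<equiv> {x \<in> carrier (Fr n). \<psi>' x \<in> J}"

interpretation F: left_module S' "Fr n" by (rule free_left_module[OF S'_ring])
interpretation BR: ring B by (rule B_ring)

text \<open>Sending \<open>x\<close> to the class of \<open>\<psi>' x\<close> embeds the quotient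
  into \<open>B/J\<close>. There \<open>s\<close> acts by right multiplication with the class of
  \<open>s # 1\<close>, which is the situation of \<open>GKdim_module_le\<close>.\<close>

lemma GKdim_quotient_le:
  assumes J: "ideal J B"
    and nz: "carrier (rep_quotient (Fr n) (N_of J)) \<noteq> {\<zero>\<^bsub>rep_quotient (Fr n) (N_of J)\<^esub>}"
  shows "GKdim_module K S' (rep_quotient (Fr n) (N_of J)) \<le> GKdim K (quot_alg B J)"
proof -
  let ?M = "rep_quotient (Fr n) (N_of J)" and ?r = "coset_rep (Fr n) (N_of J)"
  interpret J: ideal J B by fact
  interpret Q: quotient_space K B J
    by (intro quotient_space.intro B_vectorspace ideal_subspace[OF B_algebra J])
  note N = N_submodule[OF frob ix J]
  note cr = rep_quotient(5-)[OF F.left_module_axioms N]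
  note psi = psi_free_closed[OF frob ix] and padd = psi_free_add[OF frob ix]
    and psm = psi_free_smult[OF frob ix]
  define \<rho> where "\<rho> s = J +>\<^bsub>B\<^esub> (s \<sharp> \<one>\<^bsub>H\<^esub>)" for s
  define \<iota> where "\<iota> x = J +>\<^bsub>B\<^esub> \<psi>' x" for x
  have psi_diff: "\<psi>' (x \<ominus>\<^bsub>Fr n\<^esub> y) = \<psi>' x \<ominus>\<^bsub>B\<^esub> \<psi>' y"
    if x: "x \<in> carrier (Fr n)" and y: "y \<in> carrier (Fr n)" for x y
  proof -
    have "\<psi>' (\<ominus>\<^bsub>Fr n\<^esub> y) = \<ominus>\<^bsub>B\<^esub> \<psi>' y"
    proof (rule additive_uminus[of "Fr n" B \<psi>', OF F.abelian_group BR.abelian_group_axioms _ _ y])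
      show "\<psi>' u \<in> carrier B" if "u \<in> carrier (Fr n)" for u using psi[OF that] by simp
      show "\<psi>' (u \<oplus>\<^bsub>Fr n\<^esub> v) = \<psi>' u \<oplus>\<^bsub>B\<^esub> \<psi>' v"
        if "u \<in> carrier (Fr n)" "v \<in> carrier (Fr n)" for u v
        using padd[OF that] by (simp del: free_module_simps)
    qed
    then show ?thesis unfolding a_minus_def using padd[OF x F.M.a_inv_closed[OF y]]
      by (simp del: free_module_simps)
  qed
  have iota_eq: "\<iota> x = \<iota> y \<longleftrightarrow> ?r x = ?r y"
    if x: "x \<in> carrier (Fr n)" and y: "y \<in> carrier (Fr n)" for x y
  proof -
    have "\<iota> x = \<iota> y \<longleftrightarrow> \<psi>' (x \<ominus>\<^bsub>Fr n\<^esub> y) \<in> J"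
      unfolding \<iota>_def psi_diff[OF x y] using psi[OF x] psi[OF y] by (intro Q.coset_eq_iff) simp_all
    also have "\<dots> \<longleftrightarrow> x \<ominus>\<^bsub>Fr n\<^esub> y \<in> N_of J"
      using F.M.minus_closed[OF x y] by (simp del: free_module_simps)
    finally show ?thesis using cr(3)[OF x y] by simp
  qed
  \<comment> \<open>The operations of \<open>rep_quotient\<close> choose a representative anew after
    each step; \<open>\<iota>\<close> does not notice this.\<close>
  have iota_r: "\<iota> (?r x) = \<iota> x" if x: "x \<in> carrier (Fr n)" for x
    unfolding iota_eq[OF cr(1)[OF x] x] cr(3)[OF cr(1)[OF x] x] by (rule cr(2)[OF x])
  show ?thesis
  proof (rule GKdim_module_le[where \<rho> = \<rho> and \<iota> = \<iota>, OF quot_alg_algebra[OF B_algebra J]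
      opposite_algebra[OF algebra] rep_quotient(1)[OF F.left_module_axioms N] nz])
    show "\<rho> \<in> module_hom K S' (quot_alg B J)"
    proof (rule module_homI)
      have l: "(\<lambda>s. s \<sharp> \<one>\<^bsub>H\<^esub>) \<in> module_hom K S SH.T" by (intro pr_intros lin_id) simp
      have "(\<lambda>s. s \<sharp> \<one>\<^bsub>H\<^esub>) \<in> module_hom K S B"
        using l unfolding module_hom_def by simp
      from lin_comp[OF Q.coset_linear this] have l: "\<rho> \<in> module_hom K S (quot_alg B J)"
        unfolding \<rho>_def .
      show "\<rho> x \<in> carrier (quot_alg B J)" if "x \<in> carrier S'" for x
        using module_hom_mem[OF l] that by simp
      show "\<rho> (x \<oplus>\<^bsub>S'\<^esub> y) = \<rho> x \<oplus>\<^bsub>quot_alg B J\<^esub> \<rho> y" if "x \<in> carrier S'" "y \<in> carrier S'" for x y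
        using module_hom_add[OF l] that by simp
      show "\<rho> (c \<odot>\<^bsub>S'\<^esub> x) = c \<odot>\<^bsub>quot_alg B J\<^esub> \<rho> x" if "c \<in> carrier K" "x \<in> carrier S'" for c x
        using module_hom_smult[OF l] that by simp
    qed
    show "\<rho> \<one>\<^bsub>S'\<^esub> = \<one>\<^bsub>quot_alg B J\<^esub>" by (simp add: \<rho>_def quot_alg_one)
    show "\<iota> x \<in> carrier (quot_alg B J)" if "x \<in> carrier ?M" for x
      unfolding \<iota>_def using psi[OF cr(4)[OF that]] by (intro Q.quot_coset_closed) simp
    show "\<iota> (x \<oplus>\<^bsub>?M\<^esub> y) = \<iota> x \<oplus>\<^bsub>quot_alg B J\<^esub> \<iota> y" if "x \<in> carrier ?M" "y \<in> carrier ?M" for x y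
    proof -
      have x: "x \<in> carrier (Fr n)" and y: "y \<in> carrier (Fr n)" using cr(4) that by blast+
      have "\<iota> (x \<oplus>\<^bsub>?M\<^esub> y) = \<iota> (x \<oplus>\<^bsub>Fr n\<^esub> y)"
        using iota_r[OF F.M.a_closed[OF x y]] by (simp add: rep_quotient_def del: free_module_simps)
      also have "\<dots> = \<iota> x \<oplus>\<^bsub>quot_alg B J\<^esub> \<iota> y"
        unfolding \<iota>_def padd[OF x y] using psi[OF x] psi[OF y] by (simp add: Q.quot_add)
      finally show ?thesis .
    qed
    show "\<iota> (s \<odot>\<^bsub>?M\<^esub> x) = \<iota> x \<otimes>\<^bsub>quot_alg B J\<^esub> \<rho> s" if s: "s \<in> carrier S'" and xM: "x \<in> carrier ?M" for s x
    proof -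
      have x: "x \<in> carrier (Fr n)" by (rule cr(4)[OF xM])
      have s': "s \<in> carrier S" using s by simp
      have "\<iota> (s \<odot>\<^bsub>?M\<^esub> x) = \<iota> (s \<odot>\<^bsub>Fr n\<^esub> x)"
        using iota_r[OF F.smult_closed[OF s x]] by (simp add: rep_quotient_def del: free_module_simps)
      also have "\<dots> = \<iota> x \<otimes>\<^bsub>quot_alg B J\<^esub> \<rho> s"
        unfolding \<iota>_def \<rho>_def psm[OF s' x] using psi[OF x] s' by (simp add: quot_alg_mult[OF J])
      finally show ?thesis .
    qed
    show "inj_on \<iota> (carrier ?M)"
    proof (rule inj_onI)
      fix x y assume x: "x \<in> carrier ?M" and y: "y \<in> carrier ?M" and "\<iota> x = \<iota> y"
      then have "?r x = ?r y" using iota_eq[OF cr(4)[OF x] cr(4)[OF y]] by simp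
      then show "x = y" unfolding cr(5)[OF x] cr(5)[OF y] .
    qed
  qed
qed

end

text \<open>A nonzero quotient \<open>M\<close> of \<open>S\<^sup>n\<close> embeds into \<open>B/J\<close>, so \<open>j(M) = d - GKdim M \<ge> 2\<close>.\<close>

lemma grade_rep_quotient:
  assumes frob: "frob_basis E hh" and ix: "bij_betw ix E {..<n::nat}" and J: "ideal J B"
    and CM: "GK_Cohen_Macaulay K S" and d: "GKdim K S = ereal d"
    and le: "GKdim K (quot_alg B J) \<le> ereal (d - 2)"
  shows "carrier (rep_quotient (Fr n) {x \<in> carrier (Fr n). \<psi> E hh ix x \<in> J}) \<noteq>
      {\<zero>\<^bsub>rep_quotient (Fr n) {x \<in> carrier (Fr n). \<psi> E hh ix x \<in> J}\<^esub>} \<longrightarrow>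
    grade S' (rep_quotient (Fr n) {x \<in> carrier (Fr n). \<psi> E hh ix x \<in> J}) > 1"
proof (rule impI, rule ccontr)
  let ?N = "{x \<in> carrier (Fr n). \<psi> E hh ix x \<in> J}"
  let ?M = "rep_quotient (Fr n) ?N"
  note F = free_left_module[OF S'_ring, of n] and N = N_submodule[OF frob ix J]
  note rq = rep_quotient[OF F N]
  assume nz: "carrier ?M \<noteq> {\<zero>\<^bsub>?M\<^esub>}"
  assume "\<not> grade S' ?M > 1"
  then have "grade S' ?M \<le> 1" by simp
  moreover have "GKdim_module K S' ?M \<le> ereal (d - 2)"
    using GKdim_quotient_le[OF frob ix J nz] le by (rule order_trans)
  \<comment> \<open>A grade of at most one would make the sum at most \<open>d - 1\<close>, while
    the Cohen--Macaulay condition makes it the finite number \<open>d\<close>.\<close>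
  ultimately have "grade S' ?M + GKdim_module K S' ?M \<le> 1 + ereal (d - 2)" by (rule add_mono)
  moreover have "grade S' ?M + GKdim_module K S' ?M = GKdim K S"
    by (rule CM[unfolded GK_Cohen_Macaulay_def, THEN conjunct2, THEN bspec, THEN spec, THEN mp])
      (use rq(1) fin_gen_image_free[OF rq(1-3)] nz in simp_all)
  ultimately show False using d by (simp add: one_ereal_def)
qed

end

theorem theorem1p4:
  fixes K :: "'k ring"
    and S :: "('k, 's) module"
    and H :: "('k, 'h) hopf"
    and act :: "'h \<Rightarrow> 's \<Rightarrow> 's"
    and d :: real
    and t :: 'h
  assumes field: "field K"
    and S_algebra: "assoc_algebra K S"
    and S_noetherian: "noetherian S"
    and H_hopf: "hopf_algebra K H"
    and H_fin_dim: "vectorspace.fin_dim K H"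
    and action: "module_algebra K H S act"
    and faithful: "faithful_action H S act"
    and CM: "GK_Cohen_Macaulay K S"
    and GKdim_S: "GKdim K S = ereal d" "d \<ge> 2"
    and no_zero_divisors:
      "\<forall>a\<in>carrier S. \<forall>b\<in>carrier S. a \<otimes>\<^bsub>S\<^esub> b = \<zero>\<^bsub>S\<^esub> \<longrightarrow> a = \<zero>\<^bsub>S\<^esub> \<or> b = \<zero>\<^bsub>S\<^esub>"
    and integral: "left_integral H t" "t \<noteq> \<zero>\<^bsub>H\<^esub>"
    and GKdim_quotient:
      "GKdim K (quot_alg (smash K S H act)
         (Idl\<^bsub>smash K S H act\<^esub> {pure_tensor K S H \<one>\<^bsub>S\<^esub> t})) \<le> ereal (d - 2)"
  shows "auslander_map K S H act
           \<in> ring_iso (smash K S H act) (right_End S (invariants H S act))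
             \<inter> module_hom K (smash K S H act) (right_End S (invariants H S act))"
proof -
  interpret hopf_action K H S act t
    by (intro hopf_action.intro action hopf_action_axioms.intro H_fin_dim integral)
  interpret BR: ring B by (rule B_ring)
  obtain E hh where frob: "frob_basis E hh" using frob_basis_exists by (elim exE)
  define n where "n = card E"
  obtain ix where ix: "bij_betw ix E {..<n}"
    using ex_bij_betw_finite_nat[OF fE[OF frob]] unfolding n_def atLeast0LessThan by (elim exE)
  define J where "J = Idl\<^bsub>B\<^esub> {e_t}"
  have e_t: "e_t \<in> carrier B" by simp
  have J: "ideal J B" unfolding J_def by (rule BR.genideal_ideal) (use e_t in simp)
  have J_t: "e_t \<in> J" unfolding J_def by (rule BR.genideal_self'[OF e_t])
  have J_ann: "J \<subseteq> ann" unfolding J_def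
    by (rule BR.genideal_minimal[OF ann_ideal]) (simp add: e_t_ann)
  have J_absorb: "J \<subseteq> absorb" unfolding J_def
    by (rule BR.genideal_minimal[OF absorb_ideal]) (simp add: e_t_absorb)
  \<comment> \<open>The modules to be resolved are right \<open>S\<close>-modules, hence the
    noetherian condition for the opposite ring.\<close>
  have noeth: "left_noetherian S'" using S_noetherian by (simp add: noetherian_def)
  note gr = grade_rep_quotient[OF frob ix J CM GKdim_S(1) GKdim_quotient[folded J_def]]
  note van = rep_quotient_grade[OF S'_ring noeth N_submodule[OF frob ix J] gr]
  note hyps = frob ix J J_ann J_absorb J_t van
  have inj: "inj_on \<phi> (carrier B)"
  proof (rule inj_onI)
    fix z z' assume z: "z \<in> carrier B" "z' \<in> carrier B" "\<phi> z = \<phi> z'"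
    show "z = z'"
      by (rule phi_injective[OF hyps]) (use z in simp_all)
  qed
  have "\<exists>b\<in>carrier B. \<phi> b = f" if f: "f \<in> carrier Endo" for f
    unfolding B_simps
    by (rule phi_surjective[OF hyps f faithful]) (use no_zero_divisors in blast)
  then have "bij_betw \<phi> (carrier B) (carrier Endo)"
    using inj phi_End by (intro bij_betw_imageI) auto
  then show ?thesis using phi_hom by (simp add: ring_iso_def)
qed

end
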